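(* Fix $c>0$ and let $\mu(\cdot;k)$ be the smooth solitary wave solution (momentum density) of the Novikov equation described in the context, for some $k\in(0,\sqrt c/2)$. Assume that the associated operator $\mathcal{L}$ satisfies the spectral assumption (A) of the context and that the strict inequality $$\frac{\partial}{\partial k}\mathcal{F}(\mu(\cdot;k))<0$$ holds at this value of $k$. Given any $\varepsilon>0$ sufficiently small there exists a constant $C=C(\varepsilon)>0$ such that if $v\in H^1(\mathbb{R})$ with $\|v\|_{H^1}\le\varepsilon$ and if $m(\cdot,t)$ is a solution of the Novikov equation for some interval of time with initial condition $m(\cdot,0)=\mu(\cdot;k)+v$, then $m(\cdot,t)$ may be continued to a solution for all $t>0$ such that $$\sup_{t>0}\inf_{x_0\in\mathbb{R}}\|m(\cdot,t)-\mu(\cdot-x_0;k)\|_{H^1}\le C\|v\|_{H^1}.$$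
   Context: The Novikov equation is $u_t-u_{xxt}=u^2u_{xxx}-4u^2u_x+3uu_xu_{xx}$; in terms of the momentum density $m=u-u_{xx}$ (so $u=(1-\partial_x^2)^{-1}m$, where $(1-\partial_x^2)^{-1}$ is convolution with $\frac12e^{-|x|}$) it reads $m_t+u^2m_x+3uu_xm=0$. For fixed $c>0$ and $k\in(0,\sqrt c/2)$, set $a=k(c-k^2)^{3/2}$ and $E=\frac{k^2(c-2k^2)}{2c}$; $\phi=\phi(\cdot;k)$ denotes the unique nonconstant smooth even function on $\mathbb{R}$ with $\phi'(0)=0$, $\phi(x)\to k$ as $x\to\pm\infty$ (exponentially fast, together with decay of all derivatives), $\phi^2<c$, and $\phi-\phi''=a(c-\phi^2)^{-3/2}$; then $u(x,t)=\phi(x-ct)$ is a smooth solitary wave of the Novikov equation. Put $\mu=\mu(\cdot;k)=\phi-\phi''>0$, $\omega_0=-9a^{-2/3}$, $\omega_1=9c\,a^{-4/3}(2E+c)$. The family depends smoothly on $k$. The operator $\mathcal{L}$ on $L^2(\mathbb{R})$ with domain $H^2(\mathbb{R})$ is $$\mathcal{L}=\frac23\left(-3\,\partial_x\left(\mu^{-8/3}\partial_x\right)+8\mu''\mu^{-11/3}-\frac{44}{3}(\mu')^2\mu^{-14/3}+15\mu^{-8/3}\right)-\frac{2\omega_1}{9}\mu^{-4/3}+2\omega_0(1-\partial_x^2)^{-1}.$$ Spectral assumption (A): the spectrum of the symmetric operator $\mathcal{L}$ on $L^2(\mathbb{R})$ consists of a simple negative eigenvalue, a simple eigenvalue at $\lambda=0$,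 and the rest of the spectrum is strictly positive and uniformly bounded away from $0$. For each $k$, with $$\mathcal{E}(m)=\int_{\mathbb{R}}(m(1-\partial_x^2)^{-1}m-k^2)dx,\quad F_1(m)=\int_{\mathbb{R}}(m^{2/3}-k^{2/3})dx,\quad F_2(m)=\int_{\mathbb{R}}\left(m^{-8/3}m_x^2+9(m^{-2/3}-k^{-2/3})\right)dx,$$ set $\mathcal{F}(m)=\mathcal{E}(m)-3k^{4/3}F_1(m)$. In $\frac{\partial}{\partial k}\mathcal{F}(\mu(\cdot;k))$ the derivative is the total derivative in $k$, i.e. of the function $k\mapsto\mathcal{F}(\mu(\cdot;k))$ where $\mathcal{F}$ also depends explicitly on $k$. Standing assumptions. $X_k$ is the set of $m$ with $m-k\in H^1(\mathbb{R})$ and $m>0$ on $\mathbb{R}$; solutions are considered in $X_k$. It is assumed throughout that local and global well-posedness of the Novikov equation holds in $X_k$: writing $u(x,t)=k+w(x-k^2t,t)$, the equation for $w$ is locally well-posed for initial data in $H^s(\mathbb{R})$, $s>\frac32$ (the case $s=3$ corresponding to $m\in X_k$), with global existence if the momentum density is initially positive. The functionals $\mathcal{E},F_1,F_2$ are the (formally) conserved quantities of the equation; the combinations $\mathcal{F}$ and $\omega_0\mathcal{E}+\omega_1F_1+F_2$, each read as a single improper integral of the combined density, are conserved along solutions in $X_k$. *)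

theory Defs
  imports "HOL-Analysis.Analysis"
begin

section \<open>Sobolev spaces on the real line\<close>

text \<open>
  Elements of \<open>L\<^sup>2(\<real>)\<close> and \<open>H\<^sup>n(\<real>)\<close> are represented by Borel functions, and
  equality of elements is equality almost everywhere. The value type is a parameter: real-valued
  functions are used for the Novikov equation, complex-valued ones for spectra.
\<close>

definition smooth :: "(real \<Rightarrow> real) \<Rightarrow> bool" where
  "smooth f \<longleftrightarrow> (\<forall>n x. (deriv ^^ n) f field_differentiable at x)"

definition test_function :: "(real \<Rightarrow> real) \<Rightarrow> bool" where
  "test_function \<psi> \<longleftrightarrow> smooth \<psi> \<and> compact (closure {x. \<psi> x \<noteq> 0})"

definition L2 :: "(real \<Rightarrow> 'a::euclidean_space) \<Rightarrow> bool" where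
  "L2 f \<longleftrightarrow> f \<in> borel_measurable lborel \<and> integrable lborel (\<lambda>x. (norm (f x))\<^sup>2)"

definition L2_norm :: "(real \<Rightarrow> 'a::euclidean_space) \<Rightarrow> real" where
  "L2_norm f = sqrt (LINT x|lborel. (norm (f x))\<^sup>2)"

definition locally_integrable :: "(real \<Rightarrow> 'a::euclidean_space) \<Rightarrow> bool" where
  "locally_integrable f \<longleftrightarrow> (\<forall>a b. set_integrable lborel {a..b} f)"

definition has_weak_deriv ::
    "(real \<Rightarrow> 'a::euclidean_space) \<Rightarrow> (real \<Rightarrow> 'a) \<Rightarrow> bool" where
  "has_weak_deriv f g \<longleftrightarrow> locally_integrable f \<and> locally_integrable g \<and>
     (\<forall>\<psi>. test_function \<psi> \<longrightarrow>
        (LINT x|lborel. deriv \<psi> x *\<^sub>R f x) = - (LINT x|lborel. \<psi> x *\<^sub>R g x))"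

text \<open>
  The weak derivative in \<open>L\<^sup>2\<close>, determined almost everywhere. The function itself need not be
  square integrable, so this applies to functions tending to a nonzero constant at infinity.
\<close>

definition weak_deriv :: "(real \<Rightarrow> 'a::euclidean_space) \<Rightarrow> real \<Rightarrow> 'a" where
  "weak_deriv f = (SOME g. L2 g \<and> has_weak_deriv f g)"

primrec sobolev :: "nat \<Rightarrow> (real \<Rightarrow> 'a::euclidean_space) \<Rightarrow> bool" where
  "sobolev 0 f \<longleftrightarrow> L2 f"
| "sobolev (Suc n) f \<longleftrightarrow> L2 f \<and> (\<exists>g. has_weak_deriv f g \<and> sobolev n g)"

definition sobolev_norm :: "nat \<Rightarrow> (real \<Rightarrow> 'a::euclidean_space) \<Rightarrow> real" where
  "sobolev_norm n f = sqrt (\<Sum>i\<le>n. (L2_norm ((weak_deriv ^^ i) f))\<^sup>2)"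

text \<open>The operator \<open>(1 - \<partial>\<^sub>x\<^sup>2)\<^sup>-\<^sup>1\<close>, as convolution with \<open>exp (- \<bar>x\<bar>) / 2\<close>.\<close>

definition helmholtz_inv :: "(real \<Rightarrow> 'a::euclidean_space) \<Rightarrow> real \<Rightarrow> 'a" where
  "helmholtz_inv f x = (LINT y|lborel. (exp (- \<bar>x - y\<bar>) / 2) *\<^sub>R f y)"


section \<open>Solutions of the Novikov equation\<close>

definition X_space :: "real \<Rightarrow> (real \<Rightarrow> real) set" where
  "X_space k = {m. continuous_on UNIV m \<and> sobolev 1 (\<lambda>x. m x - k) \<and> (\<forall>x. m x > 0)}"

definition novikov_rhs :: "(real \<Rightarrow> real) \<Rightarrow> real \<Rightarrow> real" where
  "novikov_rhs m x = (let u = helmholtz_inv m in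
     - ((u x)\<^sup>2 * weak_deriv m x + 3 * u x * deriv u x * m x))"

text \<open>
  Strong solutions \<open>m - k \<in> C(I; H\<^sup>1) \<inter> C\<^sup>1(I; L\<^sup>2)\<close>; time is the first argument. The derivative
  in \<open>L\<^sup>2\<close> is one-sided at end points of \<open>I\<close>, and it is continuous in time because the right-hand
  side depends continuously on \<open>m - k \<in> H\<^sup>1\<close>.
\<close>

definition novikov_solution :: "real \<Rightarrow> real set \<Rightarrow> (real \<Rightarrow> real \<Rightarrow> real) \<Rightarrow> bool" where
  "novikov_solution k I m \<longleftrightarrow>
     (\<forall>t\<in>I. m t \<in> X_space k) \<and>
     (\<forall>t\<in>I. ((\<lambda>s. sobolev_norm 1 (\<lambda>x. m s x - m t x)) \<longlongrightarrow> 0) (at t within I)) \<and>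
     (\<forall>t\<in>I. ((\<lambda>s. L2_norm (\<lambda>x. (m s x - m t x) / (s - t) - novikov_rhs (m t) x)) \<longlongrightarrow> 0)
        (at t within I))"

text \<open>
  Global existence, uniqueness and continuous dependence on the data, uniformly on compact time
  intervals. In terms of \<open>u(x,t) = k + w(x - k\<^sup>2 t, t)\<close> this is well-posedness of the equation
  for \<open>w\<close> in \<open>H\<^sup>3\<close> for data with positive momentum density: \<open>m - k \<in> H\<^sup>1\<close> iff \<open>w \<in> H\<^sup>3\<close>, and the
  spatial translation by \<open>k\<^sup>2 t\<close> is an isometry.
\<close>

definition novikov_wellposed :: "real \<Rightarrow> bool" where
  "novikov_wellposed k \<longleftrightarrow>
     (\<forall>m0\<in>X_space k. \<exists>m. novikov_solution k {0..} m \<and> m 0 = m0) \<and>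
     (\<forall>T m n. novikov_solution k {0..<T} m \<and> novikov_solution k {0..<T} n \<and> m 0 = n 0 \<longrightarrow>
        (\<forall>t\<in>{0..<T}. m t = n t)) \<and>
     (\<forall>m T. novikov_solution k {0..} m \<longrightarrow>
        (\<forall>\<eta>>0. \<exists>\<delta>>0. \<forall>n. novikov_solution k {0..} n \<and>
           sobolev_norm 1 (\<lambda>x. n 0 x - m 0 x) < \<delta> \<longrightarrow>
           (\<forall>t\<in>{0..T}. sobolev_norm 1 (\<lambda>x. n t x - m t x) < \<eta>)))"

definition novikov_conserved :: "real \<Rightarrow> ((real \<Rightarrow> real) \<Rightarrow> real) \<Rightarrow> bool" where
  "novikov_conserved k G \<longleftrightarrow>
     (\<forall>T m. novikov_solution k {0..<T} m \<longrightarrow> (\<forall>t\<in>{0..<T}. G (m t) = G (m 0)))"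


section \<open>Conserved functionals\<close>

definition E_density :: "real \<Rightarrow> (real \<Rightarrow> real) \<Rightarrow> real \<Rightarrow> real" where
  "E_density k m x = m x * helmholtz_inv m x - k\<^sup>2"

definition F1_density :: "real \<Rightarrow> (real \<Rightarrow> real) \<Rightarrow> real \<Rightarrow> real" where
  "F1_density k m x = m x powr (2/3) - k powr (2/3)"

definition F2_density :: "real \<Rightarrow> (real \<Rightarrow> real) \<Rightarrow> real \<Rightarrow> real" where
  "F2_density k m x =
     m x powr (-8/3) * (weak_deriv m x)\<^sup>2 + 9 * (m x powr (-2/3) - k powr (-2/3))"

text \<open>
  The separate densities are in general not integrable for \<open>m \<in> X_space k\<close>, and the combined ones
  only conditionally: they contain a multiple of \<open>(1 - \<partial>\<^sub>x\<^sup>2)\<^sup>-\<^sup>1 w - w\<close> with \<open>w = m - k\<close>. The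
  Henstock-Kurzweil integral over \<open>UNIV\<close> is the improper integral, i.e. the limit of the integrals
  over compact intervals exhausting the line.
\<close>

definition F_functional :: "real \<Rightarrow> (real \<Rightarrow> real) \<Rightarrow> real" where
  "F_functional k m =
     integral UNIV (\<lambda>x. E_density k m x - 3 * k powr (4/3) * F1_density k m x)"

definition wave_a :: "real \<Rightarrow> real \<Rightarrow> real" where
  "wave_a c k = k * (c - k\<^sup>2) powr (3/2)"

definition wave_E :: "real \<Rightarrow> real \<Rightarrow> real" where
  "wave_E c k = k\<^sup>2 * (c - 2 * k\<^sup>2) / (2 * c)"

definition omega0 :: "real \<Rightarrow> real \<Rightarrow> real" where
  "omega0 c k = - 9 * wave_a c k powr (-2/3)"

definition omega1 :: "real \<Rightarrow> real \<Rightarrow> real" where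
  "omega1 c k = 9 * c * wave_a c k powr (-4/3) * (2 * wave_E c k + c)"

definition Lambda_functional :: "real \<Rightarrow> real \<Rightarrow> (real \<Rightarrow> real) \<Rightarrow> real" where
  "Lambda_functional c k m =
     integral UNIV
       (\<lambda>x. omega0 c k * E_density k m x + omega1 c k * F1_density k m x + F2_density k m x)"


section \<open>Smooth solitary waves\<close>

definition solitary_profile :: "real \<Rightarrow> real \<Rightarrow> (real \<Rightarrow> real) \<Rightarrow> bool" where
  "solitary_profile c k \<phi> \<longleftrightarrow>
     smooth \<phi> \<and>
     \<not> (\<exists>r. \<forall>x. \<phi> x = r) \<and>
     (\<forall>x. \<phi> (- x) = \<phi> x) \<and>
     deriv \<phi> 0 = 0 \<and>
     (\<forall>n. \<exists>C. \<exists>\<alpha>>0. \<forall>x. \<bar>(deriv ^^ n) (\<lambda>y. \<phi> y - k) x\<bar> \<le> C * exp (- \<alpha> * \<bar>x\<bar>)) \<and>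
     (\<forall>x. (\<phi> x)\<^sup>2 < c) \<and>
     (\<forall>x. \<phi> x - deriv (deriv \<phi>) x = wave_a c k * (c - (\<phi> x)\<^sup>2) powr (-3/2))"

definition momentum :: "(real \<Rightarrow> real) \<Rightarrow> real \<Rightarrow> real" where
  "momentum \<phi> x = \<phi> x - deriv (deriv \<phi>) x"

text \<open>
  Smooth dependence on \<open>k\<close>: for every \<open>n\<close>, the curve \<open>k \<mapsto> \<phi>(\<cdot>;k) - k\<close> is infinitely
  differentiable with values in \<open>H\<^sup>n\<close>. Here \<open>\<Phi> j\<close> is its \<open>j\<close>-th derivative.
\<close>

definition smooth_family :: "real \<Rightarrow> (real \<Rightarrow> real \<Rightarrow> real) \<Rightarrow> bool" where
  "smooth_family c \<phi> \<longleftrightarrow>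
     (\<exists>\<Phi> :: nat \<Rightarrow> real \<Rightarrow> real \<Rightarrow> real.
        (\<forall>\<kappa>\<in>{0<..<sqrt c / 2}. \<Phi> 0 \<kappa> = (\<lambda>x. \<phi> \<kappa> x - \<kappa>)) \<and>
        (\<forall>j n. \<forall>\<kappa>\<in>{0<..<sqrt c / 2}.
           sobolev n (\<Phi> j \<kappa>) \<and>
           ((\<lambda>h. sobolev_norm n (\<lambda>x. (\<Phi> j (\<kappa> + h) x - \<Phi> j \<kappa> x) / h - \<Phi> (Suc j) \<kappa> x))
              \<longlongrightarrow> 0) (at 0)))"


section \<open>The linearized operator and its spectrum\<close>

definition L_operator ::
    "real \<Rightarrow> real \<Rightarrow> (real \<Rightarrow> real) \<Rightarrow> (real \<Rightarrow> complex) \<Rightarrow> real \<Rightarrow> complex" where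
  "L_operator c k \<mu> f x =
     (2/3) *\<^sub>R
       (- 3 *\<^sub>R weak_deriv (\<lambda>y. \<mu> y powr (-8/3) *\<^sub>R weak_deriv f y) x
        + (8 * deriv (deriv \<mu>) x * \<mu> x powr (-11/3)
           - 44/3 * (deriv \<mu> x)\<^sup>2 * \<mu> x powr (-14/3)
           + 15 * \<mu> x powr (-8/3)) *\<^sub>R f x)
     - (2 * omega1 c k / 9 * \<mu> x powr (-4/3)) *\<^sub>R f x
     + (2 * omega0 c k) *\<^sub>R helmholtz_inv f x"

text \<open>
  Spectral notions for a linear operator \<open>A\<close> on complex \<open>L\<^sup>2(\<real>)\<close> with domain \<open>D\<close>: \<open>z\<close> belongs
  to the resolvent set iff \<open>A - z\<close> maps \<open>D\<close> bijectively onto \<open>L\<^sup>2(\<real>)\<close> with bounded inverse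
  (injectivity is contained in the bound).
\<close>

definition resolvent_set ::
    "((real \<Rightarrow> complex) \<Rightarrow> bool) \<Rightarrow> ((real \<Rightarrow> complex) \<Rightarrow> real \<Rightarrow> complex) \<Rightarrow> complex set" where
  "resolvent_set D A = {z.
     (\<forall>f. L2 f \<longrightarrow> (\<exists>u. D u \<and> (AE x in lborel. A u x - z * u x = f x))) \<and>
     (\<exists>C. \<forall>u. D u \<longrightarrow> L2_norm u \<le> C * L2_norm (\<lambda>x. A u x - z * u x))}"

definition spectrum ::
    "((real \<Rightarrow> complex) \<Rightarrow> bool) \<Rightarrow> ((real \<Rightarrow> complex) \<Rightarrow> real \<Rightarrow> complex) \<Rightarrow> complex set" where
  "spectrum D A = - resolvent_set D A"

text \<open>
  For symmetric operators, geometric and algebraic simplicity of an eigenvalue agree.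
\<close>

definition simple_eigenvalue ::
    "((real \<Rightarrow> complex) \<Rightarrow> bool) \<Rightarrow> ((real \<Rightarrow> complex) \<Rightarrow> real \<Rightarrow> complex) \<Rightarrow> complex \<Rightarrow> bool" where
  "simple_eigenvalue D A z \<longleftrightarrow>
     (\<exists>u. D u \<and> \<not> (AE x in lborel. u x = 0) \<and> (AE x in lborel. A u x = z * u x) \<and>
        (\<forall>v. D v \<and> (AE x in lborel. A v x = z * v x) \<longrightarrow>
           (\<exists>\<alpha>. AE x in lborel. v x = \<alpha> * u x)))"

definition spectral_assumption ::
    "((real \<Rightarrow> complex) \<Rightarrow> bool) \<Rightarrow> ((real \<Rightarrow> complex) \<Rightarrow> real \<Rightarrow> complex) \<Rightarrow> bool" where
  "spectral_assumption D A \<longleftrightarrow>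
     (\<exists>\<nu>::real. \<nu> < 0 \<and> simple_eigenvalue D A (of_real \<nu>) \<and> simple_eigenvalue D A 0 \<and>
        (\<exists>\<delta>>0. spectrum D A - {of_real \<nu>, 0} \<subseteq> of_real ` {\<delta>..}))"

end

theory Submission
  imports Defs "HOL-Library.Function_Algebras"
begin

text \<open>
  The energy method of Grillakis, Shatah and Strauss. On \<open>X_space k\<close> both conserved functionals
  become absolutely convergent once \<open>w = m - k\<close> is split off, because the linear terms combine to
  \<open>(1 - \<partial>\<^sub>x\<^sup>2)\<^sup>-\<^sup>1 w - w\<close>, whose improper integral vanishes; \<open>\<mu>\<close> is a critical point of the functional
  \<open>\<Lambda>\<close>, with second variation the quadratic form of \<open>\<L>\<close>.

  Differentiating the Euler-Lagrange equation in \<open>k\<close> and using the scaling \<open>m \<mapsto> r m\<close> gives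
  \<open>\<L> (\<partial>\<^sub>k \<mu> - \<mu> / k) = \<gamma> F'(\<mu>)\<close> with \<open>\<gamma> > 0\<close>. Since \<open>F\<close> is homogeneous of degree 2 under that scaling,
  the pairing of \<open>F'(\<mu>)\<close> with \<open>\<partial>\<^sub>k \<mu> - \<mu> / k\<close> is the slope minus \<open>2 F(\<mu>) / k\<close>, and \<open>F(\<mu>) \<ge> 0\<close>, so it is
  negative. With the spectral assumption, this makes \<open>\<L>\<close> coercive in \<open>H\<^sup>1\<close> on the orthogonal complement
  of \<open>F'(\<mu>)\<close> and \<open>\<mu>'\<close>. Translating the solution to meet the second constraint, and controlling its component along \<open>F'(\<mu>)\<close>
  by conservation of \<open>F\<close>, conservation of \<open>\<Lambda>\<close> bounds the distance to the orbit as long as it is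
  small; continuity in time then makes the bound global.
\<close>

section \<open>Symmetric operators with a spectral gap\<close>

text \<open>The spectral assumption speaks only of resolvents and eigenvectors, whereas stability
  needs a lower bound of a quadratic form. The passage uses no spectral measure: a lower bound of a
  symmetric operator is moved up across a resolvent gap, and past an eigenvalue once the space is
  orthogonal to its eigenvector. Functions are not identified almost everywhere, so the pairing is
  only semidefinite and operator equations are tested against all of L2.

  Both \<open>\<partial>\<^sub>k \<mu>\<close> and \<open>\<mu> / k\<close> tend to 1 at infinity
  and are not in L2, but their difference decays. It is the tangent of the curve of waves rescaled
  to the fixed background \<open>k\<close>, where a single functional can be expanded. Its negative
  pairing with F' is the Vakhitov-Kolokolov criterion: a direction orthogonal to F' is orthogonal,
  for the form, to a vector of negative energy, which uses up the only negative direction.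

  The H1 norm controls the supremum of a perturbation but not that of its derivative; the expansion
  of \<Lambda> closes because the derivative enters at most quadratically.\<close>

locale sym_form =
  fixes S :: "'a::real_vector set" and B :: "'a \<Rightarrow> 'a \<Rightarrow> real"
  assumes subspace: "subspace S"
    and add_left: "\<lbrakk>x \<in> S; y \<in> S; z \<in> S\<rbrakk> \<Longrightarrow> B (x + y) z = B x z + B y z"
    and scale_left: "\<lbrakk>x \<in> S; z \<in> S\<rbrakk> \<Longrightarrow> B (r *\<^sub>R x) z = r * B x z"
    and sym: "\<lbrakk>x \<in> S; y \<in> S\<rbrakk> \<Longrightarrow> B x y = B y x"
begin

lemma mem_add [simp]: "\<lbrakk>x \<in> S; y \<in> S\<rbrakk> \<Longrightarrow> x + y \<in> S"
  and mem_diff [simp]: "\<lbrakk>x \<in> S; y \<in> S\<rbrakk> \<Longrightarrow> x - y \<in> S"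
  and mem_scale [simp]: "x \<in> S \<Longrightarrow> r *\<^sub>R x \<in> S"
  using subspace by (auto simp: subspace_add subspace_diff subspace_scale)

lemma add_right: "\<lbrakk>x \<in> S; y \<in> S; z \<in> S\<rbrakk> \<Longrightarrow> B z (x + y) = B z x + B z y"
  using add_left sym by simp

lemma scale_right: "\<lbrakk>x \<in> S; z \<in> S\<rbrakk> \<Longrightarrow> B z (r *\<^sub>R x) = r * B z x"
  using scale_left sym by simp

lemma diff_left: "\<lbrakk>x \<in> S; y \<in> S; z \<in> S\<rbrakk> \<Longrightarrow> B (x - y) z = B x z - B y z"
  using add_left[of "x - y" y z] by simp

lemma diff_right: "\<lbrakk>x \<in> S; y \<in> S; z \<in> S\<rbrakk> \<Longrightarrow> B z (x - y) = B z x - B z y"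
  using diff_left sym by simp

lemmas expand = add_left add_right diff_left diff_right scale_left scale_right

lemma sub_form:
  assumes "T \<subseteq> S" "Real_Vector_Spaces.subspace T"
  shows "sym_form T B"
  using assms add_left scale_left sym by unfold_locales (auto simp: subset_iff)

lemma Cauchy_Schwarz:
  assumes nonneg: "\<And>x. x \<in> S \<Longrightarrow> B x x \<ge> 0" and x: "x \<in> S" and y: "y \<in> S"
  shows "(B x y)\<^sup>2 \<le> B x x * B y y"
proof -
  have q: "B x x + 2 * t * B x y + t\<^sup>2 * B y y \<ge> 0" for t
    using nonneg[of "x + t *\<^sub>R y"] x y sym[OF y x]
    by (simp add: expand algebra_simps power2_eq_square)
  show ?thesis
  proof (cases "B y y = 0")
    case True
    have "B x y = 0"
    proof (rule ccontr)
      assume "B x y \<noteq> 0"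
      \<comment> \<open>For \<open>B y y = 0\<close> the quadratic is affine in \<open>t\<close>;
        the chosen \<open>t\<close> makes it equal to -1.\<close>
      then show False
        using q[of "- (B x x + 1) / (2 * B x y)"] True by (simp add: field_simps)
    qed
    then show ?thesis using True by simp
  next
    case False
    then have pos: "B y y > 0" using nonneg[OF y] by simp
    have "B x x - (B x y)\<^sup>2 / B y y \<ge> 0"
      using q[of "- B x y / B y y"] pos by (simp add: field_simps power2_eq_square)
    then show ?thesis using pos by (simp add: field_simps)
  qed
qed

end

section \<open>Semi-inner products and operators determined up to null vectors\<close>

locale semi_inner = sym_form V ip for V :: "'a::real_vector set" and ip +
  assumes nonneg: "x \<in> V \<Longrightarrow> ip x x \<ge> 0"
begin

lemma CS: "\<lbrakk>x \<in> V; y \<in> V\<rbrakk> \<Longrightarrow> (ip x y)\<^sup>2 \<le> ip x x * ip y y"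
  by (rule Cauchy_Schwarz) (auto simp: nonneg)

lemma null_left: "\<lbrakk>x \<in> V; y \<in> V; ip x x = 0\<rbrakk> \<Longrightarrow> ip x y = 0"
  using CS[of x y] by simp

definition complete :: bool where
  "complete \<longleftrightarrow> (\<forall>g::nat \<Rightarrow> 'a. (\<forall>n. g n \<in> V) \<and>
     (\<forall>e>0. \<exists>M. \<forall>m\<ge>M. \<forall>n\<ge>M. ip (g m - g n) (g m - g n) < e) \<longrightarrow>
     (\<exists>x\<in>V. (\<lambda>n. ip (g n - x) (g n - x)) \<longlonglongrightarrow> 0))"

lemma tendsto_ip:
  assumes "\<And>n. g n \<in> V" "x \<in> V" "h \<in> V" "(\<lambda>n. ip (g n - x) (g n - x)) \<longlonglongrightarrow> 0"
  shows "(\<lambda>n. ip (g n) h) \<longlonglongrightarrow> ip x h"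
proof -
  have "(\<lambda>n. (ip (g n - x) h)\<^sup>2) \<longlonglongrightarrow> 0"
  proof (rule tendsto_sandwich[OF _ _ tendsto_const])
    show "(\<lambda>n. ip (g n - x) (g n - x) * ip h h) \<longlonglongrightarrow> 0"
      using tendsto_mult_left_zero[OF assms(4)] .
    show "\<forall>\<^sub>F n in sequentially. (ip (g n - x) h)\<^sup>2 \<le> ip (g n - x) (g n - x) * ip h h"
      using CS assms by (intro always_eventually) auto
  qed auto
  then have "(\<lambda>n. ip (g n - x) h) \<longlonglongrightarrow> 0"
    using tendsto_real_sqrt by (fastforce simp: tendsto_rabs_zero_iff)
  then have "(\<lambda>n. ip (g n - x) h + ip x h) \<longlonglongrightarrow> 0 + ip x h" by (intro tendsto_intros)
  then show ?thesis using assms by (simp add: expand)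
qed

end

text \<open>Linearity and symmetry are required only after pairing, since in the application
  \<open>A\<close> involves a weak derivative picked up to null sets: \<open>A (x + y)\<close> and
  \<open>A x + A y\<close> need not be the same function.\<close>

locale sym_operator = semi_inner V ip for V :: "'a::real_vector set" and ip +
  fixes D :: "'a set" and A :: "'a \<Rightarrow> 'a"
  assumes D_sub: "D \<subseteq> V" and D_subspace: "Real_Vector_Spaces.subspace D"
    and A_mem [simp]: "x \<in> D \<Longrightarrow> A x \<in> V"
    and A_add: "\<lbrakk>x \<in> D; y \<in> D; g \<in> V\<rbrakk> \<Longrightarrow> ip (A (x + y)) g = ip (A x) g + ip (A y) g"
    and A_scale: "\<lbrakk>x \<in> D; g \<in> V\<rbrakk> \<Longrightarrow> ip (A (r *\<^sub>R x)) g = r * ip (A x) g"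
    and A_sym: "\<lbrakk>x \<in> D; y \<in> D\<rbrakk> \<Longrightarrow> ip (A x) y = ip x (A y)"
begin

lemma D_V [simp]: "x \<in> D \<Longrightarrow> x \<in> V"
  using D_sub by auto

lemma D_add [simp]: "\<lbrakk>x \<in> D; y \<in> D\<rbrakk> \<Longrightarrow> x + y \<in> D"
  and D_diff [simp]: "\<lbrakk>x \<in> D; y \<in> D\<rbrakk> \<Longrightarrow> x - y \<in> D"
  and D_scale [simp]: "x \<in> D \<Longrightarrow> r *\<^sub>R x \<in> D"
  using D_subspace by (auto simp: subspace_add subspace_diff subspace_scale)

lemma A_diff: "\<lbrakk>x \<in> D; y \<in> D; g \<in> V\<rbrakk> \<Longrightarrow> ip (A (x - y)) g = ip (A x) g - ip (A y) g"
  using A_add[of "x - y" y g] by simp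

lemmas A_expand = A_add A_diff A_scale

text \<open>
  Solvability of \<open>(A - z) u = f\<close> with a bound. The equation is tested against \<open>V\<close> because \<open>ip\<close>
  may be degenerate.
\<close>

definition resolvent :: "real \<Rightarrow> bool" where
  "resolvent z \<longleftrightarrow> (\<exists>C\<ge>0. \<forall>f\<in>V. \<exists>u\<in>D. (\<forall>g\<in>V. ip (A u) g - z * ip u g = ip f g) \<and> ip u u \<le> C * ip f f)"

lemma sym_form_shift: "sym_form D (\<lambda>x y. ip (A x) y - l * ip x y)"
proof unfold_locales
  fix x y assume "x \<in> D" "y \<in> D"
  then show "ip (A x) y - l * ip x y = ip (A y) x - l * ip y x"
    using A_sym[of x y] sym[of x "A y"] sym[of x y] by simp
qed (auto simp: D_subspace A_expand expand algebra_simps)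

text \<open>This is \<open>(A - l0) (A - l1) \<ge> 0\<close> as a quadratic form: the polynomial is
  negative only in the gap. If the infimum \<open>l\<close> of its Rayleigh quotient were negative,
  the polynomial minus \<open>l\<close> would factor with both roots in the gap; the two resolvents
  then make the nonnegative form strictly positive, so that \<open>l\<close> could be
  raised.\<close>

lemma square_ge_form:
  assumes low: "\<And>x. x \<in> D \<Longrightarrow> ip (A x) x \<ge> l0 * ip x x" and less: "l0 < l1"
    and res: "\<And>r. l0 < r \<Longrightarrow> r < l1 \<Longrightarrow> resolvent r" and f: "f \<in> D"
  defines "z \<equiv> l1 - l0"
  shows "ip (A f - l0 *\<^sub>R f) (A f - l0 *\<^sub>R f) \<ge> z * (ip (A f) f - l0 * ip f f)"
proof (rule ccontr)
  define b where "b = (\<lambda>x y. ip (A x) y - l0 * ip x y)"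
  define q where "q = (\<lambda>x y. ip (A x - l0 *\<^sub>R x) (A y - l0 *\<^sub>R y) - z * b x y)"
  have z: "z > 0" using less by (simp add: z_def)
  interpret b: sym_form D b unfolding b_def by (rule sym_form_shift)
  have bq: "ip (A x - l0 *\<^sub>R x) y = b x y" if "x \<in> D" "y \<in> V" for x y
    using that by (simp add: b_def expand)
  have qb: "q x y = b x (A y) - l0 * b x y - z * b x y" if "x \<in> D" "y \<in> D" for x y
    using that by (simp add: q_def b_def expand algebra_simps)
  have Aq: "ip (A x) (A y) = ip (A y) (A x)" if "x \<in> D" "y \<in> D" for x y
    using that by (simp add: sym)
  interpret q: sym_form D q
  proof unfold_locales
    show "Real_Vector_Spaces.subspace D" by (rule D_subspace)
    fix x y w assume "x \<in> D" "y \<in> D" "w \<in> D"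
    then show "q (x + y) w = q x w + q y w"
      by (simp add: q_def b_def expand A_expand algebra_simps)
  next
    fix x w r assume "x \<in> D" "w \<in> D"
    then show "q (r *\<^sub>R x) w = r * q x w"
      by (simp add: q_def b_def expand A_expand algebra_simps)
  next
    fix x y assume "x \<in> D" "y \<in> D"
    then show "q x y = q y x"
      using sym[of "A x - l0 *\<^sub>R x" "A y - l0 *\<^sub>R y"] b.sym[of x y] by (simp add: q_def)
  qed
  have q_low: "q x x \<ge> - (z\<^sup>2 / 4) * ip x x" if "x \<in> D" for x
  proof -
    define w where "w = A x - l0 *\<^sub>R x"
    have w: "w \<in> V" "ip w x = b x x" "ip x w = b x x" "q x x = ip w w - z * b x x"
      using that bq[of x x] sym[of w x] by (auto simp: w_def q_def)
    \<comment> \<open>Completing the square bounds the form from below although \<open>A\<close> may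
      be unbounded.\<close>
    have "0 \<le> ip (w - (z / 2) *\<^sub>R x) (w - (z / 2) *\<^sub>R x)"
      using that w by (intro nonneg) simp
    also have "\<dots> = q x x + (z\<^sup>2 / 4) * ip x x"
      using that w by (simp add: expand power2_eq_square algebra_simps)
    finally show ?thesis by simp
  qed
  assume "\<not> ?thesis"
  then have qf: "q f f < 0" using f by (simp add: q_def b_def)
  then have fpos: "ip f f > 0" using q_low[OF f] nonneg[of f] f by (cases "ip f f = 0") auto
  define Q where "Q = {q x x / ip x x | x. x \<in> D \<and> ip x x > 0}"
  define l where "l = Inf Q"
  have ne: "q f f / ip f f \<in> Q" using f fpos by (auto simp: Q_def)
  have lb: "- (z\<^sup>2 / 4) \<le> r" if "r \<in> Q" for r
    using that q_low unfolding Q_def by (auto simp: field_simps)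
  have bdd: "bdd_below Q" using lb by (rule bdd_belowI)
  have l1: "- (z\<^sup>2 / 4) \<le> l" unfolding l_def using ne lb by (intro cInf_greatest) auto
  have "l \<le> q f f / ip f f" unfolding l_def using ne bdd by (rule cInf_lower)
  also have "\<dots> < 0" using qf fpos by (simp add: divide_neg_pos)
  finally have l2: "l < 0" .
  have ql: "q x x \<ge> l * ip x x" if "x \<in> D" for x
  proof (cases "ip x x = 0")
    case True then show ?thesis using q_low[OF that] by simp
  next
    case False
    then have "ip x x > 0" using nonneg[of x] that by simp
    moreover from this have "l \<le> q x x / ip x x" unfolding l_def using bdd that
      by (intro cInf_lower) (auto simp: Q_def)
    ultimately show ?thesis by (simp add: field_simps)
  qed
  \<comment> \<open>\<open>r1\<close> and \<open>r2\<close> below are the roots of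
    \<open>t\<^sup>2 - z * t - l\<close>; the bounds \<open>- (z\<^sup>2 / 4) \<le> l < 0\<close>
    put them strictly between 0 and \<open>z\<close>.\<close>
  define d where "d = sqrt (z\<^sup>2 + 4 * l)"
  have d2: "d\<^sup>2 = z\<^sup>2 + 4 * l" using l1 by (simp add: d_def)
  have d0: "d \<ge> 0" using l1 by (simp add: d_def)
  have "d < z" using l2 z unfolding d_def by (intro real_less_lsqrt) auto
  define r1 where "r1 = (z - d) / 2"
  define r2 where "r2 = (z + d) / 2"
  have r: "0 < r1" "r1 < z" "0 < r2" "r2 < z" using \<open>d < z\<close> d0 z by (auto simp: r1_def r2_def)
  have rs: "r1 + r2 = z" "r1 * r2 = - l" using d2
    by (auto simp: r1_def r2_def field_simps power2_eq_square)
  obtain C1 where C1: "C1 \<ge> 0" "\<And>f. f \<in> V \<Longrightarrow> \<exists>u\<in>D. (\<forall>g\<in>V. ip (A u) g - (l0 + r1) * ip u g = ip f g) \<and> ip u u \<le> C1 * ip f f"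
    using res[of "l0 + r1"] r by (auto simp: resolvent_def z_def)
  obtain C2 where C2: "C2 \<ge> 0" "\<And>f. f \<in> V \<Longrightarrow> \<exists>u\<in>D. (\<forall>g\<in>V. ip (A u) g - (l0 + r2) * ip u g = ip f g) \<and> ip u u \<le> C2 * ip f f"
    using res[of "l0 + r2"] r by (auto simp: resolvent_def z_def)
  define p where "p = (\<lambda>x y. q x y - l * ip x y)"
  interpret p: sym_form D p
  proof unfold_locales
    fix x y assume "x \<in> D" "y \<in> D"
    then show "p x y = p y x" using q.sym[of x y] sym[of x y] by (simp add: p_def)
  qed (auto simp: p_def D_subspace q.expand expand algebra_simps)
  have p_eq: "p x y = ip (A x - (l0 + r1) *\<^sub>R x) (A y - (l0 + r2) *\<^sub>R y)" if "x \<in> D" "y \<in> D" for x y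
  proof -
    have "ip (A x - (l0 + r1) *\<^sub>R x) (A y - (l0 + r2) *\<^sub>R y)
      = ip (A x) (A y) - (l0 + r2) * ip (A x) y - (l0 + r1) * ip x (A y) + (l0 + r1) * (l0 + r2) * ip x y"
      using that by (simp add: expand algebra_simps)
    also have "\<dots> = ip (A x) (A y) - (2 * l0 + (r1 + r2)) * ip (A x) y + (l0\<^sup>2 + l0 * (r1 + r2) + r1 * r2) * ip x y"
      using that by (simp add: A_sym algebra_simps power2_eq_square)
    also have "\<dots> = p x y"
      unfolding rs using that by (simp add: p_def q_def b_def expand A_sym algebra_simps power2_eq_square)
    finally show ?thesis by simp
  qed
  define C where "C = 1 + C1 * C2 + C2"
  \<comment> \<open>With \<open>g\<close> obtained from \<open>x\<close> by applying both
    resolvents, \<open>p x g = ip x x\<close> and \<open>p g g = ip x g\<close>. Cauchy-Schwarz for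
    \<open>p\<close> then bounds \<open>ip x x\<close> by a multiple of
    \<open>p x x\<close>.\<close>
  have key: "ip x x \<le> p x x * (C1 * C2 + 1 + C2)" if x: "x \<in> D" for x
  proof -
    obtain u where u: "u \<in> D" "\<And>g. g \<in> V \<Longrightarrow> ip (A u) g - (l0 + r1) * ip u g = ip x g" "ip u u \<le> C1 * ip x x"
      using C1(2)[of x] x by auto
    obtain g where g: "g \<in> D" "\<And>h. h \<in> V \<Longrightarrow> ip (A g) h - (l0 + r2) * ip g h = ip u h" "ip g g \<le> C2 * ip u u"
      using C2(2)[of u] u by auto
    have gg: "ip h (A g - (l0 + r2) *\<^sub>R g) = ip h u" if "h \<in> V" for h
      using that g(1) g(2)[OF that] u(1) sym[of h u] sym[of h "A g - (l0 + r2) *\<^sub>R g"] by (simp add: expand)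
    have "p x g = ip (A x - (l0 + r1) *\<^sub>R x) u"
      using p_eq[OF x g(1)] gg[of "A x - (l0 + r1) *\<^sub>R x"] x by simp
    also have "\<dots> = ip (A u) x - (l0 + r1) * ip u x"
      using x u(1) A_sym[OF x u(1)] sym[of x u] sym[of x "A u"] by (simp add: expand)
    finally have pxg: "p x g = ip x x" using u(2)[of x] x by simp
    have "p g g = ip (A g - (l0 + r1) *\<^sub>R g) u"
      using p_eq[OF g(1) g(1)] gg[of "A g - (l0 + r1) *\<^sub>R g"] g by simp
    also have "\<dots> = ip (A u) g - (l0 + r1) * ip u g"
      using g(1) u(1) A_sym[OF g(1) u(1)] sym[of g u] sym[of g "A u"] by (simp add: expand)
    finally have pgg: "p g g = ip x g" using u(2)[of g] g by simp
    have p_nonneg: "p y y \<ge> 0" if "y \<in> D" for y using ql[OF that] by (simp add: p_def)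
    have "(ip x g)\<^sup>2 \<le> ip x x * ip g g" using x g by (intro CS) auto
    also have "\<dots> \<le> ip x x * (C2 * (C1 * ip x x))"
      using g(3) u(3) C2(1) nonneg[of x] x
      by (intro mult_left_mono) (auto intro: order_trans[OF _ mult_left_mono])
    also have "\<dots> \<le> ((C1 * C2 + 1 + C2) * ip x x)\<^sup>2"
    proof -
      have "1 \<le> C1 * C2 + 1 + C2" "C2 * C1 \<le> C1 * C2 + 1 + C2"
        using C1(1) C2(1) mult_nonneg_nonneg[OF C1(1) C2(1)] by (auto simp: mult.commute)
      then have "C2 * C1 \<le> (C1 * C2 + 1 + C2)\<^sup>2"
        using self_le_power[of "C1 * C2 + 1 + C2" 2] by linarith
      from mult_right_mono[OF this, of "(ip x x)\<^sup>2"] show ?thesis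
        by (simp add: power2_eq_square algebra_simps)
    qed
    finally have sq_le: "(ip x g)\<^sup>2 \<le> ((C1 * C2 + 1 + C2) * ip x x)\<^sup>2" .
    have gx: "ip x g \<le> (C1 * C2 + 1 + C2) * ip x x"
      by (rule power2_le_imp_le[OF sq_le])
        (intro mult_nonneg_nonneg add_nonneg_nonneg C1(1) C2(1) nonneg D_V x zero_le_one)
    have "(p x g)\<^sup>2 \<le> p x x * p g g" by (intro p.Cauchy_Schwarz p_nonneg x g(1))
    also have "\<dots> \<le> p x x * ((C1 * C2 + 1 + C2) * ip x x)"
      using gx p_nonneg[OF x] unfolding pgg by (intro mult_left_mono)
    finally have "ip x x * ip x x \<le> (p x x * (C1 * C2 + 1 + C2)) * ip x x"
      unfolding pxg by (simp add: power2_eq_square mult_ac)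
    moreover have "0 \<le> p x x * (C1 * C2 + 1 + C2)"
      by (intro mult_nonneg_nonneg add_nonneg_nonneg C1(1) C2(1) p_nonneg x zero_le_one)
    ultimately show ?thesis
      using nonneg[OF D_V[OF x]] mult_right_le_imp_le[of "ip x x" "ip x x"] by (cases "ip x x = 0") force+
  qed
  have Cpos: "C1 * C2 + 1 + C2 > 0" using C1(1) C2(1) by (simp add: add_nonneg_pos add_pos_nonneg)
  have "l + 1 / (C1 * C2 + 1 + C2) \<le> r" if r: "r \<in> Q" for r
  proof -
    obtain x where x: "x \<in> D" "ip x x > 0" "r = q x x / ip x x" using r by (auto simp: Q_def)
    have "p x x = (r - l) * ip x x" using x by (simp add: p_def field_simps)
    then have "1 * ip x x \<le> ((r - l) * (C1 * C2 + 1 + C2)) * ip x x" using key[OF x(1)] by (simp add: mult_ac)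
    then have "1 \<le> (r - l) * (C1 * C2 + 1 + C2)" using x(2) by (rule mult_right_le_imp_le)
    then show ?thesis using Cpos by (simp add: field_simps)
  qed
  then have "l + 1 / (C1 * C2 + 1 + C2) \<le> l"
    unfolding l_def using ne by (intro cInf_greatest) auto
  then show False using Cpos by simp
qed

text \<open>Without an eigenvector at \<open>l0\<close> no spectrum is left below \<open>l1\<close>.
  The vector \<open>f\<close> is split as \<open>p n + g n\<close>, where \<open>g n\<close> is
  \<open>s n\<close> times the resolvent at \<open>l0 - s n\<close> applied to \<open>f\<close> and
  \<open>p n\<close> lies in the range of \<open>A - l0\<close>. On that range the form has the gap
  \<open>z\<close>; the parts \<open>g n\<close> converge to an element of the kernel, which is
  null.\<close>

lemma gap_step:
  assumes cmpl: complete
    and low: "\<And>x. x \<in> D \<Longrightarrow> ip (A x) x \<ge> l0 * ip x x" and less: "l0 < l1"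
    and res: "\<And>r. l0 < r \<Longrightarrow> r < l1 \<Longrightarrow> resolvent r"
    and s0: "s0 > 0" "\<And>s. 0 < s \<Longrightarrow> s < s0 \<Longrightarrow> resolvent (l0 - s)"
    and ker: "\<And>x. x \<in> D \<Longrightarrow> (\<And>g. g \<in> V \<Longrightarrow> ip (A x) g = l0 * ip x g) \<Longrightarrow> ip x x = 0"
    and f: "f \<in> D"
  shows "ip (A f) f \<ge> l1 * ip f f"
proof -
  define z where "z = l1 - l0"
  define b where "b = (\<lambda>x y. ip (A x) y - l0 * ip x y)"
  have z: "z > 0" using less by (simp add: z_def)
  interpret b: sym_form D b unfolding b_def by (rule sym_form_shift)
  have b_nonneg: "b x x \<ge> 0" if "x \<in> D" for x using low[OF that] by (simp add: b_def)
  have bip: "b x y = ip (A x - l0 *\<^sub>R x) y" if "x \<in> D" "y \<in> V" for x y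
    using that by (simp add: b_def expand)
  have sq: "ip (A x - l0 *\<^sub>R x) (A x - l0 *\<^sub>R x) \<ge> z * b x x" if "x \<in> D" for x
    using square_ge_form[OF low less res that] by (simp add: b_def z_def)
  \<comment> \<open>Combines \<open>z * b u u \<le> ip p p\<close> with Cauchy-Schwarz for
    \<open>b\<close>; since \<open>p\<close> represents \<open>(A - l0) u\<close>, the mixed term is
    \<open>b u p = ip p p\<close>.\<close>
  have range_gap: "z * ip p p \<le> b p p"
    if u: "u \<in> D" and p: "p \<in> D" and eq: "\<And>g. g \<in> V \<Longrightarrow> b u g = ip p g" for u p
  proof -
    have "ip (A u - l0 *\<^sub>R u) (A u - l0 *\<^sub>R u) = ip p p"
      using u p eq[of "A u - l0 *\<^sub>R u"] eq[of p] bip[of u] sym[of p "A u - l0 *\<^sub>R u"] by simp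
    then have 1: "z * b u u \<le> ip p p" using sq[OF u] by simp
    have "(b u p)\<^sup>2 \<le> b u u * b p p" by (intro b.Cauchy_Schwarz b_nonneg u p)
    then have "z * (ip p p)\<^sup>2 \<le> z * (b u u * b p p)"
      using eq[of p] p z by (intro mult_left_mono) auto
    also have "\<dots> \<le> ip p p * b p p"
      using mult_right_mono[OF 1 b_nonneg[OF p]] by (simp add: mult_ac)
    finally have "ip p p * (z * ip p p) \<le> ip p p * b p p" by (simp add: power2_eq_square mult_ac)
    then show ?thesis
      using nonneg[of p] p b_nonneg[OF p] by (cases "ip p p = 0") (auto simp: mult_le_cancel_left)
  qed
  define s where "s = (\<lambda>n::nat. s0 / (real n + 2))"
  have s: "0 < s n" "s n < s0" for n using s0(1) by (auto simp: s_def field_simps intro!: add_pos_nonneg)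
  have s_lim: "s \<longlonglongrightarrow> 0"
    using tendsto_mult[OF tendsto_const[of s0] LIMSEQ_ignore_initial_segment[OF lim_inverse_n', of 2]]
    by (simp add: s_def divide_inverse add.commute)
  have "\<exists>u\<in>D. \<forall>g\<in>V. b u g + s n * ip u g = ip f g" for n
  proof -
    obtain u where "u \<in> D" "\<forall>g\<in>V. ip (A u) g - (l0 - s n) * ip u g = ip f g"
      using s0(2)[OF s(1,2)[of n]] f unfolding resolvent_def by fastforce
    then show ?thesis by (intro bexI[of _ u]) (auto simp: b_def algebra_simps)
  qed
  then obtain u where u: "\<And>n. u n \<in> D" "\<And>n g. g \<in> V \<Longrightarrow> b (u n) g + s n * ip (u n) g = ip f g"
    by metis
  define g where "g = (\<lambda>n. s n *\<^sub>R u n)"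
  define p where "p = (\<lambda>n. f - g n)"
  have gD [simp]: "g n \<in> D" and pD [simp]: "p n \<in> D" and uD [simp]: "u n \<in> D" for n
    using u(1) f by (auto simp: g_def p_def)
  have fD [simp]: "f \<in> D" by (rule f)
  have bp: "b (u n) h = ip (p n) h" if "h \<in> V" for n h
    using u(2)[OF that, of n] that by (simp add: p_def g_def expand)
  have bg: "b (g n) h = s n * ip (p n) h" if "h \<in> V" for n h
    using bp[OF that, of n] that by (simp add: g_def b_def expand A_expand algebra_simps)
  have gap_p: "z * ip (p n) (p n) \<le> b (p n) (p n)" for n
    using bp by (intro range_gap[of "u n"]) auto
  have g_le: "ip (g n) (g n) \<le> ip f (g n)" for n
  proof -
    have "0 \<le> s n * b (u n) (g n)"
      using s(1)[of n] b_nonneg[of "u n"] by (simp add: g_def b.scale_right)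
    also have "\<dots> = s n * ip (p n) (g n)" using bp[of "g n" n] by simp
    finally have "0 \<le> ip (p n) (g n)" using s(1)[of n] by (simp add: zero_le_mult_iff)
    then show ?thesis by (simp add: p_def expand)
  qed
  have p_le: "ip (p n) (p n) \<le> ip f f" for n
    using g_le[of n] nonneg[of "g n"] sym[of "g n" f] by (simp add: p_def expand)
  \<comment> \<open>The difference \<open>g n - g m = p m - p n\<close> lies again in the range of
    \<open>A - l0\<close>, so the gap estimate applies to it, while \<open>A - l0\<close> maps it to
    the small vector \<open>s n * p n - s m * p m\<close>.\<close>
  have diff_le: "z\<^sup>2 * ip (g n - g m) (g n - g m) \<le> 2 * ((s n)\<^sup>2 + (s m)\<^sup>2) * ip f f" for m n
  proof -
    define w where "w = g n - g m"
    define y where "y = s n *\<^sub>R p n - s m *\<^sub>R p m"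
    have wD [simp]: "w \<in> D" and yD [simp]: "y \<in> D" by (auto simp: w_def y_def)
    have "z * ip w w \<le> b w w"
    proof (rule range_gap)
      show "u m - u n \<in> D" by simp
      fix h assume h: "h \<in> V"
      have "b (u m - u n) h = b (u m) h - b (u n) h"
        using h by (simp add: b_def expand A_expand algebra_simps)
      then show "b (u m - u n) h = ip w h" using h by (simp add: bp w_def p_def expand)
    qed simp
    also have "b w w = ip y w"
      using bg[of w n] bg[of w m] unfolding w_def y_def
      by (simp add: b.diff_left expand algebra_simps)
    finally have 1: "z * ip w w \<le> ip y w" .
    have "(z * ip w w)\<^sup>2 \<le> (ip y w)\<^sup>2" using 1 z nonneg[of w] by (intro power_mono) auto
    also have "\<dots> \<le> ip y y * ip w w" by (intro CS) auto
    finally have "ip w w * (z\<^sup>2 * ip w w) \<le> ip w w * ip y y" by (simp add: power2_eq_square mult_ac)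
    then have 2: "z\<^sup>2 * ip w w \<le> ip y y"
      using nonneg[of w] nonneg[of y] by (cases "ip w w = 0") (auto simp: mult_le_cancel_left)
    have "0 \<le> ip (s n *\<^sub>R p n + s m *\<^sub>R p m) (s n *\<^sub>R p n + s m *\<^sub>R p m)" by (intro nonneg) simp
    then have "ip y y \<le> 2 * ((s n)\<^sup>2 * ip (p n) (p n) + (s m)\<^sup>2 * ip (p m) (p m))"
      unfolding y_def using sym[of "p n" "p m"] by (simp add: expand power2_eq_square algebra_simps)
    also have "\<dots> \<le> 2 * ((s n)\<^sup>2 * ip f f + (s m)\<^sup>2 * ip f f)"
      using p_le by (intro mult_left_mono add_mono) auto
    finally show ?thesis using 2 by (simp add: w_def algebra_simps)
  qed
  have "\<exists>x\<in>V. (\<lambda>n. ip (g n - x) (g n - x)) \<longlonglongrightarrow> 0"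
  proof (rule cmpl[unfolded complete_def, rule_format], intro conjI allI impI)
    show "g n \<in> V" for n by simp
    fix e :: real assume e: "e > 0"
    have "(\<lambda>n. 4 * (s n)\<^sup>2 * ip f f / z\<^sup>2) \<longlonglongrightarrow> 4 * 0\<^sup>2 * ip f f / z\<^sup>2"
      using z by (intro tendsto_intros s_lim) auto
    then have "\<forall>\<^sub>F n in sequentially. 4 * (s n)\<^sup>2 * ip f f / z\<^sup>2 < e"
      using e by (intro order_tendstoD) auto
    then obtain M where M: "\<And>n. n \<ge> M \<Longrightarrow> 4 * (s n)\<^sup>2 * ip f f / z\<^sup>2 < e"
      by (auto simp: eventually_sequentially)
    show "\<exists>M. \<forall>m\<ge>M. \<forall>n\<ge>M. ip (g m - g n) (g m - g n) < e"
    proof (intro exI allI impI)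
      fix m n assume "m \<ge> M" "n \<ge> M"
      then have "4 * (s n)\<^sup>2 * ip f f < e * z\<^sup>2" "4 * (s m)\<^sup>2 * ip f f < e * z\<^sup>2"
        using M[of n] M[of m] z by (auto simp: field_simps)
      then have "z\<^sup>2 * ip (g m - g n) (g m - g n) < z\<^sup>2 * e"
        using diff_le[of m n] by (simp add: algebra_simps)
      then show "ip (g m - g n) (g m - g n) < e" using z by (simp add: mult_less_cancel_left)
    qed
  qed
  then obtain g0 where g0: "g0 \<in> V" "(\<lambda>n. ip (g n - g0) (g n - g0)) \<longlonglongrightarrow> 0" by auto
  have lim: "(\<lambda>n. ip (g n) h) \<longlonglongrightarrow> ip g0 h" if "h \<in> V" for h
    using g0 that by (intro tendsto_ip) auto
  \<comment> \<open>The limit \<open>g0\<close> is only known to lie in \<open>V\<close>. Solving at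
    the midpoint of the gap gives \<open>x\<close> in \<open>D\<close>, which is then shown to pair
    like \<open>g0\<close>; this plays the part of closedness of \<open>A\<close>.\<close>
  have res2: "resolvent (l0 + z / 2)" using z by (intro res) (auto simp: z_def field_simps)
  then obtain x where x: "x \<in> D" "\<And>h. h \<in> V \<Longrightarrow> b x h - z / 2 * ip x h = - (z / 2) * ip g0 h"
  proof -
    obtain x where "x \<in> D" "\<forall>h\<in>V. ip (A x) h - (l0 + z / 2) * ip x h = ip (- (z / 2) *\<^sub>R g0) h"
      using res2 mem_scale[OF g0(1)] unfolding resolvent_def by meson
    then show ?thesis using g0(1) by (intro that[of x]) (auto simp: b_def scale_left algebra_simps simp del: scaleR_minus_left)
  qed
  have x_g0: "ip x h = ip g0 h" if h: "h \<in> V" for h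
  proof -
    obtain y where y: "y \<in> D" "\<And>k. k \<in> V \<Longrightarrow> b y k - z / 2 * ip y k = ip h k"
    proof -
      obtain y where "y \<in> D" "\<forall>k\<in>V. ip (A y) k - (l0 + z / 2) * ip y k = ip h k"
        using res2 h unfolding resolvent_def by meson
      then show ?thesis by (intro that[of y]) (auto simp: b_def algebra_simps)
    qed
    have eq: "ip (g n - x) h = s n * ip (p n) y - z / 2 * (ip (g n) y - ip g0 y)" for n
    proof -
      have "ip (g n - x) h = b y (g n - x) - z / 2 * ip y (g n - x)"
        using y(2)[of "g n - x"] sym[OF h, of "g n - x"] x(1) by simp
      also have "\<dots> = (b (g n) y - z / 2 * ip (g n) y) - (b x y - z / 2 * ip x y)"
      proof -
        have *: "b y (g n - x) = b (g n) y - b x y" "ip y (g n - x) = ip (g n) y - ip x y"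
          using y(1) x(1) b.sym[of y "g n - x"] sym[of y "g n - x"] by (auto simp: b.diff_left diff_left)
        show ?thesis unfolding * by (simp add: algebra_simps)
      qed
      also have "\<dots> = s n * ip (p n) y - z / 2 * ip (g n) y - (- (z / 2) * ip g0 y)"
        using y(1) bg[of y n] x(2)[of y] by simp
      finally show ?thesis by (simp add: algebra_simps)
    qed
    have bd: "norm (s n * ip (p n) y) \<le> s n * sqrt (ip f f * ip y y)" for n
    proof -
      have "(ip (p n) y)\<^sup>2 \<le> ip (p n) (p n) * ip y y" using y by (intro CS) auto
      also have "\<dots> \<le> ip f f * ip y y" using p_le[of n] nonneg[of y] y by (intro mult_right_mono) auto
      finally have "norm (ip (p n) y) \<le> sqrt (ip f f * ip y y)"
        by (metis real_norm_def real_sqrt_abs real_sqrt_le_iff)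
      then show ?thesis using s(1)[of n] by (simp add: abs_mult)
    qed
    have "(\<lambda>n. s n * ip (p n) y) \<longlonglongrightarrow> 0"
      by (rule Lim_null_comparison[OF always_eventually tendsto_mult_left_zero[OF s_lim]]) (use bd in blast)
    then have "(\<lambda>n. ip (g n - x) h) \<longlonglongrightarrow> 0 - z / 2 * (ip g0 y - ip g0 y)"
      unfolding eq using lim[of y] y(1) by (intro tendsto_intros) auto
    moreover have "(\<lambda>n. ip (g n) h - ip x h) \<longlonglongrightarrow> ip g0 h - ip x h"
      using lim[OF h] by (intro tendsto_intros)
    ultimately show ?thesis
      using x(1) h LIMSEQ_unique[of "\<lambda>n. ip (g n) h - ip x h" 0 "ip g0 h - ip x h"] by (simp add: expand)
  qed
  have "ip x x = 0"
  proof (rule ker[OF x(1)])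
    fix h assume "h \<in> V"
    then show "ip (A x) h = l0 * ip x h" using x(2)[of h] x_g0[of h] by (simp add: b_def)
  qed
  then have "ip g0 h = 0" if "h \<in> V" for h
    using x_g0[OF that] null_left[of x h] x(1) that by simp
  then have lim0: "(\<lambda>n. ip (g n) h) \<longlonglongrightarrow> 0" if "h \<in> V" for h
    using lim[OF that] that by simp
  have "(\<lambda>n. ip f f - 2 * ip (g n) f) \<longlonglongrightarrow> ip f f - 2 * 0"
    by (intro tendsto_intros lim0) simp
  moreover have "z * (ip f f - 2 * ip (g n) f) \<le> b f f" for n
  proof -
    have "b f f = b (p n) (p n) + 2 * b (g n) (p n) + b (g n) (g n)"
      using b.sym[of "g n" "p n"] 
      by (simp add: p_def b.expand)
    then have "b f f = b (p n) (p n) + 2 * s n * ip (p n) (p n) + b (g n) (g n)"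
      using bg[of "p n" n] by simp
    moreover have "0 \<le> s n * ip (p n) (p n)" using s(1)[of n] nonneg[of "p n"] by simp
    ultimately have "z * ip (p n) (p n) \<le> b f f"
      using gap_p[of n] b_nonneg[of "g n"] by simp
    moreover have "ip f f - 2 * ip (g n) f \<le> ip (p n) (p n)"
      using nonneg[of "g n"] sym[of "g n" f] by (simp add: p_def expand)
    ultimately show ?thesis using z by (meson mult_left_mono less_imp_le order_trans)
  qed
  ultimately have "z * (ip f f - 2 * 0) \<le> b f f"
    by (intro LIMSEQ_le_const2[OF tendsto_mult_left]) auto
  then show ?thesis by (simp add: b_def z_def algebra_simps)
qed

text \<open>\<open>psi\<close> has negative energy, and the constraint \<open>ip y G = 0\<close>
  says that \<open>y\<close> is orthogonal to \<open>psi\<close> for the form. On the complement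
  \<open>W\<close> of the two eigenvectors the form is positive, so the negative part of either
  vector is its \<open>e1\<close>-component; Cauchy-Schwarz for the form on \<open>W\<close>
  compares these components.\<close>

lemma constrained_coercive:
  assumes cmpl: complete
    and Q: "sym_form Q a" "D \<subseteq> Q" "Q \<subseteq> V"
    and a_A: "\<And>f g. f \<in> D \<Longrightarrow> g \<in> Q \<Longrightarrow> a f g = ip (A f) g"
    and a_low: "\<And>f. f \<in> Q \<Longrightarrow> a f f \<ge> - K * ip f f"
    and nu: "nu < 0" and del: "del > 0"
    and res: "\<And>r. r < del \<Longrightarrow> r \<noteq> nu \<Longrightarrow> r \<noteq> 0 \<Longrightarrow> resolvent r"
    and e1: "e1 \<in> D" "ip e1 e1 > 0" "\<And>g. g \<in> V \<Longrightarrow> ip (A e1) g = nu * ip e1 g"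
    and e0: "e0 \<in> D" "ip e0 e0 > 0" "\<And>g. g \<in> V \<Longrightarrow> ip (A e0) g = 0"
    and simple1: "\<And>x. x \<in> D \<Longrightarrow> (\<And>g. g \<in> V \<Longrightarrow> ip (A x) g = nu * ip x g) \<Longrightarrow>
                    \<exists>\<beta>. \<forall>g\<in>V. ip x g = \<beta> * ip e1 g"
    and simple0: "\<And>x. x \<in> D \<Longrightarrow> (\<And>g. g \<in> V \<Longrightarrow> ip (A x) g = 0) \<Longrightarrow>
                    \<exists>\<beta>. \<forall>g\<in>V. ip x g = \<beta> * ip e0 g"
    and psi: "psi \<in> D" "G \<in> V" "\<And>g. g \<in> V \<Longrightarrow> ip (A psi) g = ip G g" "ip G psi < 0"
  shows "\<exists>\<alpha>>0. \<forall>y\<in>Q. ip y G = 0 \<and> ip y e0 = 0 \<longrightarrow> a y y \<ge> \<alpha> * ip y y"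
proof -
  interpret a: sym_form Q a by (rule Q(1))
  have QV [simp]: "y \<in> Q \<Longrightarrow> y \<in> V" and DQ [simp]: "y \<in> D \<Longrightarrow> y \<in> Q" for y
    using Q by auto
  note [simp] = e1(1) e0(1) psi(1,2)
  define W where "W = {f \<in> V. ip f e1 = 0 \<and> ip f e0 = 0}"
  have WV [simp]: "f \<in> W \<Longrightarrow> f \<in> V" and We [simp]: "f \<in> W \<Longrightarrow> ip f e1 = 0" "f \<in> W \<Longrightarrow> ip f e0 = 0" for f
    by (auto simp: W_def)
  have WI: "f \<in> W" if "f \<in> V" "ip f e1 = 0" "ip f e0 = 0" for f
    using that unfolding W_def by blast
  have W_sub: "Real_Vector_Spaces.subspace W"
    unfolding W_def Real_Vector_Spaces.subspace_def
    using scale_left[of e1 e1 0] scale_left[of e1 e0 0] mem_scale[of e1 0] by (auto simp: expand)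
  have e10: "ip e1 e0 = 0"
    using e1(3)[of e0] e0(3)[of e1] A_sym[of e1 e0] sym[of e1 "A e0"] nu by auto
  have e01: "ip e0 e1 = 0" using e10 sym[of e0 e1] by simp
  have Ae1: "ip (A x) e1 = nu * ip x e1" if "x \<in> D" for x
    using that A_sym[of x e1] sym[of x "A e1"] sym[of x e1] e1(3)[of x] by simp
  have Ae0: "ip (A x) e0 = 0" if "x \<in> D" for x
    using that A_sym[of x e0] sym[of x "A e0"] e0(3)[of x] by simp
  interpret w: sym_operator W ip "D \<inter> W" A
  proof -
    have W: "sym_form W ip" by (rule sub_form[OF _ W_sub]) (unfold W_def, blast)
    show "sym_operator W ip (D \<inter> W) A"
    proof (intro sym_operator.intro semi_inner.intro W semi_inner_axioms.intro sym_operator_axioms.intro)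
      fix x assume "x \<in> D \<inter> W"
      then show "A x \<in> W" using Ae1[of x] Ae0[of x] by (intro WI) auto
    next
      fix x y assume "x \<in> D \<inter> W" "y \<in> D \<inter> W"
      then show "ip (A x) y = ip x (A y)" by (intro A_sym) auto
    qed (use D_subspace W_sub in \<open>auto simp: nonneg A_add A_scale subspace_inter\<close>)
  qed
  have decomp: "g - (ip g e1 / ip e1 e1) *\<^sub>R e1 - (ip g e0 / ip e0 e0) *\<^sub>R e0 \<in> W" if "g \<in> V" for g
  proof -
    have [simp]: "e1 \<in> V" "e0 \<in> V" by simp_all
    note D_V [simp del] note QV [simp del] note WV [simp del] note w.D_V [simp del]
    show ?thesis
      using that less_imp_neq[OF e1(2)] less_imp_neq[OF e0(2)]
      by (intro WI) (simp_all add: expand e10 e01)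
  qed
  have weak: "ip f g = 0" if f: "f \<in> W" and z: "\<And>g. g \<in> W \<Longrightarrow> ip f g = 0" and g: "g \<in> V" for f g
    using z[OF decomp[OF g]] f g by (simp add: expand)
  have wc: w.complete
    unfolding w.complete_def
  proof (intro allI impI, elim conjE)
    fix g :: "nat \<Rightarrow> 'a" assume g: "\<forall>n. g n \<in> W" "\<forall>e>0. \<exists>M. \<forall>m\<ge>M. \<forall>n\<ge>M. ip (g m - g n) (g m - g n) < e"
    have "(\<forall>n. g n \<in> V) \<and> (\<forall>e>0. \<exists>M. \<forall>m\<ge>M. \<forall>n\<ge>M. ip (g m - g n) (g m - g n) < e)"
      using g by auto
    then obtain x where x: "x \<in> V" "(\<lambda>n. ip (g n - x) (g n - x)) \<longlonglongrightarrow> 0"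
      using cmpl[unfolded complete_def, THEN spec, of g] by blast
    have "ip x h = 0" if "h \<in> V" "\<And>n. ip (g n) h = 0" for h
      using tendsto_ip[of g x h] x g(1) that by (simp add: LIMSEQ_const_iff)
    then have "x \<in> W" using x(1) g(1) by (intro WI) auto
    with x(2) show "\<exists>x\<in>W. (\<lambda>n. ip (g n - x) (g n - x)) \<longlonglongrightarrow> 0" by auto
  qed
  have wres: "w.resolvent r" if r: "r < del" "r \<noteq> nu" "r \<noteq> 0" for r
  proof -
    obtain C where C: "C \<ge> 0" "\<And>f. f \<in> V \<Longrightarrow> \<exists>u\<in>D. (\<forall>g\<in>V. ip (A u) g - r * ip u g = ip f g) \<and> ip u u \<le> C * ip f f"
      using res[OF r] unfolding resolvent_def by auto
    show ?thesis unfolding w.resolvent_def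
    proof (intro exI conjI ballI)
      fix f assume f: "f \<in> W"
      then obtain u where u: "u \<in> D" "\<And>g. g \<in> V \<Longrightarrow> ip (A u) g - r * ip u g = ip f g" "ip u u \<le> C * ip f f"
        using C(2)[of f] by auto
      \<comment> \<open>Testing with the eigenvectors shows that the solution stays in
        \<open>W\<close>, because the factors \<open>nu - r\<close> and \<open>r\<close> are
        nonzero.\<close>
      have "(nu - r) * ip u e1 = 0" "r * ip u e0 = 0"
        using u(2)[of e1] u(2)[of e0] Ae1[OF u(1)] Ae0[OF u(1)] f by (auto simp: algebra_simps)
      then have "ip u e1 = 0" "ip u e0 = 0" using r by auto
      then have "u \<in> D \<inter> W" using u(1) by (intro IntI WI) auto
      then show "\<exists>u\<in>D \<inter> W. (\<forall>g\<in>W. ip (A u) g - r * ip u g = ip f g) \<and> ip u u \<le> C * ip f f"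
        using u(2,3) by (intro bexI[of _ u]) auto
    qed (rule C(1))
  qed
  \<comment> \<open>A starting point below the lower bound \<open>- K\<close> of the form and below
    \<open>nu\<close>. From it the bound on \<open>W\<close> climbs in three stages, to
    \<open>nu\<close>, to 0 and to \<open>del\<close>; simplicity together with orthogonality
    excludes eigenvectors in \<open>W\<close> at the two eigenvalues passed.\<close>
  define l where "l = min (- K) nu - 1"
  have l: "l < - K" "l < nu" "l < 0" using nu by (auto simp: l_def)
  have Aa: "ip (A x) x \<ge> - K * ip x x" if "x \<in> D" for x using a_low[of x] a_A[of x x] that by simp
  have low0: "ip (A x) x \<ge> l * ip x x" if "x \<in> D \<inter> W" for x
    using Aa[of x] that l(1) mult_right_mono[of l "- K" "ip x x"] nonneg[of x] by auto
  have low1: "ip (A x) x \<ge> nu * ip x x" if "x \<in> D \<inter> W" for x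
  proof (rule w.gap_step[OF wc low0 l(2) _ zero_less_one _ _ that])
    fix y assume y: "y \<in> D \<inter> W" "\<And>g. g \<in> W \<Longrightarrow> ip (A y) g = l * ip y g"
    then have "(l + K) * ip y y \<ge> 0" using Aa[of y] by (auto simp: algebra_simps)
    then show "ip y y = 0" using l(1) nonneg[of y] y(1) by (auto simp: zero_le_mult_iff)
  qed (use l nu del in \<open>auto intro!: wres\<close>)
  have low2: "ip (A x) x \<ge> 0 * ip x x" if "x \<in> D \<inter> W" for x
  proof (rule w.gap_step[OF wc low1 nu _ zero_less_one _ _ that])
    fix y assume y: "y \<in> D \<inter> W" "\<And>g. g \<in> W \<Longrightarrow> ip (A y) g = nu * ip y g"
    have "ip (A y - nu *\<^sub>R y) g = 0" if "g \<in> V" for g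
    proof (rule weak[OF _ _ that])
      show "A y - nu *\<^sub>R y \<in> W" using y(1) by (intro WI) (auto simp: expand Ae1 Ae0)
      show "ip (A y - nu *\<^sub>R y) h = 0" if "h \<in> W" for h using y that by (simp add: expand)
    qed
    then have "ip (A y) g = nu * ip y g" if "g \<in> V" for g using that y by (simp add: expand)
    then obtain \<beta> where "\<forall>g\<in>V. ip y g = \<beta> * ip e1 g" using simple1[of y] y by auto
    then show "ip y y = 0" using y(1) sym[of e1 y] by auto
  qed (use nu del in \<open>auto intro!: wres\<close>)
  have "- nu > 0" using nu by simp
  have low3: "ip (A x) x \<ge> del * ip x x" if "x \<in> D \<inter> W" for x
  proof (rule w.gap_step[OF wc low2 del _ \<open>- nu > 0\<close> _ _ that])
    fix y assume y: "y \<in> D \<inter> W" "\<And>g. g \<in> W \<Longrightarrow> ip (A y) g = 0 * ip y g"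
    have "ip (A y) g = 0" if "g \<in> V" for g
    proof (rule weak[OF _ _ that])
      show "A y \<in> W" using y(1) by (intro WI) (auto simp: Ae1 Ae0)
      show "ip (A y) h = 0" if "h \<in> W" for h using y that by simp
    qed
    then obtain \<beta> where "\<forall>g\<in>V. ip y g = \<beta> * ip e0 g" using simple0[of y] y by auto
    then show "ip y y = 0" using y(1) sym[of e0 y] by auto
  qed (use nu del in \<open>auto intro!: wres\<close>)
  \<comment> \<open>Passage from \<open>D\<close> to the form domain. \<open>u\<close> approximates
    \<open>y\<close> through the resolvent at \<open>- n\<close>; the cross term is
    \<open>a u v = n * ip v v\<close>, which for this \<open>n\<close> outweighs the lower bound
    \<open>- K\<close> on \<open>v\<close>.\<close>
  have coer: "a y y \<ge> del / 2 * ip y y" if y: "y \<in> Q" "y \<in> W" for y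
  proof -
    define n where "n = \<bar>K\<bar> + del - nu + 1"
    have n: "n > 0" "n > - nu" "2 * n - K \<ge> del" using nu del by (auto simp: n_def)
    obtain u where u: "u \<in> D" "u \<in> W" "\<And>g. g \<in> W \<Longrightarrow> ip (A u) g + n * ip u g = n * ip y g"
    proof -
      have "w.resolvent (- n)" using n del by (intro wres) auto
      then obtain u where u: "u \<in> D \<inter> W" "\<forall>g\<in>W. ip (A u) g - (- n) * ip u g = ip (n *\<^sub>R y) g"
        using w.mem_scale[OF y(2), of n] unfolding w.resolvent_def by blast
      then show ?thesis using y by (intro that[of u]) (auto simp: scale_left)
    qed
    define v where "v = y - u"
    have v: "v \<in> Q" "v \<in> W" using y u(1,2) unfolding v_def by (auto simp: W_sub subspace_diff)
    have yv: "y = u + v" by (simp add: v_def)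
    have uv: "a u v = n * ip v v"
      using a_A[OF u(1) v(1)] u(3)[OF v(2)] u(1) v(1) unfolding yv by (simp add: expand algebra_simps)
    have "a y y = a u u + 2 * a u v + a v v"
      using u(1) v(1) a.sym[of u v] unfolding yv by (simp add: a.expand)
    moreover have "a u u \<ge> del * ip u u" using low3[of u] u(1,2) a_A[of u u] by simp
    moreover have "a v v \<ge> - K * ip v v" using a_low v by simp
    moreover have "(2 * n - K) * ip v v \<ge> del * ip v v" using n(3) nonneg[of v] v by (intro mult_right_mono) auto
    ultimately have "a y y \<ge> del * (ip u u + ip v v)" using uv by (simp add: algebra_simps)
    moreover have "0 \<le> ip (u - v) (u - v)" using u(1) v(1) by (intro nonneg) auto
    then have "ip y y \<le> 2 * (ip u u + ip v v)"
      using u(1) v(1) sym[of u v] unfolding yv by (simp add: expand)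
    then have "del / 2 * ip y y \<le> del / 2 * (2 * (ip u u + ip v v))"
      using del by (intro mult_left_mono) auto
    ultimately show ?thesis by (simp add: algebra_simps)
  qed
  define N where "N = ip e1 e1"
  have N: "N > 0" using e1 by (simp add: N_def)
  define s where "s = ip psi e1 / N"
  define t where "t = ip psi e0 / ip e0 e0"
  define p where "p = psi - s *\<^sub>R e1 - t *\<^sub>R e0"
  have psiV: "psi \<in> V" by simp
  have p: "p \<in> W" using decomp[OF psiV] unfolding p_def s_def t_def N_def .
  have pD: "p \<in> D" unfolding p_def by (intro D_diff D_scale psi(1) e1(1) e0(1))
  \<comment> \<open>The membership rules are chained no further: on sums they make the simplifier backtrack exponentially.\<close>
  have [simp]: "p \<in> Q" "p \<in> V" "e1 \<in> Q" "e0 \<in> Q" "e1 \<in> V" "e0 \<in> V" "psi \<in> Q" "psi \<in> V"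
    using p pD psiV by simp_all
  note D_V [simp del] note DQ [simp del] note QV [simp del] note WV [simp del]
    note w.D_V [simp del]
  have a1: "a e1 x = nu * ip x e1" "a x e1 = nu * ip x e1" if "x \<in> Q" for x
    using a_A[of e1 x] e1(3)[of x] a.sym[of x e1] sym[of x e1] that QV[OF that] by auto
  have a0: "a e0 x = 0" "a x e0 = 0" if "x \<in> Q" for x
    using a_A[of e0 x] e0(3)[of x] a.sym[of x e0] that QV[OF that] by auto
  have psi_eq: "psi = s *\<^sub>R e1 + t *\<^sub>R e0 + p" by (simp add: p_def)
  define X where "X = - nu * s\<^sup>2 * N"
  define \<kappa> where "\<kappa> = - ip G psi"
  have \<kappa>: "\<kappa> > 0" using psi by (simp add: \<kappa>_def)
  have app: "a p p = X - \<kappa>"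
  proof -
    have "- \<kappa> = a psi psi" using a_A[of psi psi] psi(3)[of psi] by (simp add: \<kappa>_def)
    also have "\<dots> = s\<^sup>2 * nu * N + a p p"
      unfolding psi_eq using p pD e01 e10 by (simp add: a.expand expand a1 a0 N_def power2_eq_square)
    finally show ?thesis by (simp add: X_def algebra_simps)
  qed
  have a_nonneg: "a y y \<ge> 0" if "y \<in> Q" "y \<in> W" for y
    using order_trans[OF mult_nonneg_nonneg coer[OF that]] nonneg[OF QV[OF that(1)]] del by simp
  have X: "X \<ge> \<kappa>" "X > 0" using app a_nonneg[of p] p \<kappa> by auto
  interpret aw: sym_form "Q \<inter> W" a
    by (rule a.sub_form[OF Int_lower1 subspace_inter[OF a.subspace W_sub]])
  show ?thesis
  proof (intro exI[of _ "\<kappa> / X / (1 / (- nu) + 2 / del)"] conjI ballI impI)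
    have pos: "1 / (- nu) + 2 / del > 0" using nu del by (intro add_pos_pos) auto
    then show "\<kappa> / X / (1 / (- nu) + 2 / del) > 0" using \<kappa> X by simp
    fix y assume y: "y \<in> Q" "ip y G = 0 \<and> ip y e0 = 0"
    define c where "c = ip y e1 / N"
    define v where "v = y - c *\<^sub>R e1"
    have yV [simp]: "y \<in> V" "y \<in> Q" using y QV by auto
    have v: "v \<in> Q" "v \<in> W" using decomp[OF yV(1)] y(2) by (simp_all add: v_def c_def N_def)
    have [simp]: "v \<in> V" using v WV by blast
    have yv: "y = c *\<^sub>R e1 + v" by (simp add: v_def)
    define P where "P = a v v"
    define Y where "Y = - nu * c\<^sup>2 * N"
    have Y0: "Y \<ge> 0" unfolding Y_def using nu N by (simp add: mult_nonpos_nonneg)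
    have ayy: "a y y = P - Y"
      unfolding yv P_def Y_def using v by (simp add: a.expand expand a1 N_def power2_eq_square)
    \<comment> \<open>The constraint enters here: pairing with \<open>G\<close> is the form against
      \<open>psi\<close>, and the \<open>e0\<close>-component of \<open>psi\<close> contributes
      nothing.\<close>
    have "0 = a psi y" using a_A[of psi y] psi(3)[of y] y sym[of y G] by simp
    also have "\<dots> = s * c * nu * N + a p v"
      unfolding yv psi_eq using v p pD e01 e10 by (simp add: a.expand expand a1 a0 N_def)
    finally have apv: "a p v = - (s * c * nu * N)" by simp
    have "(a p v)\<^sup>2 \<le> a p p * a v v"
      using v p by (intro aw.Cauchy_Schwarz a_nonneg) auto
    \<comment> \<open>\<open>X\<close> and \<open>Y\<close> measure the negative parts of
      \<open>psi\<close> and \<open>y\<close>. Since \<open>a p p = X - \<kappa>\<close> with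
      \<open>\<kappa> > 0\<close>, the difference \<open>P - Y\<close> is at least
      \<open>\<kappa> / X * P\<close>.\<close>
    then have "X * Y \<le> (X - \<kappa>) * P"
      unfolding apv app P_def X_def Y_def by (simp add: power2_eq_square algebra_simps)
    then have "\<kappa> / X * P \<le> a y y" unfolding ayy using X by (simp add: field_simps)
    moreover have "ip y y \<le> P * (1 / (- nu) + 2 / del)"
    proof -
      have "ip y y = c\<^sup>2 * N + ip v v"
        unfolding yv using v sym[of e1 v] by (simp add: expand N_def power2_eq_square)
      moreover have "ip v v \<le> P * (2 / del)" using coer[OF v] del by (simp add: P_def field_simps)
      moreover have "c\<^sup>2 * N = Y * (1 / (- nu))" using nu by (simp add: Y_def)
      moreover have "X * Y \<le> X * P"
        using \<open>X * Y \<le> (X - \<kappa>) * P\<close> mult_nonneg_nonneg[OF less_imp_le[OF \<kappa>] a_nonneg[OF v]]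
        by (simp add: P_def algebra_simps)
      then have "Y * (1 / (- nu)) \<le> P * (1 / (- nu))" using X nu by (intro mult_right_mono) auto
      ultimately show ?thesis by (simp add: algebra_simps)
    qed
    ultimately show "\<kappa> / X / (1 / (- nu) + 2 / del) * ip y y \<le> a y y"
    proof -
      assume 1: "\<kappa> / X * P \<le> a y y" and 2: "ip y y \<le> P * (1 / (- nu) + 2 / del)"
      have "\<kappa> / X / (1 / (- nu) + 2 / del) * ip y y
          \<le> \<kappa> / X / (1 / (- nu) + 2 / del) * (P * (1 / (- nu) + 2 / del))"
        using \<kappa> X pos by (intro mult_left_mono[OF 2]) auto
      also have "\<dots> = \<kappa> / X * P" using less_imp_neq[OF pos] by (simp only: times_divide_eq_left) simp
      finally show ?thesis using 1 by simp
    qed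
  qed
qed

end

section \<open>Test functions\<close>

text \<open>Recursion through the derivative, rather than a statement about all iterated
  derivatives, is what makes sums, products and affine substitutions accessible to
  induction.\<close>

primrec times_diff :: "nat \<Rightarrow> (real \<Rightarrow> real) \<Rightarrow> bool" where
  "times_diff 0 f \<longleftrightarrow> True"
| "times_diff (Suc n) f \<longleftrightarrow> (\<forall>x. f field_differentiable at x) \<and> times_diff n (deriv f)"

lemma times_diff_iff: "times_diff n f \<longleftrightarrow> (\<forall>i<n. \<forall>x. (deriv ^^ i) f field_differentiable at x)"
proof (induction n arbitrary: f)
  case (Suc n)
  have "(\<forall>i<Suc n. \<forall>x. (deriv ^^ i) f field_differentiable at x) \<longleftrightarrow>
    (\<forall>x. f field_differentiable at x) \<and> (\<forall>i<n. \<forall>x. (deriv ^^ i) (deriv f) field_differentiable at x)"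
    by (simp add: All_less_Suc2 funpow_swap1)
  then show ?case using Suc.IH by simp
qed simp

lemma smooth_iff_times_diff: "smooth f \<longleftrightarrow> (\<forall>n. times_diff n f)"
  unfolding smooth_def times_diff_iff by blast

lemma times_diffI:
  assumes "\<And>x. (f has_field_derivative g x) (at x)" "times_diff n g"
  shows "times_diff (Suc n) f"
proof -
  have "deriv f = g" using assms(1) by (auto intro: DERIV_imp_deriv)
  then show ?thesis using assms by (auto simp: field_differentiable_def)
qed

lemma times_diff_Suc: "times_diff (Suc n) f \<Longrightarrow> times_diff n f"
  by (simp add: times_diff_iff del: times_diff.simps)

lemma times_diff_DERIV: "times_diff (Suc n) f \<Longrightarrow> (f has_field_derivative deriv f x) (at x)"
  by (simp add: DERIV_deriv_iff_field_differentiable)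

lemma times_diff_add: "times_diff n f \<Longrightarrow> times_diff n g \<Longrightarrow> times_diff n (\<lambda>x. f x + g x)"
proof (induction n arbitrary: f g)
  case (Suc n)
  show ?case
    by (rule times_diffI[where g = "\<lambda>x. deriv f x + deriv g x"])
       (use Suc in \<open>auto intro!: derivative_eq_intros times_diff_DERIV[of n]\<close>)
qed simp

lemma times_diff_mult: "times_diff n f \<Longrightarrow> times_diff n g \<Longrightarrow> times_diff n (\<lambda>x. f x * g x)"
proof (induction n arbitrary: f g)
  case (Suc n)
  show ?case
  proof (rule times_diffI[where g = "\<lambda>x. deriv f x * g x + deriv g x * f x"])
    show "((\<lambda>x. f x * g x) has_field_derivative deriv f x * g x + deriv g x * f x) (at x)" for x
      using DERIV_mult[OF times_diff_DERIV[OF Suc.prems(1)] times_diff_DERIV[OF Suc.prems(2)]] .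
    have "times_diff n (deriv f)" "times_diff n (deriv g)" "times_diff n f" "times_diff n g"
      using Suc.prems by (auto intro: times_diff_Suc)
    then show "times_diff n (\<lambda>x. deriv f x * g x + deriv g x * f x)"
      by (intro times_diff_add Suc.IH)
  qed
qed simp

lemma times_diff_affine: "times_diff n f \<Longrightarrow> times_diff n (\<lambda>x. f (a * x + b))"
proof (induction n arbitrary: f)
  case (Suc n)
  have c: "times_diff m (\<lambda>x. a)" for m by (induction m arbitrary: a) auto
  show ?case
  proof (rule times_diffI[where g = "\<lambda>x. deriv f (a * x + b) * a"])
    show "((\<lambda>x. f (a * x + b)) has_field_derivative deriv f (a * x + b) * a) (at x)" for x
      by (rule DERIV_chain2[OF times_diff_DERIV[OF Suc.prems]]) (auto intro!: derivative_eq_intros)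
    show "times_diff n (\<lambda>x. deriv f (a * x + b) * a)"
      using Suc by (intro times_diff_mult c) auto
  qed
qed simp

lemma smooth_mult: "smooth f \<Longrightarrow> smooth g \<Longrightarrow> smooth (\<lambda>x. f x * g x)"
  by (simp add: smooth_iff_times_diff times_diff_mult)

lemma smooth_add: "smooth f \<Longrightarrow> smooth g \<Longrightarrow> smooth (\<lambda>x. f x + g x)"
  by (simp add: smooth_iff_times_diff times_diff_add)

lemma smooth_affine: "smooth f \<Longrightarrow> smooth (\<lambda>x. f (a * x + b))"
  by (simp add: smooth_iff_times_diff times_diff_affine)

lemma smooth_const: "smooth (\<lambda>x. a)"
proof -
  have "times_diff m (\<lambda>x. a)" for m by (induction m arbitrary: a) auto
  then show ?thesis by (simp add: smooth_iff_times_diff)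
qed

lemma smooth_scale: "smooth f \<Longrightarrow> smooth (\<lambda>x. a * f x)"
  by (rule smooth_mult[OF smooth_const])

lemma smooth_deriv: "smooth f \<Longrightarrow> smooth (deriv f)"
  unfolding smooth_iff_times_diff by (metis times_diff.simps(2))

lemma smooth_DERIV: "smooth f \<Longrightarrow> (f has_field_derivative deriv f x) (at x)"
  unfolding smooth_iff_times_diff by (metis times_diff_DERIV)

lemma smoothI: "(\<And>x. (f has_field_derivative g x) (at x)) \<Longrightarrow> smooth g \<Longrightarrow> smooth f"
  unfolding smooth_iff_times_diff by (metis times_diffI times_diff_Suc)

lemma smooth_continuous: "smooth f \<Longrightarrow> continuous_on A f"
  by (meson DERIV_isCont continuous_at_imp_continuous_on smooth_DERIV)

text \<open>The classical flat function times a polynomial in \<open>1 / x\<close>. The polynomial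
  makes the class closed under differentiation, \<open>p\<close> being replaced by
  \<open>X^2 (p - p')\<close>, so smoothness follows by induction over all \<open>p\<close> at
  once.\<close>

definition flat :: "real poly \<Rightarrow> real \<Rightarrow> real" where
  "flat p x = (if x > 0 then poly p (1 / x) * exp (- (1 / x)) else 0)"

lemma poly_exp_tendsto_0: "((\<lambda>x::real. poly p x * exp (- x)) \<longlongrightarrow> 0) at_top"
proof -
  have "((\<lambda>x. poly p x * x ^ n * exp (- x)) \<longlongrightarrow> 0) at_top" for n
  proof (induction p arbitrary: n)
    case (pCons a p)
    have "((\<lambda>x. a * (x ^ n / exp x) + poly p x * x ^ Suc n * exp (- x)) \<longlongrightarrow> a * 0 + 0) at_top"
      by (intro tendsto_intros tendsto_power_div_exp_0 pCons.IH)
    then show ?case by (simp add: algebra_simps exp_minus divide_inverse)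
  qed simp
  from this[of 0] show ?thesis by simp
qed

lemma flat_tendsto: "(flat p \<longlongrightarrow> 0) (at 0)"
proof (rule filterlim_split_at)
  show "(flat p \<longlongrightarrow> 0) (at_left 0)"
    by (rule Lim_transform_eventually[OF tendsto_const])
       (auto simp: flat_def eventually_at_filter)
  have "((\<lambda>x. poly p (1 / x) * exp (- (1 / x))) \<longlongrightarrow> 0) (at_right 0)"
    using filterlim_compose[OF poly_exp_tendsto_0 filterlim_inverse_at_top_right]
    by (simp add: inverse_eq_divide)
  then show "(flat p \<longlongrightarrow> 0) (at_right 0)"
    by (rule Lim_transform_eventually) (auto simp: flat_def eventually_at_filter)
qed

lemma flat_DERIV: "(flat p has_field_derivative flat ([:0, 0, 1:] * (p - pderiv p)) x) (at x)"
proof (cases x "0 :: real" rule: linorder_cases)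
  case greater
  have "((\<lambda>x. poly p (1 / x) * exp (- (1 / x))) has_field_derivative
      flat ([:0, 0, 1:] * (p - pderiv p)) x) (at x)"
    using greater by (auto intro!: derivative_eq_intros simp: flat_def field_simps power2_eq_square)
  moreover have "\<forall>\<^sub>F y in nhds x. poly p (1 / y) * exp (- (1 / y)) = flat p y"
    using order_tendstoD(1)[OF tendsto_ident_at greater, of UNIV] greater
    by (auto simp: flat_def eventually_at_filter elim: eventually_mono)
  ultimately show ?thesis by (subst DERIV_cong_ev[OF refl _ refl]) (auto elim: eventually_mono)
next
  case less
  have "\<forall>\<^sub>F y in nhds x. flat p y = 0"
    using eventually_nhds_in_open[of "{..<0}" x] less by (auto simp: flat_def elim: eventually_mono)
  then have "(flat p has_field_derivative 0) (at x)"
    by (subst DERIV_cong_ev[OF refl _ refl]) auto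
  then show ?thesis using less by (simp add: flat_def)
next
  case equal
  \<comment> \<open>The difference quotient at 0 belongs to the same class, so its limit is already
    known.\<close>
  have eq: "flat p h / h = flat (pCons 0 p) h" if "h \<noteq> 0" for h using that by (simp add: flat_def)
  have "((\<lambda>h. flat p h / h) \<longlongrightarrow> 0) (at 0)"
    by (rule Lim_transform_eventually[OF flat_tendsto[of "pCons 0 p"]]) (auto simp: eq eventually_at_filter)
  then show ?thesis using equal by (simp add: has_field_derivative_iff flat_def)
qed

lemma smooth_flat: "smooth (flat p)"
proof -
  have "times_diff n (flat p)" for n
    by (induction n arbitrary: p) (auto intro!: times_diffI flat_DERIV simp del: times_diff.simps(2))
  then show ?thesis by (simp add: smooth_iff_times_diff)
qed

section \<open>Compactly supported functions and smooth approximations of indicators\<close>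

lemma test_functionI:
  assumes "smooth \<psi>" "\<And>x. x < a \<or> b < x \<Longrightarrow> \<psi> x = 0"
  shows "test_function \<psi>"
proof -
  have "{x. \<psi> x \<noteq> 0} \<subseteq> {a..b}" using assms(2) by (auto simp: not_less[symmetric])
  then have "bounded {x. \<psi> x \<noteq> 0}" using bounded_subset[OF bounded_closed_interval] by auto
  then show ?thesis using assms(1) by (simp add: test_function_def compact_closure)
qed

lemma test_function_support:
  assumes "test_function \<psi>"
  shows "\<exists>R>0. \<forall>x. \<bar>x\<bar> \<ge> R \<longrightarrow> \<psi> x = 0 \<and> deriv \<psi> x = 0"
proof -
  have "bounded {x. \<psi> x \<noteq> 0}"
    using assms bounded_subset[OF compact_imp_bounded closure_subset] by (auto simp: test_function_def)
  then obtain r where r: "\<And>x. \<psi> x \<noteq> 0 \<Longrightarrow> \<bar>x\<bar> \<le> r" by (auto simp: bounded_real)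
  have 0: "\<psi> x = 0" if "\<bar>x\<bar> > r" for x using r[of x] that by auto
  have d: "deriv \<psi> x = 0" if "\<bar>x\<bar> > r" for x
  proof -
    have "open {x::real. \<bar>x\<bar> > r}" by (intro open_Collect_less continuous_intros)
    then have "\<forall>\<^sub>F y in nhds x. \<psi> y = 0"
      using eventually_nhds_in_open[of "{x. \<bar>x\<bar> > r}" x] that 0 by (auto elim: eventually_mono)
    then have "(\<psi> has_field_derivative 0) (at x)" by (subst DERIV_cong_ev[OF refl _ refl]) auto
    then show ?thesis by (rule DERIV_imp_deriv)
  qed
  show ?thesis using 0 d by (intro exI[of _ "\<bar>r\<bar> + 1"]) auto
qed

text \<open>Smooth functions between 0 and the indicator of the closed interval that converge to the
  indicator of the open one. They do the work of mollifiers: testing against them yields integrals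
  over intervals.\<close>

definition bump :: "real \<Rightarrow> real \<Rightarrow> nat \<Rightarrow> real \<Rightarrow> real" where
  "bump a b n x = flat 1 (real n * (x - a)) * flat 1 (real n * (b - x))"

lemma bump_test: "test_function (bump a b n)"
proof (rule test_functionI)
  have "smooth (\<lambda>x. flat 1 (real n * x + - real n * a) * flat 1 (- real n * x + real n * b))"
    by (intro smooth_mult smooth_affine smooth_flat)
  then show "smooth (bump a b n)" by (simp add: bump_def[abs_def] algebra_simps)
  fix x assume "x < a \<or> b < x"
  then show "bump a b n x = 0" by (auto simp: bump_def flat_def zero_less_mult_iff)
qed

lemma bump_bounds: "0 \<le> bump a b n x" "bump a b n x \<le> indicator {a..b} x"
proof -
  have "0 \<le> flat 1 y" "flat 1 y \<le> 1" for y by (auto simp: flat_def)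
  then show "0 \<le> bump a b n x" by (simp add: bump_def)
  have "bump a b n x \<le> 1" unfolding bump_def
    using \<open>\<And>y. 0 \<le> flat 1 y\<close> \<open>\<And>y. flat 1 y \<le> 1\<close> by (intro mult_le_one) auto
  moreover have "bump a b n x = 0" if "x \<notin> {a..b}"
    using that by (auto simp: bump_def flat_def zero_less_mult_iff)
  ultimately show "bump a b n x \<le> indicator {a..b} x" by (auto split: split_indicator)
qed

lemma bump_tendsto: "(\<lambda>n. bump a b n x) \<longlonglongrightarrow> indicator {a<..<b} x"
proof -
  have 1: "(\<lambda>n. flat 1 (real n * y)) \<longlonglongrightarrow> 1" if "y > 0" for y
  proof -
    have "(\<lambda>n. exp (- (inverse y * inverse (real (Suc n))))) \<longlonglongrightarrow> exp (- (inverse y * 0))"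
      by (intro tendsto_intros LIMSEQ_inverse_real_of_nat)
    moreover have "exp (- (inverse y * inverse (real (Suc n)))) = flat 1 (real (Suc n) * y)" for n
      using that by (simp add: flat_def inverse_eq_divide zero_less_mult_iff mult.commute)
    ultimately have "(\<lambda>n. flat 1 (real (Suc n) * y)) \<longlonglongrightarrow> 1" by simp
    then show ?thesis by (rule LIMSEQ_imp_Suc)
  qed
  show ?thesis
  proof (cases "x \<in> {a<..<b}")
    case True
    then show ?thesis using tendsto_mult[OF 1[of "x - a"] 1[of "b - x"]] by (simp add: bump_def)
  next
    case False
    then have "bump a b n x = 0" for n by (auto simp: bump_def flat_def zero_less_mult_iff)
    then show ?thesis using False by simp
  qed
qed

section \<open>Weak derivatives and absolutely continuous representatives\<close>

lemma locally_integrable_measurable: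
  assumes "locally_integrable (f :: real \<Rightarrow> real)" shows "f \<in> borel_measurable borel"
proof (rule borel_measurable_LIMSEQ_real)
  have "(\<lambda>x. indicator {- real n..real n} x *\<^sub>R f x) \<in> borel_measurable lborel" for n
    using assms unfolding locally_integrable_def set_integrable_def by blast
  then show "(\<lambda>x. indicator {- real n..real n} x *\<^sub>R f x) \<in> borel_measurable borel" for n by simp
  fix x :: real
  have "\<forall>\<^sub>F n in sequentially. indicator {- real n..real n} x *\<^sub>R f x = f x"
    using eventually_ge_at_top[of "nat \<lceil>\<bar>x\<bar>\<rceil>"]
  proof eventually_elim
    case (elim n)
    then have "\<bar>x\<bar> \<le> real n" by linarith
    then show ?case by (auto split: split_indicator)
  qed
  then show "(\<lambda>n. indicator {- real n..real n} x *\<^sub>R f x) \<longlonglongrightarrow> f x" by (rule tendsto_eventually)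
qed

lemma locally_integrable_bounded_mult:
  fixes f g :: "real \<Rightarrow> real"
  assumes f: "locally_integrable f" and g: "g \<in> borel_measurable borel"
    and bd: "\<And>a b. \<exists>C. \<forall>x\<in>{a..b}. \<bar>g x\<bar> \<le> C"
  shows "locally_integrable (\<lambda>x. g x * f x)"
  unfolding locally_integrable_def
proof (intro allI)
  fix a b
  obtain C where C: "\<And>x. x \<in> {a..b} \<Longrightarrow> \<bar>g x\<bar> \<le> C" using bd by blast
  have m: "f \<in> borel_measurable borel" by (rule locally_integrable_measurable[OF f])
  have i: "set_integrable lborel {a..b} f" using f by (auto simp: locally_integrable_def)
  have i2: "set_integrable lborel {a..b} (\<lambda>x. C * f x)" using i by (rule set_integrable_mult_right)
  show "set_integrable lborel {a..b} (\<lambda>x. g x * f x)"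
    unfolding set_integrable_def
  proof (rule Bochner_Integration.integrable_bound[OF i2[unfolded set_integrable_def]])
    show "(\<lambda>x. indicator {a..b} x *\<^sub>R (g x * f x)) \<in> borel_measurable lborel" using m g by measurable
    show "AE x in lborel. norm (indicator {a..b} x *\<^sub>R (g x * f x)) \<le> norm (indicator {a..b} x *\<^sub>R (C * f x))"
      using C by (auto split: split_indicator simp: abs_mult intro!: AE_I2 mult_right_mono) (meson abs_ge_self order_trans)
  qed
qed

lemma continuous_on_Icc_bounded:
  fixes g :: "real \<Rightarrow> real"
  assumes "continuous_on UNIV g" shows "\<exists>C. \<forall>x\<in>{a..b}. \<bar>g x\<bar> \<le> C"
proof -
  have "compact (g ` {a..b})"
    by (intro compact_continuous_image continuous_on_subset[OF assms]) auto
  from compact_imp_bounded[OF this] show ?thesis by (auto simp: bounded_real)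
qed

lemma locally_integrable_continuous:
  "continuous_on UNIV (f :: real \<Rightarrow> real) \<Longrightarrow> locally_integrable f"
  unfolding locally_integrable_def
  by (blast intro: borel_integrable_atLeastAtMost' continuous_on_subset)

lemma locally_integrable_mult_continuous:
  fixes f g :: "real \<Rightarrow> real"
  assumes "locally_integrable f" "continuous_on UNIV g"
  shows "locally_integrable (\<lambda>x. g x * f x)"
  using assms by (intro locally_integrable_bounded_mult continuous_on_Icc_bounded)
     (auto intro: borel_measurable_continuous_onI)

lemma locally_integrable_add:
  "locally_integrable (f :: real \<Rightarrow> real) \<Longrightarrow> locally_integrable g \<Longrightarrow> locally_integrable (\<lambda>x. f x + g x)"
  unfolding locally_integrable_def by auto

lemma locally_integrable_diff:
  "locally_integrable (f :: real \<Rightarrow> real) \<Longrightarrow> locally_integrable g \<Longrightarrow> locally_integrable (\<lambda>x. f x - g x)"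
  unfolding locally_integrable_def by auto

lemma locally_integrable_cmult:
  "locally_integrable (f :: real \<Rightarrow> real) \<Longrightarrow> locally_integrable (\<lambda>x. c * f x)"
  unfolding locally_integrable_def by auto

lemma test_integrable:
  fixes f \<psi> :: "real \<Rightarrow> real"
  assumes "locally_integrable f" "continuous_on UNIV \<psi>" "\<And>x. \<bar>x\<bar> \<ge> R \<Longrightarrow> \<psi> x = 0"
  shows "integrable lborel (\<lambda>x. \<psi> x * f x)"
    and "(LINT x|lborel. \<psi> x * f x) = (LINT x:{-R..R}|lborel. \<psi> x * f x)"
proof -
  have eq: "(\<lambda>x. indicator {-R..R} x *\<^sub>R (\<psi> x * f x)) = (\<lambda>x. \<psi> x * f x)"
  proof
    fix x show "indicator {-R..R} x *\<^sub>R (\<psi> x * f x) = \<psi> x * f x"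
      using assms(3)[of x] by (cases "\<bar>x\<bar> \<ge> R") (auto split: split_indicator)
  qed
  have "set_integrable lborel {-R..R} (\<lambda>x. \<psi> x * f x)"
    using locally_integrable_mult_continuous[OF assms(1,2)] by (auto simp: locally_integrable_def)
  then show "integrable lborel (\<lambda>x. \<psi> x * f x)" by (simp only: set_integrable_def eq)
  show "(LINT x|lborel. \<psi> x * f x) = (LINT x:{-R..R}|lborel. \<psi> x * f x)"
    by (simp only: set_lebesgue_integral_def eq)
qed

text \<open>Absolute continuity with the density carried along as an explicit function. Nothing is
  claimed about derivatives at single points, and the density may be changed on a null set.\<close>

definition ac :: "(real \<Rightarrow> real) \<Rightarrow> (real \<Rightarrow> real) \<Rightarrow> bool" where
  "ac F f \<longleftrightarrow> locally_integrable f \<and> (\<forall>a b. a \<le> b \<longrightarrow> F b - F a = (LINT x:{a..b}|lborel. f x))"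

lemma ac_integral: "ac F f \<Longrightarrow> a \<le> b \<Longrightarrow> (LINT x:{a..b}|lborel. f x) = F b - F a"
  by (simp add: ac_def)

lemma ac_locally_integrable: "ac F f \<Longrightarrow> locally_integrable f"
  by (simp add: ac_def)

lemma ac_DERIV:
  assumes "\<And>x. (F has_field_derivative f x) (at x)" "continuous_on UNIV f"
  shows "ac F f"
  unfolding ac_def set_lebesgue_integral_def
proof (intro conjI allI impI)
  fix a b :: real assume "a \<le> b"
  have "(F has_vector_derivative f x) (at x within {a..b})" for x
    using has_field_derivative_at_within[OF assms(1)]
    by (simp add: has_real_derivative_iff_has_vector_derivative[symmetric])
  then show "F b - F a = (LINT x|lborel. indicator {a..b} x *\<^sub>R f x)"
    using \<open>a \<le> b\<close> continuous_on_subset[OF assms(2)]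
    by (intro integral_FTC_atLeastAtMost[symmetric]) auto
qed (rule locally_integrable_continuous[OF assms(2)])

lemma set_integral_Icc_split:
  fixes f :: "real \<Rightarrow> real"
  assumes "locally_integrable f" "a \<le> b" "b \<le> c"
  shows "(LINT x:{a..c}|lborel. f x) = (LINT x:{a..b}|lborel. f x) + (LINT x:{b..c}|lborel. f x)"
proof -
  have i: "set_integrable lborel {u..v} f" for u v using assms by (auto simp: locally_integrable_def)
  have e: "{a..c} = {a..b} \<union> {b..c}" using assms by auto
  show ?thesis unfolding e
  proof (rule set_integral_Un_AE)
    have "AE x in lborel. x \<noteq> b" by (rule AE_lborel_singleton)
    then show "AE x in lborel. \<not> (x \<in> {a..b} \<and> x \<in> {b..c})" by eventually_elim auto
  qed (use i in auto)
qed

lemma ac_antiderivative: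
  assumes f: "locally_integrable f" shows "\<exists>F. ac F f \<and> F 0 = 0"
proof (intro exI conjI)
  define F where "F = (\<lambda>x. if x \<ge> 0 then (LINT y:{0..x}|lborel. f y) else - (LINT y:{x..0}|lborel. f y))"
  show "ac F f" unfolding ac_def
  proof (intro conjI allI impI f)
    fix a b :: real assume "a \<le> b"
    then show "F b - F a = (LINT x:{a..b}|lborel. f x)"
      using set_integral_Icc_split[OF f, of 0 a b] set_integral_Icc_split[OF f, of a 0 b]
        set_integral_Icc_split[OF f, of a b 0] set_integral_Icc_split[OF f, of 0 0 b]
      by (auto simp: F_def not_le)
  qed
  show "F 0 = 0" using set_integral_Icc_split[OF f, of 0 0 0] by (simp add: F_def)
qed

lemma ac_continuous:
  assumes "ac F f" shows "continuous_on UNIV F"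
proof (rule continuous_at_imp_continuous_on, rule ballI)
  fix x :: real
  have i: "set_integrable lborel {x - 1..x + 1} f" using assms by (auto simp: ac_def locally_integrable_def)
  have "f integrable_on {x - 1..x + 1}" using set_borel_integral_eq_integral(1)[OF i] .
  then have c: "continuous_on {x - 1..x + 1} (\<lambda>y. integral {x - 1..y} f)"
    by (rule indefinite_integral_continuous_1)
  have "F y = F (x - 1) + integral {x - 1..y} f" if "y \<in> {x - 1..x + 1}" for y
  proof -
    have "set_integrable lborel {x - 1..y} f" using assms by (auto simp: ac_def locally_integrable_def)
    from set_borel_integral_eq_integral(2)[OF this] show ?thesis
      using that ac_integral[OF assms, of "x - 1" y] by simp
  qed
  then have "continuous_on {x - 1..x + 1} F"
    by (rule continuous_on_eq[OF continuous_on_add[OF continuous_on_const[of _ "F (x - 1)"] c] sym])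
  then show "isCont F x"
    by (rule continuous_on_interior) simp
qed

lemma ac_add: "ac F f \<Longrightarrow> ac G g \<Longrightarrow> ac (\<lambda>x. F x + G x) (\<lambda>x. f x + g x)"
  unfolding ac_def by (auto simp: locally_integrable_add) (simp add: locally_integrable_def algebra_simps)

lemma ac_cmult: "ac F f \<Longrightarrow> ac (\<lambda>x. c * F x) (\<lambda>x. c * f x)"
  unfolding ac_def by (auto simp: locally_integrable_cmult right_diff_distrib[symmetric])

lemma ac_diff: "ac F f \<Longrightarrow> ac G g \<Longrightarrow> ac (\<lambda>x. F x - G x) (\<lambda>x. f x - g x)"
  using ac_add[OF _ ac_cmult[of G g "-1"]] by simp

lemma ac_const: "ac (\<lambda>x. c) (\<lambda>x. 0)"
  by (rule ac_DERIV) auto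

text \<open>Integrating \<open>f x * g y\<close> over the square with side from \<open>a\<close> to
  \<open>b\<close> gives the product of the two increments. Splitting the square along the diagonal
  and applying Fubini to each half turns this into the product rule, without any pointwise
  derivative.\<close>

lemma ac_mult:
  assumes F: "ac F f" and G: "ac G g"
  shows "ac (\<lambda>x. F x * G x) (\<lambda>x. f x * G x + F x * g x)"
  unfolding ac_def
proof (intro conjI allI impI)
  have li: "locally_integrable (\<lambda>x. f x * G x)" "locally_integrable (\<lambda>x. F x * g x)"
    using locally_integrable_mult_continuous[OF ac_locally_integrable[OF F] ac_continuous[OF G]]
      locally_integrable_mult_continuous[OF ac_locally_integrable[OF G] ac_continuous[OF F]]
    by (auto simp: mult.commute)
  then show "locally_integrable (\<lambda>x. f x * G x + F x * g x)" by (rule locally_integrable_add)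
  fix a b :: real assume ab: "a \<le> b"
  define f0 where "f0 = (\<lambda>x. indicator {a..b} x * f x)"
  define g0 where "g0 = (\<lambda>x. indicator {a..b} x * g x)"
  have if0: "integrable lborel f0" and ig0: "integrable lborel g0"
    using F G by (auto simp: ac_def locally_integrable_def set_integrable_def f0_def g0_def)
  have [measurable]: "f0 \<in> borel_measurable borel" "g0 \<in> borel_measurable borel"
    using borel_measurable_integrable[OF if0] borel_measurable_integrable[OF ig0] by auto
  have Gx: "(LINT y|lborel. indicator {..x} y * g0 y) = G x - G a" if "x \<in> {a..b}" for x
  proof -
    have "(\<lambda>y. indicator {..x} y * g0 y) = (\<lambda>y. indicator {a..x} y *\<^sub>R g y)"
      using that by (auto simp: g0_def fun_eq_iff split: split_indicator)
    then show ?thesis using ac_integral[OF G, of a x] that by (simp add: set_lebesgue_integral_def)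
  qed
  have Fy: "(LINT x|lborel. indicator {..<y} x * f0 x) = F y - F a" if "y \<in> {a..b}" for y
  proof -
    have "(LINT x|lborel. indicator {..<y} x * f0 x) = (LINT x|lborel. indicator {a..y} x *\<^sub>R f x)"
    proof (rule integral_cong_AE)
      have "AE x in lborel. x \<noteq> y" by (rule AE_lborel_singleton)
      then show "AE x in lborel. indicator {..<y} x * f0 x = indicator {a..y} x *\<^sub>R f x"
        by eventually_elim (use that in \<open>auto simp: f0_def split: split_indicator\<close>)
    qed (use locally_integrable_measurable[OF ac_locally_integrable[OF F]] in auto)
    then show ?thesis using ac_integral[OF F, of a y] that by (simp add: set_lebesgue_integral_def)
  qed
  define P where "P = (\<lambda>(x, y). f0 x * g0 y)"
  have iP: "integrable (lborel \<Otimes>\<^sub>M lborel) P"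
  proof (rule lborel_pair.Fubini_integrable)
    show "P \<in> borel_measurable (lborel \<Otimes>\<^sub>M lborel)" unfolding P_def by measurable
    have "integrable lborel (\<lambda>x. \<bar>f0 x\<bar> * (LINT y|lborel. \<bar>g0 y\<bar>))" using if0 by auto
    then show "integrable lborel (\<lambda>x. LINT y|lborel. norm (P (x, y)))" by (simp add: P_def abs_mult)
    show "AE x in lborel. integrable lborel (\<lambda>y. P (x, y))" using ig0 by (simp add: P_def)
  qed
  define A where "A = (\<lambda>(x::real, y::real). indicator {p. snd p \<le> fst p} (x, y) * P (x, y))"
  define B where "B = (\<lambda>(x::real, y::real). indicator {p. fst p < snd p} (x, y) * P (x, y))"
  have mS: "{p. snd p \<le> (fst p::real)} \<in> sets (lborel \<Otimes>\<^sub>M lborel)"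
    "{p. fst p < (snd p::real)} \<in> sets (lborel \<Otimes>\<^sub>M lborel)"
    unfolding lborel_prod sets_lborel
    by (intro borel_closed borel_open closed_Collect_le open_Collect_less continuous_intros)+
  have iA: "integrable (lborel \<Otimes>\<^sub>M lborel) A" and iB: "integrable (lborel \<Otimes>\<^sub>M lborel) B"
    using integrable_real_mult_indicator[OF mS(1) iP] integrable_real_mult_indicator[OF mS(2) iP]
    by (simp_all add: A_def B_def case_prod_beta' mult.commute)
  have "(LINT p|(lborel \<Otimes>\<^sub>M lborel). P p) = (LINT x|lborel. LINT y|lborel. P (x, y))"
    using lborel_pair.integral_fst'[OF iP] by simp
  also have "\<dots> = (LINT x|lborel. f0 x) * (LINT y|lborel. g0 y)" by (simp add: P_def)
  also have "\<dots> = (F b - F a) * (G b - G a)"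
    using ac_integral[OF F ab] ac_integral[OF G ab] by (simp add: f0_def g0_def set_lebesgue_integral_def)
  finally have 1: "(LINT p|(lborel \<Otimes>\<^sub>M lborel). P p) = (F b - F a) * (G b - G a)" .
  have "(LINT p|(lborel \<Otimes>\<^sub>M lborel). A p) = (LINT x|lborel. LINT y|lborel. A (x, y))"
    using lborel_pair.integral_fst'[OF iA] by simp
  also have "\<dots> = (LINT x|lborel. f0 x * (G x - G a))"
  proof (rule Bochner_Integration.integral_cong[OF refl])
    fix x
    have "(LINT y|lborel. A (x, y)) = (LINT y|lborel. f0 x * (indicator {..x} y * g0 y))"
      by (rule Bochner_Integration.integral_cong) (auto simp: A_def P_def split: split_indicator)
    also have "\<dots> = f0 x * (G x - G a)" using Gx[of x] by (cases "x \<in> {a..b}") (auto simp: f0_def)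
    finally show "(LINT y|lborel. A (x, y)) = f0 x * (G x - G a)" .
  qed
  also have "\<dots> = (LINT x:{a..b}|lborel. f x * G x) - G a * (F b - F a)"
  proof -
    have "(LINT x|lborel. f0 x * (G x - G a)) = (LINT x:{a..b}|lborel. f x * G x - G a * f x)"
      unfolding set_lebesgue_integral_def
      by (rule Bochner_Integration.integral_cong) (auto simp: f0_def algebra_simps)
    then show ?thesis using li ac_integral[OF F ab] ac_locally_integrable[OF F]
      by (simp add: locally_integrable_def)
  qed
  finally have 2: "(LINT p|(lborel \<Otimes>\<^sub>M lborel). A p) = (LINT x:{a..b}|lborel. f x * G x) - G a * (F b - F a)" .
  have "(LINT p|(lborel \<Otimes>\<^sub>M lborel). B p) = (LINT y|lborel. LINT x|lborel. B (x, y))"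
    using lborel_pair.integral_snd[of "\<lambda>x y. B (x, y)"] iB by simp
  also have "\<dots> = (LINT y|lborel. g0 y * (F y - F a))"
  proof (rule Bochner_Integration.integral_cong[OF refl])
    fix y
    have "(LINT x|lborel. B (x, y)) = (LINT x|lborel. g0 y * (indicator {..<y} x * f0 x))"
      by (rule Bochner_Integration.integral_cong) (auto simp: B_def P_def split: split_indicator)
    also have "\<dots> = g0 y * (F y - F a)" using Fy[of y] by (cases "y \<in> {a..b}") (auto simp: g0_def)
    finally show "(LINT x|lborel. B (x, y)) = g0 y * (F y - F a)" .
  qed
  also have "\<dots> = (LINT x:{a..b}|lborel. F x * g x) - F a * (G b - G a)"
  proof -
    have "(LINT x|lborel. g0 x * (F x - F a)) = (LINT x:{a..b}|lborel. F x * g x - F a * g x)"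
      unfolding set_lebesgue_integral_def
      by (rule Bochner_Integration.integral_cong) (auto simp: g0_def algebra_simps)
    then show ?thesis using li ac_integral[OF G ab] ac_locally_integrable[OF G]
      by (simp add: locally_integrable_def)
  qed
  finally have 3: "(LINT p|(lborel \<Otimes>\<^sub>M lborel). B p) = (LINT x:{a..b}|lborel. F x * g x) - F a * (G b - G a)" .
  have "(LINT p|(lborel \<Otimes>\<^sub>M lborel). P p) = (LINT p|(lborel \<Otimes>\<^sub>M lborel). A p + B p)"
    by (rule Bochner_Integration.integral_cong) (auto simp: A_def B_def split: split_indicator)
  also have "\<dots> = (LINT p|(lborel \<Otimes>\<^sub>M lborel). A p) + (LINT p|(lborel \<Otimes>\<^sub>M lborel). B p)"
    using iA iB by (rule Bochner_Integration.integral_add)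
  finally have "(F b - F a) * (G b - G a) = (LINT x:{a..b}|lborel. f x * G x) - G a * (F b - F a)
     + ((LINT x:{a..b}|lborel. F x * g x) - F a * (G b - G a))"
    using 1 2 3 by simp
  moreover have "(LINT x:{a..b}|lborel. f x * G x + F x * g x)
     = (LINT x:{a..b}|lborel. f x * G x) + (LINT x:{a..b}|lborel. F x * g x)"
    using li by (intro set_integral_add) (auto simp: locally_integrable_def)
  ultimately show "F b * G b - F a * G a = (LINT x:{a..b}|lborel. f x * G x + F x * g x)"
    by (simp add: algebra_simps)
qed

text \<open>The product rule with the test function, on an interval at whose ends the test function
  vanishes.\<close>

lemma ac_has_weak_deriv:
  assumes F: "ac F f" shows "has_weak_deriv F f"
  unfolding has_weak_deriv_def
proof (intro conjI allI impI)
  show li: "locally_integrable F" "locally_integrable f"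
    using F by (auto intro: locally_integrable_continuous ac_continuous ac_locally_integrable)
  fix \<psi> assume t: "test_function \<psi>"
  then have s: "smooth \<psi>" by (simp add: test_function_def)
  obtain R where R: "R > 0" "\<And>x. \<bar>x\<bar> \<ge> R \<Longrightarrow> \<psi> x = 0" "\<And>x. \<bar>x\<bar> \<ge> R \<Longrightarrow> deriv \<psi> x = 0"
    using test_function_support[OF t] by blast
  have c: "continuous_on UNIV \<psi>" "continuous_on UNIV (deriv \<psi>)"
    using s smooth_deriv smooth_continuous by blast+
  have "ac \<psi> (deriv \<psi>)" using s c by (intro ac_DERIV smooth_DERIV)
  from ac_integral[OF ac_mult[OF this F], of "-R" R]
  have "(LINT x:{-R..R}|lborel. deriv \<psi> x * F x + \<psi> x * f x) = 0" using R by simp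
  moreover have "set_integrable lborel {-R..R} (\<lambda>x. deriv \<psi> x * F x)" "set_integrable lborel {-R..R} (\<lambda>x. \<psi> x * f x)"
    using locally_integrable_mult_continuous[OF li(1) c(2)] locally_integrable_mult_continuous[OF li(2) c(1)]
    by (auto simp: locally_integrable_def)
  ultimately show "(LINT x|lborel. deriv \<psi> x *\<^sub>R F x) = - (LINT x|lborel. \<psi> x *\<^sub>R f x)"
    using test_integrable(2)[OF li(1) c(2) R(3)] test_integrable(2)[OF li(2) c(1) R(2)] by simp
qed

text \<open>After truncation to a bounded interval, the sets over which the integral vanishes form a
  Dynkin class that contains the open intervals; these are stable under intersection and generate
  the Borel sets.\<close>

lemma AE_zero_of_intervals:
  fixes f :: "real \<Rightarrow> real"
  assumes f: "locally_integrable f" and 0: "\<And>a b. a < b \<Longrightarrow> (LINT x:{a<..<b}|lborel. f x) = 0"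
  shows "AE x in lborel. f x = 0"
proof -
  have "AE x in lborel. indicator {- real n<..<real n} x *\<^sub>R f x = 0" for n :: nat
  proof (rule density_unique_real)
    define g where "g = (\<lambda>x. indicator {- real n<..<real n} x *\<^sub>R f x)"
    show "integrable lborel (\<lambda>x. 0 :: real)" by simp
    have "set_integrable lborel {- real n<..<real n} f"
      using f by (rule_tac set_integrable_subset[of lborel "{- real n..real n}"]) (auto simp: locally_integrable_def)
    then show int: "integrable lborel (\<lambda>x. indicator {- real n<..<real n} x *\<^sub>R f x)" by (simp add: set_integrable_def)
    then have ig: "integrable lborel g" by (simp add: g_def)
    have sg: "set_integrable lborel A g" if "A \<in> sets borel" for A
      using integrable_mult_indicator[OF _ ig, of A] that by (simp add: set_integrable_def)
    have iv: "(LINT x:{a<..<b}|lborel. g x) = 0" for a b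
    proof -
      have "(LINT x:{a<..<b}|lborel. g x) = (LINT x:{max a (- real n)<..<min b (real n)}|lborel. f x)"
        unfolding set_lebesgue_integral_def g_def
        by (rule Bochner_Integration.integral_cong) (auto split: split_indicator)
      then show ?thesis
        using 0[of "max a (- real n)" "min b (real n)"]
        by (cases "max a (- real n) < min b (real n)") (auto simp: set_lebesgue_integral_def)
    qed
    have all: "(LINT x|lborel. g x) = 0"
    proof -
      have "(\<lambda>x. indicator {- real n<..<real n} x *\<^sub>R g x) = g" by (auto simp: g_def split: split_indicator)
      then show ?thesis using iv[of "- real n" "real n"] by (simp only: set_lebesgue_integral_def)
    qed
    fix A assume "A \<in> sets (lborel :: real measure)"
    then have sA: "A \<in> sigma_sets UNIV (range (\<lambda>(a, b). {a<..<b::real}))"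
      by (simp add: borel_eq_box)
    have st: "Int_stable (range (\<lambda>(a, b). {a<..<b::real}))"
      by (auto simp: Int_stable_def image_iff Int_greaterThanLessThan)
    have sub: "range (\<lambda>(a, b). {a<..<b::real}) \<subseteq> Pow UNIV" by simp
    from st sub sA have "(LINT x:A|lborel. g x) = 0"
    proof (induction rule: sigma_sets_induct_disjoint)
      case (basic A) then show ?case using iv by auto
    next
      case (compl A)
      then have A: "A \<in> sets borel" by (simp add: borel_eq_box)
      have "(LINT x:UNIV - A|lborel. g x) = (LINT x|lborel. g x - indicator A x *\<^sub>R g x)"
        unfolding set_lebesgue_integral_def
        by (rule Bochner_Integration.integral_cong) (auto split: split_indicator)
      also have "\<dots> = (LINT x|lborel. g x) - (LINT x:A|lborel. g x)"
        unfolding set_lebesgue_integral_def using ig sg[OF A] by (simp add: set_integrable_def)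
      finally show ?case using all compl by simp
    next
      case (union A)
      then have A: "A i \<in> sets borel" for i by (auto simp: borel_eq_box)
      have "(LINT x:(\<Union>i. A i)|lborel. g x) = (\<Sum>i. (LINT x:(A i)|lborel. g x))"
        by (rule lebesgue_integral_countable_add) (use A union sg in \<open>auto simp: disjoint_family_on_def\<close>)
      then show ?case using union by simp
    qed (auto simp: set_lebesgue_integral_def)
    then show "(LINT x:A|lborel. indicator {- real n<..<real n} x *\<^sub>R f x) = (LINT x:A|lborel. 0)" by (simp add: g_def)
  qed
  then have "AE x in lborel. \<forall>n::nat. indicator {- real n<..<real n} x *\<^sub>R f x = 0"
    unfolding AE_all_countable by blast
  then show ?thesis
  proof eventually_elim
    case (elim x)
    obtain n where "\<bar>x\<bar> < real n" using reals_Archimedean2 by blast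
    then show ?case using elim[rule_format, of n] by (auto simp: abs_less_iff indicator_def split: if_splits)
  qed
qed

lemma test_function_continuous:
  "test_function \<psi> \<Longrightarrow> continuous_on UNIV \<psi>" "test_function \<psi> \<Longrightarrow> continuous_on UNIV (deriv \<psi>)"
  using smooth_deriv smooth_continuous by (auto simp: test_function_def)

lemma integrable_test_mult:
  assumes "test_function \<psi>" "locally_integrable f"
  shows "integrable lborel (\<lambda>x. \<psi> x * f x)" "integrable lborel (\<lambda>x. deriv \<psi> x * f x)"
  using test_function_support[OF assms(1)] test_integrable(1)[OF assms(2)] test_function_continuous[OF assms(1)]
  by metis+

lemma integral_bump_tendsto:
  assumes f: "locally_integrable f"
  shows "(\<lambda>n. LINT x|lborel. bump a b n x * f x) \<longlonglongrightarrow> (LINT x:{a<..<b}|lborel. f x)"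
  unfolding set_lebesgue_integral_def
proof (rule integral_dominated_convergence[where w = "\<lambda>x. norm (indicator {a..b} x *\<^sub>R f x)"])
  have [measurable]: "f \<in> borel_measurable borel" by (rule locally_integrable_measurable[OF f])
  show "(\<lambda>x. indicator {a<..<b} x *\<^sub>R f x) \<in> borel_measurable lborel" by measurable
  show "(\<lambda>x. bump a b n x * f x) \<in> borel_measurable lborel" for n
    using integrable_test_mult(1)[OF bump_test f] by (rule borel_measurable_integrable)
  show "integrable lborel (\<lambda>x. norm (indicator {a..b} x *\<^sub>R f x))"
    using f by (auto simp: locally_integrable_def set_integrable_def)
  show "AE x in lborel. (\<lambda>n. bump a b n x * f x) \<longlonglongrightarrow> indicator {a<..<b} x *\<^sub>R f x"
    by (auto intro!: tendsto_intros bump_tendsto)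
  show "AE x in lborel. norm (bump a b n x * f x) \<le> norm (indicator {a..b} x *\<^sub>R f x)" for n
    using bump_bounds[of a b n] by (auto simp: abs_mult intro!: mult_right_mono)
qed

lemma fundamental_lemma:
  assumes f: "locally_integrable f" and 0: "\<And>\<psi>. test_function \<psi> \<Longrightarrow> (LINT x|lborel. \<psi> x * f x) = 0"
  shows "AE x in lborel. f x = 0"
proof (rule AE_zero_of_intervals[OF f])
  fix a b :: real
  show "(LINT x:{a<..<b}|lborel. f x) = 0"
    using integral_bump_tendsto[OF f, of a b] 0[OF bump_test] by (simp add: LIMSEQ_const_iff)
qed

text \<open>A primitive is constant on either side of the support, and zero mean makes the two
  constants equal.\<close>

lemma test_function_antiderivative:
  assumes t: "test_function \<eta>" and 0: "(LINT x|lborel. \<eta> x) = 0"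
  obtains \<psi> where "test_function \<psi>" "deriv \<psi> = \<eta>"
proof -
  have s: "smooth \<eta>" using t by (simp add: test_function_def)
  have c: "continuous_on UNIV \<eta>" by (rule smooth_continuous[OF s])
  obtain R where R: "R > 0" "\<And>x. \<bar>x\<bar> \<ge> R \<Longrightarrow> \<eta> x = 0" "\<And>x. \<bar>x\<bar> \<ge> R \<Longrightarrow> deriv \<eta> x = 0"
    using test_function_support[OF t] by blast
  obtain F where F: "\<And>x. (F has_field_derivative \<eta> x) (at x)"
  proof -
    have "\<exists>F. \<forall>x. -\<infinity> < ereal x \<longrightarrow> ereal x < \<infinity> \<longrightarrow> (F has_vector_derivative \<eta> x) (at x)"
      using c by (intro einterval_antiderivative) (auto simp: continuous_on_eq_continuous_at)
    then show thesis using that by (auto simp: has_real_derivative_iff_has_vector_derivative)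
  qed
  have a: "ac F \<eta>" by (rule ac_DERIV[OF F c])
  have left: "F x = F (- R)" if "x \<le> - R" for x
  proof -
    have "(LINT y:{x..- R}|lborel. \<eta> y) = (LINT y:{x..- R}|lborel. 0)"
      using R that by (intro set_lebesgue_integral_cong) auto
    then show ?thesis using ac_integral[OF a that] by simp
  qed
  have right: "F x = F R" if "R \<le> x" for x
  proof -
    have "(LINT y:{R..x}|lborel. \<eta> y) = (LINT y:{R..x}|lborel. 0)"
      using R that by (intro set_lebesgue_integral_cong) auto
    then show ?thesis using ac_integral[OF a that] by simp
  qed
  have mid: "F R = F (- R)"
    using ac_integral[OF a, of "- R" R] R 0
      test_integrable(2)[of "\<lambda>x. 1" \<eta> R, OF locally_integrable_continuous c] by simp
  show thesis
  proof
    show "deriv (\<lambda>x. F x - F R) = \<eta>"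
      by (rule ext, rule DERIV_imp_deriv) (auto intro!: derivative_eq_intros F)
    have "smooth (\<lambda>x. F x - F R)"
      by (rule smoothI[OF _ s]) (auto intro!: derivative_eq_intros F)
    then show "test_function (\<lambda>x. F x - F R)"
    proof (rule test_functionI[of _ "- R" R])
      fix x assume "x < - R \<or> R < x"
      then show "F x - F R = 0" using left[of x] right[of x] mid by linarith
    qed
  qed
qed

lemma test_function_add: "test_function f \<Longrightarrow> test_function g \<Longrightarrow> test_function (\<lambda>x. f x + c * g x)"
proof -
  assume f: "test_function f" and g: "test_function g"
  obtain R1 where R1: "R1 > 0" "\<And>x. \<bar>x\<bar> \<ge> R1 \<Longrightarrow> f x = 0" "\<And>x. \<bar>x\<bar> \<ge> R1 \<Longrightarrow> deriv f x = 0"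
    using test_function_support[OF f] by blast
  obtain R2 where R2: "R2 > 0" "\<And>x. \<bar>x\<bar> \<ge> R2 \<Longrightarrow> g x = 0" "\<And>x. \<bar>x\<bar> \<ge> R2 \<Longrightarrow> deriv g x = 0"
    using test_function_support[OF g] by blast
  show ?thesis
  proof (rule test_functionI[of _ "- max R1 R2" "max R1 R2"])
    show "smooth (\<lambda>x. f x + c * g x)"
      using f g by (auto simp: test_function_def intro!: smooth_add smooth_scale)
    fix x assume "x < - max R1 R2 \<or> max R1 R2 < x"
    then have "\<bar>x\<bar> \<ge> R1" "\<bar>x\<bar> \<ge> R2" by linarith+
    then show "f x + c * g x = 0" using R1 R2 by simp
  qed
qed

text \<open>A test function minus a suitable multiple of one fixed bump has mean zero and is thus
  the derivative of a test function. Testing with it shows that \<open>h\<close> pairs like the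
  constant \<open>c\<close>, the average of \<open>h\<close> weighted by that bump.\<close>

lemma du_Bois_Reymond:
  assumes "has_weak_deriv h (\<lambda>x. 0 :: real)"
  shows "\<exists>c. AE x in lborel. h x = c"
proof -
  have h: "locally_integrable h" using assms by (simp add: has_weak_deriv_def)
  have one: "locally_integrable (\<lambda>x. 1 :: real)" by (intro locally_integrable_continuous continuous_intros)
  have "(\<lambda>n. LINT x|lborel. bump 0 1 n x * 1) \<longlonglongrightarrow> 1"
    using integral_bump_tendsto[OF one, of 0 1] by (simp add: set_lebesgue_integral_def)
  then have "\<forall>\<^sub>F n in sequentially. (LINT x|lborel. bump 0 1 n x * 1) > 0"
    by (rule order_tendstoD) simp
  then obtain n where n: "(LINT x|lborel. bump 0 1 n x) > 0" by (auto simp: eventually_sequentially)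
  define I where "I = (LINT x|lborel. bump 0 1 n x)"
  define c where "c = (LINT x|lborel. bump 0 1 n x * h x) / I"
  have I: "I > 0" using n by (simp add: I_def)
  have ib: "integrable lborel (\<lambda>x. bump 0 1 n x)" "integrable lborel (\<lambda>x. bump 0 1 n x * h x)"
    using integrable_test_mult(1)[OF bump_test one] integrable_test_mult(1)[OF bump_test h] by auto
  have "AE x in lborel. h x - c = 0"
  proof (rule fundamental_lemma)
    show "locally_integrable (\<lambda>x. h x - c)"
      by (intro locally_integrable_diff h locally_integrable_continuous continuous_intros)
    fix \<theta> assume t: "test_function \<theta>"
    define J where "J = (LINT x|lborel. \<theta> x)"
    define \<eta> where "\<eta> = (\<lambda>x. \<theta> x + (- J / I) * bump 0 1 n x)"
    have it: "integrable lborel \<theta>" "integrable lborel (\<lambda>x. \<theta> x * h x)"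
      using integrable_test_mult(1)[OF t one] integrable_test_mult(1)[OF t h] by auto
    have "test_function \<eta>" unfolding \<eta>_def by (rule test_function_add[OF t bump_test])
    moreover have "(LINT x|lborel. \<eta> x) = 0"
      using it ib I by (simp add: \<eta>_def J_def I_def[symmetric])
    ultimately obtain \<psi> where \<psi>: "test_function \<psi>" "deriv \<psi> = \<eta>"
      by (rule test_function_antiderivative)
    then have "(LINT x|lborel. \<eta> x * h x) = 0" using assms by (auto simp: has_weak_deriv_def)
    moreover have "(LINT x|lborel. \<eta> x * h x) = (LINT x|lborel. \<theta> x * h x + (- J / I) * (bump 0 1 n x * h x))"
      by (simp add: \<eta>_def algebra_simps)
    ultimately have "(LINT x|lborel. \<theta> x * h x) = J * c"
      using it ib by (simp add: c_def)
    moreover have "(LINT x|lborel. \<theta> x * (h x - c)) = (LINT x|lborel. \<theta> x * h x - \<theta> x * c)"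
      by (simp add: algebra_simps)
    ultimately show "(LINT x|lborel. \<theta> x * (h x - c)) = 0" using it by (simp add: J_def)
  qed
  then show ?thesis by (intro exI[of _ c]) auto
qed

lemma has_weak_deriv_diff:
  fixes f g :: "real \<Rightarrow> real"
  assumes "has_weak_deriv f f'" "has_weak_deriv g g'"
  shows "has_weak_deriv (\<lambda>x. f x - c * g x) (\<lambda>x. f' x - c * g' x)"
proof -
  have li: "locally_integrable f" "locally_integrable g" "locally_integrable f'" "locally_integrable g'"
    using assms by (auto simp: has_weak_deriv_def)
  show ?thesis unfolding has_weak_deriv_def
  proof (intro conjI allI impI locally_integrable_diff locally_integrable_cmult li)
    fix \<psi> assume t: "test_function \<psi>"
    have 1: "(LINT x|lborel. deriv \<psi> x *\<^sub>R (f x - c * g x)) = (LINT x|lborel. deriv \<psi> x * f x - c * (deriv \<psi> x * g x))"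
      and 2: "(LINT x|lborel. \<psi> x *\<^sub>R (f' x - c * g' x)) = (LINT x|lborel. \<psi> x * f' x - c * (\<psi> x * g' x))"
      by (simp_all add: algebra_simps)
    show "(LINT x|lborel. deriv \<psi> x *\<^sub>R (f x - c * g x)) = - (LINT x|lborel. \<psi> x *\<^sub>R (f' x - c * g' x))"
      unfolding 1 2 using integrable_test_mult[OF t] li assms t by (simp add: has_weak_deriv_def)
  qed
qed

lemma has_weak_deriv_unique:
  fixes f :: "real \<Rightarrow> real"
  assumes "has_weak_deriv f g" "has_weak_deriv f h"
  shows "AE x in lborel. g x = h x"
proof -
  have li: "locally_integrable g" "locally_integrable h"
    using assms by (auto simp: has_weak_deriv_def)
  have "AE x in lborel. g x - h x = 0"
  proof (rule fundamental_lemma[OF locally_integrable_diff[OF li]])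
    fix \<psi> assume t: "test_function \<psi>"
    have "(LINT x|lborel. \<psi> x * (g x - h x)) = (LINT x|lborel. \<psi> x * g x - \<psi> x * h x)" by (simp add: algebra_simps)
    then show "(LINT x|lborel. \<psi> x * (g x - h x)) = 0"
      using assms t integrable_test_mult[OF t] li by (simp add: has_weak_deriv_def)
  qed
  then show ?thesis by simp
qed

text \<open>An antiderivative of \<open>g\<close> differs from \<open>f\<close> by a function with
  vanishing weak derivative, that is, by a constant; this yields the continuous
  representative.\<close>

lemma has_weak_deriv_imp_ac:
  assumes "has_weak_deriv f g"
  shows "\<exists>F. ac F g \<and> (AE x in lborel. f x = F x)"
proof -
  obtain G where G: "ac G g" using assms ac_antiderivative by (auto simp: has_weak_deriv_def)
  have "has_weak_deriv (\<lambda>x. f x - 1 * G x) (\<lambda>x. g x - 1 * g x)"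
    by (intro has_weak_deriv_diff assms ac_has_weak_deriv G)
  then obtain c where c: "AE x in lborel. f x - G x = c" using du_Bois_Reymond[of "\<lambda>x. f x - G x"] by auto
  show ?thesis
  proof (intro exI conjI)
    show "ac (\<lambda>x. G x + c) g" using ac_add[OF G ac_const[of c]] by simp
    show "AE x in lborel. f x = G x + c" using c by eventually_elim auto
  qed
qed

section \<open>Square integrable functions\<close>

text \<open>The abstract form arguments ask for a real vector space. Functions themselves serve, not
  classes modulo null sets, which is why the pairing below is only a semi-inner product.\<close>

instantiation "fun" :: (type, real_vector) real_vector
begin

definition "scaleR r f = (\<lambda>x. r *\<^sub>R f x)"

instance
  by standard (auto simp: scaleR_fun_def fun_eq_iff algebra_simps)

end

lemma scaleR_fun_apply [simp]: "(r *\<^sub>R f) x = r *\<^sub>R f x"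
  by (simp add: scaleR_fun_def)

lemma L2_real_iff: "L2 (f :: real \<Rightarrow> real) \<longleftrightarrow> f \<in> borel_measurable borel \<and> integrable lborel (\<lambda>x. (f x)\<^sup>2)"
  by (simp add: L2_def)

lemma L2_measurable: "L2 (f :: real \<Rightarrow> real) \<Longrightarrow> f \<in> borel_measurable borel"
  by (simp add: L2_real_iff)

lemma L2_mult_integrable:
  fixes f g :: "real \<Rightarrow> real"
  assumes "L2 f" "L2 g" shows "integrable lborel (\<lambda>x. f x * g x)"
proof (rule Bochner_Integration.integrable_bound)
  show "integrable lborel (\<lambda>x. (f x)\<^sup>2 + (g x)\<^sup>2)" using assms by (simp add: L2_real_iff)
  show "(\<lambda>x. f x * g x) \<in> borel_measurable lborel"
    using L2_measurable[OF assms(1)] L2_measurable[OF assms(2)] by measurable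
  have "\<bar>a * b\<bar> \<le> a\<^sup>2 + b\<^sup>2" for a b :: real
    using sum_squares_bound[of "\<bar>a\<bar>" "\<bar>b\<bar>"] mult_nonneg_nonneg[OF abs_ge_zero abs_ge_zero, of a b]
    unfolding abs_mult power2_abs by linarith
  then show "AE x in lborel. norm (f x * g x) \<le> norm ((f x)\<^sup>2 + (g x)\<^sup>2)" by (intro AE_I2) (force intro: order_trans)
qed

lemma L2_add: "L2 (f :: real \<Rightarrow> real) \<Longrightarrow> L2 g \<Longrightarrow> L2 (\<lambda>x. f x + g x)"
  using L2_mult_integrable[of f g] by (auto simp: L2_real_iff power2_sum mult.assoc)

lemma L2_cmult: "L2 (f :: real \<Rightarrow> real) \<Longrightarrow> L2 (\<lambda>x. c * f x)"
  by (auto simp: L2_real_iff power_mult_distrib)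

lemma L2_diff: "L2 (f :: real \<Rightarrow> real) \<Longrightarrow> L2 g \<Longrightarrow> L2 (\<lambda>x. f x - g x)"
  using L2_add[OF _ L2_cmult[of g "-1"]] by simp

lemma integrable_indicator_times:
  fixes f :: "real \<Rightarrow> real"
  shows "integrable lborel f \<Longrightarrow> A \<in> sets borel \<Longrightarrow> integrable lborel (\<lambda>x. indicator A x * f x)"
  using integrable_mult_indicator[of A lborel f] by simp

lemma L2_zero: "L2 (\<lambda>x. 0 :: real)"
  by (simp add: L2_real_iff)

lemma L2_bound:
  fixes f g :: "real \<Rightarrow> real"
  assumes f: "L2 f" and g: "g \<in> borel_measurable borel" and bd: "\<And>x. \<bar>g x\<bar> \<le> C * \<bar>f x\<bar>"
  shows "L2 g" "(LINT x|lborel. (g x)\<^sup>2) \<le> C\<^sup>2 * (LINT x|lborel. (f x)\<^sup>2)"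
proof -
  have sq: "(g x)\<^sup>2 \<le> C\<^sup>2 * (f x)\<^sup>2" for x
    using power_mono[OF bd[of x], of 2] by (simp add: power_mult_distrib)
  have i: "integrable lborel (\<lambda>x. C\<^sup>2 * (f x)\<^sup>2)" using f by (simp add: L2_real_iff)
  have ig: "integrable lborel (\<lambda>x. (g x)\<^sup>2)"
    by (rule Bochner_Integration.integrable_bound[OF i]) (use g sq in auto)
  then show "L2 g" using g by (simp add: L2_real_iff)
  show "(LINT x|lborel. (g x)\<^sup>2) \<le> C\<^sup>2 * (LINT x|lborel. (f x)\<^sup>2)"
    using integral_mono[OF ig i sq] by simp
qed

lemma L2_bounded_mult:
  fixes f g :: "real \<Rightarrow> real"
  assumes f: "L2 f" and g: "g \<in> borel_measurable borel" "\<And>x. \<bar>g x\<bar> \<le> C"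
  shows "L2 (\<lambda>x. g x * f x)"
  by (rule L2_bound(1)[OF f, where C = C])
     (use f g in \<open>auto simp: L2_real_iff abs_mult intro: mult_right_mono\<close>)

lemma L2_cong_AE:
  fixes f g :: "real \<Rightarrow> real"
  assumes f: "L2 f" and g: "g \<in> borel_measurable borel" and eq: "AE x in lborel. f x = g x"
  shows "L2 g"
proof -
  have "integrable lborel (\<lambda>x. (f x)\<^sup>2) \<longleftrightarrow> integrable lborel (\<lambda>x. (g x)\<^sup>2)"
    by (rule integrable_cong_AE) (use f g eq in \<open>auto simp: L2_real_iff\<close>)
  then show ?thesis using f g by (simp add: L2_real_iff)
qed

lemma L2_locally_integrable:
  fixes f :: "real \<Rightarrow> real"
  assumes "L2 f" shows "locally_integrable f"
  unfolding locally_integrable_def set_integrable_def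
proof (intro allI)
  fix a b :: real
  have "L2 (\<lambda>x. indicator {a..b} x :: real)"
    by (simp add: L2_real_iff power2_eq_square flip: indicator_inter_arith)
      (auto intro!: integrable_real_indicator simp: emeasure_lborel_Icc_eq)
  from L2_mult_integrable[OF this assms] show "integrable lborel (\<lambda>x. indicator {a..b} x *\<^sub>R f x)" by simp
qed

section \<open>The L2 pairing and its completeness\<close>

definition ip :: "(real \<Rightarrow> real) \<Rightarrow> (real \<Rightarrow> real) \<Rightarrow> real" where
  "ip f g = (LINT x|lborel. f x * g x)"

lemma ip_commute: "ip f g = ip g f"
  by (simp add: ip_def mult.commute)

lemma ip_self: "ip f f = (LINT x|lborel. (f x)\<^sup>2)"
  by (simp add: ip_def power2_eq_square)

lemma ip_nonneg: "ip f f \<ge> 0"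
  by (simp add: ip_self)

lemma L2_norm_sq: "(L2_norm (f :: real \<Rightarrow> real))\<^sup>2 = ip f f"
  using ip_nonneg[of f] by (simp add: L2_norm_def ip_self)

lemma ip_add: "L2 f \<Longrightarrow> L2 g \<Longrightarrow> L2 h \<Longrightarrow> ip (\<lambda>x. f x + g x) h = ip f h + ip g h"
  unfolding ip_def by (simp add: algebra_simps L2_mult_integrable)

lemma ip_diff: "L2 f \<Longrightarrow> L2 g \<Longrightarrow> L2 h \<Longrightarrow> ip (\<lambda>x. f x - g x) h = ip f h - ip g h"
  unfolding ip_def by (simp add: algebra_simps L2_mult_integrable)

lemma ip_cmult: "ip (\<lambda>x. c * f x) h = c * ip f h"
  unfolding ip_def by (simp add: mult.assoc)

lemma ip_cong_AE:
  assumes "f \<in> borel_measurable borel" "f' \<in> borel_measurable borel" "g \<in> borel_measurable borel" "g' \<in> borel_measurable borel"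
    "AE x in lborel. f x = f' x" "AE x in lborel. g x = g' x"
  shows "ip f g = ip f' g'"
  unfolding ip_def by (rule integral_cong_AE) (use assms in auto)

global_interpretation L2: semi_inner "{f. L2 f}" ip
proof
  show "Real_Vector_Spaces.subspace {f :: real \<Rightarrow> real. L2 f}"
    unfolding Real_Vector_Spaces.subspace_def
    by (auto simp: plus_fun_def scaleR_fun_def zero_fun_def L2_add L2_cmult L2_zero)
qed (auto simp: plus_fun_def scaleR_fun_def ip_add ip_cmult ip_nonneg intro: ip_commute)

lemma ip_Cauchy_Schwarz: "L2 f \<Longrightarrow> L2 g \<Longrightarrow> (ip f g)\<^sup>2 \<le> ip f f * ip g g"
  using L2.CS[of f g] by simp

lemma ip_abs_le: "L2 f \<Longrightarrow> L2 g \<Longrightarrow> \<bar>ip f g\<bar> \<le> sqrt (ip f f) * sqrt (ip g g)"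
  using ip_Cauchy_Schwarz[of f g] by (metis real_sqrt_abs real_sqrt_le_iff real_sqrt_mult)

lemma ip_sum_le:
  assumes "L2 f" "L2 g"
  shows "ip (\<lambda>x. f x + g x) (\<lambda>x. f x + g x) \<le> 2 * ip f f + 2 * ip g g"
proof -
  have i: "integrable lborel (\<lambda>x. (f x)\<^sup>2)" "integrable lborel (\<lambda>x. (g x)\<^sup>2)" "integrable lborel (\<lambda>x. (f x + g x)\<^sup>2)"
    using assms L2_add[OF assms] by (auto simp: L2_real_iff)
  have "(f x + g x)\<^sup>2 \<le> 2 * (f x)\<^sup>2 + 2 * (g x)\<^sup>2" for x
    using zero_le_power2[of "f x - g x"] by (simp add: power2_sum power2_diff)
  then have "(LINT x|lborel. (f x + g x)\<^sup>2) \<le> (LINT x|lborel. 2 * (f x)\<^sup>2 + 2 * (g x)\<^sup>2)"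
    using i by (intro integral_mono) auto
  then show ?thesis using i by (simp add: ip_self)
qed

text \<open>Riesz-Fischer. Along a fast subsequence the squared increments have integral at most
  \<open>(1 / 4) ^ k\<close>; the weights \<open>2 ^ k\<close> leave a convergent sum of integrals
  and still force geometric decay of the increments at almost every point. Fatou's lemma turns the
  pointwise limit into a limit in norm.\<close>

lemma L2_complete: "L2.complete"
  unfolding L2.complete_def
proof (intro allI impI, elim conjE)
  fix g :: "nat \<Rightarrow> real \<Rightarrow> real"
  assume g: "\<forall>n. g n \<in> {f. L2 f}" and cau: "\<forall>e>0. \<exists>M. \<forall>m\<ge>M. \<forall>n\<ge>M. ip (g m - g n) (g m - g n) < e"
  have gL [simp]: "L2 (g n)" for n using g by simp
  have [measurable]: "g n \<in> borel_measurable borel" for n using gL by (rule L2_measurable)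
  have "\<exists>M. \<forall>k. (\<forall>m\<ge>M k. \<forall>n\<ge>M k. ip (g m - g n) (g m - g n) < (1 / 4) ^ k) \<and> M k < M (Suc k)"
  proof (rule dependent_nat_choice)
    show "\<exists>x. \<forall>m\<ge>x. \<forall>n\<ge>x. ip (g m - g n) (g m - g n) < (1 / 4) ^ 0" using cau by simp
    fix x k
    obtain y where y: "\<forall>m\<ge>y. \<forall>n\<ge>y. ip (g m - g n) (g m - g n) < (1 / 4) ^ Suc k"
      using cau[rule_format, of "(1 / 4) ^ Suc k"] by auto
    then show "\<exists>y. (\<forall>m\<ge>y. \<forall>n\<ge>y. ip (g m - g n) (g m - g n) < (1 / 4) ^ Suc k) \<and> x < y"
      by (intro exI[of _ "max y (Suc x)"]) auto
  qed
  then obtain M where M: "\<And>k. M k < M (Suc k)"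
    "\<And>k m n. m \<ge> M k \<Longrightarrow> n \<ge> M k \<Longrightarrow> ip (g m - g n) (g m - g n) < (1 / 4) ^ k" by blast
  have mono: "strict_mono M" using M(1) by (simp add: strict_mono_Suc_iff)
  define d where "d = (\<lambda>k x. g (M (Suc k)) x - g (M k) x)"
  have dL [simp]: "L2 (d k)" for k unfolding d_def by (intro L2_diff gL)
  have d_small: "(LINT x|lborel. (d k x)\<^sup>2) \<le> (1 / 4) ^ k" for k
    using M(2)[of k "M (Suc k)" "M k"] M(1)[of k] by (simp add: ip_self d_def)
  have "(\<integral>\<^sup>+x. (\<Sum>k. ennreal (2 ^ k * (d k x)\<^sup>2)) \<partial>lborel) = (\<Sum>k. \<integral>\<^sup>+x. ennreal (2 ^ k * (d k x)\<^sup>2) \<partial>lborel)"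
    by (rule nn_integral_suminf) (simp add: d_def)
  also have "\<dots> = (\<Sum>k. ennreal (2 ^ k * (LINT x|lborel. (d k x)\<^sup>2)))"
    using dL by (intro suminf_cong) (simp add: nn_integral_eq_integral L2_real_iff)
  also have "\<dots> \<le> (\<Sum>k. ennreal ((1 / 2) ^ k))"
  proof (intro suminf_le summableI ennreal_leI)
    fix k
    have "2 ^ k * (LINT x|lborel. (d k x)\<^sup>2) \<le> 2 ^ k * (1 / 4) ^ k" by (intro mult_left_mono d_small) auto
    then show "2 ^ k * (LINT x|lborel. (d k x)\<^sup>2) \<le> (1 / 2) ^ k" by (simp flip: power_mult_distrib)
  qed
  also have "\<dots> = ennreal (\<Sum>k. (1 / 2) ^ k)" by (intro suminf_ennreal2) (auto simp: summable_geometric)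
  also have "\<dots> < \<infinity>" by simp
  finally have "AE x in lborel. (\<Sum>k. ennreal (2 ^ k * (d k x)\<^sup>2)) \<noteq> \<infinity>"
    by (intro nn_integral_PInf_AE) (auto simp: d_def)
  then have conv: "AE x in lborel. convergent (\<lambda>k. g (M k) x)"
  proof eventually_elim
    case (elim x)
    define T where "T = (\<Sum>k. 2 ^ k * (d k x)\<^sup>2)"
    have "summable (\<lambda>k. 2 ^ k * (d k x)\<^sup>2)"
      using elim by (intro summable_suminf_not_top) auto
    then have "2 ^ k * (d k x)\<^sup>2 \<le> T" for k
      unfolding T_def using sum_le_suminf[of "\<lambda>k. 2 ^ k * (d k x)\<^sup>2" "{k}"] by simp
    then have "(d k x)\<^sup>2 \<le> T * (1 / 2) ^ k" for k
      by (metis (no_types, lifting) divide_inverse mult.commute mult_le_cancel_left_pos power_one_over pos_le_divide_eq zero_less_numeral zero_less_power inverse_eq_divide)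
    then have bd: "norm (d k x) \<le> sqrt T * (sqrt (1 / 2)) ^ k" for k
      by (metis real_norm_def real_sqrt_abs real_sqrt_le_iff real_sqrt_mult real_sqrt_power)
    have "sqrt (1 / 2) < 1" using real_sqrt_less_mono[of "1 / 2" 1] by simp
    then have "summable (\<lambda>k. sqrt T * (sqrt (1 / 2)) ^ k)" by (intro summable_mult summable_geometric) simp
    then have "summable (\<lambda>k. d k x)" by (rule summable_comparison_test') (rule bd)
    then have "convergent (\<lambda>n. (\<Sum>k<n. d k x))" by (simp add: summable_iff_convergent)
    moreover have "(\<Sum>k<n. d k x) = g (M n) x - g (M 0) x" for n
      using sum_lessThan_telescope[of "\<lambda>k. g (M k) x" n] by (simp add: d_def)
    ultimately have "convergent (\<lambda>n. g (M n) x - g (M 0) x)" by simp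
    then show ?case by (simp add: convergent_diff_const_right_iff)
  qed
  define h where "h = (\<lambda>x. lim (\<lambda>k. g (M k) x))"
  have [measurable]: "h \<in> borel_measurable borel" unfolding h_def by measurable
  have lim: "AE x in lborel. (\<lambda>k. g (M k) x) \<longlonglongrightarrow> h x"
    using conv by eventually_elim (simp add: h_def convergent_LIMSEQ_iff)
  have fatou: "(\<integral>\<^sup>+x. ennreal ((g n x - h x)\<^sup>2) \<partial>lborel) \<le> ennreal ((1 / 4) ^ k)" if "n \<ge> M k" for n k
  proof -
    have "(\<integral>\<^sup>+x. ennreal ((g n x - h x)\<^sup>2) \<partial>lborel) = (\<integral>\<^sup>+x. liminf (\<lambda>j. ennreal ((g n x - g (M j) x)\<^sup>2)) \<partial>lborel)"
    proof (rule nn_integral_cong_AE)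
      show "AE x in lborel. ennreal ((g n x - h x)\<^sup>2) = liminf (\<lambda>j. ennreal ((g n x - g (M j) x)\<^sup>2))"
        using lim
      proof eventually_elim
        case (elim x)
        have "(\<lambda>j. ennreal ((g n x - g (M j) x)\<^sup>2)) \<longlonglongrightarrow> ennreal ((g n x - h x)\<^sup>2)"
          by (intro tendsto_ennrealI tendsto_intros elim)
        from lim_imp_Liminf[OF sequentially_bot this] show ?case by simp
      qed
    qed
    also have "\<dots> \<le> liminf (\<lambda>j. \<integral>\<^sup>+x. ennreal ((g n x - g (M j) x)\<^sup>2) \<partial>lborel)"
      by (rule nn_integral_liminf) measurable
    also have "\<dots> \<le> liminf (\<lambda>j. ennreal ((1 / 4) ^ k))"
    proof (rule Liminf_mono)
      show "\<forall>\<^sub>F j in sequentially. (\<integral>\<^sup>+x. ennreal ((g n x - g (M j) x)\<^sup>2) \<partial>lborel) \<le> ennreal ((1 / 4) ^ k)"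
        using eventually_ge_at_top[of k]
      proof eventually_elim
        case (elim j)
        have "M k \<le> M j" using mono elim by (simp add: strict_mono_less_eq)
        then have "ip (g n - g (M j)) (g n - g (M j)) \<le> (1 / 4) ^ k" using M(2)[of k n "M j"] that by simp
        moreover have "L2 (\<lambda>x. g n x - g (M j) x)" by (intro L2_diff gL)
        ultimately show ?case by (simp add: ip_self nn_integral_eq_integral L2_real_iff ennreal_leI)
      qed
    qed
    also have "\<dots> = ennreal ((1 / 4) ^ k)" by (simp add: Liminf_const)
    finally show ?thesis .
  qed
  have dL2: "L2 (\<lambda>x. g n x - h x)" "ip (\<lambda>x. g n x - h x) (\<lambda>x. g n x - h x) \<le> (1 / 4) ^ k" if "n \<ge> M k" for n k
  proof -
    have fin: "(\<integral>\<^sup>+x. ennreal ((g n x - h x)\<^sup>2) \<partial>lborel) < \<infinity>"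
      using fatou[OF that] by (rule order_le_less_trans) simp
    then have i: "integrable lborel (\<lambda>x. (g n x - h x)\<^sup>2)"
      by (intro integrableI_nonneg) auto
    then show "L2 (\<lambda>x. g n x - h x)" by (simp add: L2_real_iff)
    have "ennreal (LINT x|lborel. (g n x - h x)\<^sup>2) \<le> ennreal ((1 / 4) ^ k)"
      using fatou[OF that] i by (simp add: nn_integral_eq_integral)
    then show "ip (\<lambda>x. g n x - h x) (\<lambda>x. g n x - h x) \<le> (1 / 4) ^ k"
      by (simp add: ip_self ennreal_le_iff)
  qed
  have "L2 (\<lambda>x. g (M 0) x - (g (M 0) x - h x))" by (rule L2_diff[OF gL dL2(1)[of 0 "M 0"]]) simp
  moreover have "(\<lambda>x. g (M 0) x - (g (M 0) x - h x)) = h" by (simp add: fun_eq_iff)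
  ultimately have hL: "L2 h" by simp
  show "\<exists>x\<in>{f. L2 f}. (\<lambda>n. ip (g n - x) (g n - x)) \<longlonglongrightarrow> 0"
  proof (rule bexI[of _ h])
    show "(\<lambda>n. ip (g n - h) (g n - h)) \<longlonglongrightarrow> 0"
    proof (rule LIMSEQ_I)
      fix r :: real assume "r > 0"
      then obtain k where k: "(1 / 4) ^ k < r" using real_arch_pow_inv[of r "1 / 4"] by auto
      have "norm (ip (g n - h) (g n - h) - 0) < r" if "n \<ge> M k" for n
      proof -
        have "g n - h = (\<lambda>x. g n x - h x)" by (simp add: fun_eq_iff)
        then show ?thesis using dL2(2)[OF that] k ip_nonneg[of "g n - h"] by simp
      qed
      then show "\<exists>no. \<forall>n\<ge>no. norm (ip (g n - h) (g n - h) - 0) < r" by blast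
    qed
  qed (simp add: hL)
qed

section \<open>The Sobolev space of order one\<close>

text \<open>\<open>F\<close> is the continuous representative and \<open>f\<close> a named version
  of its derivative. Working with pairs keeps the chosen function \<open>weak_deriv\<close> out of
  the estimates.\<close>

definition H1 :: "(real \<Rightarrow> real) \<Rightarrow> (real \<Rightarrow> real) \<Rightarrow> bool" where
  "H1 F f \<longleftrightarrow> ac F f \<and> L2 F \<and> L2 f"

definition n1 :: "(real \<Rightarrow> real) \<Rightarrow> (real \<Rightarrow> real) \<Rightarrow> real" where
  "n1 F f = ip F F + ip f f"

lemma H1_D: "H1 F f \<Longrightarrow> ac F f" "H1 F f \<Longrightarrow> L2 F" "H1 F f \<Longrightarrow> L2 f"
  by (auto simp: H1_def)

lemma n1_nonneg: "n1 F f \<ge> 0"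
  by (simp add: n1_def ip_nonneg)

lemma H1_add: "H1 F f \<Longrightarrow> H1 G g \<Longrightarrow> H1 (\<lambda>x. F x + G x) (\<lambda>x. f x + g x)"
  by (auto simp: H1_def ac_add L2_add)

lemma H1_diff: "H1 F f \<Longrightarrow> H1 G g \<Longrightarrow> H1 (\<lambda>x. F x - G x) (\<lambda>x. f x - g x)"
  by (auto simp: H1_def ac_diff L2_diff)

lemma H1_cmult: "H1 F f \<Longrightarrow> H1 (\<lambda>x. c * F x) (\<lambda>x. c * f x)"
  by (auto simp: H1_def ac_cmult L2_cmult)

lemma n1_add_le: "H1 F f \<Longrightarrow> H1 G g \<Longrightarrow> n1 (\<lambda>x. F x + G x) (\<lambda>x. f x + g x) \<le> 2 * n1 F f + 2 * n1 G g"
  using ip_sum_le[of F G] ip_sum_le[of f g] by (simp add: n1_def H1_def)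

lemma n1_cmult: "n1 (\<lambda>x. c * F x) (\<lambda>x. c * f x) = c\<^sup>2 * n1 F f"
  by (simp add: n1_def ip_cmult ip_commute[of _ "\<lambda>x. c * _ x"] power2_eq_square algebra_simps)

lemma weak_deriv_AE:
  fixes f :: "real \<Rightarrow> real"
  assumes "has_weak_deriv f g" "L2 g"
  shows "AE x in lborel. weak_deriv f x = g x" "L2 (weak_deriv f)" "has_weak_deriv f (weak_deriv f)"
proof -
  have "L2 (weak_deriv f) \<and> has_weak_deriv f (weak_deriv f)"
    unfolding weak_deriv_def by (rule someI[of "\<lambda>g. L2 g \<and> has_weak_deriv f g"]) (use assms in auto)
  then show "L2 (weak_deriv f)" "has_weak_deriv f (weak_deriv f)" by auto
  then show "AE x in lborel. weak_deriv f x = g x" using has_weak_deriv_unique assms(1) by blast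
qed

lemma has_weak_deriv_cong_AE:
  fixes f h :: "real \<Rightarrow> real"
  assumes "has_weak_deriv h g" "f \<in> borel_measurable borel" "AE x in lborel. f x = h x"
  shows "has_weak_deriv f g"
proof -
  have [measurable]: "h \<in> borel_measurable borel" "f \<in> borel_measurable borel"
    using assms by (auto simp: has_weak_deriv_def intro: locally_integrable_measurable)
  have li: "locally_integrable f"
    unfolding locally_integrable_def
  proof (intro allI)
    fix a b
    have "set_integrable lborel {a..b} h" using assms(1) by (auto simp: has_weak_deriv_def locally_integrable_def)
    moreover have "set_integrable lborel {a..b} h = set_integrable lborel {a..b} f"
      unfolding set_integrable_def by (rule integrable_cong_AE) (use assms(3) in auto)
    ultimately show "set_integrable lborel {a..b} f" by simp
  qed
  have eq: "(LINT x|lborel. deriv \<psi> x *\<^sub>R f x) = (LINT x|lborel. deriv \<psi> x *\<^sub>R h x)" if t: "test_function \<psi>" for \<psi>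
  proof (rule integral_cong_AE)
    have [measurable]: "deriv \<psi> \<in> borel_measurable borel"
      by (intro borel_measurable_continuous_onI test_function_continuous t)
    show "(\<lambda>x. deriv \<psi> x *\<^sub>R f x) \<in> borel_measurable lborel" "(\<lambda>x. deriv \<psi> x *\<^sub>R h x) \<in> borel_measurable lborel"
      by measurable
  qed (use assms(3) in auto)
  then show ?thesis using assms(1) li by (simp add: has_weak_deriv_def)
qed

lemma H1_imp_sobolev:
  assumes "H1 F f" shows "sobolev 1 F" "AE x in lborel. weak_deriv F x = f x"
    and "sobolev_norm 1 F = sqrt (n1 F f)"
proof -
  have w: "has_weak_deriv F f" using assms by (auto simp: H1_def intro: ac_has_weak_deriv)
  show "sobolev 1 F" using assms w by (auto simp: H1_def)
  show ae: "AE x in lborel. weak_deriv F x = f x" using weak_deriv_AE[OF w] assms by (auto simp: H1_def)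
  have "ip (weak_deriv F) (weak_deriv F) = ip f f"
    using weak_deriv_AE[OF w] assms by (intro ip_cong_AE) (auto simp: H1_def intro: L2_measurable)
  then show "sobolev_norm 1 F = sqrt (n1 F f)" by (simp add: sobolev_norm_def n1_def L2_norm_sq)
qed

lemma sobolev_imp_H1:
  fixes u :: "real \<Rightarrow> real"
  assumes "sobolev 1 u"
  shows "\<exists>F f. H1 F f \<and> (AE x in lborel. u x = F x) \<and> (AE x in lborel. weak_deriv u x = f x)
    \<and> sobolev_norm 1 u = sqrt (n1 F f)"
proof -
  obtain g where g: "has_weak_deriv u g" "L2 g" "L2 u" using assms by auto
  obtain F where F: "ac F g" "AE x in lborel. u x = F x" using has_weak_deriv_imp_ac[OF g(1)] by blast
  have "F \<in> borel_measurable borel" by (intro borel_measurable_continuous_onI ac_continuous[OF F(1)])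
  then have LF: "L2 F" using L2_cong_AE[OF g(3) _ F(2)] by blast
  have wd: "AE x in lborel. weak_deriv u x = g x" "L2 (weak_deriv u)" using weak_deriv_AE[OF g(1,2)] by auto
  have "ip (weak_deriv u) (weak_deriv u) = ip g g" "ip u u = ip F F"
    using wd g LF F(2) by (auto intro!: ip_cong_AE L2_measurable)
  then have "sobolev_norm 1 u = sqrt (n1 F g)" by (simp add: sobolev_norm_def n1_def L2_norm_sq)
  then show ?thesis using F g LF wd by (auto simp: H1_def)
qed

lemma AE_eq_continuous:
  fixes f g :: "real \<Rightarrow> real"
  assumes "continuous_on UNIV f" "continuous_on UNIV g" "AE x in lborel. f x = g x"
  shows "f = g"
proof (rule ccontr)
  assume "f \<noteq> g"
  then obtain x where x: "f x \<noteq> g x" by auto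
  define U where "U = {x. f x \<noteq> g x}"
  have "open U" unfolding U_def using assms(1,2) by (intro open_Collect_neq) auto
  moreover have "x \<in> U" using x by (simp add: U_def)
  ultimately obtain e where e: "e > 0" "ball x e \<subseteq> U" by (auto simp: open_contains_ball)
  have "{x<..<x + e} \<subseteq> U" using e by (auto simp: ball_def dist_real_def subset_iff)
  moreover have "U \<in> null_sets lborel"
  proof (rule AE_iff_null_sets[THEN iffD2])
    show "U \<in> sets lborel" using \<open>open U\<close> by simp
    show "AE x in lborel. x \<notin> U" using assms(3) by (simp add: U_def)
  qed
  ultimately have "{x<..<x + e} \<in> null_sets lborel" by (auto intro: null_sets_subset)
  then show False using e(1) by (simp add: null_sets_def)
qed

lemma sobolev_continuous_imp_H1:
  fixes u :: "real \<Rightarrow> real"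
  assumes "sobolev 1 u" "continuous_on UNIV u"
  shows "\<exists>f. H1 u f \<and> (AE x in lborel. weak_deriv u x = f x) \<and> sobolev_norm 1 u = sqrt (n1 u f)"
  using sobolev_imp_H1[OF assms(1)] AE_eq_continuous[OF assms(2)] ac_continuous H1_D(1) by metis

section \<open>Supremum bound, decay at infinity and integration by parts\<close>

lemma integral_Icc_tendsto:
  fixes f :: "real \<Rightarrow> real"
  assumes "integrable lborel f"
  shows "(\<lambda>n. LINT x:{- real n..real n}|lborel. f x) \<longlonglongrightarrow> (LINT x|lborel. f x)"
  unfolding set_lebesgue_integral_def
proof (rule integral_dominated_convergence[where w = "\<lambda>x. norm (f x)"])
  show "AE x in lborel. (\<lambda>n. indicator {- real n..real n} x *\<^sub>R f x) \<longlonglongrightarrow> f x"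
  proof (rule AE_I2)
    fix x :: real
    have "\<forall>\<^sub>F n in sequentially. indicator {- real n..real n} x *\<^sub>R f x = f x"
      using eventually_ge_at_top[of "nat \<lceil>\<bar>x\<bar>\<rceil>"]
    proof eventually_elim
      case (elim n)
      then have "\<bar>x\<bar> \<le> real n" by linarith
      then show ?case by (auto split: split_indicator)
    qed
    then show "(\<lambda>n. indicator {- real n..real n} x *\<^sub>R f x) \<longlonglongrightarrow> f x" by (rule tendsto_eventually)
  qed
qed (use assms in \<open>auto split: split_indicator\<close>)

text \<open>The square of \<open>F\<close> has density \<open>2 F f\<close>, which is at most
  \<open>F\<^sup>2 + f\<^sup>2\<close>. Keeping the integral between the two points lets the bound
  serve both the supremum estimate and the decay at infinity.\<close>

lemma ac_sq_diff_le:
  assumes "H1 F f"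
  shows "(F x)\<^sup>2 - (F y)\<^sup>2 \<le> (LINT t:{min x y..max x y}|lborel. (F t)\<^sup>2 + (f t)\<^sup>2)"
proof -
  have F: "ac F f" "L2 F" "L2 f" using assms by (auto simp: H1_def)
  have a: "ac (\<lambda>x. F x * F x) (\<lambda>x. f x * F x + F x * f x)" by (rule ac_mult[OF F(1) F(1)])
  have i: "integrable lborel (\<lambda>x. (F x)\<^sup>2 + (f x)\<^sup>2)" "integrable lborel (\<lambda>x. f x * F x + F x * f x)"
    using F by (auto simp: L2_real_iff L2_mult_integrable)
  have si: "set_integrable lborel {p..q} (\<lambda>x. (F x)\<^sup>2 + (f x)\<^sup>2)"
    "set_integrable lborel {p..q} (\<lambda>x. f x * F x + F x * f x)" for p q
    unfolding set_integrable_def real_scaleR_def using i by (intro integrable_indicator_times; simp)+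
  have "\<bar>LINT t:{p..q}|lborel. f t * F t + F t * f t\<bar> \<le> (LINT t:{p..q}|lborel. (F t)\<^sup>2 + (f t)\<^sup>2)" for p q
  proof -
    have "\<bar>a * b + b * a\<bar> \<le> b\<^sup>2 + a\<^sup>2" for a b :: real
      using sum_squares_bound[of "\<bar>a\<bar>" "\<bar>b\<bar>"] by (simp add: abs_mult mult.commute algebra_simps)
    then have pt: "\<bar>f t * F t + F t * f t\<bar> \<le> (F t)\<^sup>2 + (f t)\<^sup>2" for t .
    have "\<bar>LINT t:{p..q}|lborel. f t * F t + F t * f t\<bar> \<le> (LINT t:{p..q}|lborel. \<bar>f t * F t + F t * f t\<bar>)"
      "(LINT t:{p..q}|lborel. \<bar>f t * F t + F t * f t\<bar>) \<le> (LINT t:{p..q}|lborel. (F t)\<^sup>2 + (f t)\<^sup>2)"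
      using set_integral_norm_bound[OF si(2), of p q] set_integral_mono[OF set_integrable_abs[OF si(2)] si(1) pt, of p q]
      by auto
    then show ?thesis by linarith
  qed
  from this[of "min x y" "max x y"] show ?thesis
    using ac_integral[OF a, of "min x y" "max x y"] by (cases "x \<le> y") (auto simp: power2_eq_square)
qed

text \<open>If \<open>f\<close> stayed above \<open>e\<close> on an interval of length
  \<open>L\<close>, its integral there would exceed the integral of \<open>\<bar>f\<bar>\<close>
  over the line, by the choice of \<open>L\<close>.\<close>

lemma integrable_small_point:
  fixes f :: "real \<Rightarrow> real"
  assumes f: "integrable lborel f" and e: "e > 0"
  shows "\<exists>y\<ge>R. f y < e" "\<exists>y\<le>R. f y < e"
proof -
  define L where "L = (LINT x|lborel. \<bar>f x\<bar>) / e + 1"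
  have L: "L > 0" using e by (auto simp: L_def intro!: add_nonneg_pos divide_nonneg_pos)
  have small: "\<exists>y\<in>{a..a + L}. f y < e" for a
  proof (rule ccontr)
    assume "\<not> ?thesis"
    then have ge: "e \<le> f y" if "y \<in> {a..a + L}" for y using that by force
    have ii: "integrable lborel (indicator {a..a + L} :: real \<Rightarrow> real)"
      by (intro integrable_real_indicator) (auto simp: emeasure_lborel_Icc_eq)
    have "(LINT x|lborel. e * indicator {a..a + L} x) \<le> (LINT x|lborel. \<bar>f x\<bar>)"
    proof (rule integral_mono)
      fix x show "e * indicator {a..a + L} x \<le> \<bar>f x\<bar>"
        using ge[of x] by (auto split: split_indicator)
    qed (use f ii in auto)
    then have "e * L \<le> (LINT x|lborel. \<bar>f x\<bar>)" using L by simp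
    moreover have "e * L = (LINT x|lborel. \<bar>f x\<bar>) + e" using e by (simp add: L_def distrib_left)
    ultimately show False using e by linarith
  qed
  show "\<exists>y\<ge>R. f y < e" using small[of R] by auto
  show "\<exists>y\<le>R. f y < e" using small[of "R - L"] by auto
qed

text \<open>Comparison with a point at which \<open>F\<close> is almost zero gives the constant
  1.\<close>

lemma H1_sup_bound:
  assumes "H1 F f" shows "(F x)\<^sup>2 \<le> n1 F f"
proof (rule field_le_epsilon)
  fix e :: real assume "e > 0"
  have F: "ac F f" "L2 F" "L2 f" using assms by (auto simp: H1_def)
  have i: "integrable lborel (\<lambda>x. (F x)\<^sup>2 + (f x)\<^sup>2)" "integrable lborel (\<lambda>x. (F x)\<^sup>2)"
    using F by (auto simp: L2_real_iff)
  obtain y where y: "(F y)\<^sup>2 < e" using integrable_small_point(1)[OF i(2) \<open>e > 0\<close>, of 0] by blast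
  have "(LINT t:{min x y..max x y}|lborel. (F t)\<^sup>2 + (f t)\<^sup>2) \<le> (LINT t|lborel. (F t)\<^sup>2 + (f t)\<^sup>2)"
    unfolding set_lebesgue_integral_def
    by (rule integral_mono[OF integrable_mult_indicator[OF _ i(1)] i(1)]) (auto split: split_indicator)
  also have "\<dots> = n1 F f" using F by (simp add: n1_def ip_self L2_real_iff)
  finally show "(F x)\<^sup>2 \<le> n1 F f + e" using ac_sq_diff_le[OF assms, of x y] y by linarith
qed

lemma H1_sup_bound': "H1 F f \<Longrightarrow> \<bar>F x\<bar> \<le> sqrt (n1 F f)"
  using H1_sup_bound[of F f x] by (metis real_sqrt_abs real_sqrt_le_iff)

lemma H1_tail:
  assumes "H1 F f" "e > 0" shows "\<exists>R. \<forall>x. \<bar>x\<bar> \<ge> R \<longrightarrow> \<bar>F x\<bar> < e"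
proof -
  have F: "ac F f" "L2 F" "L2 f" using assms by (auto simp: H1_def)
  define G where "G = (\<lambda>x. (F x)\<^sup>2 + (f x)\<^sup>2)"
  have i: "integrable lborel G" "integrable lborel (\<lambda>x. (F x)\<^sup>2)"
    using F by (auto simp: L2_real_iff G_def)
  have G0: "G x \<ge> 0" for x by (simp add: G_def)
  have "\<forall>\<^sub>F n in sequentially. (LINT x:{- real n..real n}|lborel. G x) > (LINT x|lborel. G x) - e\<^sup>2 / 2"
    using integral_Icc_tendsto[OF i(1)] by (rule order_tendstoD) (use assms in simp)
  from eventually_happens[OF this]
  obtain n :: nat where "(LINT x|lborel. G x) - e\<^sup>2 / 2 < (LINT x:{- real n..real n}|lborel. G x)" by auto
  then have n: "(LINT x|lborel. G x) - (LINT x:{- real n..real n}|lborel. G x) < e\<^sup>2 / 2" by linarith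
  \<comment> \<open>An interval outside \<open>(-n, n)\<close> and the interval
    \<open>[-n, n]\<close> overlap in a null set, so together they carry at most the total
    integral.\<close>
  have out: "(LINT t:{a..b}|lborel. G t) < e\<^sup>2 / 2" if "{a..b} \<inter> {- real n<..<real n} = {}" for a b
  proof -
    have "(LINT t:{a..b}|lborel. G t) + (LINT x:{- real n..real n}|lborel. G x)
        = (LINT t|lborel. indicator {a..b} t *\<^sub>R G t + indicator {- real n..real n} t *\<^sub>R G t)"
      unfolding set_lebesgue_integral_def
      by (intro Bochner_Integration.integral_add[symmetric] integrable_mult_indicator i) auto
    also have "\<dots> \<le> (LINT t|lborel. G t)"
    proof (rule integral_mono_AE)
      have "AE x in lborel. x \<noteq> real n" "AE x in lborel. x \<noteq> - real n" by (rule AE_lborel_singleton)+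
      then show "AE x in lborel. indicator {a..b} x *\<^sub>R G x + indicator {- real n..real n} x *\<^sub>R G x \<le> G x"
      proof eventually_elim
        case (elim x)
        then have "\<not> (x \<in> {a..b} \<and> x \<in> {- real n..real n})" using that by force
        then show ?case using G0[of x] by (auto split: split_indicator)
      qed
    qed (use i in \<open>auto intro!: Bochner_Integration.integrable_add integrable_indicator_times\<close>)
    finally show ?thesis using n by linarith
  qed
  have "\<bar>F x\<bar> < e" if x: "\<bar>x\<bar> \<ge> real n" for x
  proof -
    have e2: "e\<^sup>2 / 2 > 0" using assms by simp
    have "\<exists>y. (F y)\<^sup>2 < e\<^sup>2 / 2 \<and> {min x y..max x y} \<inter> {- real n<..<real n} = {}"
    proof (cases "x \<ge> 0")
      case True
      then show ?thesis using integrable_small_point(1)[OF i(2) e2, of x] x by fastforce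
    next
      case False
      then show ?thesis using integrable_small_point(2)[OF i(2) e2, of x] x by fastforce
    qed
    then obtain y where y: "(F y)\<^sup>2 < e\<^sup>2 / 2" "{min x y..max x y} \<inter> {- real n<..<real n} = {}" by blast
    have "(F x)\<^sup>2 < e\<^sup>2" using ac_sq_diff_le[OF assms(1), of x y] out[OF y(2)] y(1) by (simp add: G_def)
    then show ?thesis using assms(2) by (metis abs_le_square_iff abs_of_pos linorder_not_less)
  qed
  then show ?thesis by blast
qed

lemma H1_tendsto:
  assumes "H1 F f" shows "(F \<longlongrightarrow> 0) at_top" "(F \<longlongrightarrow> 0) at_bot"
proof -
  have *: "\<exists>R. \<forall>x. \<bar>x\<bar> \<ge> R \<longrightarrow> dist (F x) 0 < e" if "e > 0" for e using H1_tail[OF assms that] by simp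
  show "(F \<longlongrightarrow> 0) at_top"
  proof (rule tendstoI)
    fix e :: real assume "e > 0"
    then obtain R where "\<forall>x. \<bar>x\<bar> \<ge> R \<longrightarrow> dist (F x) 0 < e" using * by blast
    then show "\<forall>\<^sub>F x in at_top. dist (F x) 0 < e" by (auto simp: eventually_at_top_linorder intro!: exI[of _ "\<bar>R\<bar>"])
  qed
  show "(F \<longlongrightarrow> 0) at_bot"
  proof (rule tendstoI)
    fix e :: real assume "e > 0"
    then obtain R where "\<forall>x. \<bar>x\<bar> \<ge> R \<longrightarrow> dist (F x) 0 < e" using * by blast
    then show "\<forall>\<^sub>F x in at_bot. dist (F x) 0 < e" by (auto simp: eventually_at_bot_linorder intro!: exI[of _ "- \<bar>R\<bar>"])
  qed
qed

lemma ac_integral_zero: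
  assumes "ac F f" "integrable lborel f" "(F \<longlongrightarrow> 0) at_top" "(F \<longlongrightarrow> 0) at_bot"
  shows "(LINT x|lborel. f x) = 0"
proof -
  have "(\<lambda>n. F (real n) - F (- real n)) \<longlonglongrightarrow> 0 - 0"
    by (intro tendsto_diff filterlim_compose[OF assms(3)] filterlim_compose[OF assms(4)]
        filterlim_real_sequentially filterlim_compose[OF filterlim_uminus_at_bot_at_top])
  moreover have "(LINT x:{- real n..real n}|lborel. f x) = F (real n) - F (- real n)" for n
    using ac_integral[OF assms(1), of "- real n" "real n"] by simp
  ultimately show ?thesis using integral_Icc_tendsto[OF assms(2)] LIMSEQ_unique by fastforce
qed

lemma integration_by_parts:
  assumes "H1 F f" "H1 G g" shows "ip F g = - ip f G"
proof -
  have "(LINT x|lborel. f x * G x + F x * g x) = 0"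
  proof (rule ac_integral_zero)
    show "ac (\<lambda>x. F x * G x) (\<lambda>x. f x * G x + F x * g x)" using assms by (auto intro: ac_mult H1_D)
    show "integrable lborel (\<lambda>x. f x * G x + F x * g x)"
      using assms by (intro Bochner_Integration.integrable_add L2_mult_integrable) (auto intro: H1_D)
    show "((\<lambda>x. F x * G x) \<longlongrightarrow> 0) at_top" "((\<lambda>x. F x * G x) \<longlongrightarrow> 0) at_bot"
      using tendsto_mult[OF H1_tendsto(1)[OF assms(1)] H1_tendsto(1)[OF assms(2)]]
        tendsto_mult[OF H1_tendsto(2)[OF assms(1)] H1_tendsto(2)[OF assms(2)]] by auto
  qed
  then show ?thesis using assms by (simp add: ip_def L2_mult_integrable H1_def)
qed

lemma H1_bounded_mult:
  assumes F: "H1 F f" and G: "\<And>x. (G has_field_derivative g x) (at x)" "continuous_on UNIV g"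
    and bd: "\<And>x. \<bar>G x\<bar> \<le> C" "\<And>x. \<bar>g x\<bar> \<le> C'"
  shows "H1 (\<lambda>x. G x * F x) (\<lambda>x. g x * F x + G x * f x)"
proof -
  have aG: "ac G g" by (rule ac_DERIV[OF G])
  have m: "G \<in> borel_measurable borel" "g \<in> borel_measurable borel"
    using ac_continuous[OF aG] G(2) by (auto intro: borel_measurable_continuous_onI)
  show ?thesis unfolding H1_def
    using ac_mult[OF aG H1_D(1)[OF F]] F m bd
    by (auto simp: H1_def intro!: L2_add L2_bounded_mult)
qed

section \<open>The inverse Helmholtz operator\<close>

lemma nn_integral_exp_abs: "(\<integral>\<^sup>+y. ennreal (exp (- \<bar>x - y\<bar>) / 2) \<partial>lborel) = 1"
proof -
  have half: "(\<integral>\<^sup>+y. ennreal (exp (- y) / 2) * indicator {0..} y \<partial>lborel) = ennreal (0 - (- exp (- 0) / 2))"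
  proof (rule nn_integral_FTC_atLeast)
    show "((\<lambda>y::real. - exp (- y) / 2) \<longlongrightarrow> 0) at_top"
      using tendsto_divide[OF tendsto_minus[OF filterlim_compose[OF exp_at_bot filterlim_uminus_at_bot_at_top]] tendsto_const, of 2]
      by simp
  qed (auto intro!: derivative_eq_intros)
  have neg: "(\<integral>\<^sup>+y. ennreal (exp y / 2) * indicator {..0} y \<partial>lborel) = (\<integral>\<^sup>+y. ennreal (exp (- y) / 2) * indicator {0..} y \<partial>lborel)"
    by (subst nn_integral_real_affine[where c = "-1" and t = 0]) (auto intro!: nn_integral_cong split: split_indicator)
  have "(\<integral>\<^sup>+y. ennreal (exp (- \<bar>x - y\<bar>) / 2) \<partial>lborel) = (\<integral>\<^sup>+y. ennreal (exp (- \<bar>y\<bar>) / 2) \<partial>lborel)"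
    by (subst nn_integral_real_affine[where c = 1 and t = x]) auto
  also have "\<dots> = (\<integral>\<^sup>+y. ennreal (exp (- y) / 2) * indicator {0..} y + ennreal (exp y / 2) * indicator {..0} y \<partial>lborel)"
  proof (rule nn_integral_cong_AE)
    have "AE y in lborel. y \<noteq> (0::real)" by (rule AE_lborel_singleton)
    then show "AE y in lborel. ennreal (exp (- \<bar>y\<bar>) / 2) =
        ennreal (exp (- y) / 2) * indicator {0..} y + ennreal (exp y / 2) * indicator {..0} y"
      by eventually_elim (auto split: split_indicator)
  qed
  also have "\<dots> = ennreal (1 / 2) + ennreal (1 / 2)"
    by (subst nn_integral_add) (use half neg in auto)
  also have "\<dots> = ennreal (1 / 2 + 1 / 2)" by (rule ennreal_plus[symmetric]) auto
  also have "\<dots> = 1" by simp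
  finally show ?thesis .
qed

lemma integrable_exp_abs: "integrable lborel (\<lambda>y. exp (- \<bar>x - y\<bar>) / 2 :: real)"
  and integral_exp_abs: "(LINT y|lborel. exp (- \<bar>x - y\<bar>) / 2) = (1 :: real)"
proof -
  show i: "integrable lborel (\<lambda>y. exp (- \<bar>x - y\<bar>) / 2 :: real)"
    by (rule integrableI_nonneg) (auto simp: nn_integral_exp_abs)
  have "ennreal (LINT y|lborel. exp (- \<bar>x - y\<bar>) / 2) = 1"
    using nn_integral_eq_integral[OF i] nn_integral_exp_abs[of x] by simp
  then show "(LINT y|lborel. exp (- \<bar>x - y\<bar>) / 2) = (1 :: real)"
    by (simp add: ennreal_eq_1)
qed

lemma L2_exp_abs: "L2 (\<lambda>y. exp (- \<bar>x - y\<bar>) / 2 :: real)"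
  unfolding L2_real_iff
proof
  show "integrable lborel (\<lambda>y. (exp (- \<bar>x - y\<bar>) / 2 :: real)\<^sup>2)"
  proof (rule Bochner_Integration.integrable_bound[OF integrable_exp_abs[of x]])
    have "(exp (- \<bar>x - y\<bar>) / 2)\<^sup>2 \<le> (exp (- \<bar>x - y\<bar>) / 2 :: real)" for y
      unfolding power2_eq_square by (rule mult_left_le) (auto intro: order_trans[of _ 1])
    then show "AE y in lborel. norm ((exp (- \<bar>x - y\<bar>) / 2 :: real)\<^sup>2) \<le> norm (exp (- \<bar>x - y\<bar>) / 2 :: real)" by simp
  qed measurable
qed measurable

lemma helmholtz_integrable:
  fixes f :: "real \<Rightarrow> real"
  assumes "L2 f" shows "integrable lborel (\<lambda>y. exp (- \<bar>x - y\<bar>) / 2 * f y)"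
  using L2_mult_integrable[OF L2_exp_abs assms] .

lemma helmholtz_real: "helmholtz_inv (f :: real \<Rightarrow> real) x = (LINT y|lborel. exp (- \<bar>x - y\<bar>) / 2 * f y)"
  by (simp add: helmholtz_inv_def)

lemma helmholtz_add_const:
  fixes f :: "real \<Rightarrow> real"
  assumes "L2 f" shows "helmholtz_inv (\<lambda>x. k + f x) x = k + helmholtz_inv f x"
proof -
  have "(LINT y|lborel. exp (- \<bar>x - y\<bar>) / 2 * (k + f y))
      = (LINT y|lborel. exp (- \<bar>x - y\<bar>) / 2 * k + exp (- \<bar>x - y\<bar>) / 2 * f y)"
    by (rule Bochner_Integration.integral_cong) (auto simp: algebra_simps)
  also have "\<dots> = (LINT y|lborel. exp (- \<bar>x - y\<bar>) / 2 * k) + (LINT y|lborel. exp (- \<bar>x - y\<bar>) / 2 * f y)"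
    using integrable_exp_abs[of x] helmholtz_integrable[OF assms, of x]
    by (intro Bochner_Integration.integral_add integrable_mult_left) auto
  also have "(LINT y|lborel. exp (- \<bar>x - y\<bar>) / 2 * k) = (LINT y|lborel. exp (- \<bar>x - y\<bar>) / 2) * k"
    by (rule integral_mult_left_zero)
  finally show ?thesis by (simp only: helmholtz_real integral_exp_abs mult_1)
qed

lemma helmholtz_linear:
  fixes f g :: "real \<Rightarrow> real"
  assumes "L2 f" "L2 g"
  shows "helmholtz_inv (\<lambda>x. f x + c * g x) x = helmholtz_inv f x + c * helmholtz_inv g x"
proof -
  have "(LINT y|lborel. exp (- \<bar>x - y\<bar>) / 2 * (f y + c * g y))
      = (LINT y|lborel. exp (- \<bar>x - y\<bar>) / 2 * f y + c * (exp (- \<bar>x - y\<bar>) / 2 * g y))"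
    by (rule Bochner_Integration.integral_cong) (auto simp: algebra_simps)
  also have "\<dots> = (LINT y|lborel. exp (- \<bar>x - y\<bar>) / 2 * f y) + (LINT y|lborel. c * (exp (- \<bar>x - y\<bar>) / 2 * g y))"
    using helmholtz_integrable[OF assms(1), of x] helmholtz_integrable[OF assms(2), of x]
    by (intro Bochner_Integration.integral_add integrable_mult_right) auto
  finally show ?thesis by (simp only: helmholtz_real integral_mult_right_zero)
qed

lemma helmholtz_cong_AE:
  fixes f g :: "real \<Rightarrow> real"
  assumes [measurable]: "f \<in> borel_measurable borel" "g \<in> borel_measurable borel" and "AE x in lborel. f x = g x"
  shows "helmholtz_inv f = helmholtz_inv g"
proof
  fix x show "helmholtz_inv f x = helmholtz_inv g x"
    unfolding helmholtz_real by (rule integral_cong_AE) (use assms(3) in auto)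
qed

lemma helmholtz_translate:
  fixes f :: "real \<Rightarrow> real"
  shows "helmholtz_inv (\<lambda>x. f (x + s)) x = helmholtz_inv f (x + s)"
  unfolding helmholtz_real
  by (subst lborel_integral_real_affine[where c = 1 and t = s and f = "\<lambda>y. exp (- \<bar>x + s - y\<bar>) / 2 * f y"])
     (auto simp: add.commute)

text \<open>The kernel is a probability density in either variable: Cauchy-Schwarz against it,
  followed by Fubini, gives square integrability. The absolute value is kept so that each half of
  the kernel can be dominated separately.\<close>

lemma helmholtz_abs_L2:
  fixes f :: "real \<Rightarrow> real"
  assumes f: "L2 f" shows "L2 (helmholtz_inv (\<lambda>x. \<bar>f x\<bar>))"
proof -
  have [measurable]: "f \<in> borel_measurable borel" using f by (rule L2_measurable)
  have fa: "L2 (\<lambda>x. \<bar>f x\<bar>)" using f by (auto simp: L2_real_iff)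
  define K where "K = (\<lambda>x y. exp (- \<bar>x - y\<bar>) / 2 :: real)"
  have K0: "K x y \<ge> 0" for x y by (simp add: K_def)
  have K1: "K x y \<le> 1" for x y by (simp add: K_def order_trans[of _ 1])
  have meas [measurable]: "(\<lambda>(x, y). K x y) \<in> borel_measurable (borel \<Otimes>\<^sub>M borel)" unfolding K_def by measurable
  have hm [measurable]: "helmholtz_inv (\<lambda>x. \<bar>f x\<bar>) \<in> borel_measurable borel"
  proof -
    have "(\<lambda>x. LINT y|lborel. K x y * \<bar>f y\<bar>) \<in> borel_measurable lborel" unfolding K_def by measurable
    then show ?thesis by (simp add: helmholtz_real[abs_def] K_def)
  qed
  have i: "integrable lborel (\<lambda>y. K x y * (f y)\<^sup>2)" for x
  proof (rule Bochner_Integration.integrable_bound[of lborel "\<lambda>y. (f y)\<^sup>2"])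
    show "AE y in lborel. norm (K x y * (f y)\<^sup>2) \<le> norm ((f y)\<^sup>2)"
      using K0 K1 by (intro AE_I2) (auto simp: abs_mult intro: mult_left_le_one_le)
  qed (use f in \<open>auto simp: L2_real_iff K_def\<close>)
  have cs: "(helmholtz_inv (\<lambda>x. \<bar>f x\<bar>) x)\<^sup>2 \<le> (LINT y|lborel. K x y * (f y)\<^sup>2)" for x
  proof -
    define a where "a = (\<lambda>y. sqrt (K x y))"
    define b where "b = (\<lambda>y. sqrt (K x y) * \<bar>f y\<bar>)"
    have a: "L2 a" using integrable_exp_abs[of x] K0 unfolding L2_real_iff a_def by (auto simp: K_def)
    have b: "L2 b" unfolding L2_real_iff b_def using i[of x] K0[of x] by (auto simp: power_mult_distrib K_def)
    have "ip a b = helmholtz_inv (\<lambda>x. \<bar>f x\<bar>) x"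
      unfolding ip_def a_def b_def helmholtz_real using K0 by (simp add: mult.assoc[symmetric] K_def)
    moreover have "ip a a = 1" unfolding ip_self a_def using K0 integral_exp_abs[of x] by (simp add: K_def)
    moreover have "ip b b = (LINT y|lborel. K x y * (f y)\<^sup>2)"
      unfolding ip_self b_def using K0 by (simp add: power_mult_distrib)
    ultimately show ?thesis using ip_Cauchy_Schwarz[OF a b] by simp
  qed
  have "(\<integral>\<^sup>+x. ennreal ((helmholtz_inv (\<lambda>x. \<bar>f x\<bar>) x)\<^sup>2) \<partial>lborel) \<le> (\<integral>\<^sup>+x. (\<integral>\<^sup>+y. ennreal (K x y) * ennreal ((f y)\<^sup>2) \<partial>lborel) \<partial>lborel)"
  proof (rule nn_integral_mono)
    fix x
    have "(\<integral>\<^sup>+y. ennreal (K x y) * ennreal ((f y)\<^sup>2) \<partial>lborel) = ennreal (LINT y|lborel. K x y * (f y)\<^sup>2)"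
      using nn_integral_eq_integral[OF i[of x]] K0 by (simp add: ennreal_mult)
    then show "ennreal ((helmholtz_inv (\<lambda>x. \<bar>f x\<bar>) x)\<^sup>2) \<le> (\<integral>\<^sup>+y. ennreal (K x y) * ennreal ((f y)\<^sup>2) \<partial>lborel)"
      using cs[of x] by (simp add: ennreal_leI)
  qed
  also have "\<dots> = (\<integral>\<^sup>+y. (\<integral>\<^sup>+x. ennreal (K x y) * ennreal ((f y)\<^sup>2) \<partial>lborel) \<partial>lborel)"
    by (rule lborel_pair.Fubini') (simp add: K_def)
  also have "\<dots> = (\<integral>\<^sup>+y. ennreal ((f y)\<^sup>2) \<partial>lborel)"
  proof (rule nn_integral_cong)
    fix y
    have "(\<integral>\<^sup>+x. ennreal (K x y) * ennreal ((f y)\<^sup>2) \<partial>lborel) = (\<integral>\<^sup>+x. ennreal (K x y) \<partial>lborel) * ennreal ((f y)\<^sup>2)"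
      by (rule nn_integral_multc) (simp add: K_def)
    also have "(\<integral>\<^sup>+x. ennreal (K x y) \<partial>lborel) = 1"
      using nn_integral_exp_abs[of y] by (simp add: K_def abs_minus_commute)
    finally show "(\<integral>\<^sup>+x. ennreal (K x y) * ennreal ((f y)\<^sup>2) \<partial>lborel) = ennreal ((f y)\<^sup>2)" by simp
  qed
  also have "\<dots> < \<infinity>"
    using f by (simp add: L2_real_iff nn_integral_eq_integral)
  finally have "integrable lborel (\<lambda>x. (helmholtz_inv (\<lambda>x. \<bar>f x\<bar>) x)\<^sup>2)"
    by (intro integrableI_nonneg) auto
  then show ?thesis by (simp add: L2_real_iff)
qed

text \<open>
  Splitting the kernel at \<open>y = x\<close> writes \<open>(1 - \<partial>\<^sub>x\<^sup>2)\<^sup>-\<^sup>1 w\<close> as \<open>(P + Q) / 2\<close> with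
  \<open>P' = w - P\<close> and \<open>Q' = Q - w\<close>.
\<close>

lemma helmholtz_H1:
  fixes w :: "real \<Rightarrow> real"
  assumes w: "L2 w"
  shows "\<exists>v. H1 (helmholtz_inv w) v \<and> H1 v (\<lambda>x. helmholtz_inv w x - w x)"
proof -
  have [measurable]: "w \<in> borel_measurable borel" using w by (rule L2_measurable)
  have wl: "locally_integrable w" by (rule L2_locally_integrable[OF w])
  have ki: "integrable lborel (\<lambda>y. exp (- \<bar>x - y\<bar>) * w y)" for x
    using integrable_mult_right[OF helmholtz_integrable[OF w, of x], of 2] by simp
  define h1 where "h1 = (\<lambda>x y. indicator {..x} y * (exp (- \<bar>x - y\<bar>) * w y))"
  define h2 where "h2 = (\<lambda>x y. indicator {x<..} y * (exp (- \<bar>x - y\<bar>) * w y))"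
  have i1: "integrable lborel (h1 x)" and i2: "integrable lborel (h2 x)" for x
    unfolding h1_def h2_def by (intro integrable_indicator_times ki; simp)+
  define P where "P = (\<lambda>x. LINT y|lborel. h1 x y)"
  define Q where "Q = (\<lambda>x. LINT y|lborel. h2 x y)"
  define S where "S = (\<lambda>x. exp x * P x)"
  define T where "T = (\<lambda>x. exp (- x) * Q x)"
  have expc: "continuous_on UNIV (\<lambda>x::real. exp x)" "continuous_on UNIV (\<lambda>x::real. exp (- x))"
    by (intro continuous_intros)+
  have S_int: "integrable lborel (\<lambda>y. indicator {..x} y * (exp y * w y))"
    and S_eq: "S x = (LINT y|lborel. indicator {..x} y * (exp y * w y))" for x
  proof -
    have eq: "exp x * h1 x y = indicator {..x} y * (exp y * w y)" for y
      by (auto simp: h1_def exp_diff split: split_indicator)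
    show "integrable lborel (\<lambda>y. indicator {..x} y * (exp y * w y))"
      using integrable_mult_right[OF i1[of x], of "exp x"] by (simp add: eq)
    show "S x = (LINT y|lborel. indicator {..x} y * (exp y * w y))"
      unfolding S_def P_def by (simp add: eq flip: integral_mult_right_zero)
  qed
  have T_int: "integrable lborel (\<lambda>y. indicator {x<..} y * (exp (- y) * w y))"
    and T_eq: "T x = (LINT y|lborel. indicator {x<..} y * (exp (- y) * w y))" for x
  proof -
    have eq: "exp (- x) * h2 x y = indicator {x<..} y * (exp (- y) * w y)" for y
      by (auto simp: h2_def exp_diff exp_minus field_simps split: split_indicator)
    show "integrable lborel (\<lambda>y. indicator {x<..} y * (exp (- y) * w y))"
      using integrable_mult_right[OF i2[of x], of "exp (- x)"] by (simp add: eq)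
    show "T x = (LINT y|lborel. indicator {x<..} y * (exp (- y) * w y))"
      unfolding T_def Q_def by (simp add: eq flip: integral_mult_right_zero)
  qed
  have Icc_Ioc: "(LINT y:{a..b}|lborel. g y) = (LINT y|lborel. indicator {a<..b} y * g y)"
    if [measurable]: "g \<in> borel_measurable borel" for a b :: real and g :: "real \<Rightarrow> real"
    unfolding set_lebesgue_integral_def
  proof (rule integral_cong_AE)
    have "AE y in lborel. y \<noteq> a" by (rule AE_lborel_singleton)
    then show "AE y in lborel. indicator {a..b} y *\<^sub>R g y = indicator {a<..b} y * g y"
      by eventually_elim (auto split: split_indicator)
  qed measurable
  have acS: "ac S (\<lambda>x. exp x * w x)"
    unfolding ac_def
  proof (intro conjI allI impI locally_integrable_mult_continuous wl expc)
    fix a b :: real assume ab: "a \<le> b"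
    have "S b - S a = (LINT y|lborel. indicator {..b} y * (exp y * w y) - indicator {..a} y * (exp y * w y))"
      unfolding S_eq using S_int by simp
    also have "\<dots> = (LINT y|lborel. indicator {a<..b} y * (exp y * w y))"
      using ab by (intro Bochner_Integration.integral_cong) (auto split: split_indicator)
    finally show "S b - S a = (LINT y:{a..b}|lborel. exp y * w y)" by (simp add: Icc_Ioc)
  qed
  have acT: "ac T (\<lambda>x. - (exp (- x) * w x))"
    unfolding ac_def
  proof (intro conjI allI impI)
    show "locally_integrable (\<lambda>x. - (exp (- x) * w x))"
      using locally_integrable_cmult[OF locally_integrable_mult_continuous[OF wl expc(2)], of "-1"] by simp
    fix a b :: real assume ab: "a \<le> b"
    have "T b - T a = (LINT y|lborel. indicator {b<..} y * (exp (- y) * w y) - indicator {a<..} y * (exp (- y) * w y))"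
      unfolding T_eq using T_int by simp
    also have "\<dots> = (LINT y|lborel. - (indicator {a<..b} y * (exp (- y) * w y)))"
      using ab by (intro Bochner_Integration.integral_cong) (auto split: split_indicator)
    finally show "T b - T a = (LINT y:{a..b}|lborel. - (exp (- y) * w y))" by (simp add: Icc_Ioc)
  qed
  have e1: "ac (\<lambda>x. exp (- x)) (\<lambda>x. - exp (- x) :: real)" and e2: "ac (\<lambda>x. exp x) (\<lambda>x. exp x :: real)"
    by (rule ac_DERIV, auto intro!: derivative_eq_intros continuous_intros)+
  have PS: "P = (\<lambda>x. exp (- x) * S x)" by (auto simp: S_def exp_minus fun_eq_iff)
  have QT: "Q = (\<lambda>x. exp x * T x)" by (auto simp: T_def exp_minus fun_eq_iff)
  have ee: "exp x * (w x * inverse (exp x)) = w x" for x by simp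
  have acP: "ac P (\<lambda>x. w x - P x)"
    using ac_mult[OF e1 acS] unfolding PS by (simp add: exp_minus algebra_simps ee del: mult_exp_exp)
  have acQ: "ac Q (\<lambda>x. Q x - w x)"
    using ac_mult[OF e2 acT] unfolding QT by (simp add: exp_minus algebra_simps ee del: mult_exp_exp)
  define u where "u = helmholtz_inv w"
  have u_eq: "u = (\<lambda>x. 1 / 2 * (P x + Q x))"
  proof
    fix x
    have "P x + Q x = (LINT y|lborel. h1 x y + h2 x y)" unfolding P_def Q_def using i1 i2 by simp
    also have "\<dots> = (LINT y|lborel. 2 * (exp (- \<bar>x - y\<bar>) / 2 * w y))"
      by (rule Bochner_Integration.integral_cong) (auto simp: h1_def h2_def split: split_indicator)
    also have "\<dots> = 2 * helmholtz_inv w x" unfolding helmholtz_real by (rule integral_mult_right_zero)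
    finally show "u x = 1 / 2 * (P x + Q x)" by (simp add: u_def)
  qed
  define v where "v = (\<lambda>x. 1 / 2 * (Q x - P x))"
  have acu: "ac u v"
    using ac_cmult[OF ac_add[OF acP acQ], of "1 / 2"] unfolding u_eq v_def by (simp add: algebra_simps)
  have acv: "ac v (\<lambda>x. u x - w x)"
  proof -
    have "(\<lambda>x. 1 / 2 * (Q x - w x - (w x - P x))) = (\<lambda>x. u x - w x)" by (simp add: u_eq fun_eq_iff field_simps)
    then show ?thesis using ac_cmult[OF ac_diff[OF acQ acP], of "1 / 2"] unfolding v_def by simp
  qed
  \<comment> \<open>Either half of the kernel integral is dominated by the convolution with
    \<open>\<bar>w\<bar>\<close>, which puts \<open>P\<close> and \<open>Q\<close> in L2.\<close>
  have bound: "\<bar>LINT y|lborel. indicator A y * (exp (- \<bar>x - y\<bar>) * w y)\<bar> \<le> 2 * \<bar>helmholtz_inv (\<lambda>x. \<bar>w x\<bar>) x\<bar>"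
    if "A \<in> sets borel" for A x
  proof -
    have wa: "L2 (\<lambda>x. \<bar>w x\<bar>)" using w by (auto simp: L2_real_iff)
    have "\<bar>LINT y|lborel. indicator A y * (exp (- \<bar>x - y\<bar>) * w y)\<bar> \<le> (LINT y|lborel. 2 * (exp (- \<bar>x - y\<bar>) / 2 * \<bar>w y\<bar>))"
    proof (rule integral_abs_bound_integral)
      show "integrable lborel (\<lambda>y. 2 * (exp (- \<bar>x - y\<bar>) / 2 * \<bar>w y\<bar>))"
        by (intro integrable_mult_right helmholtz_integrable[OF wa])
      show "integrable lborel (\<lambda>y. indicator A y * (exp (- \<bar>x - y\<bar>) * w y))"
        by (intro integrable_indicator_times ki that)
    qed (auto simp: abs_mult split: split_indicator)
    also have "\<dots> = 2 * helmholtz_inv (\<lambda>x. \<bar>w x\<bar>) x"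
      unfolding helmholtz_real by (rule integral_mult_right_zero)
    finally show ?thesis by simp
  qed
  have PL: "L2 P" "L2 Q"
    by (rule L2_bound(1)[OF helmholtz_abs_L2[OF w], where C = 2];
        use acP acQ bound in \<open>auto simp: P_def Q_def h1_def h2_def intro: borel_measurable_continuous_onI ac_continuous\<close>)+
  have "L2 u" "L2 v" unfolding u_eq v_def by (intro L2_cmult L2_add L2_diff PL)+
  then show ?thesis using acu acv w unfolding H1_def u_def[symmetric]
    by (intro exI[of _ v]) (auto intro: L2_diff)
qed

lemma helmholtz_L2: "L2 (w :: real \<Rightarrow> real) \<Longrightarrow> L2 (helmholtz_inv w)"
  using helmholtz_H1[of w] by (auto simp: H1_def)

text \<open>One integration by parts, using \<open>s' = helmholtz_inv z - z\<close>. The right-hand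
  side is the H1 inner product of the two images, from which symmetry and positivity can be read
  off.\<close>

lemma helmholtz_form:
  fixes w z :: "real \<Rightarrow> real"
  assumes w: "L2 w" and z: "L2 z"
    and v: "H1 (helmholtz_inv w) v" "H1 v (\<lambda>x. helmholtz_inv w x - w x)"
    and s: "H1 (helmholtz_inv z) s" "H1 s (\<lambda>x. helmholtz_inv z x - z x)"
  shows "ip (helmholtz_inv w) z = ip (helmholtz_inv w) (helmholtz_inv z) + ip v s"
proof -
  have "ip (helmholtz_inv w) (\<lambda>x. helmholtz_inv z x - z x) = - ip v s"
    by (rule integration_by_parts[OF v(1) s(2)])
  moreover have "ip (helmholtz_inv w) (\<lambda>x. helmholtz_inv z x - z x)
      = ip (helmholtz_inv w) (helmholtz_inv z) - ip (helmholtz_inv w) z"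
    using ip_diff[OF helmholtz_L2[OF z] z helmholtz_L2[OF w]] by (simp add: ip_commute)
  ultimately show ?thesis by simp
qed

lemma helmholtz_sym:
  fixes w z :: "real \<Rightarrow> real"
  assumes "L2 w" "L2 z" shows "ip (helmholtz_inv w) z = ip w (helmholtz_inv z)"
proof -
  obtain v where v: "H1 (helmholtz_inv w) v" "H1 v (\<lambda>x. helmholtz_inv w x - w x)"
    using helmholtz_H1[OF assms(1)] by blast
  obtain s where s: "H1 (helmholtz_inv z) s" "H1 s (\<lambda>x. helmholtz_inv z x - z x)"
    using helmholtz_H1[OF assms(2)] by blast
  show ?thesis
    using helmholtz_form[OF assms v s] helmholtz_form[OF assms(2,1) s v] by (simp add: ip_commute)
qed

lemma helmholtz_bounds:
  fixes w :: "real \<Rightarrow> real"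
  assumes "L2 w"
  shows "0 \<le> ip (helmholtz_inv w) w" "ip (helmholtz_inv w) w \<le> ip w w"
    "ip (helmholtz_inv w) (helmholtz_inv w) \<le> ip w w"
proof -
  obtain v where v: "H1 (helmholtz_inv w) v" "H1 v (\<lambda>x. helmholtz_inv w x - w x)"
    using helmholtz_H1[OF assms(1)] by blast
  let ?u = "helmholtz_inv w"
  have u: "L2 ?u" by (rule helmholtz_L2[OF assms])
  have eq: "ip ?u w = ip ?u ?u + ip v v" by (rule helmholtz_form[OF assms assms v v])
  show nn: "0 \<le> ip ?u w" using eq ip_nonneg by simp
  have le: "ip ?u ?u \<le> ip ?u w" using eq ip_nonneg[of v] by simp
  \<comment> \<open>Expanding this square and using \<open>ip ?u ?u \<le> ip ?u w\<close> gives both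
    upper bounds.\<close>
  have "0 \<le> ip (\<lambda>x. w x - ?u x) (\<lambda>x. w x - ?u x)" by (rule ip_nonneg)
  also have "\<dots> = ip w w - 2 * ip ?u w + ip ?u ?u"
    using assms u L2_diff[OF assms u] ip_diff[OF assms u L2_diff[OF assms u]]
      ip_diff[OF assms u assms] ip_diff[OF assms u u] ip_commute[of w ?u]
      ip_commute[of "\<lambda>x. w x - ?u x" w] ip_commute[of "\<lambda>x. w x - ?u x" ?u] by simp
  finally have 1: "0 \<le> ip w w - 2 * ip ?u w + ip ?u ?u" .
  show "ip ?u w \<le> ip w w" "ip ?u ?u \<le> ip w w" using 1 le by linarith+
qed

text \<open>The difference \<open>d\<close> of the two sides satisfies \<open>d'' = d\<close> with
  \<open>d\<close> and \<open>d'\<close> in H1, and integration by parts makes its H1 norm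
  zero.\<close>

lemma helmholtz_inverse:
  fixes f :: "real \<Rightarrow> real"
  assumes f: "H1 f g" "H1 g h"
  shows "helmholtz_inv (\<lambda>x. f x - h x) = f"
proof -
  define w where "w = (\<lambda>x. f x - h x)"
  have w: "L2 w" unfolding w_def using f by (auto simp: H1_def intro: L2_diff)
  obtain v where v: "H1 (helmholtz_inv w) v" "H1 v (\<lambda>x. helmholtz_inv w x - w x)"
    using helmholtz_H1[OF w] by blast
  define d where "d = (\<lambda>x. f x - helmholtz_inv w x)"
  define d1 where "d1 = (\<lambda>x. g x - v x)"
  have d: "H1 d d1" unfolding d_def d1_def by (rule H1_diff[OF f(1) v(1)])
  have "(\<lambda>x. h x - (helmholtz_inv w x - w x)) = d" by (simp add: d_def w_def fun_eq_iff)
  with H1_diff[OF f(2) v(2)] have d1: "H1 d1 d" by (simp add: d1_def)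
  have "ip d1 d1 = - ip d d" using integration_by_parts[OF d1 d] by (simp add: ip_commute)
  then have "n1 d d1 = 0" using ip_nonneg[of d] ip_nonneg[of d1] by (simp add: n1_def)
  then have "d x = 0" for x using H1_sup_bound[OF d, of x] by simp
  then have "f x = helmholtz_inv w x" for x by (simp add: d_def)
  then show ?thesis unfolding w_def[symmetric] by (intro ext) simp
qed

text \<open>The primitive \<open>V\<close> vanishes at both ends, so the integrals over large
  intervals are small; this is conditional convergence of the integral of \<open>g\<close>.\<close>

lemma has_integral_UNIV_improper:
  fixes V g :: "real \<Rightarrow> real"
  assumes "ac V g" "(V \<longlongrightarrow> 0) at_top" "(V \<longlongrightarrow> 0) at_bot"
  shows "(g has_integral 0) UNIV"
proof (rule has_integral'[THEN iffD2], intro allI impI)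
  fix e :: real assume e: "e > 0"
  have "\<forall>\<^sub>F x in at_top. \<bar>V x\<bar> < e / 2" "\<forall>\<^sub>F x in at_bot. \<bar>V x\<bar> < e / 2"
    using tendstoD[OF assms(2), of "e / 2"] tendstoD[OF assms(3), of "e / 2"] e by simp_all
  then obtain R1 R2 where R1: "\<And>x. x \<ge> R1 \<Longrightarrow> \<bar>V x\<bar> < e / 2" and R2: "\<And>x. x \<le> R2 \<Longrightarrow> \<bar>V x\<bar> < e / 2"
    unfolding eventually_at_bot_linorder eventually_at_top_linorder by blast
  define B where "B = \<bar>R1\<bar> + \<bar>R2\<bar> + 1"
  show "\<exists>B>0. \<forall>a b :: real. ball 0 B \<subseteq> cbox a b \<longrightarrow>
      (\<exists>z. ((\<lambda>x. if x \<in> UNIV then g x else 0) has_integral z) (cbox a b) \<and> norm (z - 0) < e)"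
  proof (rule exI[of _ B], intro conjI allI impI)
    show "B > 0" by (simp add: B_def)
    fix a b :: real assume "ball 0 B \<subseteq> cbox a b"
    then have ab: "ball 0 B \<subseteq> {a..b}" by simp
    have ab2: "a \<le> R2" "R1 \<le> b" "a \<le> b"
    proof -
      have "R2 \<in> ball 0 B" "R1 \<in> ball 0 B" by (auto simp: B_def)
      then have "R2 \<in> {a..b}" "R1 \<in> {a..b}" using ab by blast+
      then show "a \<le> R2" "R1 \<le> b" "a \<le> b" by auto
    qed
    have si: "set_integrable lborel {a..b} g" using assms(1) by (auto simp: ac_def locally_integrable_def)
    have "(g has_integral (V b - V a)) {a..b}"
      using set_borel_integral_eq_integral[OF si] ac_integral[OF assms(1) ab2(3)] by (metis integrable_integral)
    moreover have "\<bar>V b - V a\<bar> < e" using R1[OF ab2(2)] R2[OF ab2(1)] by linarith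
    ultimately show "\<exists>z. ((\<lambda>x. if x \<in> UNIV then g x else 0) has_integral z) (cbox a b) \<and> norm (z - 0) < e"
      by auto
  qed
qed

text \<open>The integrand is the derivative of an H1 function. This is the conditionally convergent
  part of the densities of the conserved functionals.\<close>

lemma helmholtz_has_integral_zero:
  fixes w :: "real \<Rightarrow> real"
  assumes "L2 w" shows "((\<lambda>x. helmholtz_inv w x - w x) has_integral 0) UNIV"
proof -
  obtain v where v: "H1 v (\<lambda>x. helmholtz_inv w x - w x)"
    using helmholtz_H1[OF assms(1)] by blast
  show ?thesis by (rule has_integral_UNIV_improper[OF H1_D(1)[OF v] H1_tendsto[OF v]])
qed

section \<open>The solitary wave\<close>

definition expdecay :: "(real \<Rightarrow> real) \<Rightarrow> bool" where
  "expdecay f \<longleftrightarrow> (\<exists>C \<alpha>. \<alpha> > 0 \<and> (\<forall>x. \<bar>f x\<bar> \<le> C * exp (- \<alpha> * \<bar>x\<bar>)))"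

lemma expdecay_bounded: "expdecay f \<Longrightarrow> \<exists>C. \<forall>x. \<bar>f x\<bar> \<le> C"
proof -
  assume "expdecay f"
  then obtain C \<alpha> where C: "\<alpha> > 0" "\<And>x. \<bar>f x\<bar> \<le> C * exp (- \<alpha> * \<bar>x\<bar>)" by (auto simp: expdecay_def)
  have "0 \<le> C" using order_trans[OF abs_ge_zero C(2)[of 0]] by simp
  then have "C * exp (- \<alpha> * \<bar>x\<bar>) \<le> C * 1" for x using C(1) by (intro mult_left_mono) auto
  then show ?thesis using C(2) by (intro exI[of _ C]) (metis mult.right_neutral order_trans)
qed

lemma expdecay_diff: "expdecay f \<Longrightarrow> expdecay g \<Longrightarrow> expdecay (\<lambda>x. f x - g x)"
proof -
  assume "expdecay f" "expdecay g"
  then obtain C \<alpha> C' \<alpha>' where C: "\<alpha> > 0" "\<And>x. \<bar>f x\<bar> \<le> C * exp (- \<alpha> * \<bar>x\<bar>)"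
    "\<alpha>' > 0" "\<And>x. \<bar>g x\<bar> \<le> C' * exp (- \<alpha>' * \<bar>x\<bar>)" by (auto simp: expdecay_def)
  have C0: "0 \<le> C" "0 \<le> C'"
    using order_trans[OF abs_ge_zero C(2)[of 0]] order_trans[OF abs_ge_zero C(4)[of 0]] by auto
  have "\<bar>f x - g x\<bar> \<le> (C + C') * exp (- min \<alpha> \<alpha>' * \<bar>x\<bar>)" for x
  proof -
    have "exp (- \<alpha> * \<bar>x\<bar>) \<le> exp (- min \<alpha> \<alpha>' * \<bar>x\<bar>)" "exp (- \<alpha>' * \<bar>x\<bar>) \<le> exp (- min \<alpha> \<alpha>' * \<bar>x\<bar>)"
      by (auto intro!: mult_right_mono)
    then have "C * exp (- \<alpha> * \<bar>x\<bar>) \<le> C * exp (- min \<alpha> \<alpha>' * \<bar>x\<bar>)"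
      "C' * exp (- \<alpha>' * \<bar>x\<bar>) \<le> C' * exp (- min \<alpha> \<alpha>' * \<bar>x\<bar>)"
      using C0 by (auto intro!: mult_left_mono)
    then show ?thesis using C(2)[of x] C(4)[of x] unfolding distrib_right by linarith
  qed
  then show ?thesis unfolding expdecay_def using C by (intro exI[of _ "C + C'"] exI[of _ "min \<alpha> \<alpha>'"]) auto
qed

lemma expdecay_L2:
  assumes "expdecay f" "continuous_on UNIV f" shows "L2 f"
proof -
  obtain C \<alpha> where C: "\<alpha> > 0" "\<And>x. \<bar>f x\<bar> \<le> C * exp (- \<alpha> * \<bar>x\<bar>)" using assms by (auto simp: expdecay_def)
  have "integrable lborel (\<lambda>x. exp (- \<bar>0 - (0 + (2 * \<alpha>) * x)\<bar>) / 2 :: real)"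
    by (rule lborel_integrable_real_affine[OF integrable_exp_abs[of 0]]) (use C in simp)
  then have "integrable lborel (\<lambda>x. 2 * (exp (- \<bar>0 - (0 + (2 * \<alpha>) * x)\<bar>) / 2 :: real))" by (rule integrable_mult_right)
  then have i: "integrable lborel (\<lambda>x. (exp (- \<alpha> * \<bar>x\<bar>))\<^sup>2)"
    using C(1) by (simp add: abs_mult power2_eq_square mult_exp_exp mult.assoc)
  have "L2 (\<lambda>x. exp (- \<alpha> * \<bar>x\<bar>))" unfolding L2_real_iff using i by simp
  then show ?thesis
    by (rule L2_bound(1)[where C = C]) (use assms C in \<open>auto intro: borel_measurable_continuous_onI\<close>)
qed

lemma expdecay_tendsto: "expdecay f \<Longrightarrow> (f \<longlongrightarrow> 0) at_top"
proof -
  assume "expdecay f"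
  then obtain C \<alpha> where C: "\<alpha> > 0" "\<And>x. \<bar>f x\<bar> \<le> C * exp (- \<alpha> * \<bar>x\<bar>)" by (auto simp: expdecay_def)
  have "filterlim (\<lambda>x::real. \<alpha> * x) at_top at_top"
    using C(1) by (intro filterlim_tendsto_pos_mult_at_top[OF tendsto_const]) (auto intro: filterlim_ident)
  then have "filterlim (\<lambda>x. - (\<alpha> * x)) at_bot at_top" by (simp add: filterlim_uminus_at_top)
  then have "((\<lambda>x. C * exp (- (\<alpha> * x))) \<longlongrightarrow> C * 0) at_top"
    by (intro tendsto_intros filterlim_compose[OF exp_at_bot])
  then have lim: "((\<lambda>x. C * exp (- (\<alpha> * x))) \<longlongrightarrow> 0) at_top" by simp
  have ev: "\<forall>\<^sub>F x in at_top. norm (f x) \<le> C * exp (- (\<alpha> * x))"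
    using eventually_ge_at_top[of 0]
  proof eventually_elim
    case (elim x)
    then show ?case using C(2)[of x] by simp
  qed
  show ?thesis by (rule Lim_null_comparison[OF ev lim])
qed

text \<open>Fractional exponents are traded for integer powers of a cube root, after which
  identities among them become rational.\<close>

lemma powr_third:
  fixes y :: real
  assumes "y > 0" shows "(y ^ 3) powr (- (real n) / 3) = 1 / y ^ n"
proof -
  have "(y ^ 3) powr (- (real n) / 3) = (y powr 3) powr (- (real n) / 3)" using assms by (simp add: powr_numeral)
  also have "\<dots> = y powr (- real n)" by (simp add: powr_powr)
  also have "\<dots> = 1 / y ^ n" using assms by (simp add: powr_minus_divide powr_realpow)
  finally show ?thesis .
qed

section \<open>A single wave: smoothness, decay and algebraic identities\<close>

locale wave =
  fixes c k :: real and \<phi> :: "real \<Rightarrow> real"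
  assumes c: "c > 0" and k: "k \<in> {0<..<sqrt c / 2}" and profile: "solitary_profile c k \<phi>"
begin

abbreviation \<mu> where "\<mu> \<equiv> momentum \<phi>"
definition a where "a = wave_a c k"
definition w where "w = (\<lambda>x. \<mu> x - k)"
definition \<mu>1 where "\<mu>1 = deriv \<mu>"
definition \<mu>2 where "\<mu>2 = deriv \<mu>1"
definition \<mu>3 where "\<mu>3 = deriv \<mu>2"
abbreviation w0 where "w0 \<equiv> omega0 c k"
abbreviation w1 where "w1 \<equiv> omega1 c k"

lemma k_pos: "k > 0" and k_sq: "4 * k\<^sup>2 < c" and ck: "c - k\<^sup>2 > 0"
proof -
  show "k > 0" using k by simp
  have "(2 * k)\<^sup>2 < (sqrt c)\<^sup>2" using k by (intro power_strict_mono) auto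
  then show "4 * k\<^sup>2 < c" using c by (simp add: power_mult_distrib)
  then show "c - k\<^sup>2 > 0" using zero_le_power2[of k] by linarith
qed

lemma a_pos: "a > 0"
  using k_pos ck by (simp add: a_def wave_a_def)

lemma smooth_phi: "smooth \<phi>" using profile by (simp add: solitary_profile_def)
lemma phi_lt: "(\<phi> x)\<^sup>2 < c" using profile by (simp add: solitary_profile_def)
lemma phi_even: "\<phi> (- x) = \<phi> x" using profile by (simp add: solitary_profile_def)
lemma phi_not_const: "\<not> (\<exists>r. \<forall>x. \<phi> x = r)" using profile by (simp add: solitary_profile_def)

lemma smooth_d: "smooth ((deriv ^^ n) \<phi>)"
  by (induction n) (auto intro: smooth_phi smooth_deriv)

lemma smooth_mu: "smooth \<mu>"
proof -
  have "smooth (\<lambda>x. \<phi> x + (-1) * deriv (deriv \<phi>) x)"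
    by (intro smooth_add smooth_scale smooth_deriv smooth_phi)
  moreover have "\<mu> = (\<lambda>x. \<phi> x + (-1) * deriv (deriv \<phi>) x)" by (simp add: momentum_def fun_eq_iff)
  ultimately show ?thesis by simp
qed

lemma mu_smooth: "smooth \<mu>1" "smooth \<mu>2" "smooth \<mu>3"
  unfolding \<mu>1_def \<mu>2_def \<mu>3_def by (intro smooth_deriv smooth_mu)+

lemma mu_DERIV: "(\<mu> has_field_derivative \<mu>1 x) (at x)" "(\<mu>1 has_field_derivative \<mu>2 x) (at x)"
  "(\<mu>2 has_field_derivative \<mu>3 x) (at x)"
  using smooth_DERIV smooth_mu mu_smooth by (auto simp: \<mu>1_def \<mu>2_def \<mu>3_def)

lemma phi_DERIV: "(\<phi> has_field_derivative deriv \<phi> x) (at x)"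
  "(deriv \<phi> has_field_derivative deriv (deriv \<phi>) x) (at x)"
  using smooth_DERIV smooth_phi smooth_deriv by auto

lemma deriv_pow_sub: "(deriv ^^ Suc n) (\<lambda>y. \<phi> y - k) = (deriv ^^ Suc n) \<phi>"
proof -
  have "deriv (\<lambda>y. \<phi> y - k) = deriv \<phi>"
    by (rule ext, rule DERIV_imp_deriv) (auto intro!: derivative_eq_intros phi_DERIV)
  then show ?thesis by (simp add: funpow_Suc_right del: funpow.simps)
qed

lemma phi_decay: "expdecay (\<lambda>x. \<phi> x - k)" "expdecay ((deriv ^^ Suc n) \<phi>)"
proof -
  have *: "expdecay ((deriv ^^ n) (\<lambda>y. \<phi> y - k))" for n
    using profile unfolding solitary_profile_def expdecay_def by blast
  show "expdecay (\<lambda>x. \<phi> x - k)" using *[of 0] by simp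
  show "expdecay ((deriv ^^ Suc n) \<phi>)" using *[of "Suc n"] unfolding deriv_pow_sub .
qed

lemma deriv_mu: "(deriv ^^ n) \<mu> = (\<lambda>x. (deriv ^^ n) \<phi> x - (deriv ^^ (n + 2)) \<phi> x)"
proof (induction n)
  case 0 then show ?case by (simp add: momentum_def fun_eq_iff numeral_2_eq_2)
next
  case (Suc n)
  have "(deriv ^^ Suc n) \<mu> = deriv (\<lambda>x. (deriv ^^ n) \<phi> x - (deriv ^^ (n + 2)) \<phi> x)" by (simp add: Suc.IH)
  also have "\<dots> = (\<lambda>x. deriv ((deriv ^^ n) \<phi>) x - deriv ((deriv ^^ (n + 2)) \<phi>) x)"
    by (rule ext, rule DERIV_imp_deriv) (intro derivative_intros smooth_DERIV smooth_d)
  finally show ?case by simp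
qed

lemma mu_decay: "expdecay w" "expdecay \<mu>1" "expdecay \<mu>2" "expdecay \<mu>3"
proof -
  have "w = (\<lambda>x. (\<phi> x - k) - (deriv ^^ Suc 1) \<phi> x)" by (simp add: w_def momentum_def fun_eq_iff)
  then show "expdecay w" using expdecay_diff[OF phi_decay(1) phi_decay(2)[of 1]] by simp
  have *: "expdecay ((deriv ^^ Suc n) \<mu>)" for n
    unfolding deriv_mu using expdecay_diff[OF phi_decay(2)[of n] phi_decay(2)[of "n + 2"]] by simp
  show "expdecay \<mu>1" using *[of 0] by (simp add: \<mu>1_def)
  show "expdecay \<mu>2" using *[of 1] by (simp add: \<mu>1_def \<mu>2_def)
  show "expdecay \<mu>3" using *[of 2] by (simp add: \<mu>1_def \<mu>2_def \<mu>3_def numeral_2_eq_2)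
qed

lemma cont: "continuous_on A \<phi>" "continuous_on A (deriv \<phi>)" "continuous_on A (deriv (deriv \<phi>))" "continuous_on A \<mu>"
  "continuous_on A \<mu>1" "continuous_on A \<mu>2" "continuous_on A \<mu>3" "continuous_on A w"
  using smooth_continuous smooth_phi smooth_deriv smooth_mu mu_smooth
  by (auto simp: w_def intro!: continuous_intros)

lemma H1_waves: "H1 w \<mu>1" "H1 \<mu>1 \<mu>2" "H1 \<mu>2 \<mu>3" "H1 (\<lambda>x. \<phi> x - k) (deriv \<phi>)" "H1 (deriv \<phi>) (deriv (deriv \<phi>))"
proof -
  have L: "L2 w" "L2 \<mu>1" "L2 \<mu>2" "L2 \<mu>3" "L2 (\<lambda>x. \<phi> x - k)" "L2 (deriv \<phi>)" "L2 (deriv (deriv \<phi>))"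
    using expdecay_L2 mu_decay cont phi_decay phi_decay(2)[of 0] phi_decay(2)[of 1]
    by (auto intro!: expdecay_L2 continuous_intros)
  have "(w has_field_derivative \<mu>1 x) (at x)" for x
    unfolding w_def by (auto intro!: derivative_eq_intros mu_DERIV)
  then show "H1 w \<mu>1" "H1 \<mu>1 \<mu>2" "H1 \<mu>2 \<mu>3" using L cont mu_DERIV by (auto simp: H1_def intro!: ac_DERIV)
  have "((\<lambda>x. \<phi> x - k) has_field_derivative deriv \<phi> x) (at x)" for x
    by (auto intro!: derivative_eq_intros phi_DERIV)
  then show "H1 (\<lambda>x. \<phi> x - k) (deriv \<phi>)" "H1 (deriv \<phi>) (deriv (deriv \<phi>))"
    using L cont phi_DERIV by (auto simp: H1_def intro!: ac_DERIV)
qed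

lemma helmholtz_w: "helmholtz_inv w = (\<lambda>x. \<phi> x - k)"
proof -
  have "w = (\<lambda>x. (\<phi> x - k) - deriv (deriv \<phi>) x)" by (simp add: w_def momentum_def fun_eq_iff)
  then show ?thesis using helmholtz_inverse[OF H1_waves(4,5)] by simp
qed

lemma helmholtz_mu1: "helmholtz_inv \<mu>1 = deriv \<phi>"
proof -
  have L: "H1 (deriv (deriv \<phi>)) (deriv (deriv (deriv \<phi>)))"
    using H1_D(3)[OF H1_waves(5)] expdecay_L2[OF phi_decay(2)[of 2]] smooth_d[of 2] smooth_d[of 3]
    by (auto simp: H1_def numeral_2_eq_2 numeral_3_eq_3 intro!: ac_DERIV smooth_DERIV smooth_continuous)
  have "\<mu>1 = (\<lambda>x. deriv \<phi> x - deriv (deriv (deriv \<phi>)) x)"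
    using deriv_mu[of 1] by (simp add: \<mu>1_def)
  then show ?thesis using helmholtz_inverse[OF H1_waves(5) L] by simp
qed

text \<open>With this function the profile equation becomes \<open>\<mu> = a / s\<^sup>3\<close> and
  \<open>s\<^sup>2 + \<phi>\<^sup>2 = c\<close>, so a power of \<open>\<mu>\<close> with exponent
  \<open>- n / 3\<close> is a multiple of the integer power \<open>s\<^sup>n\<close>.\<close>

definition s where "s x = sqrt (c - (\<phi> x)\<^sup>2)"

lemma s_pos: "s x > 0" and s_sq: "(s x)\<^sup>2 = c - (\<phi> x)\<^sup>2"
  using phi_lt[of x] by (auto simp: s_def)

lemma powr_three_halves: "(y::real) > 0 \<Longrightarrow> y powr (-3/2) = 1 / sqrt y ^ 3"
  by (simp add: powr_half_sqrt[symmetric] powr_powr powr_minus_divide flip: powr_numeral)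

lemma mu_eq: "\<mu> x = a / s x ^ 3"
proof -
  have "\<mu> x = a * (c - (\<phi> x)\<^sup>2) powr (-3/2)"
    using profile by (simp add: solitary_profile_def momentum_def a_def)
  then show ?thesis using phi_lt[of x] powr_three_halves[of "c - (\<phi> x)\<^sup>2"] by (simp add: s_def)
qed

lemma mu_pos: "\<mu> x > 0"
  using a_pos s_pos[of x] by (simp add: mu_eq)

lemma s_DERIV: "(s has_field_derivative - \<phi> x * deriv \<phi> x / s x) (at x)"
proof -
  have "((\<lambda>x. sqrt (c - (\<phi> x)\<^sup>2)) has_field_derivative - \<phi> x * deriv \<phi> x / sqrt (c - (\<phi> x)\<^sup>2)) (at x)"
    using phi_lt[of x] by (auto intro!: derivative_eq_intros phi_DERIV simp: field_simps)
  then show ?thesis by (simp add: s_def[abs_def])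
qed

lemma mu1_eq: "\<mu>1 x = 3 * a * \<phi> x * deriv \<phi> x / s x ^ 5"
proof -
  have "((\<lambda>x. a / s x ^ 3) has_field_derivative 3 * a * \<phi> x * deriv \<phi> x / s x ^ 5) (at x)"
    using s_pos[of x] by (auto intro!: derivative_eq_intros s_DERIV simp: field_simps power_numeral_reduce)
  then show ?thesis using mu_DERIV(1)[of x] DERIV_unique by (simp add: mu_eq[abs_def])
qed

lemma mu2_eq: "\<mu>2 x = 3 * a * ((deriv \<phi> x)\<^sup>2 + \<phi> x * deriv (deriv \<phi>) x) / s x ^ 5 + 15 * a * (\<phi> x)\<^sup>2 * (deriv \<phi> x)\<^sup>2 / s x ^ 7"
proof -
  have "((\<lambda>x. 3 * a * \<phi> x * deriv \<phi> x / s x ^ 5) has_field_derivative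
      3 * a * ((deriv \<phi> x)\<^sup>2 + \<phi> x * deriv (deriv \<phi>) x) / s x ^ 5 + 15 * a * (\<phi> x)\<^sup>2 * (deriv \<phi> x)\<^sup>2 / s x ^ 7) (at x)"
    using s_pos[of x] by (auto intro!: derivative_eq_intros s_DERIV phi_DERIV simp: field_simps power_numeral_reduce)
  then show ?thesis using mu_DERIV(2)[of x] DERIV_unique by (simp add: mu1_eq[abs_def])
qed

lemma phi2_eq: "deriv (deriv \<phi>) x = \<phi> x - a / s x ^ 3"
  using mu_eq[of x] by (simp add: momentum_def)

text \<open>Multiplying the profile equation by the derivative of \<open>\<phi>\<close> gives an
  exact derivative, because \<open>\<phi> / s\<close> has derivative
  \<open>c \<phi>' / s\<^sup>3\<close>. The limit at infinity identifies the constant of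
  integration.\<close>

lemma first_integral: "(deriv \<phi> x)\<^sup>2 = (\<phi> x)\<^sup>2 + 2 * wave_E c k - 2 * a / c * \<phi> x / s x"
proof -
  define G where "G = (\<lambda>x. (deriv \<phi> x)\<^sup>2 - (\<phi> x)\<^sup>2 + 2 * a / c * \<phi> x / s x)"
  have D0: "(G has_field_derivative 0) (at x)" for x
  proof -
    have s0: "s x \<noteq> 0" using s_pos[of x] by simp
    have "(G has_field_derivative (2 * deriv \<phi> x * deriv (deriv \<phi>) x - 2 * \<phi> x * deriv \<phi> x
        + 2 * a / c * ((deriv \<phi> x * s x - \<phi> x * (- \<phi> x * deriv \<phi> x / s x)) / (s x)\<^sup>2))) (at x)"
    proof -
      have "((\<lambda>x. \<phi> x / s x) has_field_derivative
          (deriv \<phi> x * s x - \<phi> x * (- \<phi> x * deriv \<phi> x / s x)) / (s x)\<^sup>2) (at x)"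
        unfolding power2_eq_square by (rule DERIV_divide[OF phi_DERIV(1) s_DERIV s0])
      from DERIV_cmult[OF this, of "2 * a / c"] show ?thesis
        unfolding G_def times_divide_eq_right[of "2 * a / c", symmetric]
        by (intro DERIV_add DERIV_diff) (auto intro!: derivative_eq_intros phi_DERIV)
    qed
    moreover have "2 * deriv \<phi> x * deriv (deriv \<phi>) x - 2 * \<phi> x * deriv \<phi> x
        + 2 * a / c * ((deriv \<phi> x * s x - \<phi> x * (- \<phi> x * deriv \<phi> x / s x)) / (s x)\<^sup>2) = 0"
    proof -
      have "(deriv \<phi> x * s x - \<phi> x * (- \<phi> x * deriv \<phi> x / s x)) / (s x)\<^sup>2
          = deriv \<phi> x * ((s x)\<^sup>2 + (\<phi> x)\<^sup>2) / s x ^ 3"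
        using s0 by (simp add: field_simps power2_eq_square power3_eq_cube)
      also have "(s x)\<^sup>2 + (\<phi> x)\<^sup>2 = c" using s_sq[of x] by simp
      finally show ?thesis using c by (simp add: phi2_eq algebra_simps)
    qed
    ultimately show ?thesis by (rule DERIV_cong)
  qed
  have const: "G x = G y" for x y using DERIV_isconst_all[of G x y] D0 by blast
  have p: "(\<phi> \<longlongrightarrow> k) at_top" using tendsto_add[OF expdecay_tendsto[OF phi_decay(1)] tendsto_const[of k]] by simp
  have p1: "(deriv \<phi> \<longlongrightarrow> 0) at_top" using expdecay_tendsto[OF phi_decay(2)[of 0]] by simp
  have "(G \<longlongrightarrow> 0\<^sup>2 - k\<^sup>2 + 2 * a / c * k / sqrt (c - k\<^sup>2)) at_top"
    unfolding G_def s_def using c ck by (intro tendsto_intros p p1) auto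
  moreover have "(G \<longlongrightarrow> G x) at_top"
    by (intro tendsto_eventually always_eventually allI const)
  ultimately have "G x = - k\<^sup>2 + 2 * a / c * k / sqrt (c - k\<^sup>2)"
    using tendsto_unique trivial_limit_at_top_linorder by fastforce
  moreover have "a / sqrt (c - k\<^sup>2) = k * (c - k\<^sup>2)"
  proof -
    have "(c - k\<^sup>2) powr (3/2) = (c - k\<^sup>2) powr 1 * (c - k\<^sup>2) powr (1/2)"
      unfolding powr_add[symmetric] by simp
    then show ?thesis using ck by (simp add: a_def wave_a_def powr_half_sqrt)
  qed
  moreover have "2 * a / c * k / sqrt (c - k\<^sup>2) = 2 / c * k * (a / sqrt (c - k\<^sup>2))" by simp
  ultimately have "G x = - k\<^sup>2 + 2 / c * k * (k * (c - k\<^sup>2))" by (simp only:)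
  also have "\<dots> = 2 * wave_E c k" using c by (simp add: wave_E_def field_simps power2_eq_square)
  finally show ?thesis by (simp add: G_def)
qed

definition \<beta> where "\<beta> = a powr (1/3)"

lemma beta_pos: "\<beta> > 0" and beta_cube: "\<beta> ^ 3 = a"
  using a_pos by (auto simp: \<beta>_def powr_powr simp flip: powr_numeral)

lemma w0_beta: "w0 = - 9 / \<beta>\<^sup>2" and w1_beta: "w1 = 9 * c * (2 * wave_E c k + c) / \<beta> ^ 4"
  using powr_third[OF beta_pos, of 2] powr_third[OF beta_pos, of 4]
  by (auto simp: omega0_def omega1_def a_def[symmetric] beta_cube)

lemma mu_powr: "\<mu> x powr (- (real n) / 3) = s x ^ n / \<beta> ^ n"
proof -
  have "\<mu> x = (\<beta> / s x) ^ 3" by (simp add: mu_eq beta_cube power_divide)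
  then have "\<mu> x powr (- (real n) / 3) = 1 / (\<beta> / s x) ^ n"
    using powr_third[of "\<beta> / s x" n] beta_pos s_pos[of x] by simp
  then show ?thesis by (simp add: power_divide)
qed

text \<open>This is the critical point equation of \<Lambda> at \<open>\<mu>\<close>. The first
  integral removes the square of the first derivative of \<open>\<phi>\<close> and the profile
  equation removes the second derivative; what remains is an algebraic identity closed by
  \<open>s\<^sup>2 + \<phi>\<^sup>2 = c\<close>.\<close>

lemma Euler_Lagrange:
  "2 * w0 * \<phi> x + 2 / 3 * w1 * \<mu> x powr (-1/3) - 2 * \<mu> x powr (-8/3) * \<mu>2 x
     + 8 / 3 * \<mu> x powr (-11/3) * (\<mu>1 x)\<^sup>2 - 6 * \<mu> x powr (-5/3) = 0"
proof -
  define S where "S = s x"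
  define p where "p = \<phi> x"
  define p1 where "p1 = deriv \<phi> x"
  define p2 where "p2 = deriv (deriv \<phi>) x"
  define E where "E = wave_E c k"
  have S: "S > 0" "S\<^sup>2 = c - p\<^sup>2" using s_pos s_sq by (auto simp: S_def p_def)
  have b: "\<beta> > 0" by (rule beta_pos)
  have f1: "p1\<^sup>2 = p\<^sup>2 + 2 * E - 2 * \<beta> ^ 3 / c * p / S"
    using first_integral[of x] by (simp add: p1_def p_def E_def S_def beta_cube)
  have f2: "p2 = p - \<beta> ^ 3 / S ^ 3" using phi2_eq[of x] by (simp add: p2_def p_def S_def beta_cube)
  have m1: "\<mu>1 x = 3 * \<beta> ^ 3 * p * p1 / S ^ 5"
    using mu1_eq[of x] by (simp add: p1_def p_def S_def beta_cube)
  have m2: "\<mu>2 x = 3 * \<beta> ^ 3 * (p1\<^sup>2 + p * p2) / S ^ 5 + 15 * \<beta> ^ 3 * p\<^sup>2 * p1\<^sup>2 / S ^ 7"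
    using mu2_eq[of x] by (simp add: p1_def p_def p2_def S_def beta_cube)
  have P: "\<mu> x powr (-1/3) = S / \<beta>" "\<mu> x powr (-8/3) = S ^ 8 / \<beta> ^ 8"
    "\<mu> x powr (-11/3) = S ^ 11 / \<beta> ^ 11" "\<mu> x powr (-5/3) = S ^ 5 / \<beta> ^ 5"
    using mu_powr[of x 1] mu_powr[of x 8] mu_powr[of x 11] mu_powr[of x 5] by (auto simp: S_def)
  have "2 * (S ^ 8 / \<beta> ^ 8) * \<mu>2 x = (6 * (p1\<^sup>2 + p * p2) * S ^ 3 + 30 * p\<^sup>2 * p1\<^sup>2 * S) / \<beta> ^ 5"
    unfolding m2 using S(1) b by (simp add: field_simps power_numeral_reduce)
  moreover have "8 / 3 * (S ^ 11 / \<beta> ^ 11) * (\<mu>1 x)\<^sup>2 = 24 * p\<^sup>2 * p1\<^sup>2 * S / \<beta> ^ 5"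
    unfolding m1 using S(1) b by (simp add: field_simps power_numeral_reduce)
  ultimately have "- 2 * (S ^ 8 / \<beta> ^ 8) * \<mu>2 x + 8 / 3 * (S ^ 11 / \<beta> ^ 11) * (\<mu>1 x)\<^sup>2
     = (24 * p\<^sup>2 * p1\<^sup>2 * S - (6 * (p1\<^sup>2 + p * p2) * S ^ 3 + 30 * p\<^sup>2 * p1\<^sup>2 * S)) / \<beta> ^ 5"
    unfolding diff_divide_distrib by simp
  also have "24 * p\<^sup>2 * p1\<^sup>2 * S - (6 * (p1\<^sup>2 + p * p2) * S ^ 3 + 30 * p\<^sup>2 * p1\<^sup>2 * S)
     = - (6 * S * ((S\<^sup>2 + p\<^sup>2) * p1\<^sup>2 + S\<^sup>2 * p * p2))"
    by (simp add: algebra_simps power_numeral_reduce)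
  also have "S\<^sup>2 + p\<^sup>2 = c" using S by simp
  also have "c * p1\<^sup>2 + S\<^sup>2 * p * p2 = c * p\<^sup>2 + 2 * c * E + S\<^sup>2 * p\<^sup>2 - 3 * \<beta> ^ 3 * p / S"
    unfolding f1 f2 using S(1) c by (simp add: field_simps power_numeral_reduce)
  finally have 1: "- 2 * (S ^ 8 / \<beta> ^ 8) * \<mu>2 x + 8 / 3 * (S ^ 11 / \<beta> ^ 11) * (\<mu>1 x)\<^sup>2
     = - (6 * S * (c * p\<^sup>2 + 2 * c * E + S\<^sup>2 * p\<^sup>2 - 3 * \<beta> ^ 3 * p / S)) / \<beta> ^ 5" .
  have "6 * S * (c * p\<^sup>2 + 2 * c * E + S\<^sup>2 * p\<^sup>2 - 3 * \<beta> ^ 3 * p / S) + 6 * S ^ 5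
      = 6 * S * (c * p\<^sup>2 + 2 * c * E + S\<^sup>2 * (p\<^sup>2 + S\<^sup>2)) - 18 * \<beta> ^ 3 * p"
    using S(1) by (simp add: field_simps power_numeral_reduce)
  also have "p\<^sup>2 + S\<^sup>2 = c" using S by simp
  also have "c * p\<^sup>2 + 2 * c * E + S\<^sup>2 * c = c * (p\<^sup>2 + S\<^sup>2) + 2 * c * E" by (simp add: algebra_simps)
  also have "p\<^sup>2 + S\<^sup>2 = c" using S by simp
  also have "c * c + 2 * c * E = c * (c + 2 * E)" by (simp add: algebra_simps)
  finally have 2: "6 * S * (c * p\<^sup>2 + 2 * c * E + S\<^sup>2 * p\<^sup>2 - 3 * \<beta> ^ 3 * p / S)
      = 6 * S * (c * (c + 2 * E)) - 18 * \<beta> ^ 3 * p - 6 * S ^ 5" by simp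
  have 3: "2 * w0 * p + 2 / 3 * w1 * (S / \<beta>) - 6 * (S ^ 5 / \<beta> ^ 5)
      = (6 * S * (c * (c + 2 * E)) - 18 * \<beta> ^ 3 * p - 6 * S ^ 5) / \<beta> ^ 5"
    unfolding w0_beta w1_beta E_def[symmetric] using b by (simp add: field_simps power_numeral_reduce)
  show ?thesis unfolding P p_def[symmetric] using 1[unfolded 2] 3 unfolding minus_divide_left[symmetric] by linarith
qed

text \<open>Closed forms that can be differentiated in \<open>k\<close>. They rest on \<open>c * (2
  * wave_E c k + c) = (c - k\<^sup>2) * (c + 2 * k\<^sup>2)\<close>.\<close>

lemma w0_k: "w0 = - 9 * k powr (-2/3) / (c - k\<^sup>2)"
  and w1_k: "w1 = 9 * k powr (-4/3) * (c + 2 * k\<^sup>2) / (c - k\<^sup>2)"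
proof -
  have a2: "a powr (-2/3) = k powr (-2/3) / (c - k\<^sup>2)"
    using k_pos ck by (simp add: a_def wave_a_def powr_mult powr_powr powr_minus_divide)
  show "w0 = - 9 * k powr (-2/3) / (c - k\<^sup>2)" unfolding omega0_def a_def[symmetric] a2 by simp
  have a4: "a powr (-4/3) = k powr (-4/3) / (c - k\<^sup>2)\<^sup>2"
    using k_pos ck by (simp add: a_def wave_a_def powr_mult powr_powr powr_minus_divide)
  have "c * (2 * wave_E c k + c) = (c - k\<^sup>2) * (c + 2 * k\<^sup>2)"
    using c by (simp add: wave_E_def field_simps power2_eq_square)
  then have "w1 = 9 * (k powr (-4/3) / (c - k\<^sup>2)\<^sup>2) * ((c - k\<^sup>2) * (c + 2 * k\<^sup>2))"
    unfolding omega1_def a_def[symmetric] a4 by simp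
  then show "w1 = 9 * k powr (-4/3) * (c + 2 * k\<^sup>2) / (c - k\<^sup>2)"
    using ck by (simp add: power2_eq_square)
qed

text \<open>The Euler-Lagrange equation at the constant state \<open>k\<close>. It reduces the terms
  linear in \<open>v = m - k\<close> of the combined density to a multiple of
  \<open>helmholtz_inv v - v\<close>.\<close>

lemma Euler_Lagrange_infinity: "2 * w0 * k + 2 / 3 * w1 * k powr (-1/3) - 6 * k powr (-5/3) = 0"
proof -
  define y where "y = k powr (1/3)"
  have y: "y > 0" "y ^ 3 = k" using k_pos by (auto simp: y_def powr_powr simp flip: powr_numeral)
  have P: "k powr (-2/3) = 1 / y\<^sup>2" "k powr (-4/3) = 1 / y ^ 4" "k powr (-1/3) = 1 / y" "k powr (-5/3) = 1 / y ^ 5"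
    using powr_third[OF y(1), of 2] powr_third[OF y(1), of 4] powr_third[OF y(1), of 1] powr_third[OF y(1), of 5] y(2) by auto
  define d where "d = c - k\<^sup>2"
  have d: "d \<noteq> 0" "c + 2 * k\<^sup>2 = d + 3 * (y ^ 3 * y ^ 3)"
    using ck y(2) by (auto simp: d_def power2_eq_square)
  show ?thesis unfolding w0_k w1_k P d(2) d_def[symmetric]
    using y(1) d(1) by (subst y(2)[symmetric]) (simp add: field_simps power_numeral_reduce)
qed

text \<open>The local part of the linearized Euler-Lagrange expression at \<open>\<mu>\<close>, with
  the values of a direction and of its two derivatives as separate arguments. Adding
  \<open>2 * w0 * helmholtz_inv\<close> of the direction gives the linearized operator.\<close>

definition Lin where
  "Lin x h h1 h2 = - (2 / 9) * w1 * \<mu> x powr (-4/3) * h - 2 * \<mu> x powr (-8/3) * h2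
     + 16 / 3 * \<mu> x powr (-11/3) * \<mu>1 x * h1
     + (16 / 3 * \<mu> x powr (-11/3) * \<mu>2 x - 88 / 9 * \<mu> x powr (-14/3) * (\<mu>1 x)\<^sup>2 + 10 * \<mu> x powr (-8/3)) * h"

text \<open>Translation invariance: the Euler-Lagrange equation is differentiated in
  \<open>x\<close>.\<close>

lemma Lin_mu1: "2 * w0 * deriv \<phi> x + Lin x (\<mu>1 x) (\<mu>2 x) (\<mu>3 x) = 0"
proof -
  let ?G = "\<lambda>x. 2 * w0 * \<phi> x + 2 / 3 * w1 * \<mu> x powr (-1/3) - 2 * \<mu> x powr (-8/3) * \<mu>2 x
     + 8 / 3 * \<mu> x powr (-11/3) * (\<mu>1 x)\<^sup>2 - 6 * \<mu> x powr (-5/3)"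
  have "(?G has_field_derivative 2 * w0 * deriv \<phi> x + Lin x (\<mu>1 x) (\<mu>2 x) (\<mu>3 x)) (at x)"
    unfolding Lin_def
    by (rule derivative_eq_intros phi_DERIV mu_DERIV mu_pos refl)+
       (simp add: algebra_simps power2_eq_square)
  moreover have "?G = (\<lambda>x. 0)" using Euler_Lagrange by auto
  ultimately show ?thesis using DERIV_unique[OF _ DERIV_const] by metis
qed

text \<open>Euler's relation for homogeneous expressions: the local terms of the Euler-Lagrange
  equation have degree \<open>-1/3\<close> or \<open>-5/3\<close> in \<open>\<mu>\<close>, and the
  equation itself eliminates those of degree \<open>-5/3\<close>.\<close>

lemma Lin_mu: "Lin x (\<mu> x) (\<mu>1 x) (\<mu>2 x) = 10 / 3 * w0 * \<phi> x + 8 / 9 * w1 * \<mu> x powr (-1/3)"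
proof -
  have P: "\<mu> x powr (p - 1) * \<mu> x = \<mu> x powr p" for p
    using mu_pos[of x] by (simp add: powr_diff)
  have e: "\<mu> x powr (-4/3) * \<mu> x = \<mu> x powr (-1/3)" "\<mu> x powr (-11/3) * \<mu> x = \<mu> x powr (-8/3)"
    "\<mu> x powr (-14/3) * \<mu> x = \<mu> x powr (-11/3)" "\<mu> x powr (-8/3) * \<mu> x = \<mu> x powr (-5/3)"
    using P[of "-1/3"] P[of "-8/3"] P[of "-11/3"] P[of "-5/3"] by simp_all
  have "Lin x (\<mu> x) (\<mu>1 x) (\<mu>2 x) = - (2 / 9) * w1 * (\<mu> x powr (-4/3) * \<mu> x) - 2 * \<mu> x powr (-8/3) * \<mu>2 x
     + 16 / 3 * \<mu> x powr (-11/3) * (\<mu>1 x)\<^sup>2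
     + 16 / 3 * (\<mu> x powr (-11/3) * \<mu> x) * \<mu>2 x - 88 / 9 * (\<mu> x powr (-14/3) * \<mu> x) * (\<mu>1 x)\<^sup>2
     + 10 * (\<mu> x powr (-8/3) * \<mu> x)"
    by (simp add: Lin_def algebra_simps power2_eq_square)
  then show ?thesis unfolding e using Euler_Lagrange[of x] by (simp add: algebra_simps)
qed

text \<open>A constant \<open>\<mu>\<close> forces \<open>s\<close>, hence the square of
  \<open>\<phi>\<close>, to be constant. Its value \<open>k\<^sup>2\<close> keeps
  \<open>\<phi>\<close> away from zero, and then \<open>\<phi>\<close> itself would be
  constant.\<close>

lemma mu1_nonzero: "\<exists>x. \<mu>1 x \<noteq> 0"
proof (rule ccontr)
  assume "\<not> ?thesis"
  then have 0: "\<mu>1 x = 0" for x by blast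
  then have m: "\<mu> x = \<mu> 0" for x
    using DERIV_isconst_all[of \<mu> x 0] mu_DERIV(1) by metis
  have "s x = s 0" for x
  proof -
    have "s x ^ 3 = s 0 ^ 3" using m[of x] a_pos s_pos[of x] s_pos[of 0] by (simp add: mu_eq field_simps)
    then show ?thesis using s_pos[of x] s_pos[of 0] by (simp add: power_eq_iff_eq_base)
  qed
  then have sc: "s = (\<lambda>x. s 0)" by (simp add: fun_eq_iff)
  have s0: "\<phi> x * deriv \<phi> x = 0" for x
  proof -
    have "(s has_field_derivative 0) (at x)" by (subst sc) simp
    from DERIV_unique[OF s_DERIV this] show ?thesis using s_pos[of x] by simp
  qed
  have "((\<lambda>x. \<phi> x * \<phi> x) has_field_derivative 0) (at x)" for x
    using s0[of x] by (auto intro!: derivative_eq_intros phi_DERIV simp: mult.commute)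
  then have sq: "\<phi> x * \<phi> x = \<phi> 0 * \<phi> 0" for x
    using DERIV_isconst_all[of "\<lambda>x. \<phi> x * \<phi> x" x 0] by blast
  have lim: "((\<lambda>x. \<phi> x * \<phi> x) \<longlongrightarrow> k * k) at_top"
    using tendsto_add[OF expdecay_tendsto[OF phi_decay(1)] tendsto_const[of k]] by (intro tendsto_intros) simp_all
  have "((\<lambda>x. \<phi> x * \<phi> x) \<longlongrightarrow> \<phi> 0 * \<phi> 0) (at_top :: real filter)"
    by (intro tendsto_eventually always_eventually allI sq)
  then have "\<phi> 0 * \<phi> 0 = k * k" using tendsto_unique[OF _ _ lim] by simp
  then have nz: "\<phi> x \<noteq> 0" for x using sq[of x] k_pos by auto
  then have "deriv \<phi> x = 0" for x using s0[of x] by simp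
  then have "\<phi> x = \<phi> 0" for x using DERIV_isconst_all[of \<phi> x 0] phi_DERIV(1) by metis
  then show False using phi_not_const by blast
qed

section \<open>Parity and uniform bounds of the wave\<close>

lemma mu_even: "\<mu> (- x) = \<mu> x"
  by (simp add: mu_eq s_def phi_even)

lemma mu1_odd: "\<mu>1 (- x) = - \<mu>1 x"
proof -
  have "((\<lambda>x. \<mu> (- x)) has_field_derivative \<mu>1 (- x) * (-1)) (at x)"
    by (rule DERIV_chain2[OF mu_DERIV(1)]) (auto intro!: derivative_eq_intros)
  then show ?thesis using DERIV_unique[OF mu_DERIV(1)[of x]] by (simp add: mu_even)
qed

lemma mu_lower: "\<exists>m0>0. \<forall>x. m0 \<le> \<mu> x"
proof (intro exI[of _ "a / sqrt c ^ 3"] conjI allI)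
  show "a / sqrt c ^ 3 > 0" using a_pos c by simp
  fix x
  have "s x \<le> sqrt c" by (simp add: s_def)
  then have "s x ^ 3 \<le> sqrt c ^ 3" using s_pos[of x] by (intro power_mono) auto
  then show "a / sqrt c ^ 3 \<le> \<mu> x"
    unfolding mu_eq using a_pos s_pos[of x] c by (intro divide_left_mono) auto
qed

lemma mu_bounds: "\<exists>B. \<forall>x. \<bar>\<mu> x\<bar> \<le> B \<and> \<bar>\<mu>1 x\<bar> \<le> B \<and> \<bar>\<mu>2 x\<bar> \<le> B \<and> \<bar>\<mu>3 x\<bar> \<le> B"
proof -
  obtain C0 C1 C2 C3 where C: "\<forall>x. \<bar>w x\<bar> \<le> C0" "\<forall>x. \<bar>\<mu>1 x\<bar> \<le> C1" "\<forall>x. \<bar>\<mu>2 x\<bar> \<le> C2" "\<forall>x. \<bar>\<mu>3 x\<bar> \<le> C3"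
    using mu_decay expdecay_bounded by meson
  have "\<bar>\<mu> x\<bar> \<le> C0 + k" for x using C(1)[rule_format, of x] k_pos unfolding w_def by linarith
  then show ?thesis using C
    by (intro exI[of _ "max (C0 + k) (max C1 (max C2 C3))"]) (auto intro: le_max_iff_disj[THEN iffD2] simp: le_max_iff_disj)
qed

end

section \<open>Taylor expansion of powers\<close>

text \<open>A power is monotone on the positive axis in one direction or the other; the sum of the
  end values covers both signs of the exponent.\<close>

lemma powr_le_ends:
  fixes t l u q :: real
  assumes "0 < l" "l \<le> t" "t \<le> u" shows "t powr q \<le> l powr q + u powr q"
proof (cases "q \<ge> 0")
  case True
  then have "t powr q \<le> u powr q" using assms by (intro powr_mono2) auto
  then show ?thesis by (smt (verit) powr_ge_zero)
next
  case False
  then have "t powr q \<le> l powr q" using assms by (intro powr_mono2') auto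
  then show ?thesis by (smt (verit) powr_ge_zero)
qed

lemma powr_Taylor:
  fixes l u p :: real and n :: nat
  assumes l: "0 < l" and n: "n > 0"
  shows "\<exists>C\<ge>0. \<forall>x\<in>{l..u}. \<forall>y\<in>{l..u}.
    \<bar>y powr p - (\<Sum>m<n. (\<Prod>j<m. p - real j) * x powr (p - real m) / fact m * (y - x) ^ m)\<bar> \<le> C * \<bar>y - x\<bar> ^ n"
proof -
  define C where "C = \<bar>\<Prod>j<n. p - real j\<bar> * (l powr (p - real n) + u powr (p - real n)) / fact n"
  have C0: "C \<ge> 0" unfolding C_def by (intro divide_nonneg_pos mult_nonneg_nonneg add_nonneg_nonneg) auto
  define d where "d = (\<lambda>m t. (\<Prod>j<m. p - real j) * t powr (p - real m))"
  have D: "(d m has_field_derivative d (Suc m) t) (at t)" if "t > 0" for m t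
    unfolding d_def using that
    by (auto intro!: derivative_eq_intros simp: algebra_simps)
  have "\<bar>y powr p - (\<Sum>m<n. d m x / fact m * (y - x) ^ m)\<bar> \<le> C * \<bar>y - x\<bar> ^ n"
    if x: "x \<in> {l..u}" and y: "y \<in> {l..u}" for x y
  proof (cases "y = x")
    case True
    have "(\<Sum>m<n. d m x / fact m * (y - x) ^ m) = (\<Sum>m<n. if m = 0 then d m x / fact m else 0)"
      using True by (intro sum.cong) auto
    also have "\<dots> = x powr p" using n by (simp add: sum.delta d_def)
    finally show ?thesis using True C0 by simp
  next
    case False
    have "\<exists>t. (if y < x then y < t \<and> t < x else x < t \<and> t < y) \<and>
        d 0 y = (\<Sum>m<n. d m x / fact m * (y - x) ^ m) + d n t / fact n * (y - x) ^ n"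
      by (rule Taylor[where a = l and b = u]) (use n x y False l D in auto)
    then obtain t where t0: "if y < x then y < t \<and> t < x else x < t \<and> t < y"
      and t1: "d 0 y = (\<Sum>m<n. d m x / fact m * (y - x) ^ m) + d n t / fact n * (y - x) ^ n" by blast
    have t: "t \<in> {l..u}" "d 0 y = (\<Sum>m<n. d m x / fact m * (y - x) ^ m) + d n t / fact n * (y - x) ^ n"
      using t0 t1 x y by (auto split: if_splits)
    have "\<bar>d n t / fact n * (y - x) ^ n\<bar> = \<bar>\<Prod>j<n. p - real j\<bar> * t powr (p - real n) / fact n * \<bar>y - x\<bar> ^ n"
      by (simp add: d_def abs_mult power_abs)
    also have "\<dots> \<le> C * \<bar>y - x\<bar> ^ n"
      unfolding C_def using powr_le_ends[of l t u "p - real n"] l t(1)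
      by (intro mult_right_mono divide_right_mono mult_left_mono) auto
    finally show ?thesis using t(2) by (simp add: d_def)
  qed
  then show ?thesis using C0 by (auto simp: d_def)
qed

lemma powr_Taylor2:
  fixes l u p :: real
  assumes "0 < l"
  shows "\<exists>C\<ge>0. \<forall>x\<in>{l..u}. \<forall>y\<in>{l..u}. \<bar>y powr p - x powr p - p * x powr (p - 1) * (y - x)\<bar> \<le> C * (y - x)\<^sup>2"
  using powr_Taylor[OF assms, of 2 u p] by (simp add: numeral_2_eq_2 algebra_simps)

lemma powr_Taylor3:
  fixes l u p :: real
  assumes "0 < l"
  shows "\<exists>C\<ge>0. \<forall>x\<in>{l..u}. \<forall>y\<in>{l..u}. \<bar>y powr p - x powr p - p * x powr (p - 1) * (y - x)
     - p * (p - 1) / 2 * x powr (p - 2) * (y - x)\<^sup>2\<bar> \<le> C * \<bar>y - x\<bar> ^ 3"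
  using powr_Taylor[OF assms, of 3 u p] by (simp add: numeral_3_eq_3 numeral_2_eq_2 algebra_simps)

section \<open>The conserved functionals\<close>

lemma X_space_H1:
  assumes "m \<in> X_space k"
  shows "\<exists>m1. H1 (\<lambda>x. m x - k) m1 \<and> (AE x in lborel. weak_deriv m x = m1 x) \<and> L2 (weak_deriv m)
     \<and> continuous_on UNIV m \<and> (\<forall>x. m x > 0)"
proof -
  have m: "continuous_on UNIV m" "sobolev 1 (\<lambda>x. m x - k)" "\<forall>x. m x > 0"
    using assms by (auto simp: X_space_def)
  have "continuous_on UNIV (\<lambda>x. m x - k)" using m(1) by (intro continuous_intros) auto
  then obtain f where f: "H1 (\<lambda>x. m x - k) f" using sobolev_continuous_imp_H1[OF m(2)] by blast
  have "ac m f" using ac_add[OF H1_D(1)[OF f] ac_const[of k]] by simp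
  then have "has_weak_deriv m f" by (rule ac_has_weak_deriv)
  then show ?thesis using weak_deriv_AE[of m f] f m H1_D(3)[OF f] by blast
qed

text \<open>Near infinity \<open>m\<close> is within \<open>k / 2\<close> of \<open>k\<close>, and
  on the remaining compact interval it attains a positive minimum.\<close>

lemma X_space_bounds:
  assumes "m \<in> X_space k" "k > 0" shows "\<exists>l>0. \<exists>u. \<forall>x. m x \<in> {l..u}"
proof -
  obtain f where f: "H1 (\<lambda>x. m x - k) f" "continuous_on UNIV m" "\<forall>x. m x > 0"
    using X_space_H1[OF assms(1)] by blast
  obtain R where R: "\<And>x. \<bar>x\<bar> \<ge> R \<Longrightarrow> \<bar>m x - k\<bar> < k / 2"
    using H1_tail[OF f(1), of "k / 2"] assms(2) by auto
  have "\<exists>x0\<in>{- \<bar>R\<bar>..\<bar>R\<bar>}. \<forall>y\<in>{- \<bar>R\<bar>..\<bar>R\<bar>}. m x0 \<le> m y"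
    by (rule continuous_attains_inf) (auto intro: continuous_on_subset[OF f(2)])
  then obtain x0 where x0: "\<And>y. \<bar>y\<bar> \<le> \<bar>R\<bar> \<Longrightarrow> m x0 \<le> m y" by (force simp: abs_le_iff)
  have "min (m x0) (k / 2) \<le> m x" for x
  proof (cases "\<bar>x\<bar> \<le> \<bar>R\<bar>")
    case True then show ?thesis using x0[of x] by auto
  next
    case False
    then have "R \<le> \<bar>x\<bar>" by linarith
    then have "\<bar>m x - k\<bar> < k / 2" by (rule R)
    then have "k / 2 \<le> m x" unfolding abs_less_iff by linarith
    then show ?thesis by simp
  qed
  moreover have "m x \<le> k + sqrt (n1 (\<lambda>x. m x - k) f)" for x
    using H1_sup_bound'[OF f(1), of x] by (auto simp: abs_le_iff)
  moreover have "min (m x0) (k / 2) > 0" using f(3) assms(2) by simp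
  ultimately show ?thesis by (metis atLeastAtMost_iff)
qed

lemma helmholtz_quad:
  assumes w: "L2 w" and h: "L2 h"
  shows "ip (\<lambda>x. w x + h x) (helmholtz_inv (\<lambda>x. w x + h x))
    = ip w (helmholtz_inv w) + 2 * ip (helmholtz_inv w) h + ip h (helmholtz_inv h)"
proof -
  note Hw = helmholtz_L2[OF w] and Hh = helmholtz_L2[OF h]
  have e: "helmholtz_inv (\<lambda>x. w x + h x) = (\<lambda>x. helmholtz_inv w x + helmholtz_inv h x)"
    using helmholtz_linear[OF w h, of 1] by (simp add: fun_eq_iff)
  have "ip (\<lambda>x. w x + h x) (\<lambda>x. helmholtz_inv w x + helmholtz_inv h x)
      = ip (\<lambda>x. helmholtz_inv w x + helmholtz_inv h x) w + ip (\<lambda>x. helmholtz_inv w x + helmholtz_inv h x) h"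
    using ip_add[OF w h L2_add[OF Hw Hh]] ip_commute by metis
  also have "\<dots> = ip (helmholtz_inv w) w + ip (helmholtz_inv h) w + (ip (helmholtz_inv w) h + ip (helmholtz_inv h) h)"
    using ip_add[OF Hw Hh w] ip_add[OF Hw Hh h] by simp
  also have "ip (helmholtz_inv h) w = ip (helmholtz_inv w) h"
    using helmholtz_sym[OF h w] ip_commute by simp
  finally show ?thesis unfolding e by (simp add: ip_commute)
qed

text \<open>First-order Taylor remainder of the power at \<open>k\<close>. Being quadratic in
  \<open>m - k\<close> it is integrable, which the plain difference of powers is not in
  general.\<close>

definition prem :: "real \<Rightarrow> real \<Rightarrow> real \<Rightarrow> real" where
  "prem p k m = m powr p - k powr p - p * k powr (p - 1) * (m - k)"

lemma prem_integrable:
  assumes H: "H1 (\<lambda>x. m x - k) f" and l: "l > 0" "\<And>x. m x \<in> {l..u}" "k \<in> {l..u}"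
  shows "integrable lborel (\<lambda>x. prem p k (m x))"
proof -
  obtain C where C: "C \<ge> 0" "\<And>x y. x \<in> {l..u} \<Longrightarrow> y \<in> {l..u} \<Longrightarrow> \<bar>y powr p - x powr p - p * x powr (p - 1) * (y - x)\<bar> \<le> C * (y - x)\<^sup>2"
    using powr_Taylor2[OF l(1), of u p] by blast
  have c: "continuous_on UNIV m" using continuous_on_add[OF ac_continuous[OF H1_D(1)[OF H]] continuous_on_const[of _ k]] by simp
  then have [measurable]: "m \<in> borel_measurable borel" by (rule borel_measurable_continuous_onI)
  have i: "integrable lborel (\<lambda>x. C * (m x - k)\<^sup>2)" using H1_D(2)[OF H] by (simp add: L2_real_iff)
  show ?thesis
    by (rule Bochner_Integration.integrable_bound[OF i])
       (use C(2)[OF l(3) l(2)] C(1) in \<open>auto simp: prem_def\<close>)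
qed

lemma F_functional_eq:
  assumes m: "m \<in> X_space k" and k: "k > 0"
  defines "w \<equiv> \<lambda>x. m x - k"
  shows "F_functional k m = ip w (helmholtz_inv w) - 3 * k powr (4/3) * (LINT x|lborel. prem (2/3) k (m x))"
proof -
  obtain f where f: "H1 w f" using X_space_H1[OF m] unfolding w_def by blast
  obtain l u where l: "l > 0" "\<And>x. m x \<in> {l..u}" using X_space_bounds[OF m k] by blast
  define l' where "l' = min l k"
  define u' where "u' = max u k"
  have l': "l' > 0" "\<And>x. m x \<in> {l'..u'}" "k \<in> {l'..u'}" using l k by (auto simp: l'_def u'_def min_le_iff_disj le_max_iff_disj)
  have ir: "integrable lborel (\<lambda>x. prem (2/3) k (m x))"
    using prem_integrable[OF f[unfolded w_def] l'] .
  have w: "L2 w" using f by (rule H1_D)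
  have iw: "integrable lborel (\<lambda>x. w x * helmholtz_inv w x)" by (rule L2_mult_integrable[OF w helmholtz_L2[OF w]])
  have m_eq: "m = (\<lambda>x. k + w x)" by (simp add: w_def)
  have Hm: "helmholtz_inv m x = k + helmholtz_inv w x" for x
    unfolding m_eq by (rule helmholtz_add_const[OF w])
  have kp: "k powr (4/3) * k powr (-1/3) = k" using k by (simp flip: powr_add)
  \<comment> \<open>The weight \<open>3 * k powr (4/3)\<close> turns the linear terms into exactly
    \<open>k * (helmholtz_inv w x - w x)\<close>.\<close>
  have dens: "E_density k m x - 3 * k powr (4/3) * F1_density k m x
     = k * (helmholtz_inv w x - w x) + (w x * helmholtz_inv w x - 3 * k powr (4/3) * prem (2/3) k (m x))" for x
  proof -
    have "3 * k powr (4/3) * F1_density k m x = 3 * k powr (4/3) * prem (2/3) k (m x) + 2 * (k powr (4/3) * k powr (-1/3)) * w x"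
      by (simp add: F1_density_def prem_def w_def field_simps)
    moreover have "m x = k + w x" by (simp add: w_def)
    ultimately show ?thesis unfolding kp E_density_def Hm
      by (simp add: algebra_simps power2_eq_square)
  qed
  have "((\<lambda>x. k * (helmholtz_inv w x - w x)) has_integral k * 0) UNIV"
    by (rule has_integral_mult_right[OF helmholtz_has_integral_zero[OF w]])
  moreover have "((\<lambda>x. w x * helmholtz_inv w x - 3 * k powr (4/3) * prem (2/3) k (m x)) has_integral
      (LINT x|lborel. w x * helmholtz_inv w x - 3 * k powr (4/3) * prem (2/3) k (m x))) UNIV"
    by (rule has_integral_integral_lborel) (intro Bochner_Integration.integrable_diff iw integrable_mult_right ir)
  ultimately have "((\<lambda>x. E_density k m x - 3 * k powr (4/3) * F1_density k m x) has_integral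
     (k * 0 + (LINT x|lborel. w x * helmholtz_inv w x - 3 * k powr (4/3) * prem (2/3) k (m x)))) UNIV"
    unfolding dens by (rule has_integral_add)
  then have "F_functional k m = k * 0 + (LINT x|lborel. w x * helmholtz_inv w x - 3 * k powr (4/3) * prem (2/3) k (m x))"
    unfolding F_functional_def by (rule integral_unique)
  then show ?thesis using iw ir by (simp add: ip_def)
qed

context wave
begin

lemma mu_X: "\<mu> \<in> X_space k"
proof -
  have "sobolev 1 (\<lambda>x. \<mu> x - k)" using H1_imp_sobolev(1)[OF H1_waves(1)] by (simp add: w_def)
  then show ?thesis using cont(4) mu_pos by (auto simp: X_space_def)
qed

lemma Lambda_functional_eq:
  assumes m: "m \<in> X_space k" and f: "H1 (\<lambda>x. m x - k) f"
  defines "v \<equiv> \<lambda>x. m x - k"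
  shows "integrable lborel (\<lambda>x. w1 * prem (2/3) k (m x) + 9 * prem (-2/3) k (m x) + m x powr (-8/3) * (f x)\<^sup>2)"
    "Lambda_functional c k m = w0 * ip v (helmholtz_inv v)
      + (LINT x|lborel. w1 * prem (2/3) k (m x) + 9 * prem (-2/3) k (m x) + m x powr (-8/3) * (f x)\<^sup>2)"
proof -
  note k = k_pos
  obtain l u where l: "l > 0" "\<And>x. m x \<in> {l..u}" using X_space_bounds[OF m k] by blast
  define l' where "l' = min l k"
  define u' where "u' = max u k"
  have l': "l' > 0" "\<And>x. m x \<in> {l'..u'}" "k \<in> {l'..u'}" using l k by (auto simp: l'_def u'_def min_le_iff_disj le_max_iff_disj)
  have ir: "integrable lborel (\<lambda>x. prem p k (m x))" for p using prem_integrable[OF f l'] .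
  have v: "L2 v" "L2 f" using f H1_D unfolding v_def by blast+
  have mc: "continuous_on UNIV m" using m by (simp add: X_space_def)
  then have [measurable]: "m \<in> borel_measurable borel" by (rule borel_measurable_continuous_onI)
  have [measurable]: "f \<in> borel_measurable borel" using v(2) by (rule L2_measurable)
  have "ac m f" using ac_add[OF H1_D(1)[OF f] ac_const[of k]] by simp
  then have wd: "AE x in lborel. weak_deriv m x = f x" "L2 (weak_deriv m)"
    using weak_deriv_AE[OF ac_has_weak_deriv v(2)] by blast+
  have [measurable]: "weak_deriv m \<in> borel_measurable borel" using wd(2) by (rule L2_measurable)
  have ik: "integrable lborel (\<lambda>x. m x powr (-8/3) * (g x)\<^sup>2)" if g: "L2 g" for g
  proof (rule Bochner_Integration.integrable_bound)
    show "integrable lborel (\<lambda>x. (l' powr (-8/3) + u' powr (-8/3)) * (g x)\<^sup>2)" using g by (simp add: L2_real_iff)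
    show "AE x in lborel. norm (m x powr (-8/3) * (g x)\<^sup>2) \<le> norm ((l' powr (-8/3) + u' powr (-8/3)) * (g x)\<^sup>2)"
      using powr_le_ends[of l' _ u' "-8/3"] l'(1,2)
      by (intro AE_I2) (auto simp: abs_mult intro!: mult_right_mono)
    show "(\<lambda>x. m x powr (-8/3) * (g x)\<^sup>2) \<in> borel_measurable lborel" using L2_measurable[OF g] by measurable
  qed
  define G where "G = (\<lambda>x. w1 * prem (2/3) k (m x) + 9 * prem (-2/3) k (m x) + m x powr (-8/3) * (f x)\<^sup>2)"
  define G' where "G' = (\<lambda>x. w1 * prem (2/3) k (m x) + 9 * prem (-2/3) k (m x) + m x powr (-8/3) * (weak_deriv m x)\<^sup>2)"
  have iG: "integrable lborel G" "integrable lborel G'"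
    unfolding G_def G'_def using ir ik[OF v(2)] ik[OF wd(2)] by (intro Bochner_Integration.integrable_add integrable_mult_right; simp)+
  then show "integrable lborel (\<lambda>x. w1 * prem (2/3) k (m x) + 9 * prem (-2/3) k (m x) + m x powr (-8/3) * (f x)\<^sup>2)"
    by (simp add: G_def)
  have Geq: "(LINT x|lborel. G' x) = (LINT x|lborel. G x)"
    by (rule integral_cong_AE) (use iG wd(1) in \<open>auto simp: G_def G'_def\<close>)
  have iw: "integrable lborel (\<lambda>x. v x * helmholtz_inv v x)" by (rule L2_mult_integrable[OF v(1) helmholtz_L2[OF v(1)]])
  have m_eq: "m = (\<lambda>x. k + v x)" by (simp add: v_def)
  have Hm: "helmholtz_inv m x = k + helmholtz_inv v x" for x
    unfolding m_eq by (rule helmholtz_add_const[OF v(1)])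
  \<comment> \<open>After \<open>helmholtz_inv v - v\<close> is split off, the remaining linear term
    has the Euler-Lagrange expression of the constant state as its coefficient, which
    vanishes.\<close>
  have dens: "w0 * E_density k m x + w1 * F1_density k m x + F2_density k m x
     = w0 * k * (helmholtz_inv v x - v x) + (w0 * (v x * helmholtz_inv v x) + G' x)" for x
  proof -
    have "w0 * E_density k m x + w1 * F1_density k m x + F2_density k m x
       - (w0 * k * (helmholtz_inv v x - v x) + (w0 * (v x * helmholtz_inv v x) + G' x))
       = (2 * w0 * k + 2 / 3 * w1 * k powr (-1/3) - 6 * k powr (-5/3)) * v x"
      unfolding E_density_def Hm F1_density_def F2_density_def G'_def prem_def
      by (simp add: v_def field_simps power2_eq_square)
    then show ?thesis using Euler_Lagrange_infinity by simp
  qed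
  have "((\<lambda>x. w0 * k * (helmholtz_inv v x - v x)) has_integral w0 * k * 0) UNIV"
    by (rule has_integral_mult_right[OF helmholtz_has_integral_zero[OF v(1)]])
  moreover have "((\<lambda>x. w0 * (v x * helmholtz_inv v x) + G' x) has_integral
      (LINT x|lborel. w0 * (v x * helmholtz_inv v x) + G' x)) UNIV"
    by (rule has_integral_integral_lborel) (intro Bochner_Integration.integrable_add iw integrable_mult_right iG)
  ultimately have "((\<lambda>x. w0 * E_density k m x + w1 * F1_density k m x + F2_density k m x) has_integral
     (w0 * k * 0 + (LINT x|lborel. w0 * (v x * helmholtz_inv v x) + G' x))) UNIV"
    unfolding dens by (rule has_integral_add)
  then have "Lambda_functional c k m = w0 * k * 0 + (LINT x|lborel. w0 * (v x * helmholtz_inv v x) + G' x)"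
    unfolding Lambda_functional_def by (rule integral_unique)
  then show "Lambda_functional c k m = w0 * ip v (helmholtz_inv v)
      + (LINT x|lborel. w1 * prem (2/3) k (m x) + 9 * prem (-2/3) k (m x) + m x powr (-8/3) * (f x)\<^sup>2)"
    using iw iG Geq by (simp add: ip_def G_def)
qed

text \<open>The L2 gradient of \<open>F_functional k\<close> at \<open>\<mu>\<close>. The two
  constants cancel each other; writing them makes the decay at infinity visible.\<close>

definition Fp where "Fp x = 2 * (\<phi> x - k) - 2 * k powr (4/3) * (\<mu> x powr (-1/3) - k powr (-1/3))"

lemma Fp_eq: "Fp x = 2 * \<phi> x - 2 * k powr (4/3) * \<mu> x powr (-1/3)"
proof -
  have "k powr (4/3) * k powr (-1/3) = k" using k_pos by (simp flip: powr_add)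
  then show ?thesis by (simp add: Fp_def algebra_simps)
qed

text \<open>A single interval for \<open>k\<close>, for the wave and for its small perturbations, so
  that the Taylor constants are uniform in \<open>x\<close>.\<close>

lemma mu_k_range: "\<exists>l>0. \<exists>u. k \<in> {l..u} \<and> (\<forall>x y. \<bar>y\<bar> \<le> l \<longrightarrow> \<mu> x + y \<in> {l..u})"
proof -
  obtain m0 where m0: "m0 > 0" "\<And>x. m0 \<le> \<mu> x" using mu_lower by blast
  obtain B where B: "\<And>x. \<bar>\<mu> x\<bar> \<le> B" using mu_bounds by blast
  define l where "l = min (m0 / 2) k"
  define u where "u = max (B + l) k"
  have "\<mu> x + y \<in> {l..u}" if "\<bar>y\<bar> \<le> l" for x y
    using m0(2)[of x] B[of x] that by (auto simp: l_def u_def abs_le_iff min_def split: if_splits)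
  moreover have "l > 0" "k \<in> {l..u}" using m0 k_pos by (auto simp: l_def u_def)
  ultimately show ?thesis by blast
qed

lemma powr_mu_bounds: "\<exists>C. \<forall>x. \<mu> x powr p \<le> C"
proof -
  obtain l u where l: "l > 0" "\<And>x y. \<bar>y\<bar> \<le> l \<Longrightarrow> \<mu> x + y \<in> {l..u}" using mu_k_range by blast
  have "\<mu> x \<in> {l..u}" for x using l(2)[of 0 x] l(1) by simp
  then show ?thesis using powr_le_ends[OF l(1)] by (meson atLeastAtMost_iff)
qed

lemma measurable_mu [measurable]: "\<mu> \<in> borel_measurable borel" "\<mu>1 \<in> borel_measurable borel"
  "\<mu>2 \<in> borel_measurable borel" "\<phi> \<in> borel_measurable borel" "w \<in> borel_measurable borel"
  using cont by (auto intro: borel_measurable_continuous_onI)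

lemma L2_powr_mu_diff: "L2 (\<lambda>x. \<mu> x powr p - k powr p)"
proof -
  obtain l u where l: "l > 0" "k \<in> {l..u}" "\<And>x y. \<bar>y\<bar> \<le> l \<Longrightarrow> \<mu> x + y \<in> {l..u}" using mu_k_range by blast
  have mr: "\<mu> x \<in> {l..u}" for x using l(3)[of 0 x] l(1) by simp
  obtain C where C: "\<forall>x\<in>{l..u}. \<forall>y\<in>{l..u}. \<bar>y powr p - x powr p\<bar> \<le> C * \<bar>y - x\<bar>"
    using powr_Taylor[OF l(1), of 1 u p] by auto
  show ?thesis
    by (rule L2_bound(1)[OF H1_D(2)[OF H1_waves(1)], where C = C]) (use C[rule_format, OF l(2) mr] in \<open>auto simp: w_def\<close>)
qed

lemma Fp_L2: "L2 Fp"
  unfolding Fp_def[abs_def]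
  by (rule L2_diff[OF L2_cmult[OF H1_D(2)[OF H1_waves(4)]] L2_cmult[OF L2_powr_mu_diff]])

text \<open>The functional is quadratic apart from the integral of \<open>prem\<close>, whose
  linearization at \<open>\<mu>\<close> has an error bounded pointwise by a multiple of the square
  of \<open>h\<close>; hence only the L2 norm of \<open>h\<close> enters.\<close>

lemma F_expansion:
  "\<exists>C\<ge>0. \<exists>r>0. \<forall>h h1. H1 h h1 \<and> (\<forall>x. \<bar>h x\<bar> \<le> r) \<and> (\<lambda>x. \<mu> x + h x) \<in> X_space k \<longrightarrow>
     \<bar>F_functional k (\<lambda>x. \<mu> x + h x) - F_functional k \<mu> - ip Fp h\<bar> \<le> C * ip h h"
proof -
  obtain l u where l: "l > 0" "k \<in> {l..u}" "\<And>x y. \<bar>y\<bar> \<le> l \<Longrightarrow> \<mu> x + y \<in> {l..u}" using mu_k_range by blast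
  have mr: "\<mu> x \<in> {l..u}" for x using l(3)[of 0 x] l(1) by simp
  obtain C where C: "C \<ge> 0" "\<And>x y. x \<in> {l..u} \<Longrightarrow> y \<in> {l..u} \<Longrightarrow>
      \<bar>y powr (2/3) - x powr (2/3) - (2/3) * x powr (2/3 - 1) * (y - x)\<bar> \<le> C * (y - x)\<^sup>2"
    using powr_Taylor2[OF l(1), of u "2/3"] by blast
  define K where "K = 3 * k powr (4/3)"
  have K0: "K \<ge> 0" by (simp add: K_def)
  have "\<bar>F_functional k (\<lambda>x. \<mu> x + h x) - F_functional k \<mu> - ip Fp h\<bar> \<le> (1 + K * C) * ip h h"
    if H: "H1 h h1" and hl: "\<And>x. \<bar>h x\<bar> \<le> l" and X: "(\<lambda>x. \<mu> x + h x) \<in> X_space k" for h h1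
  proof -
    have h: "L2 h" using H by (rule H1_D)
    have wL: "L2 w" by (rule H1_D(2)[OF H1_waves(1)])
    have [measurable]: "h \<in> borel_measurable borel" using h by (rule L2_measurable)
    have vH: "H1 (\<lambda>x. w x + h x) (\<lambda>x. \<mu>1 x + h1 x)" by (rule H1_add[OF H1_waves(1) H])
    have veq: "(\<lambda>x. (\<mu> x + h x) - k) = (\<lambda>x. w x + h x)" by (simp add: w_def fun_eq_iff)
    have i1: "integrable lborel (\<lambda>x. prem (2/3) k (\<mu> x + h x))"
      using prem_integrable[of "\<lambda>x. \<mu> x + h x" k, OF _ l(1) l(3)[OF hl] l(2)] vH unfolding veq by blast
    have i2: "integrable lborel (\<lambda>x. prem (2/3) k (\<mu> x))"
      using prem_integrable[of \<mu> k, OF _ l(1) mr l(2)] H1_waves(1) unfolding w_def by blast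
    define P where "P = (\<lambda>x. 2 / 3 * (\<mu> x powr (-1/3) - k powr (-1/3)))"
    have PL: "L2 P" unfolding P_def by (intro L2_cmult L2_powr_mu_diff)
    have iP: "integrable lborel (\<lambda>x. P x * h x)" by (rule L2_mult_integrable[OF PL h])
    have quad: "ip (\<lambda>x. w x + h x) (helmholtz_inv (\<lambda>x. w x + h x)) = ip w (helmholtz_inv w) + 2 * ip (\<lambda>x. \<phi> x - k) h + ip h (helmholtz_inv h)"
      using helmholtz_quad[OF wL h] unfolding helmholtz_w .
    define R where "R = (LINT x|lborel. prem (2/3) k (\<mu> x + h x) - prem (2/3) k (\<mu> x) - P x * h x)"
    have Rle: "\<bar>R\<bar> \<le> C * ip h h"
    proof -
      have pt: "\<bar>prem (2/3) k (\<mu> x + h x) - prem (2/3) k (\<mu> x) - P x * h x\<bar> \<le> C * (h x)\<^sup>2" for x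
      proof -
        have "prem (2/3) k (\<mu> x + h x) - prem (2/3) k (\<mu> x) - P x * h x
          = (\<mu> x + h x) powr (2/3) - \<mu> x powr (2/3) - (2/3) * \<mu> x powr (2/3 - 1) * (\<mu> x + h x - \<mu> x)"
          by (simp add: prem_def P_def field_simps)
        moreover have "\<mu> x + h x \<in> {l..u}" by (rule l(3)[OF hl])
        ultimately show ?thesis using C(2)[OF mr[of x], of "\<mu> x + h x"] by simp
      qed
      have "\<bar>R\<bar> \<le> (LINT x|lborel. C * (h x)\<^sup>2)" unfolding R_def
        by (rule integral_abs_bound_integral) (use i1 i2 iP h pt in \<open>auto simp: L2_real_iff\<close>)
      then show ?thesis by (simp add: ip_self)
    qed
    have "R = (LINT x|lborel. prem (2/3) k (\<mu> x + h x)) - (LINT x|lborel. prem (2/3) k (\<mu> x)) - ip P h"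
      unfolding R_def ip_def using i1 i2 iP by simp
    then have "K * R = K * (LINT x|lborel. prem (2/3) k (\<mu> x + h x)) - K * (LINT x|lborel. prem (2/3) k (\<mu> x)) - K * ip P h"
      by (simp only: right_diff_distrib)
    moreover have "ip Fp h = 2 * ip (\<lambda>x. \<phi> x - k) h - K * ip P h"
    proof -
      have "Fp = (\<lambda>x. 2 * (\<phi> x - k) - K * P x)" by (simp add: Fp_def P_def K_def fun_eq_iff)
      then show ?thesis using ip_diff[OF L2_cmult L2_cmult h, of "\<lambda>x. \<phi> x - k" P 2 K] H1_D(2)[OF H1_waves(4)] PL
        unfolding ip_cmult by simp
    qed
    ultimately have "F_functional k (\<lambda>x. \<mu> x + h x) - F_functional k \<mu> - ip Fp h = ip h (helmholtz_inv h) - K * R"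
      using F_functional_eq[OF X k_pos] F_functional_eq[OF mu_X k_pos] quad
      unfolding veq w_def[symmetric] K_def[symmetric] by (simp add: algebra_simps)
    moreover have "\<bar>ip h (helmholtz_inv h)\<bar> \<le> ip h h" using helmholtz_bounds[OF h] by (simp add: ip_commute)
    moreover have "\<bar>K * R\<bar> \<le> K * (C * ip h h)" using Rle K0 by (simp add: abs_mult mult_left_mono)
    ultimately show ?thesis unfolding distrib_right by (simp add: mult.assoc)
  qed
  moreover have "1 + K * C \<ge> 0" using K0 C(1) by simp
  ultimately show ?thesis using l(1) by blast
qed

text \<open>Zero-order coefficient of the linearized operator. In the form that follows, the
  second-order term is integrated by parts, which makes the form available on H1.\<close>

definition V where
  "V x = 16 / 3 * \<mu> x powr (-11/3) * \<mu>2 x - 88 / 9 * \<mu> x powr (-14/3) * (\<mu>1 x)\<^sup>2 + 10 * \<mu> x powr (-8/3)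
     - 2 / 9 * w1 * \<mu> x powr (-4/3)"

definition bform where
  "bform h h1 g g1 = (LINT x|lborel. 2 * \<mu> x powr (-8/3) * (h1 x * g1 x) + V x * (h x * g x)) + 2 * w0 * ip (helmholtz_inv h) g"

lemma V_bounded: "\<exists>C. \<forall>x. \<bar>V x\<bar> \<le> C" and V_measurable [measurable]: "V \<in> borel_measurable borel"
proof -
  show "V \<in> borel_measurable borel" unfolding V_def[abs_def] by measurable
  obtain B where B: "\<And>x. \<bar>\<mu>1 x\<bar> \<le> B" "\<And>x. \<bar>\<mu>2 x\<bar> \<le> B" using mu_bounds by blast
  have B0: "B \<ge> 0" using order_trans[OF abs_ge_zero B(1)[of 0]] .
  obtain C1 C2 C3 C4 where C: "\<And>x. \<mu> x powr (-11/3) \<le> C1" "\<And>x. \<mu> x powr (-14/3) \<le> C2"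
    "\<And>x. \<mu> x powr (-8/3) \<le> C3" "\<And>x. \<mu> x powr (-4/3) \<le> C4" using powr_mu_bounds by metis
  have "\<bar>V x\<bar> \<le> 16 / 3 * (C1 * B) + 88 / 9 * (C2 * B\<^sup>2) + 10 * C3 + 2 / 9 * (\<bar>w1\<bar> * C4)" for x
  proof -
    have C10: "C1 \<ge> 0" "C2 \<ge> 0" using order_trans[OF powr_ge_zero C(1)] order_trans[OF powr_ge_zero C(2)] by auto
    have "\<bar>\<mu> x powr (-11/3) * \<mu>2 x\<bar> \<le> C1 * B" unfolding abs_mult using C(1)[of x] B(2)[of x] C10 by (intro mult_mono) auto
    moreover have "\<bar>\<mu> x powr (-14/3) * (\<mu>1 x)\<^sup>2\<bar> \<le> C2 * B\<^sup>2" unfolding abs_mult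
      using C(2)[of x] B(1)[of x] C10 power_mono[OF B(1)[of x], of 2] by (intro mult_mono) auto
    moreover have "\<bar>w1 * \<mu> x powr (-4/3)\<bar> \<le> \<bar>w1\<bar> * C4" unfolding abs_mult using C(4)[of x] by (intro mult_mono) auto
    moreover have "\<bar>\<mu> x powr (-8/3)\<bar> \<le> C3" using C(3)[of x] by simp
    ultimately show ?thesis unfolding V_def mult.assoc by linarith
  qed
  then show "\<exists>C. \<forall>x. \<bar>V x\<bar> \<le> C" by blast
qed

section \<open>Expansion of \<Lambda> to second order\<close>

lemma powr_mu_DERIV: "((\<lambda>x. \<mu> x powr p) has_field_derivative p * \<mu> x powr (p - 1) * \<mu>1 x) (at x)"
  by (rule derivative_eq_intros mu_DERIV mu_pos refl)+

lemma powr_mu_cont: "continuous_on UNIV (\<lambda>x. \<mu> x powr p)"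
  using powr_mu_DERIV by (auto intro!: continuous_at_imp_continuous_on DERIV_isCont)

lemma mu_coeff_bound:
  "\<exists>M\<ge>1. \<forall>x. \<bar>\<mu>1 x\<bar> \<le> M \<and> \<bar>\<mu>2 x\<bar> \<le> M \<and> \<mu> x powr p \<le> M \<and> \<mu> x powr (-8/3) \<le> M \<and> \<mu> x powr (-11/3) \<le> M \<and> \<mu> x powr (-14/3) \<le> M"
proof -
  obtain B where B: "\<And>x. \<bar>\<mu>1 x\<bar> \<le> B" "\<And>x. \<bar>\<mu>2 x\<bar> \<le> B" using mu_bounds by blast
  obtain C1 C2 C3 C4 where C: "\<And>x. \<mu> x powr (-11/3) \<le> C1" "\<And>x. \<mu> x powr (-14/3) \<le> C2"
    "\<And>x. \<mu> x powr (-8/3) \<le> C3" "\<And>x. \<mu> x powr p \<le> C4" using powr_mu_bounds by metis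
  define M where "M = 1 + \<bar>B\<bar> + \<bar>C1\<bar> + \<bar>C2\<bar> + \<bar>C3\<bar> + \<bar>C4\<bar>"
  show ?thesis
  proof (intro exI[of _ M] conjI allI)
    fix x
    show "\<bar>\<mu>1 x\<bar> \<le> M" "\<bar>\<mu>2 x\<bar> \<le> M" using B(1)[of x] B(2)[of x] unfolding M_def by linarith+
    show "\<mu> x powr p \<le> M" "\<mu> x powr (-8/3) \<le> M" "\<mu> x powr (-11/3) \<le> M" "\<mu> x powr (-14/3) \<le> M"
      using C(1)[of x] C(2)[of x] C(3)[of x] C(4)[of x] unfolding M_def by linarith+
  qed (simp add: M_def)
qed

lemma H1_powr_mu1: "H1 (\<lambda>x. \<mu> x powr (-8/3) * \<mu>1 x) (\<lambda>x. (-8/3) * \<mu> x powr (-11/3) * (\<mu>1 x)\<^sup>2 + \<mu> x powr (-8/3) * \<mu>2 x)"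
proof -
  obtain M where M: "M \<ge> 1" "\<And>x. \<bar>\<mu>1 x\<bar> \<le> M" "\<And>x. \<mu> x powr (-8/3) \<le> M" "\<And>x. \<mu> x powr (-11/3) \<le> M"
    using mu_coeff_bound[of 0] by blast
  have "H1 (\<lambda>x. \<mu> x powr (-8/3) * \<mu>1 x) (\<lambda>x. (-8/3) * \<mu> x powr (-8/3 - 1) * \<mu>1 x * \<mu>1 x + \<mu> x powr (-8/3) * \<mu>2 x)"
  proof (rule H1_bounded_mult[OF H1_waves(2) powr_mu_DERIV])
    show "continuous_on UNIV (\<lambda>x. (-8/3) * \<mu> x powr (-8/3 - 1) * \<mu>1 x)"
      by (intro continuous_intros powr_mu_cont cont)
    show "\<bar>\<mu> x powr (-8/3)\<bar> \<le> M" for x using M(3)[of x] by simp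
    have "\<mu> x powr (-11/3) * \<bar>\<mu>1 x\<bar> \<le> M * M" for x using M by (intro mult_mono) (auto intro: order_trans[of _ 1])
    then show "\<bar>(-8/3) * \<mu> x powr (-8/3 - 1) * \<mu>1 x\<bar> \<le> 8 / 3 * (M * M)" for x
      by (simp add: abs_mult mult_ac)
  qed
  then show ?thesis by (simp add: power2_eq_square mult.assoc)
qed

lemma H1_q_mult:
  assumes "H1 h h1"
  shows "H1 (\<lambda>x. \<mu> x powr (-11/3) * \<mu>1 x * h x)
    (\<lambda>x. ((-11/3) * \<mu> x powr (-14/3) * (\<mu>1 x)\<^sup>2 + \<mu> x powr (-11/3) * \<mu>2 x) * h x + \<mu> x powr (-11/3) * \<mu>1 x * h1 x)"
proof -
  obtain M where M: "M \<ge> 1" "\<And>x. \<bar>\<mu>1 x\<bar> \<le> M" "\<And>x. \<bar>\<mu>2 x\<bar> \<le> M" "\<And>x. \<mu> x powr (-11/3) \<le> M" "\<And>x. \<mu> x powr (-14/3) \<le> M"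
    using mu_coeff_bound[of 0] by blast
  show ?thesis
  proof (rule H1_bounded_mult[OF assms])
    have "((\<lambda>x. \<mu> x powr (-11/3) * \<mu>1 x) has_field_derivative
      ((-11/3) * \<mu> x powr (-11/3 - 1) * \<mu>1 x) * \<mu>1 x + \<mu>2 x * \<mu> x powr (-11/3)) (at x)" for x
      by (rule DERIV_mult[OF powr_mu_DERIV mu_DERIV(2)])
    then show "((\<lambda>x. \<mu> x powr (-11/3) * \<mu>1 x) has_field_derivative
      (-11/3) * \<mu> x powr (-14/3) * (\<mu>1 x)\<^sup>2 + \<mu> x powr (-11/3) * \<mu>2 x) (at x)" for x
      by (simp add: power2_eq_square mult_ac)
    show "continuous_on UNIV (\<lambda>x. (-11/3) * \<mu> x powr (-14/3) * (\<mu>1 x)\<^sup>2 + \<mu> x powr (-11/3) * \<mu>2 x)"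
      by (intro continuous_intros powr_mu_cont cont)
    show "\<bar>\<mu> x powr (-11/3) * \<mu>1 x\<bar> \<le> M * M" for x
      unfolding abs_mult using M by (intro mult_mono) (auto intro: order_trans[of _ 1])
    have 1: "\<bar>\<mu> x powr (-11/3) * \<mu>2 x\<bar> \<le> M * M" for x
      unfolding abs_mult using M by (intro mult_mono) (auto intro: order_trans[of _ 1])
    have 2: "\<bar>\<mu> x powr (-14/3) * (\<mu>1 x)\<^sup>2\<bar> \<le> M * M\<^sup>2" for x
      unfolding abs_mult using M power_mono[OF M(2)[of x], of 2] by (intro mult_mono) (auto intro: order_trans[of _ 1])
    show "\<bar>(-11/3) * \<mu> x powr (-14/3) * (\<mu>1 x)\<^sup>2 + \<mu> x powr (-11/3) * \<mu>2 x\<bar> \<le> 11 / 3 * (M * M\<^sup>2) + M * M" for x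
      using 1[of x] 2[of x] unfolding mult.assoc by linarith
  qed
qed

text \<open>Each term keeps a factor of size \<delta> beside a square of \<open>h\<close> or
  \<open>h1\<close>. The derivative \<open>h1\<close> occurs at most quadratically, so no pointwise
  bound on it enters. The integers 3 and 5 round up \<open>8 / 3\<close> and
  \<open>44 / 9\<close>.\<close>

lemma cubic_remainder_bound:
  fixes h h1 m1 q t t1 t2 t3 om C M \<delta> :: real
  assumes d: "\<bar>h\<bar> \<le> \<delta>" "\<delta> \<le> 1" and C: "C \<ge> 0" and M: "M \<ge> 1" "\<bar>m1\<bar> \<le> M" "\<bar>q\<bar> \<le> M" "\<bar>t\<bar> \<le> M"
    and T: "\<bar>t1\<bar> \<le> C * \<bar>h\<bar> ^ 3" "\<bar>t2\<bar> \<le> C * \<bar>h\<bar> ^ 3" "\<bar>t3\<bar> \<le> C * \<bar>h\<bar> ^ 3"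
  shows "\<bar>om * t1 + 9 * t2 - 8 / 3 * q * h * h1\<^sup>2 + 44 / 9 * t * h\<^sup>2 * (2 * m1 * h1 + h1\<^sup>2) + t3 * (m1 + h1)\<^sup>2\<bar>
    \<le> (\<bar>om\<bar> * C + 9 * C + 3 * M + 5 * M * M + 5 * M + 2 * M\<^sup>2 * C + 2 * C) * \<delta> * (h\<^sup>2 + h1\<^sup>2)"
proof -
  have d0: "\<delta> \<ge> 0" using d by linarith
  have h2: "h\<^sup>2 \<le> \<delta>" and h3: "\<bar>h\<bar> ^ 3 \<le> \<delta> * h\<^sup>2" and h4: "\<bar>h\<bar> ^ 3 \<le> \<delta>"
  proof -
    have "\<bar>h\<bar> * \<bar>h\<bar> \<le> \<delta> * 1" using d d0 by (intro mult_mono) auto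
    then show h2: "h\<^sup>2 \<le> \<delta>" by (simp add: power2_eq_square)
    show h3: "\<bar>h\<bar> ^ 3 \<le> \<delta> * h\<^sup>2" using mult_right_mono[OF d(1), of "h\<^sup>2"] by (simp add: power3_eq_cube power2_eq_square mult.assoc)
    have "\<delta> * h\<^sup>2 \<le> \<delta> * 1" using h2 d d0 by (intro mult_left_mono) auto
    then show "\<bar>h\<bar> ^ 3 \<le> \<delta>" using h3 by simp
  qed
  define D where "D = \<delta> * (h\<^sup>2 + h1\<^sup>2)"
  have Dh: "\<delta> * h\<^sup>2 \<le> D" "\<delta> * h1\<^sup>2 \<le> D" "D \<ge> 0" using d0 by (auto simp: D_def intro!: mult_left_mono)
  have Ti: "\<bar>t1\<bar> \<le> C * D" "\<bar>t2\<bar> \<le> C * D" "\<bar>t3\<bar> \<le> C * (\<delta> * h\<^sup>2)" "\<bar>t3\<bar> \<le> C * \<delta>"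
    using T(1,2) order_trans[OF T(3) mult_left_mono[OF h3 C]] order_trans[OF T(3) mult_left_mono[OF h4 C]]
      mult_left_mono[OF order_trans[OF h3 Dh(1)] C] by (blast intro: order_trans)+
  have 1: "\<bar>om * t1\<bar> \<le> \<bar>om\<bar> * C * D" using mult_left_mono[OF Ti(1), of "\<bar>om\<bar>"] by (simp add: abs_mult mult.assoc)
  have 3: "\<bar>q * h * h1\<^sup>2\<bar> \<le> M * D"
  proof -
    have "\<bar>q\<bar> * (\<bar>h\<bar> * h1\<^sup>2) \<le> M * (\<delta> * h1\<^sup>2)" using M d d0 by (intro mult_mono mult_right_mono) auto
    also have "\<dots> \<le> M * D" using M Dh by (intro mult_left_mono) auto
    finally show ?thesis by (simp add: abs_mult mult.assoc)
  qed
  have 4: "\<bar>t * h\<^sup>2 * (2 * m1 * h1)\<bar> \<le> M * M * D"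
  proof -
    have "\<bar>h\<^sup>2 * (2 * h1)\<bar> = \<bar>h\<bar> * (2 * \<bar>h\<bar> * \<bar>h1\<bar>)" by (simp add: abs_mult power2_eq_square)
    also have "\<dots> \<le> \<delta> * (h\<^sup>2 + h1\<^sup>2)" using d d0 sum_squares_bound[of "\<bar>h\<bar>" "\<bar>h1\<bar>"]
      by (intro mult_mono) auto
    finally have "\<bar>h\<^sup>2 * (2 * h1)\<bar> \<le> D" by (simp add: D_def)
    then have "(\<bar>t\<bar> * \<bar>m1\<bar>) * \<bar>h\<^sup>2 * (2 * h1)\<bar> \<le> (M * M) * D"
      using M by (intro mult_mono) auto
    then show ?thesis by (simp add: abs_mult mult_ac)
  qed
  have 5: "\<bar>t * h\<^sup>2 * h1\<^sup>2\<bar> \<le> M * D"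
  proof -
    have "\<bar>t\<bar> * (h\<^sup>2 * h1\<^sup>2) \<le> M * (\<delta> * h1\<^sup>2)" using M h2 by (intro mult_mono mult_right_mono) auto
    also have "\<dots> \<le> M * D" using M Dh by (intro mult_left_mono) auto
    finally show ?thesis by (simp add: abs_mult mult.assoc)
  qed
  have 6: "\<bar>t3 * (m1 + h1)\<^sup>2\<bar> \<le> (2 * M\<^sup>2 * C + 2 * C) * D"
  proof -
    have m: "m1\<^sup>2 \<le> M\<^sup>2" using power_mono[OF M(2), of 2] by simp
    have le: "(m1 + h1)\<^sup>2 \<le> 2 * M\<^sup>2 + 2 * h1\<^sup>2"
      using m zero_le_power2[of "m1 - h1"] by (simp add: power2_sum power2_diff)
    have "\<bar>t3\<bar> * (m1 + h1)\<^sup>2 \<le> \<bar>t3\<bar> * (2 * M\<^sup>2) + \<bar>t3\<bar> * (2 * h1\<^sup>2)"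
      using mult_left_mono[OF le abs_ge_zero[of t3]] by (simp only: distrib_left)
    also have "\<dots> \<le> C * (\<delta> * h\<^sup>2) * (2 * M\<^sup>2) + C * \<delta> * (2 * h1\<^sup>2)"
      using Ti by (intro add_mono mult_right_mono) auto
    also have "\<dots> = 2 * M\<^sup>2 * C * (\<delta> * h\<^sup>2) + 2 * C * (\<delta> * h1\<^sup>2)" by simp
    also have "\<dots> \<le> 2 * M\<^sup>2 * C * D + 2 * C * D" using Dh C by (intro add_mono mult_left_mono) auto
    finally show ?thesis by (simp add: abs_mult algebra_simps)
  qed
  have "44 / 9 * t * h\<^sup>2 * (2 * m1 * h1 + h1\<^sup>2) = 44 / 9 * (t * h\<^sup>2 * (2 * m1 * h1)) + 44 / 9 * (t * h\<^sup>2 * h1\<^sup>2)"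
    by (simp add: algebra_simps)
  moreover have "8 / 3 * q * h * h1\<^sup>2 = 8 / 3 * (q * h * h1\<^sup>2)" by simp
  moreover have "8 / 3 * (M * D) \<le> 3 * M * D" "44 / 9 * (M * D) \<le> 5 * M * D" "44 / 9 * (M * M * D) \<le> 5 * M * M * D"
    using M Dh by (auto intro!: mult_right_mono mult_nonneg_nonneg)
  ultimately have "\<bar>om * t1 + 9 * t2 - 8 / 3 * q * h * h1\<^sup>2 + 44 / 9 * t * h\<^sup>2 * (2 * m1 * h1 + h1\<^sup>2) + t3 * (m1 + h1)\<^sup>2\<bar>
    \<le> \<bar>om\<bar> * C * D + 9 * (C * D) + 3 * M * D + 5 * M * M * D + 5 * M * D + (2 * M\<^sup>2 * C + 2 * C) * D"
    using 1 Ti(2) 3 4 5 6 unfolding abs_le_iff by linarith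
  then show ?thesis by (simp add: D_def algebra_simps)
qed

text \<open>No linear term appears because \<open>\<mu>\<close> is critical. The supremum bound
  \<delta> is kept apart from the norm, so that the error is \<delta> times the squared
  norm.\<close>

lemma Lambda_expansion:
  "\<exists>C\<ge>0. \<exists>r>0. \<forall>h h1 \<delta>. H1 h h1 \<and> (\<forall>x. \<bar>h x\<bar> \<le> \<delta>) \<and> \<delta> \<le> r \<and> (\<lambda>x. \<mu> x + h x) \<in> X_space k \<longrightarrow>
     \<bar>Lambda_functional c k (\<lambda>x. \<mu> x + h x) - Lambda_functional c k \<mu> - bform h h1 h h1 / 2\<bar> \<le> C * \<delta> * n1 h h1"
proof -
  obtain l u where l: "l > 0" "k \<in> {l..u}" "\<And>x y. \<bar>y\<bar> \<le> l \<Longrightarrow> \<mu> x + y \<in> {l..u}" using mu_k_range by blast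
  have mr: "\<mu> x \<in> {l..u}" for x using l(3)[of 0 x] l(1) by simp
  define \<tau> where "\<tau> = (\<lambda>p x y :: real. (x + y) powr p - x powr p - p * x powr (p - 1) * y - p * (p - 1) / 2 * x powr (p - 2) * y\<^sup>2)"
  have "\<exists>C\<ge>0. \<forall>x\<in>{l..u}. \<forall>y. x + y \<in> {l..u} \<longrightarrow> \<bar>\<tau> p x y\<bar> \<le> C * \<bar>y\<bar> ^ 3" for p
  proof -
    obtain C where C: "C \<ge> 0" "\<And>x y. x \<in> {l..u} \<Longrightarrow> y \<in> {l..u} \<Longrightarrow> \<bar>y powr p - x powr p - p * x powr (p - 1) * (y - x)
     - p * (p - 1) / 2 * x powr (p - 2) * (y - x)\<^sup>2\<bar> \<le> C * \<bar>y - x\<bar> ^ 3"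
      using powr_Taylor3[OF l(1), of u p] by blast
    have "\<bar>\<tau> p x y\<bar> \<le> C * \<bar>y\<bar> ^ 3" if "x \<in> {l..u}" "x + y \<in> {l..u}" for x y
      using C(2)[OF that] by (simp add: \<tau>_def)
    then show ?thesis using C(1) by blast
  qed
  then obtain Cp where Cp: "\<And>p. Cp p \<ge> 0" "\<And>p x y. x \<in> {l..u} \<Longrightarrow> x + y \<in> {l..u} \<Longrightarrow> \<bar>\<tau> p x y\<bar> \<le> Cp p * \<bar>y\<bar> ^ 3"
    by metis
  define C where "C = max (Cp (2/3)) (max (Cp (-2/3)) (Cp (-8/3)))"
  have C0: "C \<ge> 0" using Cp(1)[of "2/3"] by (simp add: C_def le_max_iff_disj)
  have tau: "\<bar>\<tau> p (\<mu> x) y\<bar> \<le> C * \<bar>y\<bar> ^ 3" if "p \<in> {2/3, -2/3, -8/3}" "\<bar>y\<bar> \<le> l" for p x y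
  proof -
    have "\<bar>\<tau> p (\<mu> x) y\<bar> \<le> Cp p * \<bar>y\<bar> ^ 3" by (rule Cp(2)[OF mr l(3)[OF that(2)]])
    also have "Cp p \<le> C"
    proof -
      from that(1) consider "p = 2/3" | "p = -2/3" | "p = -8/3" by blast
      then show ?thesis
      proof cases
        case 1 show ?thesis unfolding C_def 1 by (rule max.cobounded1)
      next
        case 2 show ?thesis unfolding C_def 2 by (rule order_trans[OF max.cobounded1 max.cobounded2])
      next
        case 3 show ?thesis unfolding C_def 3 by (rule order_trans[OF max.cobounded2 max.cobounded2])
      qed
    qed
    then have "Cp p * \<bar>y\<bar> ^ 3 \<le> C * \<bar>y\<bar> ^ 3" by (rule mult_right_mono) simp
    finally show ?thesis .
  qed
  obtain M where M: "M \<ge> 1" "\<And>x. \<bar>\<mu>1 x\<bar> \<le> M" "\<And>x. \<mu> x powr (-11/3) \<le> M" "\<And>x. \<mu> x powr (-14/3) \<le> M" "\<And>x. \<mu> x powr (-8/3) \<le> M"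
    using mu_coeff_bound[of 0] by blast
  obtain CV where CV: "\<And>x. \<bar>V x\<bar> \<le> CV" using V_bounded by blast
  define K where "K = \<bar>w1\<bar> * C + 9 * C + 3 * M + 5 * M * M + 5 * M + 2 * M\<^sup>2 * C + 2 * C"
  have K0: "K \<ge> 0" unfolding K_def using C0 M(1) by (intro add_nonneg_nonneg mult_nonneg_nonneg) auto
  have main: "\<bar>Lambda_functional c k (\<lambda>x. \<mu> x + h x) - Lambda_functional c k \<mu> - bform h h1 h h1 / 2\<bar> \<le> K * \<delta> * n1 h h1"
    if H: "H1 h h1" and hd: "\<And>x. \<bar>h x\<bar> \<le> \<delta>" and dr: "\<delta> \<le> min l 1" and X: "(\<lambda>x. \<mu> x + h x) \<in> X_space k" for h h1 \<delta>
  proof -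
    have h: "L2 h" "L2 h1" using H by (auto dest: H1_D)
    have wL: "L2 w" by (rule H1_D(2)[OF H1_waves(1)])
    have [measurable]: "h \<in> borel_measurable borel" "h1 \<in> borel_measurable borel" using h by (auto dest: L2_measurable)
    have vH: "H1 (\<lambda>x. w x + h x) (\<lambda>x. \<mu>1 x + h1 x)" by (rule H1_add[OF H1_waves(1) H])
    have veq: "(\<lambda>x. (\<mu> x + h x) - k) = (\<lambda>x. w x + h x)" "(\<lambda>x. \<mu> x - k) = w" by (auto simp: w_def fun_eq_iff)
    define T where "T = (\<lambda>m p :: real. w1 * prem (2/3) k m + 9 * prem (-2/3) k m + m powr (-8/3) * p\<^sup>2)"
    have Lm: "integrable lborel (\<lambda>x. T (\<mu> x + h x) (\<mu>1 x + h1 x))"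
      "Lambda_functional c k (\<lambda>x. \<mu> x + h x) = w0 * ip (\<lambda>x. w x + h x) (helmholtz_inv (\<lambda>x. w x + h x))
        + (LINT x|lborel. T (\<mu> x + h x) (\<mu>1 x + h1 x))"
      unfolding T_def using Lambda_functional_eq[OF X, of "\<lambda>x. \<mu>1 x + h1 x", unfolded veq, OF vH] by blast+
    have Lmu: "integrable lborel (\<lambda>x. T (\<mu> x) (\<mu>1 x))"
      "Lambda_functional c k \<mu> = w0 * ip w (helmholtz_inv w) + (LINT x|lborel. T (\<mu> x) (\<mu>1 x))"
      unfolding T_def using Lambda_functional_eq[OF mu_X, of \<mu>1, unfolded veq, OF H1_waves(1)] by blast+
    define g where "g = (\<lambda>x. \<mu> x powr (-8/3) * \<mu>1 x)"
    define g' where "g' = (\<lambda>x. (-8/3) * \<mu> x powr (-11/3) * (\<mu>1 x)\<^sup>2 + \<mu> x powr (-8/3) * \<mu>2 x)"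
    define e where "e = (\<lambda>x. \<mu> x powr (-11/3) * \<mu>1 x)"
    define e' where "e' = (\<lambda>x. (-11/3) * \<mu> x powr (-14/3) * (\<mu>1 x)\<^sup>2 + \<mu> x powr (-11/3) * \<mu>2 x)"
    have gH: "H1 g g'" unfolding g_def g'_def by (rule H1_powr_mu1)
    have eH: "H1 (\<lambda>x. e x * h x) (\<lambda>x. e' x * h x + e x * h1 x)"
      using H1_q_mult[OF H] by (simp add: e_def e'_def)
    have ig: "integrable lborel (\<lambda>x. g x * h1 x)" "integrable lborel (\<lambda>x. g' x * h x)"
      "integrable lborel (\<lambda>x. e x * h x * h1 x)" "integrable lborel (\<lambda>x. (e' x * h x + e x * h1 x) * h x)"
      using gH eH h by (auto intro!: L2_mult_integrable dest: H1_D)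
    \<comment> \<open>The derivative of \<open>2 g h - 8 / 3 e h\<^sup>2\<close>, of integral zero.
      Subtracting it removes the products of \<open>h1\<close> with \<open>\<mu>1\<close> from the
      first and second variation, so that the first variation becomes \<open>h\<close> times the
      Euler-Lagrange expression pointwise.\<close>
    define B' where "B' = (\<lambda>x. 2 * (g' x * h x) + 2 * (g x * h1 x) - 8 / 3 * ((e' x * h x + e x * h1 x) * h x) - 8 / 3 * (e x * h x * h1 x))"
    have iB: "integrable lborel B'" unfolding B'_def using ig
      by (intro Bochner_Integration.integrable_add Bochner_Integration.integrable_diff integrable_mult_right)
    have B0: "(LINT x|lborel. B' x) = 0"
      using integration_by_parts[OF gH H] integration_by_parts[OF eH H] ig unfolding B'_def ip_def by simp
    define S where "S = (\<lambda>x. \<mu> x powr (-8/3) * (h1 x)\<^sup>2 + V x / 2 * (h x)\<^sup>2)"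
    have iS1: "integrable lborel (\<lambda>x. \<mu> x powr (-8/3) * (h1 x)\<^sup>2)"
    proof (rule Bochner_Integration.integrable_bound)
      show "integrable lborel (\<lambda>x. M * (h1 x)\<^sup>2)" using h by (simp add: L2_real_iff)
      show "AE x in lborel. norm (\<mu> x powr (-8/3) * (h1 x)\<^sup>2) \<le> norm (M * (h1 x)\<^sup>2)"
        using M by (intro AE_I2) (auto simp: abs_mult intro!: mult_right_mono order_trans[OF _ abs_ge_self])
    qed measurable
    have iS2: "integrable lborel (\<lambda>x. V x / 2 * (h x)\<^sup>2)"
    proof (rule Bochner_Integration.integrable_bound)
      show "integrable lborel (\<lambda>x. CV / 2 * (h x)\<^sup>2)" using h by (simp add: L2_real_iff)
      show "AE x in lborel. norm (V x / 2 * (h x)\<^sup>2) \<le> norm (CV / 2 * (h x)\<^sup>2)"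
        using CV by (intro AE_I2) (auto simp: abs_mult intro!: mult_right_mono divide_right_mono order_trans[OF CV abs_ge_self])
    qed measurable
    have iS: "integrable lborel S" unfolding S_def by (intro Bochner_Integration.integrable_add iS1 iS2)
    have phL: "L2 (\<lambda>x. \<phi> x - k)" by (rule H1_D(2)[OF H1_waves(4)])
    have iph: "integrable lborel (\<lambda>x. (\<phi> x - k) * h x)" by (rule L2_mult_integrable[OF phL h(1)])
    define \<rho> where "\<rho> = (\<lambda>x. T (\<mu> x + h x) (\<mu>1 x + h1 x) - T (\<mu> x) (\<mu>1 x) - B' x - S x + 2 * w0 * ((\<phi> x - k) * h x))"
    have ir: "integrable lborel \<rho>" unfolding \<rho>_def
      by (intro Bochner_Integration.integrable_add Bochner_Integration.integrable_diff integrable_mult_right Lm(1) Lmu(1) iB iS iph)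
    have rint: "(LINT x|lborel. \<rho> x) = (LINT x|lborel. T (\<mu> x + h x) (\<mu>1 x + h1 x)) - (LINT x|lborel. T (\<mu> x) (\<mu>1 x))
        - (LINT x|lborel. S x) + 2 * w0 * ip (\<lambda>x. \<phi> x - k) h"
      unfolding \<rho>_def ip_def using Lm(1) Lmu(1) iB iS iph B0 by simp
    have pt: "\<bar>\<rho> x\<bar> \<le> K * \<delta> * ((h x)\<^sup>2 + (h1 x)\<^sup>2)" for x
    proof -
      define pp where "pp = \<mu> x powr (-8/3)"
      define q where "q = \<mu> x powr (-11/3)"
      define t where "t = \<mu> x powr (-14/3)"
      define a1 where "a1 = \<mu> x powr (-1/3)"
      define a4 where "a4 = \<mu> x powr (-4/3)"
      define a5 where "a5 = \<mu> x powr (-5/3)"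
      define t1 where "t1 = \<tau> (2/3) (\<mu> x) (h x)"
      define t2 where "t2 = \<tau> (-2/3) (\<mu> x) (h x)"
      define t3 where "t3 = \<tau> (-8/3) (\<mu> x) (h x)"
      have hl: "\<bar>h x\<bar> \<le> l" using hd[of x] dr by simp
      have e1: "(\<mu> x + h x) powr (2/3) = \<mu> x powr (2/3) + 2 / 3 * a1 * h x - 1 / 9 * a4 * (h x)\<^sup>2 + t1"
        by (simp add: t1_def \<tau>_def a1_def a4_def)
      have e2: "(\<mu> x + h x) powr (-2/3) = \<mu> x powr (-2/3) - 2 / 3 * a5 * h x + 5 / 9 * pp * (h x)\<^sup>2 + t2"
        by (simp add: t2_def \<tau>_def a5_def pp_def)
      have e3: "(\<mu> x + h x) powr (-8/3) = pp - 8 / 3 * q * h x + 44 / 9 * t * (h x)\<^sup>2 + t3"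
        by (simp add: t3_def \<tau>_def pp_def q_def t_def)
      have EL0: "2 * w0 * (\<phi> x - k) + 2 / 3 * w1 * (a1 - k powr (-1/3)) - 2 * pp * \<mu>2 x
          + 8 / 3 * q * (\<mu>1 x)\<^sup>2 - 6 * (a5 - k powr (-5/3)) = 0"
        using Euler_Lagrange[of x] Euler_Lagrange_infinity
        unfolding pp_def q_def a1_def a5_def right_diff_distrib by linarith
      have Vx: "V x = 16 / 3 * q * \<mu>2 x - 88 / 9 * t * (\<mu>1 x)\<^sup>2 + 10 * pp - 2 / 9 * w1 * a4"
        by (simp add: V_def q_def t_def pp_def a4_def)
      have kk: "k powr (2 / 3 - 1) = k powr (-1/3)" "k powr (- 2 / 3 - 1) = k powr (-5/3)" by simp_all
      \<comment> \<open>Once the Euler-Lagrange expressions of the wave and of the background are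
        removed, only terms of order at least three in \<open>h\<close> and \<open>h1\<close>
        together are left.\<close>
      have "\<rho> x - h x * (2 * w0 * (\<phi> x - k) + 2 / 3 * w1 * (a1 - k powr (-1/3)) - 2 * pp * \<mu>2 x
          + 8 / 3 * q * (\<mu>1 x)\<^sup>2 - 6 * (a5 - k powr (-5/3)))
        = w1 * t1 + 9 * t2 - 8 / 3 * q * h x * (h1 x)\<^sup>2 + 44 / 9 * t * (h x)\<^sup>2 * (2 * \<mu>1 x * h1 x + (h1 x)\<^sup>2) + t3 * (\<mu>1 x + h1 x)\<^sup>2"
        unfolding \<rho>_def T_def prem_def B'_def S_def g_def g'_def e_def e'_def Vx e1 e2 e3 kk
          pp_def[symmetric] q_def[symmetric] t_def[symmetric]
        by (simp add: field_simps power2_eq_square)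
      then have "\<rho> x = w1 * t1 + 9 * t2 - 8 / 3 * q * h x * (h1 x)\<^sup>2 + 44 / 9 * t * (h x)\<^sup>2 * (2 * \<mu>1 x * h1 x + (h1 x)\<^sup>2) + t3 * (\<mu>1 x + h1 x)\<^sup>2"
        unfolding EL0 by simp
      then show ?thesis unfolding K_def
        using cubic_remainder_bound[of "h x" \<delta> C M "\<mu>1 x" q t t1 t2 t3 w1 "h1 x"] hd[of x] dr C0 M tau[of "2/3" "h x" x] tau[of "-2/3" "h x" x] tau[of "-8/3" "h x" x] hl
        by (simp add: q_def t_def t1_def t2_def t3_def)
    qed
    have rle: "\<bar>LINT x|lborel. \<rho> x\<bar> \<le> K * \<delta> * n1 h h1"
    proof -
      have i: "integrable lborel (\<lambda>x. K * \<delta> * ((h x)\<^sup>2 + (h1 x)\<^sup>2))" using h by (simp add: L2_real_iff)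
      have "\<bar>LINT x|lborel. \<rho> x\<bar> \<le> (LINT x|lborel. K * \<delta> * ((h x)\<^sup>2 + (h1 x)\<^sup>2))"
        by (rule integral_abs_bound_integral[OF ir i pt])
      also have "\<dots> = K * \<delta> * n1 h h1" using h by (simp add: n1_def ip_self L2_real_iff)
      finally show ?thesis .
    qed
    have quad: "ip (\<lambda>x. w x + h x) (helmholtz_inv (\<lambda>x. w x + h x)) = ip w (helmholtz_inv w) + 2 * ip (\<lambda>x. \<phi> x - k) h + ip (helmholtz_inv h) h"
      using helmholtz_quad[OF wL h(1)] unfolding helmholtz_w by (simp only: ip_commute[of h])
    have bf: "bform h h1 h h1 / 2 = (LINT x|lborel. S x) + w0 * ip (helmholtz_inv h) h"
    proof -
      have "(LINT x|lborel. 2 * \<mu> x powr (-8/3) * (h1 x * h1 x) + V x * (h x * h x)) = (LINT x|lborel. 2 * S x)"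
        by (rule Bochner_Integration.integral_cong) (auto simp: S_def power2_eq_square)
      also have "\<dots> = 2 * (LINT x|lborel. S x)" by (rule integral_mult_right_zero)
      finally show ?thesis unfolding bform_def by (simp add: algebra_simps)
    qed
    have "Lambda_functional c k (\<lambda>x. \<mu> x + h x) - Lambda_functional c k \<mu> - bform h h1 h h1 / 2 = (LINT x|lborel. \<rho> x)"
      unfolding Lm(2) Lmu(2) quad bf rint by (simp add: algebra_simps)
    then show ?thesis using rle by simp
  qed
  show ?thesis
    by (intro exI[of _ K] exI[of _ "min l 1"] conjI allI impI K0) (use l(1) main in auto)
qed

end

section \<open>From the spectral assumption to coercivity\<close>

lemma integrable_Complex:
  assumes "integrable M a" "integrable M b"
  shows "integrable M (\<lambda>x. Complex (a x) (b x))"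
    "(LINT x|M. Complex (a x) (b x)) = Complex (LINT x|M. a x) (LINT x|M. b x)"
proof -
  have e: "Complex s t = complex_of_real s + \<i> * complex_of_real t" for s t
    by (simp add: complex_eq_iff)
  show "integrable M (\<lambda>x. Complex (a x) (b x))"
    "(LINT x|M. Complex (a x) (b x)) = Complex (LINT x|M. a x) (LINT x|M. b x)"
    unfolding e using assms by auto
qed

lemma measurable_Complex [measurable]:
  assumes [measurable]: "a \<in> borel_measurable M" "b \<in> borel_measurable M"
  shows "(\<lambda>x. Complex (a x) (b x)) \<in> borel_measurable M"
proof -
  have "(\<lambda>x. Complex (a x) (b x)) = (\<lambda>x. complex_of_real (a x) + \<i> * complex_of_real (b x))"
    by (simp add: complex_eq_iff fun_eq_iff)
  then show ?thesis by simp
qed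

lemma L2_Complex_iff: "L2 f \<longleftrightarrow> L2 (\<lambda>x. Re (f x)) \<and> L2 (\<lambda>x. Im (f x))"
proof
  assume f: "L2 f"
  then have [measurable]: "f \<in> borel_measurable borel" and i: "integrable lborel (\<lambda>x. (norm (f x))\<^sup>2)"
    by (auto simp: L2_def)
  have "integrable lborel (\<lambda>x. (Re (f x))\<^sup>2)" "integrable lborel (\<lambda>x. (Im (f x))\<^sup>2)"
    by (rule Bochner_Integration.integrable_bound[OF i]; auto simp: cmod_power2)+
  then show "L2 (\<lambda>x. Re (f x)) \<and> L2 (\<lambda>x. Im (f x))" by (simp add: L2_real_iff)
next
  assume "L2 (\<lambda>x. Re (f x)) \<and> L2 (\<lambda>x. Im (f x))"
  then have [measurable]: "(\<lambda>x. Re (f x)) \<in> borel_measurable borel" "(\<lambda>x. Im (f x)) \<in> borel_measurable borel"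
    and i: "integrable lborel (\<lambda>x. (Re (f x))\<^sup>2 + (Im (f x))\<^sup>2)"
    by (auto simp: L2_real_iff)
  have "(\<lambda>x. Complex (Re (f x)) (Im (f x))) \<in> borel_measurable lborel" by measurable
  then show "L2 f" using i by (simp add: L2_def cmod_power2)
qed

lemma L2_norm_complex:
  assumes "L2 f" shows "(L2_norm f)\<^sup>2 = ip (\<lambda>x. Re (f x)) (\<lambda>x. Re (f x)) + ip (\<lambda>x. Im (f x)) (\<lambda>x. Im (f x))"
proof -
  have "L2 (\<lambda>x. Re (f x))" "L2 (\<lambda>x. Im (f x))" using assms L2_Complex_iff[of f] by auto
  then show ?thesis by (simp add: L2_norm_def ip_self cmod_power2 L2_real_iff)
qed

lemma locally_integrable_Re_Im:
  assumes "locally_integrable (f :: real \<Rightarrow> complex)"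
  shows "locally_integrable (\<lambda>x. Re (f x))" "locally_integrable (\<lambda>x. Im (f x))"
proof -
  have i: "integrable lborel (\<lambda>x. indicator {a..b} x *\<^sub>R f x)" for a b
    using assms by (auto simp: locally_integrable_def set_integrable_def)
  show "locally_integrable (\<lambda>x. Re (f x))" "locally_integrable (\<lambda>x. Im (f x))"
    using integrable_bounded_linear[OF bounded_linear_Re i] integrable_bounded_linear[OF bounded_linear_Im i]
    by (auto simp: locally_integrable_def set_integrable_def)
qed

lemma locally_integrable_Complex:
  assumes "locally_integrable (\<lambda>x. Re (f x))" "locally_integrable (\<lambda>x. Im (f x))"
  shows "locally_integrable f"
  unfolding locally_integrable_def set_integrable_def
proof (intro allI)
  fix a b
  have "(\<lambda>x. indicator {a..b} x *\<^sub>R f x) = (\<lambda>x. Complex (indicator {a..b} x *\<^sub>R Re (f x)) (indicator {a..b} x *\<^sub>R Im (f x)))"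
    by (simp add: complex_eq_iff fun_eq_iff)
  then show "integrable lborel (\<lambda>x. indicator {a..b} x *\<^sub>R f x)"
    using integrable_Complex(1)[of lborel "\<lambda>x. indicator {a..b} x *\<^sub>R Re (f x)" "\<lambda>x. indicator {a..b} x *\<^sub>R Im (f x)"] assms
    by (simp add: locally_integrable_def set_integrable_def)
qed

lemma has_weak_deriv_complex_iff:
  fixes f g :: "real \<Rightarrow> complex"
  shows "has_weak_deriv f g \<longleftrightarrow> has_weak_deriv (\<lambda>x. Re (f x)) (\<lambda>x. Re (g x)) \<and> has_weak_deriv (\<lambda>x. Im (f x)) (\<lambda>x. Im (g x))"
proof -
  have int: "(LINT x|lborel. \<psi> x *\<^sub>R h x) = Complex (LINT x|lborel. \<psi> x * Re (h x)) (LINT x|lborel. \<psi> x * Im (h x))"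
    if "integrable lborel (\<lambda>x. \<psi> x * Re (h x))" "integrable lborel (\<lambda>x. \<psi> x * Im (h x))" for \<psi> and h :: "real \<Rightarrow> complex"
  proof -
    have "(\<lambda>x. \<psi> x *\<^sub>R h x) = (\<lambda>x. Complex (\<psi> x * Re (h x)) (\<psi> x * Im (h x)))" by (simp add: complex_eq_iff fun_eq_iff)
    then show ?thesis using integrable_Complex(2)[OF that] by simp
  qed
  have li: "locally_integrable h \<longleftrightarrow> locally_integrable (\<lambda>x. Re (h x)) \<and> locally_integrable (\<lambda>x. Im (h x))" for h :: "real \<Rightarrow> complex"
    using locally_integrable_Re_Im locally_integrable_Complex by blast
  have eq: "(LINT x|lborel. deriv \<psi> x *\<^sub>R f x) = - (LINT x|lborel. \<psi> x *\<^sub>R g x) \<longleftrightarrow>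
      (LINT x|lborel. deriv \<psi> x *\<^sub>R Re (f x)) = - (LINT x|lborel. \<psi> x *\<^sub>R Re (g x)) \<and>
      (LINT x|lborel. deriv \<psi> x *\<^sub>R Im (f x)) = - (LINT x|lborel. \<psi> x *\<^sub>R Im (g x))"
    if t: "test_function \<psi>" and "locally_integrable f" "locally_integrable g" for \<psi>
    using int[of "deriv \<psi>" f] int[of \<psi> g] integrable_test_mult[OF t] that(2,3) unfolding li
    by (simp add: complex_eq_iff)
  show ?thesis unfolding has_weak_deriv_def using eq li by blast
qed

lemma weak_deriv_AE_complex:
  fixes f g :: "real \<Rightarrow> complex"
  assumes "has_weak_deriv f g" "L2 g"
  shows "AE x in lborel. weak_deriv f x = g x" "L2 (weak_deriv f)"
proof -
  have w: "L2 (weak_deriv f) \<and> has_weak_deriv f (weak_deriv f)"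
    unfolding weak_deriv_def by (rule someI[of "\<lambda>g. L2 g \<and> has_weak_deriv f g"]) (use assms in auto)
  then show "L2 (weak_deriv f)" by auto
  have "AE x in lborel. Re (weak_deriv f x) = Re (g x)" "AE x in lborel. Im (weak_deriv f x) = Im (g x)"
    using w assms(1) has_weak_deriv_unique unfolding has_weak_deriv_complex_iff by blast+
  then show "AE x in lborel. weak_deriv f x = g x" by eventually_elim (simp add: complex_eq_iff)
qed

lemma ac_cong_deriv_AE:
  assumes "ac F f" "g \<in> borel_measurable borel" "AE x in lborel. f x = g x"
  shows "ac F g"
proof -
  have [measurable]: "f \<in> borel_measurable borel" "g \<in> borel_measurable borel"
    using assms by (auto simp: ac_def intro: locally_integrable_measurable)
  have 1: "set_integrable lborel {a..b} g" if "set_integrable lborel {a..b} f" for a b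
    using that unfolding set_integrable_def by (subst (asm) integrable_cong_AE[of _ _ "\<lambda>x. indicator {a..b} x *\<^sub>R g x"]) (use assms(3) in auto)
  have 2: "(LINT x:{a..b}|lborel. f x) = (LINT x:{a..b}|lborel. g x)" for a b
    unfolding set_lebesgue_integral_def by (rule integral_cong_AE) (use assms(3) in auto)
  show ?thesis using assms(1) 1 2 by (auto simp: ac_def locally_integrable_def)
qed

definition H2 :: "(real \<Rightarrow> real) \<Rightarrow> (real \<Rightarrow> real) \<Rightarrow> (real \<Rightarrow> real) \<Rightarrow> bool" where
  "H2 F F1 F2 \<longleftrightarrow> H1 F F1 \<and> H1 F1 F2"

lemma weak_chain_imp_H2:
  fixes f g h :: "real \<Rightarrow> real"
  assumes "has_weak_deriv f g" "has_weak_deriv g h" "L2 f" "L2 g" "L2 h"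
  shows "\<exists>F F1. H2 F F1 h \<and> (AE x in lborel. f x = F x) \<and> (AE x in lborel. g x = F1 x)"
proof -
  obtain F1 where F1: "ac F1 h" "AE x in lborel. g x = F1 x" using has_weak_deriv_imp_ac[OF assms(2)] by blast
  obtain F where F: "ac F g" "AE x in lborel. f x = F x" using has_weak_deriv_imp_ac[OF assms(1)] by blast
  have m: "F \<in> borel_measurable borel" "F1 \<in> borel_measurable borel"
    using ac_continuous[OF F(1)] ac_continuous[OF F1(1)] by (auto intro: borel_measurable_continuous_onI)
  have "ac F F1" by (rule ac_cong_deriv_AE[OF F(1) m(2) F1(2)])
  moreover have "L2 F" "L2 F1" using L2_cong_AE[OF assms(3) m(1) F(2)] L2_cong_AE[OF assms(4) m(2) F1(2)] by auto
  ultimately show ?thesis using F F1 assms(5) by (auto simp: H2_def H1_def)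
qed

section \<open>The real linearized operator and its quadratic form\<close>

context wave
begin

text \<open>Real-valued counterpart of \<open>L_operator\<close>, with the zero-order coefficients
  collected in \<open>V\<close>. Through \<open>weak_deriv\<close> its values are meaningful only
  almost everywhere.\<close>

definition A :: "(real \<Rightarrow> real) \<Rightarrow> real \<Rightarrow> real" where
  "A f x = - 2 * weak_deriv (\<lambda>y. \<mu> y powr (-8/3) * weak_deriv f y) x + V x * f x + 2 * w0 * helmholtz_inv f x"

lemma H1_p_mult:
  assumes "H1 F f"
  shows "H1 (\<lambda>x. \<mu> x powr (-8/3) * F x) (\<lambda>x. (-8/3) * \<mu> x powr (-11/3) * \<mu>1 x * F x + \<mu> x powr (-8/3) * f x)"
proof -
  obtain M where M: "M \<ge> 1" "\<And>x. \<bar>\<mu>1 x\<bar> \<le> M" "\<And>x. \<mu> x powr (-8/3) \<le> M" "\<And>x. \<mu> x powr (-11/3) \<le> M"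
    using mu_coeff_bound[of 0] by blast
  have "H1 (\<lambda>x. \<mu> x powr (-8/3) * F x) (\<lambda>x. (-8/3) * \<mu> x powr (-8/3 - 1) * \<mu>1 x * F x + \<mu> x powr (-8/3) * f x)"
  proof (rule H1_bounded_mult[OF assms powr_mu_DERIV])
    show "continuous_on UNIV (\<lambda>x. (-8/3) * \<mu> x powr (-8/3 - 1) * \<mu>1 x)"
      by (intro continuous_intros powr_mu_cont cont)
    show "\<bar>\<mu> x powr (-8/3)\<bar> \<le> M" for x using M(3)[of x] by simp
    have "\<mu> x powr (-11/3) * \<bar>\<mu>1 x\<bar> \<le> M * M" for x using M by (intro mult_mono) (auto intro: order_trans[of _ 1])
    then show "\<bar>(-8/3) * \<mu> x powr (-8/3 - 1) * \<mu>1 x\<bar> \<le> 8 / 3 * (M * M)" for x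
      by (simp add: abs_mult mult_ac)
  qed
  then show ?thesis by simp
qed

lemma V_mult_L2: "L2 f \<Longrightarrow> L2 (\<lambda>x. V x * f x)"
  using V_bounded L2_bounded_mult V_measurable by blast

text \<open>\<open>weak_deriv\<close> is a choice among versions, so the divergence-form term is
  identified almost everywhere with the product rule applied to the continuous
  representative.\<close>

lemma flux_AE:
  assumes f: "f \<in> borel_measurable borel" "AE x in lborel. f x = F x" and F: "H2 F F1 F2"
  shows "AE x in lborel. weak_deriv f x = F1 x" "L2 (weak_deriv f)"
    "AE x in lborel. weak_deriv (\<lambda>y. \<mu> y powr (-8/3) * weak_deriv f y) x
       = (-8/3) * \<mu> x powr (-11/3) * \<mu>1 x * F1 x + \<mu> x powr (-8/3) * F2 x"
    "L2 (weak_deriv (\<lambda>y. \<mu> y powr (-8/3) * weak_deriv f y))"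
    "has_weak_deriv (\<lambda>y. \<mu> y powr (-8/3) * weak_deriv f y)
       (\<lambda>x. (-8/3) * \<mu> x powr (-11/3) * \<mu>1 x * F1 x + \<mu> x powr (-8/3) * F2 x)"
proof -
  have h: "H1 F F1" "H1 F1 F2" using F by (auto simp: H2_def)
  have "has_weak_deriv f F1" by (rule has_weak_deriv_cong_AE[OF ac_has_weak_deriv[OF H1_D(1)[OF h(1)]] f])
  then show wd: "AE x in lborel. weak_deriv f x = F1 x" "L2 (weak_deriv f)"
    using weak_deriv_AE H1_D(3)[OF h(1)] by blast+
  have [measurable]: "weak_deriv f \<in> borel_measurable borel" using wd(2) by (rule L2_measurable)
  note p = H1_p_mult[OF h(2)]
  show hw: "has_weak_deriv (\<lambda>y. \<mu> y powr (-8/3) * weak_deriv f y)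
       (\<lambda>x. (-8/3) * \<mu> x powr (-11/3) * \<mu>1 x * F1 x + \<mu> x powr (-8/3) * F2 x)"
  proof (rule has_weak_deriv_cong_AE[OF ac_has_weak_deriv[OF H1_D(1)[OF p]]])
    show "AE x in lborel. \<mu> x powr (-8/3) * weak_deriv f x = \<mu> x powr (-8/3) * F1 x" using wd(1) by eventually_elim simp
  qed measurable
  show "AE x in lborel. weak_deriv (\<lambda>y. \<mu> y powr (-8/3) * weak_deriv f y) x
       = (-8/3) * \<mu> x powr (-11/3) * \<mu>1 x * F1 x + \<mu> x powr (-8/3) * F2 x"
    "L2 (weak_deriv (\<lambda>y. \<mu> y powr (-8/3) * weak_deriv f y))"
    using weak_deriv_AE[OF hw H1_D(3)[OF p]] by auto
qed

lemma A_AE: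
  assumes f: "L2 f" "AE x in lborel. f x = F x" and F: "H2 F F1 F2"
  shows "AE x in lborel. A f x = Lin x (F x) (F1 x) (F2 x) + 2 * w0 * helmholtz_inv F x" "L2 (A f)"
proof -
  have m: "f \<in> borel_measurable borel" using f by (simp add: L2_measurable)
  have mF: "F \<in> borel_measurable borel" using F by (auto simp: H2_def H1_def L2_measurable)
  have H: "helmholtz_inv f = helmholtz_inv F" by (rule helmholtz_cong_AE[OF m mF f(2)])
  note fl = flux_AE[OF m f(2) F]
  show "AE x in lborel. A f x = Lin x (F x) (F1 x) (F2 x) + 2 * w0 * helmholtz_inv F x"
    using fl(3) f(2)
  proof eventually_elim
    case (elim x)
    show ?case unfolding A_def elim H Lin_def V_def by (simp add: algebra_simps)
  qed
  show "L2 (A f)" unfolding A_def[abs_def]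
    by (intro L2_add L2_cmult V_mult_L2 fl(4) f(1) helmholtz_L2)
qed

lemma A_L2: "H2 F F1 F2 \<Longrightarrow> L2 (A F)"
  and A_AE': "H2 F F1 F2 \<Longrightarrow> AE x in lborel. A F x = Lin x (F x) (F1 x) (F2 x) + 2 * w0 * helmholtz_inv F x"
  using A_AE[of F F] by (auto simp: H2_def H1_def)

lemma bform_integrable:
  assumes "L2 h" "L2 h1" "L2 g" "L2 g1"
  shows "integrable lborel (\<lambda>x. 2 * \<mu> x powr (-8/3) * (h1 x * g1 x))" "integrable lborel (\<lambda>x. V x * (h x * g x))"
proof -
  obtain M where M: "\<And>x. \<mu> x powr (-8/3) \<le> M" using powr_mu_bounds by blast
  have "L2 (\<lambda>x. 2 * \<mu> x powr (-8/3) * h1 x)"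
    by (rule L2_bounded_mult[OF assms(2), where C = "2 * M"]) (use M in auto)
  from L2_mult_integrable[OF this assms(4)] show "integrable lborel (\<lambda>x. 2 * \<mu> x powr (-8/3) * (h1 x * g1 x))"
    by (simp add: mult.assoc)
  from L2_mult_integrable[OF V_mult_L2[OF assms(1)] assms(3)] show "integrable lborel (\<lambda>x. V x * (h x * g x))"
    by (simp add: mult.assoc)
qed

lemma bform_cong_AE:
  assumes "L2 h" "L2 h1" "L2 h1'" "L2 g" "L2 g1" "L2 g1'"
    "AE x in lborel. h1 x = h1' x" "AE x in lborel. g1 x = g1' x"
  shows "bform h h1 g g1 = bform h h1' g g1'"
proof -
  have [measurable]: "h \<in> borel_measurable borel" "h1 \<in> borel_measurable borel" "h1' \<in> borel_measurable borel"
    "g \<in> borel_measurable borel" "g1 \<in> borel_measurable borel" "g1' \<in> borel_measurable borel"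
    using assms by (auto intro: L2_measurable)
  have "(LINT x|lborel. 2 * \<mu> x powr (-8/3) * (h1 x * g1 x) + V x * (h x * g x))
     = (LINT x|lborel. 2 * \<mu> x powr (-8/3) * (h1' x * g1' x) + V x * (h x * g x))"
    by (rule integral_cong_AE) (use assms(7,8) in auto)
  then show ?thesis by (simp add: bform_def)
qed

lemma bform_sym: "L2 h \<Longrightarrow> L2 g \<Longrightarrow> bform h h1 g g1 = bform g g1 h h1"
  using helmholtz_sym[of h g] by (simp add: bform_def ip_commute mult.commute)

lemma bform_add:
  assumes "L2 h" "L2 h1" "L2 f" "L2 f1" "L2 g" "L2 g1"
  shows "bform (\<lambda>x. h x + r * f x) (\<lambda>x. h1 x + r * f1 x) g g1 = bform h h1 g g1 + r * bform f f1 g g1"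
proof -
  note i = bform_integrable[OF assms(1,2,5,6)] bform_integrable[OF assms(3-6)]
  have "(LINT x|lborel. 2 * \<mu> x powr (-8/3) * ((h1 x + r * f1 x) * g1 x) + V x * ((h x + r * f x) * g x))
    = (LINT x|lborel. (2 * \<mu> x powr (-8/3) * (h1 x * g1 x) + V x * (h x * g x))
        + r * (2 * \<mu> x powr (-8/3) * (f1 x * g1 x) + V x * (f x * g x)))"
    by (rule Bochner_Integration.integral_cong) (auto simp: algebra_simps)
  also have "\<dots> = (LINT x|lborel. 2 * \<mu> x powr (-8/3) * (h1 x * g1 x) + V x * (h x * g x))
     + (LINT x|lborel. r * (2 * \<mu> x powr (-8/3) * (f1 x * g1 x) + V x * (f x * g x)))"
    by (intro Bochner_Integration.integral_add Bochner_Integration.integrable_add integrable_mult_right i)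
  also have "(LINT x|lborel. r * (2 * \<mu> x powr (-8/3) * (f1 x * g1 x) + V x * (f x * g x)))
     = r * (LINT x|lborel. 2 * \<mu> x powr (-8/3) * (f1 x * g1 x) + V x * (f x * g x))"
    by (rule integral_mult_right_zero)
  finally have 1: "(LINT x|lborel. 2 * \<mu> x powr (-8/3) * ((h1 x + r * f1 x) * g1 x) + V x * ((h x + r * f x) * g x))
    = (LINT x|lborel. 2 * \<mu> x powr (-8/3) * (h1 x * g1 x) + V x * (h x * g x))
     + r * (LINT x|lborel. 2 * \<mu> x powr (-8/3) * (f1 x * g1 x) + V x * (f x * g x))" .
  have "helmholtz_inv (\<lambda>x. h x + r * f x) = (\<lambda>x. helmholtz_inv h x + r * helmholtz_inv f x)"
    using helmholtz_linear[OF assms(1,3)] by (simp add: fun_eq_iff)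
  then have "ip (helmholtz_inv (\<lambda>x. h x + r * f x)) g = ip (helmholtz_inv h) g + r * ip (helmholtz_inv f) g"
    using ip_add[OF helmholtz_L2[OF assms(1)] L2_cmult[OF helmholtz_L2[OF assms(3)]] assms(5), of r] by (simp add: ip_cmult)
  then show ?thesis unfolding bform_def 1 by (simp add: algebra_simps)
qed

text \<open>Garding's inequality: the leading coefficient is bounded below because
  \<open>\<mu>\<close> is bounded above, and the other terms are bounded on L2.\<close>

lemma bform_lower:
  "\<exists>m>0. \<exists>K. \<forall>h h1. L2 h \<and> L2 h1 \<longrightarrow> bform h h1 h h1 \<ge> m * ip h1 h1 - K * ip h h"
proof -
  obtain l u where l: "l > 0" "\<And>x y. \<bar>y\<bar> \<le> l \<Longrightarrow> \<mu> x + y \<in> {l..u}" using mu_k_range by blast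
  have mr: "\<mu> x \<in> {l..u}" for x using l(2)[of 0 x] l(1) by simp
  define m where "m = 2 * u powr (-8/3)"
  have u: "u > 0" using mr[of 0] l(1) by auto
  have m: "m > 0" using u by (simp add: m_def)
  have mm: "m \<le> 2 * \<mu> x powr (-8/3)" for x
    unfolding m_def using mr[of x] l(1) by (auto intro!: powr_mono2')
  obtain CV where CV: "\<And>x. \<bar>V x\<bar> \<le> CV" using V_bounded by blast
  have "bform h h1 h h1 \<ge> m * ip h1 h1 - (CV + 2 * \<bar>w0\<bar>) * ip h h" if h: "L2 h" "L2 h1" for h h1
  proof -
    note i = bform_integrable[OF h h]
    have i2: "integrable lborel (\<lambda>x. (h x)\<^sup>2)" "integrable lborel (\<lambda>x. (h1 x)\<^sup>2)" using h by (auto simp: L2_real_iff)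
    have "(LINT x|lborel. m * (h1 x)\<^sup>2 - CV * (h x)\<^sup>2) \<le> (LINT x|lborel. 2 * \<mu> x powr (-8/3) * (h1 x * h1 x) + V x * (h x * h x))"
    proof (rule integral_mono)
      fix x
      have "m * (h1 x)\<^sup>2 \<le> 2 * \<mu> x powr (-8/3) * (h1 x)\<^sup>2" by (rule mult_right_mono[OF mm]) simp
      moreover have "- CV * (h x)\<^sup>2 \<le> V x * (h x)\<^sup>2" using CV[of x] by (intro mult_right_mono) (auto simp: abs_le_iff)
      ultimately show "m * (h1 x)\<^sup>2 - CV * (h x)\<^sup>2 \<le> 2 * \<mu> x powr (-8/3) * (h1 x * h1 x) + V x * (h x * h x)"
        by (simp add: power2_eq_square)
    qed (use i i2 in auto)
    moreover have "(LINT x|lborel. m * (h1 x)\<^sup>2 - CV * (h x)\<^sup>2) = m * ip h1 h1 - CV * ip h h"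
      using i2 by (simp add: ip_self)
    moreover have "\<bar>w0 * ip (helmholtz_inv h) h\<bar> \<le> \<bar>w0\<bar> * ip h h"
      unfolding abs_mult using helmholtz_bounds[OF h(1)] by (intro mult_left_mono) auto
    ultimately show ?thesis unfolding bform_def by (simp add: algebra_simps abs_le_iff)
  qed
  then show ?thesis using m by blast
qed

lemma bform_A:
  assumes F: "H2 F F1 F2" and G: "H1 G G1"
  shows "bform F F1 G G1 = ip (A F) G"
proof -
  have h: "H1 F F1" "H1 F1 F2" using F by (auto simp: H2_def)
  note L = H1_D(2,3)[OF h(1)] H1_D(3)[OF h(2)] H1_D(2,3)[OF G]
  define P where "P = (\<lambda>x. \<mu> x powr (-8/3) * F1 x)"
  define P' where "P' = (\<lambda>x. (-8/3) * \<mu> x powr (-11/3) * \<mu>1 x * F1 x + \<mu> x powr (-8/3) * F2 x)"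
  have P: "H1 P P'" unfolding P_def P'_def by (rule H1_p_mult[OF h(2)])
  have VL: "L2 (\<lambda>x. V x * F x)" by (rule V_mult_L2[OF L(1)])
  have HL: "L2 (helmholtz_inv F)" by (rule helmholtz_L2[OF L(1)])
  have eq: "AE x in lborel. A F x = ((-2) * P' x + V x * F x) + 2 * w0 * helmholtz_inv F x"
    using A_AE'[OF F] by eventually_elim (simp add: P'_def Lin_def V_def algebra_simps)
  have "ip (A F) G = ip (\<lambda>x. ((-2) * P' x + V x * F x) + 2 * w0 * helmholtz_inv F x) G"
    using eq L2_measurable[OF A_L2[OF F]] L2_measurable[OF L(4)]
      L2_measurable[OF L2_add[OF L2_add[OF L2_cmult[OF H1_D(3)[OF P], of "-2"] VL] L2_cmult[OF HL, of "2 * w0"]]]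
    by (intro ip_cong_AE) auto
  also have "\<dots> = (-2) * ip P' G + ip (\<lambda>x. V x * F x) G + 2 * w0 * ip (helmholtz_inv F) G"
    using ip_add[OF L2_add[OF L2_cmult[OF H1_D(3)[OF P], of "-2"] VL] L2_cmult[OF HL, of "2 * w0"] L(4)]
      ip_add[OF L2_cmult[OF H1_D(3)[OF P], of "-2"] VL L(4)] unfolding ip_cmult by simp
  also have "(-2) * ip P' G = 2 * ip P G1" using integration_by_parts[OF P G] by simp
  also have "2 * ip P G1 + ip (\<lambda>x. V x * F x) G = (LINT x|lborel. 2 * \<mu> x powr (-8/3) * (F1 x * G1 x) + V x * (F x * G x))"
    using bform_integrable[OF L(1,2,4,5)] unfolding ip_def P_def by (simp add: mult.assoc)
  finally show ?thesis by (simp add: bform_def)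
qed

definition dom where "dom = {F. \<exists>F1 F2. H2 F F1 F2}"
text \<open>\<open>bform\<close> with the derivatives filled in, to match the two-argument forms of
  the abstract argument.\<close>

definition frm where "frm f g = bform f (weak_deriv f) g (weak_deriv g)"

lemma frm_eq: "H1 f f1 \<Longrightarrow> H1 g g1 \<Longrightarrow> frm f g = bform f f1 g g1"
  unfolding frm_def
  by (rule bform_cong_AE) (auto simp: H1_def intro!: weak_deriv_AE ac_has_weak_deriv)

lemma H2_lin: "H2 F F1 F2 \<Longrightarrow> H2 G G1 G2 \<Longrightarrow> H2 (\<lambda>x. F x + r * G x) (\<lambda>x. F1 x + r * G1 x) (\<lambda>x. F2 x + r * G2 x)"
  by (auto simp: H2_def intro!: H1_add H1_cmult)

lemma H1_zero: "H1 (\<lambda>x. 0) (\<lambda>x. 0)"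
  by (simp add: H1_def ac_const L2_zero)

lemma Lin_lin: "Lin x (h + r * g) (h1 + r * g1) (h2 + r * g2) = Lin x h h1 h2 + r * Lin x g g1 g2"
  by (simp add: Lin_def field_simps)

lemma A_lin:
  assumes F: "H2 F F1 F2" and G: "H2 G G1 G2" and g: "L2 g"
  shows "ip (A (\<lambda>x. F x + r * G x)) g = ip (A F) g + r * ip (A G) g"
proof -
  have L: "L2 F" "L2 G" using F G by (auto simp: H2_def H1_def)
  have "AE x in lborel. A (\<lambda>x. F x + r * G x) x = A F x + r * A G x"
    using A_AE'[OF F] A_AE'[OF G] A_AE'[OF H2_lin[OF F G, of r]]
    unfolding helmholtz_linear[OF L] Lin_lin by eventually_elim (simp add: distrib_left mult.left_commute)
  then have "ip (A (\<lambda>x. F x + r * G x)) g = ip (\<lambda>x. A F x + r * A G x) g"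
    using A_L2[OF F] A_L2[OF G] A_L2[OF H2_lin[OF F G, of r]] g
    by (intro ip_cong_AE) (auto intro!: L2_measurable L2_add L2_cmult)
  also have "\<dots> = ip (A F) g + r * ip (A G) g"
    using ip_add[OF A_L2[OF F] L2_cmult[OF A_L2[OF G], of r] g] by (simp add: ip_cmult)
  finally show ?thesis .
qed

lemma sym_operator_A: "sym_operator {f. L2 f} ip dom A"
proof (intro sym_operator.intro sym_operator_axioms.intro L2.semi_inner_axioms)
  show "dom \<subseteq> {f. L2 f}" by (auto simp: dom_def H2_def H1_def)
  show "Real_Vector_Spaces.subspace dom"
    unfolding Real_Vector_Spaces.subspace_def
  proof (intro conjI ballI allI)
    show "0 \<in> dom" unfolding dom_def H2_def zero_fun_def using H1_zero by blast
  next
    fix x y assume "x \<in> dom" "y \<in> dom"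
    then show "x + y \<in> dom" unfolding dom_def plus_fun_def using H2_lin[where r = 1] by (auto, metis)
  next
    fix c x assume "x \<in> dom"
    then obtain F1 F2 where "H2 x F1 F2" by (auto simp: dom_def)
    then have "H2 (\<lambda>t. c * x t) (\<lambda>t. c * F1 t) (\<lambda>t. c * F2 t)" by (auto simp: H2_def intro: H1_cmult)
    then show "c *\<^sub>R x \<in> dom" unfolding dom_def scaleR_fun_def by auto
  qed
next
  fix x assume "x \<in> dom"
  then show "A x \<in> {f. L2 f}" by (auto simp: dom_def A_L2)
next
  fix x y g :: "real \<Rightarrow> real" assume "x \<in> dom" "y \<in> dom" "g \<in> {f. L2 f}"
  then show "ip (A (x + y)) g = ip (A x) g + ip (A y) g"
    using A_lin[where r = 1] unfolding dom_def plus_fun_def by auto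
next
  fix x g :: "real \<Rightarrow> real" and r assume "x \<in> dom" "g \<in> {f. L2 f}"
  then obtain F1 F2 where F: "H2 x F1 F2" and g: "L2 g" by (auto simp: dom_def)
  have Z: "H2 (\<lambda>x. 0) (\<lambda>x. 0) (\<lambda>x. 0)" by (simp add: H2_def H1_zero)
  have "ip (A (\<lambda>x. 0)) g = 0" using A_lin[OF Z Z g, of 1] by simp
  then show "ip (A (r *\<^sub>R x)) g = r * ip (A x) g" using A_lin[OF Z F g, of r] by (simp add: scaleR_fun_def)
next
  fix x y assume "x \<in> dom" "y \<in> dom"
  then obtain X1 X2 Y1 Y2 where X: "H2 x X1 X2" "H2 y Y1 Y2" by (auto simp: dom_def)
  then have H: "H1 x X1" "H1 y Y1" by (auto simp: H2_def)
  have "ip (A x) y = bform x X1 y Y1" using bform_A[OF X(1) H(2)] by simp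
  also have "\<dots> = bform y Y1 x X1" using H by (intro bform_sym) (auto simp: H1_def)
  also have "\<dots> = ip (A y) x" by (rule bform_A[OF X(2) H(1)])
  finally show "ip (A x) y = ip x (A y)" by (simp add: ip_commute)
qed

section \<open>Transfer of the spectral data from the complex to the real operator\<close>

abbreviation Lc where "Lc \<equiv> L_operator c k \<mu>"

lemma L_operator_AE:
  fixes u :: "real \<Rightarrow> complex"
  assumes u: "L2 u" and F: "AE x in lborel. Re (u x) = F x" "H2 F F1 F2"
    and G: "AE x in lborel. Im (u x) = G x" "H2 G G1 G2"
  shows "sobolev 2 u" "AE x in lborel. Lc u x = Complex (A F x) (A G x)" "Lc u \<in> borel_measurable borel"
proof -
  have hF: "H1 F F1" "H1 F1 F2" and hG: "H1 G G1" "H1 G1 G2" using F G by (auto simp: H2_def)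
  have uL: "L2 (\<lambda>x. Re (u x))" "L2 (\<lambda>x. Im (u x))" using u L2_Complex_iff[of u] by auto
  then have m: "(\<lambda>x. Re (u x)) \<in> borel_measurable borel" "(\<lambda>x. Im (u x)) \<in> borel_measurable borel"
    by (auto intro: L2_measurable)
  define u1 where "u1 = (\<lambda>x. Complex (F1 x) (G1 x))"
  define u2 where "u2 = (\<lambda>x. Complex (F2 x) (G2 x))"
  have L1: "L2 u1" "L2 u2" unfolding L2_Complex_iff u1_def u2_def using hF hG by (auto simp: H1_def)
  have d1: "has_weak_deriv u u1" unfolding has_weak_deriv_complex_iff u1_def
    using has_weak_deriv_cong_AE[OF ac_has_weak_deriv[OF H1_D(1)[OF hF(1)]] m(1) F(1)]
      has_weak_deriv_cong_AE[OF ac_has_weak_deriv[OF H1_D(1)[OF hG(1)]] m(2) G(1)] by simp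
  have d2: "has_weak_deriv u1 u2" unfolding has_weak_deriv_complex_iff u1_def u2_def
    using ac_has_weak_deriv[OF H1_D(1)[OF hF(2)]] ac_has_weak_deriv[OF H1_D(1)[OF hG(2)]] by simp
  show "sobolev 2 u" unfolding numeral_2_eq_2 sobolev.simps using u d1 d2 L1 by blast
  have wd: "AE x in lborel. weak_deriv u x = u1 x" "L2 (weak_deriv u)" using weak_deriv_AE_complex[OF d1 L1(1)] by auto
  have wm: "(\<lambda>x. Re (weak_deriv u x)) \<in> borel_measurable borel" "(\<lambda>x. Im (weak_deriv u x)) \<in> borel_measurable borel"
    using wd(2) unfolding L2_Complex_iff by (auto intro: L2_measurable)
  note pF = H1_p_mult[OF hF(2)] and pG = H1_p_mult[OF hG(2)]
  define P where "P = (\<lambda>x. Complex ((-8/3) * \<mu> x powr (-11/3) * \<mu>1 x * F1 x + \<mu> x powr (-8/3) * F2 x)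
      ((-8/3) * \<mu> x powr (-11/3) * \<mu>1 x * G1 x + \<mu> x powr (-8/3) * G2 x))"
  have d3: "has_weak_deriv (\<lambda>y. \<mu> y powr (-8/3) *\<^sub>R weak_deriv u y) P"
    unfolding has_weak_deriv_complex_iff
  proof
    have "AE x in lborel. \<mu> x powr (-8/3) * Re (weak_deriv u x) = \<mu> x powr (-8/3) * F1 x"
      using wd(1) by eventually_elim (simp add: u1_def)
    then show "has_weak_deriv (\<lambda>x. Re (\<mu> x powr (-8/3) *\<^sub>R weak_deriv u x)) (\<lambda>x. Re (P x))"
      using has_weak_deriv_cong_AE[OF ac_has_weak_deriv[OF H1_D(1)[OF pF]], of "\<lambda>x. \<mu> x powr (-8/3) * Re (weak_deriv u x)"] wm
      by (simp add: P_def)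
    have "AE x in lborel. \<mu> x powr (-8/3) * Im (weak_deriv u x) = \<mu> x powr (-8/3) * G1 x"
      using wd(1) by eventually_elim (simp add: u1_def)
    then show "has_weak_deriv (\<lambda>x. Im (\<mu> x powr (-8/3) *\<^sub>R weak_deriv u x)) (\<lambda>x. Im (P x))"
      using has_weak_deriv_cong_AE[OF ac_has_weak_deriv[OF H1_D(1)[OF pG]], of "\<lambda>x. \<mu> x powr (-8/3) * Im (weak_deriv u x)"] wm
      by (simp add: P_def)
  qed
  have PL: "L2 P" unfolding L2_Complex_iff P_def using H1_D(3)[OF pF] H1_D(3)[OF pG] by simp
  note wP = weak_deriv_AE_complex[OF d3 PL]
  have Hu: "helmholtz_inv u x = Complex (helmholtz_inv F x) (helmholtz_inv G x)" for x
  proof -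
    have e: "(exp (- \<bar>x - y\<bar>) / 2) *\<^sub>R u y = Complex (exp (- \<bar>x - y\<bar>) / 2 * Re (u y)) (exp (- \<bar>x - y\<bar>) / 2 * Im (u y))" for y
      by (simp add: complex_eq_iff)
    have "helmholtz_inv u x = Complex (helmholtz_inv (\<lambda>x. Re (u x)) x) (helmholtz_inv (\<lambda>x. Im (u x)) x)"
      unfolding helmholtz_inv_def e real_scaleR_def
      by (rule integrable_Complex(2)[OF helmholtz_integrable[OF uL(1)] helmholtz_integrable[OF uL(2)]])
    moreover have "helmholtz_inv (\<lambda>x. Re (u x)) = helmholtz_inv F" "helmholtz_inv (\<lambda>x. Im (u x)) = helmholtz_inv G"
      using m F(1) G(1) hF(1) hG(1) by (auto intro!: helmholtz_cong_AE simp: H1_def L2_measurable)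
    ultimately show ?thesis by simp
  qed
  have mu12: "deriv \<mu> = \<mu>1" "deriv \<mu>1 = \<mu>2" by (auto simp: \<mu>1_def \<mu>2_def)
  show "AE x in lborel. Lc u x = Complex (A F x) (A G x)"
    using wP(1) F(1) G(1) A_AE'[OF F(2)] A_AE'[OF G(2)]
  proof eventually_elim
    case (elim x)
    show ?case
      unfolding L_operator_def elim(1) elim(4,5) Hu mu12 complex_eq_iff
      using elim(2,3) by (simp add: P_def Lin_def field_simps)
  qed
  have [measurable]: "u \<in> borel_measurable borel"
    "weak_deriv (\<lambda>y. \<mu> y powr (-8/3) *\<^sub>R weak_deriv u y) \<in> borel_measurable borel"
    using u wP(2) by (auto simp: L2_def)
  have [measurable]: "helmholtz_inv F \<in> borel_measurable borel" "helmholtz_inv G \<in> borel_measurable borel"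
    using hF hG by (auto simp: H1_def intro: L2_measurable helmholtz_L2)
  have [measurable]: "\<mu> \<in> borel_measurable borel" "\<mu>1 \<in> borel_measurable borel" "\<mu>2 \<in> borel_measurable borel"
    using cont by (auto intro: borel_measurable_continuous_onI)
  show "Lc u \<in> borel_measurable borel"
    unfolding L_operator_def[abs_def] Hu mu12 by measurable
qed

lemma sobolev2_rep:
  fixes u :: "real \<Rightarrow> complex"
  assumes "sobolev 2 u"
  shows "\<exists>F F1 F2 G G1 G2. L2 u \<and> (AE x in lborel. Re (u x) = F x) \<and> H2 F F1 F2
     \<and> (AE x in lborel. Im (u x) = G x) \<and> H2 G G1 G2"
proof -
  obtain g h where g: "L2 u" "has_weak_deriv u g" "L2 g" "has_weak_deriv g h" "L2 h"
    using assms unfolding numeral_2_eq_2 sobolev.simps by blast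
  have L: "L2 (\<lambda>x. Re (u x))" "L2 (\<lambda>x. Im (u x))" "L2 (\<lambda>x. Re (g x))" "L2 (\<lambda>x. Im (g x))" "L2 (\<lambda>x. Re (h x))" "L2 (\<lambda>x. Im (h x))"
    using g unfolding L2_Complex_iff by blast+
  show ?thesis
    using weak_chain_imp_H2[of "\<lambda>x. Re (u x)" "\<lambda>x. Re (g x)" "\<lambda>x. Re (h x)"]
      weak_chain_imp_H2[of "\<lambda>x. Im (u x)" "\<lambda>x. Im (g x)" "\<lambda>x. Im (h x)"] L g
    unfolding has_weak_deriv_complex_iff by blast
qed

text \<open>The coefficients are real, so for real data the real part of the complex solution solves
  the real equation, and its norm is no larger.\<close>

lemma resolvent_transfer:
  fixes z :: real
  assumes "complex_of_real z \<in> resolvent_set (sobolev 2) Lc"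
  shows "sym_operator.resolvent {f. L2 f} ip dom A z"
proof -
  interpret op: sym_operator "{f. L2 f}" ip dom A by (rule sym_operator_A)
  obtain C where C: "\<And>u. sobolev 2 u \<Longrightarrow> L2_norm u \<le> C * L2_norm (\<lambda>x. Lc u x - complex_of_real z * u x)"
    using assms by (auto simp: resolvent_set_def)
  have ex: "\<exists>u. sobolev 2 u \<and> (AE x in lborel. Lc u x - complex_of_real z * u x = f x)" if "L2 f" for f
    using assms that by (auto simp: resolvent_set_def)
  show ?thesis unfolding op.resolvent_def
  proof (intro exI[of _ "C\<^sup>2"] conjI ballI)
    fix f :: "real \<Rightarrow> real" assume "f \<in> {f. L2 f}"
    then have f: "L2 f" by simp
    define fc where "fc = (\<lambda>x. Complex (f x) 0)"
    have fcL: "L2 fc" unfolding L2_Complex_iff fc_def using f L2_zero by simp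
    obtain u where u: "sobolev 2 u" "AE x in lborel. Lc u x - complex_of_real z * u x = fc x" using ex[OF fcL] by blast
    obtain F F1 F2 G G1 G2 where R: "L2 u" "AE x in lborel. Re (u x) = F x" "H2 F F1 F2" "AE x in lborel. Im (u x) = G x" "H2 G G1 G2"
      using sobolev2_rep[OF u(1)] by blast
    note Lu = L_operator_AE(2)[OF R(1,2,3,4,5)]
    have FL: "L2 F" using R by (auto simp: H2_def H1_def)
    have uL: "L2 (\<lambda>x. Re (u x))" "L2 (\<lambda>x. Im (u x))" using R(1) unfolding L2_Complex_iff by blast+
    have eq: "AE x in lborel. A F x - z * F x = f x"
      using Lu u(2) R(2) by eventually_elim (auto simp: complex_eq_iff fc_def)
    have A: "L2 (A F)" by (rule A_L2[OF R(3)])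
    have weak: "ip (A F) g - z * ip F g = ip f g" if g: "L2 g" for g
    proof -
      have "ip (A F) g - z * ip F g = ip (\<lambda>x. A F x - z * F x) g"
        using ip_diff[OF A L2_cmult[OF FL, of z] g] by (simp add: ip_cmult)
      also have "\<dots> = ip f g" using A FL f g eq by (intro ip_cong_AE) (auto intro!: L2_measurable L2_diff L2_cmult)
      finally show ?thesis .
    qed
    have bound: "ip F F \<le> C\<^sup>2 * ip f f"
    proof -
      have "L2_norm (\<lambda>x. Lc u x - complex_of_real z * u x) = L2_norm fc"
      proof -
        have "(LINT x|lborel. (norm (Lc u x - complex_of_real z * u x))\<^sup>2) = (LINT x|lborel. (norm (fc x))\<^sup>2)"
        proof (rule integral_cong_AE)
          show "AE x in lborel. (norm (Lc u x - complex_of_real z * u x))\<^sup>2 = (norm (fc x))\<^sup>2"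
            using u(2) by eventually_elim simp
          have [measurable]: "u \<in> borel_measurable borel" using R(1) by (simp add: L2_def)
          have [measurable]: "fc \<in> borel_measurable borel" using fcL by (simp add: L2_def)
          note [measurable] = L_operator_AE(3)[OF R(1,2,3,4,5)]
          show "(\<lambda>x. (norm (fc x))\<^sup>2) \<in> borel_measurable lborel" by measurable
          show "(\<lambda>x. (norm (Lc u x - complex_of_real z * u x))\<^sup>2) \<in> borel_measurable lborel"
            by measurable
        qed
        then show ?thesis by (simp add: L2_norm_def)
      qed
      then have "L2_norm u \<le> C * L2_norm fc" using C[OF u(1)] by simp
      moreover have "L2_norm u \<ge> 0" by (simp add: L2_norm_def)
      ultimately have "(L2_norm u)\<^sup>2 \<le> (C * L2_norm fc)\<^sup>2" by (intro power_mono)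
      moreover have "(L2_norm fc)\<^sup>2 = ip f f" using L2_norm_complex[OF fcL] by (simp add: fc_def ip_def)
      moreover have "ip F F = ip (\<lambda>x. Re (u x)) (\<lambda>x. Re (u x))"
        using R(2) FL uL by (intro ip_cong_AE) (auto intro: L2_measurable)
      ultimately show ?thesis using L2_norm_complex[OF R(1)] ip_nonneg[of "\<lambda>x. Im (u x)"] by (simp add: power_mult_distrib)
    qed
    show "\<exists>u\<in>dom. (\<forall>g\<in>{f. L2 f}. ip (A u) g - z * ip u g = ip f g) \<and> ip u u \<le> C\<^sup>2 * ip f f"
      using weak bound R(3) by (intro bexI[of _ F]) (auto simp: dom_def)
  qed simp
qed

lemma ip_zero_AE: "L2 f \<Longrightarrow> ip f f = 0 \<Longrightarrow> AE x in lborel. f x = 0"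
  using integral_nonneg_eq_0_iff_AE[of lborel "\<lambda>x. (f x)\<^sup>2"] by (simp add: ip_self L2_real_iff)

lemma eigen_AE:
  assumes "H2 F F1 F2" "\<And>g. L2 g \<Longrightarrow> ip (A F) g = z * ip F g"
  shows "AE x in lborel. A F x = z * F x"
proof -
  have L: "L2 (A F)" "L2 F" using assms A_L2 by (auto simp: H2_def H1_def)
  have d: "L2 (\<lambda>x. A F x - z * F x)" by (intro L2_diff L2_cmult L)
  have "ip (\<lambda>x. A F x - z * F x) (\<lambda>x. A F x - z * F x) = 0"
    using ip_diff[OF L(1) L2_cmult[OF L(2), of z] d] assms(2)[OF d] by (simp add: ip_cmult)
  from ip_zero_AE[OF d this] show ?thesis by eventually_elim simp
qed

text \<open>The real and imaginary parts of the complex eigenvector satisfy the real eigenvalue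
  equation, and at least one of them is not null. Any other real eigenvector is a complex multiple
  of the same \<open>u\<close>, hence a real multiple of \<open>e\<close>.\<close>

lemma eigen_transfer:
  fixes z :: real
  assumes "simple_eigenvalue (sobolev 2) Lc (complex_of_real z)"
  shows "\<exists>e\<in>dom. ip e e > 0 \<and> (\<forall>g :: real \<Rightarrow> real. L2 g \<longrightarrow> ip (A e) g = z * ip e g) \<and>
    (\<forall>x\<in>dom. (\<forall>g :: real \<Rightarrow> real. L2 g \<longrightarrow> ip (A x) g = z * ip x g) \<longrightarrow> (\<exists>\<beta>. \<forall>g :: real \<Rightarrow> real. L2 g \<longrightarrow> ip x g = \<beta> * ip e g))"
proof -
  obtain u where u: "sobolev 2 u" "\<not> (AE x in lborel. u x = 0)" "AE x in lborel. Lc u x = complex_of_real z * u x"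
    and simp_ev: "\<And>v. sobolev 2 v \<Longrightarrow> AE x in lborel. Lc v x = complex_of_real z * v x \<Longrightarrow> \<exists>\<alpha>. AE x in lborel. v x = \<alpha> * u x"
    using assms unfolding simple_eigenvalue_def by blast
  obtain F F1 F2 G G1 G2 where R: "L2 u" "AE x in lborel. Re (u x) = F x" "H2 F F1 F2" "AE x in lborel. Im (u x) = G x" "H2 G G1 G2"
    using sobolev2_rep[OF u(1)] by blast
  note Lu = L_operator_AE(2)[OF R(1,2,3,4,5)]
  have L: "L2 F" "L2 G" using R by (auto simp: H2_def H1_def)
  have eF: "AE x in lborel. A F x = z * F x" using Lu u(3) R(2) by eventually_elim (auto simp: complex_eq_iff)
  have eG: "AE x in lborel. A G x = z * G x" using Lu u(3) R(4) by eventually_elim (auto simp: complex_eq_iff)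
  have "ip F F > 0 \<or> ip G G > 0"
  proof (rule ccontr)
    assume "\<not> ?thesis"
    then have "ip F F = 0" "ip G G = 0" using ip_nonneg[of F] ip_nonneg[of G] by linarith+
    then have "AE x in lborel. F x = 0" "AE x in lborel. G x = 0" using ip_zero_AE L by blast+
    then have "AE x in lborel. u x = 0" using R(2) R(4) by eventually_elim (simp add: complex_eq_iff)
    then show False using u(2) by simp
  qed
  then obtain e E1 E2 where e: "ip e e > 0" "H2 e E1 E2" "AE x in lborel. A e x = z * e x" using R eF eG by blast
  have eL: "L2 e" using e by (auto simp: H2_def H1_def)
  have cx: "\<exists>\<alpha>. AE x in lborel. complex_of_real (y x) = \<alpha> * u x" if y: "H2 y Y1 Y2" "AE x in lborel. A y x = z * y x" for y Y1 Y2
  proof (rule simp_ev)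
    have yL: "L2 y" using y by (auto simp: H2_def H1_def)
    have yc: "L2 (\<lambda>x. complex_of_real (y x))" unfolding L2_Complex_iff using yL L2_zero by simp
    have Z: "H2 (\<lambda>x. 0) (\<lambda>x. 0) (\<lambda>x. 0)" by (simp add: H2_def H1_zero)
    note Ly = L_operator_AE[OF yc _ y(1) _ Z]
    show "sobolev 2 (\<lambda>x. complex_of_real (y x))" by (rule Ly(1)) auto
    have "AE x in lborel. Lc (\<lambda>x. complex_of_real (y x)) x = Complex (A y x) (A (\<lambda>x. 0) x)" by (rule Ly(2)) auto
    moreover have "AE x in lborel. A (\<lambda>x. 0) x = 0"
      using A_AE'[OF Z] by eventually_elim (simp add: Lin_def helmholtz_real)
    ultimately show "AE x in lborel. Lc (\<lambda>x. complex_of_real (y x)) x = complex_of_real z * complex_of_real (y x)"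
      using y(2) by eventually_elim (simp add: complex_eq_iff)
  qed
  obtain \<alpha> where \<alpha>: "AE x in lborel. complex_of_real (e x) = \<alpha> * u x" using cx[OF e(2,3)] by blast
  have \<alpha>0: "\<alpha> \<noteq> 0"
  proof
    assume "\<alpha> = 0"
    then have "AE x in lborel. e x = 0" using \<alpha> by simp
    then have "ip e e = ip (\<lambda>x. 0) (\<lambda>x. 0)" using eL by (intro ip_cong_AE) (auto intro: L2_measurable)
    then show False using e(1) by (simp add: ip_def)
  qed
  show ?thesis
  proof (intro bexI[of _ e] conjI allI impI ballI e(1))
    show "e \<in> dom" using e(2) by (auto simp: dom_def)
    fix g :: "real \<Rightarrow> real" assume g: "L2 g"
    have "ip (A e) g = ip (\<lambda>x. z * e x) g"
      using e(3) A_L2[OF e(2)] eL g by (intro ip_cong_AE) (auto intro!: L2_measurable L2_cmult)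
    then show "ip (A e) g = z * ip e g" by (simp add: ip_cmult)
  next
    fix x assume "x \<in> dom" and x: "\<forall>g :: real \<Rightarrow> real. L2 g \<longrightarrow> ip (A x) g = z * ip x g"
    then obtain X1 X2 where X: "H2 x X1 X2" by (auto simp: dom_def)
    have xL: "L2 x" using X by (auto simp: H2_def H1_def)
    obtain \<alpha>' where "AE t in lborel. complex_of_real (x t) = \<alpha>' * u t" using cx[OF X eigen_AE[OF X]] x by blast
    then have "AE t in lborel. x t = Re (\<alpha>' / \<alpha>) * e t"
      using \<alpha>
    proof eventually_elim
      case (elim t)
      then have "complex_of_real (x t) = (\<alpha>' / \<alpha>) * complex_of_real (e t)" using \<alpha>0 by simp
      moreover have "Re (q * complex_of_real r) = Re q * r" for q r by simp
      ultimately show ?case by (metis Re_complex_of_real)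
    qed
    then have "ip x g = Re (\<alpha>' / \<alpha>) * ip e g" if "L2 g" for g :: "real \<Rightarrow> real"
      using ip_cong_AE[OF L2_measurable[OF xL] L2_measurable[OF L2_cmult[OF eL, of "Re (\<alpha>' / \<alpha>)"]] L2_measurable[OF that] L2_measurable[OF that]]
      by (simp add: ip_cmult)
    then show "\<exists>\<beta>. \<forall>g. L2 g \<longrightarrow> ip x g = \<beta> * ip e g" by blast
  qed
qed

lemma sym_form_frm: "sym_form {f. \<exists>f1. H1 f f1} frm"
proof
  show "Real_Vector_Spaces.subspace {f. \<exists>f1. H1 f f1}"
    unfolding Real_Vector_Spaces.subspace_def zero_fun_def plus_fun_def scaleR_fun_def real_scaleR_def
    using H1_zero H1_add H1_cmult by blast
next
  fix x y z assume "x \<in> {f. \<exists>f1. H1 f f1}" "y \<in> {f. \<exists>f1. H1 f f1}" "z \<in> {f. \<exists>f1. H1 f f1}"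
  then obtain x1 y1 z1 where H: "H1 x x1" "H1 y y1" "H1 z z1" by blast
  have "frm (x + y) z = bform (\<lambda>t. x t + y t) (\<lambda>t. x1 t + y1 t) z z1"
    unfolding plus_fun_def by (rule frm_eq[OF H1_add[OF H(1,2)] H(3)])
  also have "\<dots> = bform x x1 z z1 + bform y y1 z z1"
    using bform_add[of x x1 y y1 z z1 1] H by (simp add: H1_def)
  finally show "frm (x + y) z = frm x z + frm y z" using frm_eq[OF H(1,3)] frm_eq[OF H(2,3)] by simp
next
  fix x z r assume "x \<in> {f. \<exists>f1. H1 f f1}" "z \<in> {f. \<exists>f1. H1 f f1}"
  then obtain x1 z1 where H: "H1 x x1" "H1 z z1" by blast
  have "frm (r *\<^sub>R x) z = bform (\<lambda>t. r * x t) (\<lambda>t. r * x1 t) z z1"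
    unfolding scaleR_fun_def real_scaleR_def by (rule frm_eq[OF H1_cmult[OF H(1)] H(2)])
  moreover have "bform (\<lambda>t. 0) (\<lambda>t. 0) z z1 = 0" by (simp add: bform_def helmholtz_real ip_def)
  ultimately show "frm (r *\<^sub>R x) z = r * frm x z"
    using bform_add[of "\<lambda>t. 0" "\<lambda>t. 0" x x1 z z1 r] H frm_eq[OF H] by (simp add: H1_def L2_zero)
next
  fix x y assume "x \<in> {f. \<exists>f1. H1 f f1}" "y \<in> {f. \<exists>f1. H1 f f1}"
  then obtain x1 y1 where H: "H1 x x1" "H1 y y1" by blast
  then show "frm x y = frm y x" using frm_eq[OF H] frm_eq[OF H(2,1)] bform_sym[of x y x1 y1] by (simp add: H1_def)
qed

text \<open>The abstract bound is in L2 and is upgraded to H1 by Garding's inequality. The kernel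
  vector \<open>e0\<close> of the spectral assumption may be exchanged for \<open>\<mu>1\<close>,
  since the kernel is simple and contains \<open>\<mu>1\<close>.\<close>

lemma coercive:
  assumes spec: "spectral_assumption (sobolev 2) Lc"
    and psi: "H2 psi psi1 psi2" "\<And>x. Lin x (psi x) (psi1 x) (psi2 x) + 2 * w0 * helmholtz_inv psi x = \<gamma> * Fp x"
      "\<gamma> > 0" "ip Fp psi < 0"
  shows "\<exists>\<alpha>>0. \<forall>y y1. H1 y y1 \<and> ip y Fp = 0 \<and> ip y \<mu>1 = 0 \<longrightarrow> bform y y1 y y1 \<ge> \<alpha> * n1 y y1"
proof -
  interpret op: sym_operator "{f. L2 f}" ip dom A by (rule sym_operator_A)
  obtain \<nu> \<delta> :: real where nu: "\<nu> < 0" "simple_eigenvalue (sobolev 2) Lc (of_real \<nu>)" "simple_eigenvalue (sobolev 2) Lc 0"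
    "\<delta> > 0" "spectrum (sobolev 2) Lc - {of_real \<nu>, 0} \<subseteq> of_real ` {\<delta>..}"
    using spec unfolding spectral_assumption_def by blast
  obtain e1 where e1: "e1 \<in> dom" "ip e1 e1 > 0" "\<And>g. L2 g \<Longrightarrow> ip (A e1) g = \<nu> * ip e1 g"
    "\<And>x. x \<in> dom \<Longrightarrow> (\<And>g. L2 g \<Longrightarrow> ip (A x) g = \<nu> * ip x g) \<Longrightarrow> \<exists>\<beta>. \<forall>g. L2 g \<longrightarrow> ip x g = \<beta> * ip e1 g"
    using eigen_transfer[OF nu(2)] by blast
  obtain e0 where e0: "e0 \<in> dom" "ip e0 e0 > 0" "\<And>g. L2 g \<Longrightarrow> ip (A e0) g = 0"
    "\<And>x. x \<in> dom \<Longrightarrow> (\<And>g. L2 g \<Longrightarrow> ip (A x) g = 0) \<Longrightarrow> \<exists>\<beta>. \<forall>g. L2 g \<longrightarrow> ip x g = \<beta> * ip e0 g"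
    using eigen_transfer[of 0] nu(3) by auto
  have res: "op.resolvent r" if "r < \<delta>" "r \<noteq> \<nu>" "r \<noteq> 0" for r
  proof (rule resolvent_transfer, rule ccontr)
    assume "complex_of_real r \<notin> resolvent_set (sobolev 2) Lc"
    then have "complex_of_real r \<in> spectrum (sobolev 2) Lc - {of_real \<nu>, 0}" using that by (simp add: spectrum_def)
    then have "complex_of_real r \<in> of_real ` {\<delta>..}" using nu(5) by blast
    then show False using that(1) by auto
  qed
  obtain m K where mK: "m > 0" "\<And>h h1. L2 h \<Longrightarrow> L2 h1 \<Longrightarrow> bform h h1 h h1 \<ge> m * ip h1 h1 - K * ip h h"
    using bform_lower by blast
  have psiL: "L2 psi" using psi(1) by (auto simp: H2_def H1_def)
  define G where "G = (\<lambda>x. \<gamma> * Fp x)"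
  have GL: "L2 G" unfolding G_def by (rule L2_cmult[OF Fp_L2])
  have Apsi: "ip (A psi) g = ip G g" if "L2 g" for g
  proof (rule ip_cong_AE)
    show "AE x in lborel. A psi x = G x" using A_AE'[OF psi(1)] by eventually_elim (simp add: psi(2) G_def)
  qed (use A_L2[OF psi(1)] GL that in \<open>auto intro: L2_measurable\<close>)
  have "\<exists>\<alpha>>0. \<forall>y\<in>{f. \<exists>f1. H1 f f1}. ip y G = 0 \<and> ip y e0 = 0 \<longrightarrow> frm y y \<ge> \<alpha> * ip y y"
  proof (rule op.constrained_coercive[OF L2_complete sym_form_frm, where nu = \<nu> and del = \<delta> and ?e1.0 = e1 and ?e0.0 = e0 and psi = psi and K = K])
    show "dom \<subseteq> {f. \<exists>f1. H1 f f1}" "{f. \<exists>f1. H1 f f1} \<subseteq> {f. L2 f}" by (auto simp: dom_def H2_def H1_def)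
    fix f g assume "f \<in> dom" "g \<in> {f. \<exists>f1. H1 f f1}"
    then obtain f1 f2 g1 where H: "H2 f f1 f2" "H1 g g1" by (auto simp: dom_def)
    then show "frm f g = ip (A f) g" using frm_eq[of f f1 g g1] bform_A[OF H] by (simp add: H2_def)
  next
    fix f assume "f \<in> {f. \<exists>f1. H1 f f1}"
    then obtain f1 where H: "H1 f f1" by blast
    have "0 \<le> m * ip f1 f1" using mK(1) ip_nonneg[of f1] by simp
    then show "- K * ip f f \<le> frm f f" using frm_eq[OF H H] mK(2)[OF H1_D(2,3)[OF H]] by simp
  next
    show "ip G psi < 0" unfolding G_def ip_cmult using psi(3,4) by (simp add: mult_pos_neg)
  qed (use nu res e1 e0 psi psiL GL Apsi in \<open>auto simp: dom_def\<close>)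
  then obtain \<alpha> where \<alpha>: "\<alpha> > 0" "\<And>y. \<exists>y1. H1 y y1 \<Longrightarrow> ip y G = 0 \<Longrightarrow> ip y e0 = 0 \<Longrightarrow> frm y y \<ge> \<alpha> * ip y y" by blast
  have mu1_dom: "H2 \<mu>1 \<mu>2 \<mu>3" using H1_waves by (simp add: H2_def)
  have mu1L: "L2 \<mu>1" using H1_D(2)[OF H1_waves(2)] .
  have "ip (A \<mu>1) g = 0" if "L2 g" for g
  proof -
    have "AE x in lborel. A \<mu>1 x = 0" using A_AE'[OF mu1_dom]
      by eventually_elim (use Lin_mu1 helmholtz_mu1 in \<open>simp add: algebra_simps\<close>)
    then have "ip (A \<mu>1) g = ip (\<lambda>x. 0) g" using A_L2[OF mu1_dom] that by (intro ip_cong_AE) (auto intro: L2_measurable)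
    then show ?thesis by (simp add: ip_def)
  qed
  then obtain \<beta> where \<beta>: "\<And>g. L2 g \<Longrightarrow> ip \<mu>1 g = \<beta> * ip e0 g"
    using e0(4)[of \<mu>1] mu1_dom by (auto simp: dom_def)
  have \<beta>0: "\<beta> \<noteq> 0"
  proof
    assume "\<beta> = 0"
    then have "ip \<mu>1 \<mu>1 = 0" using \<beta>[OF mu1L] by simp
    then have "AE x in lborel. \<mu>1 x = 0" using ip_zero_AE mu1L by blast
    then have "\<mu>1 = (\<lambda>x. 0)" by (intro AE_eq_continuous cont continuous_on_const)
    then show False using mu1_nonzero by (metis)
  qed
  show ?thesis
  proof (intro exI[of _ "m * \<alpha> / (m + \<alpha> + \<bar>K\<bar>)"] conjI allI impI)
    have D: "m + \<alpha> + \<bar>K\<bar> > 0" using mK(1) \<alpha>(1) by simp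
    then show "m * \<alpha> / (m + \<alpha> + \<bar>K\<bar>) > 0" using mK(1) \<alpha>(1) by simp
    fix y y1 assume "H1 y y1 \<and> ip y Fp = 0 \<and> ip y \<mu>1 = 0"
    then have y: "H1 y y1" "ip y Fp = 0" "ip y \<mu>1 = 0" by auto
    have yL: "L2 y" "L2 y1" using y by (auto simp: H1_def)
    have yG: "ip y G = 0" unfolding G_def using y(2) by (simp add: ip_commute[of y] ip_cmult)
    have ye: "ip y e0 = 0" using \<beta>[OF yL(1)] y(3) \<beta>0 by (simp add: ip_commute)
    have b1: "bform y y1 y y1 \<ge> \<alpha> * ip y y" using \<alpha>(2)[OF _ yG ye] y(1) frm_eq[OF y(1) y(1)] by auto
    have b2: "bform y y1 y y1 \<ge> m * ip y1 y1 - \<bar>K\<bar> * ip y y"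
      using mK(2)[OF yL] mult_right_mono[of K "\<bar>K\<bar>" "ip y y"] ip_nonneg[of y] by linarith
    define b where "b = bform y y1 y y1"
    \<comment> \<open>The two lower bounds are added with weights \<open>m + \<bar>K\<bar>\<close>
      and \<open>\<alpha>\<close>; the L2 terms then combine to
      \<open>m * \<alpha> * ip y y\<close>, the same factor as that of the derivative term.\<close>
    have "(m + \<bar>K\<bar>) * (\<alpha> * ip y y) \<le> (m + \<bar>K\<bar>) * b" using b1 mK(1) unfolding b_def by (intro mult_left_mono) auto
    moreover have "\<alpha> * (m * ip y1 y1 - \<bar>K\<bar> * ip y y) \<le> \<alpha> * b" using b2 \<alpha>(1) unfolding b_def by (intro mult_left_mono) auto
    ultimately have "m * \<alpha> * n1 y y1 \<le> (m + \<alpha> + \<bar>K\<bar>) * b" by (simp add: n1_def algebra_simps)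
    then show "m * \<alpha> / (m + \<alpha> + \<bar>K\<bar>) * n1 y y1 \<le> bform y y1 y y1"
      using D unfolding b_def by (simp add: field_simps)
  qed
qed

end

section \<open>The family of solitary waves\<close>

text \<open>All weak derivatives below the top order receive continuous representatives at once; the
  last member of the chain is only in L2.\<close>

lemma sobolev_chain:
  fixes u :: "real \<Rightarrow> real"
  assumes "sobolev (Suc n) u"
  shows "\<exists>F. (\<forall>i\<le>n. H1 (F i) (F (Suc i))) \<and> (AE x in lborel. u x = F (0::nat) x)"
  using assms
proof (induction n arbitrary: u)
  case 0
  then obtain g where g: "L2 u" "has_weak_deriv u g" "L2 g" by auto
  obtain F where F: "ac F g" "AE x in lborel. u x = F x" using has_weak_deriv_imp_ac[OF g(2)] by blast
  have "F \<in> borel_measurable borel" using ac_continuous[OF F(1)] by (rule borel_measurable_continuous_onI)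
  then have "H1 F g" using F g L2_cong_AE by (auto simp: H1_def)
  then show ?case using F by (intro exI[of _ "\<lambda>i. if i = 0 then F else g"]) auto
next
  case (Suc n)
  then obtain g where g: "L2 u" "has_weak_deriv u g" "sobolev (Suc n) g" by auto
  obtain G where G: "\<And>i. i \<le> n \<Longrightarrow> H1 (G i) (G (Suc i))" "AE x in lborel. g x = G (0::nat) x" using Suc.IH[OF g(3)] by blast
  obtain F where F: "ac F g" "AE x in lborel. u x = F x" using has_weak_deriv_imp_ac[OF g(2)] by blast
  have "F \<in> borel_measurable borel" using ac_continuous[OF F(1)] by (rule borel_measurable_continuous_onI)
  then have L: "L2 F" using F g L2_cong_AE by blast
  have G0: "H1 (G 0) (G 1)" using G(1)[of 0] by simp
  have "ac F (G 0)" by (rule ac_cong_deriv_AE[OF F(1) _ G(2)]) (rule L2_measurable[OF H1_D(2)[OF G0]])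
  then have "H1 F (G 0)" using L G0 by (auto simp: H1_def)
  then show ?case using F G(1) by (intro exI[of _ "case_nat F G"]) (auto split: nat.split)
qed

lemma weak_deriv_iter_AE:
  fixes u :: "real \<Rightarrow> real"
  assumes H: "\<And>i. i < n \<Longrightarrow> H1 (F i) (F (Suc i))" and u: "u \<in> borel_measurable borel" "AE x in lborel. u x = F 0 x"
  shows "(weak_deriv ^^ n) u \<in> borel_measurable borel \<and> (AE x in lborel. (weak_deriv ^^ n) u x = F n x)"
  using H
proof (induction n)
  case (Suc n)
  then have IH: "(weak_deriv ^^ n) u \<in> borel_measurable borel" "AE x in lborel. (weak_deriv ^^ n) u x = F n x" by auto
  have h: "H1 (F n) (F (Suc n))" using Suc.prems by simp
  have "has_weak_deriv ((weak_deriv ^^ n) u) (F (Suc n))"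
    by (rule has_weak_deriv_cong_AE[OF ac_has_weak_deriv[OF H1_D(1)[OF h]] IH])
  from weak_deriv_AE[OF this H1_D(3)[OF h]] show ?case by (auto intro: L2_measurable)
qed (use u in auto)

lemma sobolev_norm_chain:
  fixes u :: "real \<Rightarrow> real"
  assumes H: "\<And>i. i < n \<Longrightarrow> H1 (F i) (F (Suc i))" and n: "n > 0"
    and u: "u \<in> borel_measurable borel" "AE x in lborel. u x = F 0 x" and j: "j \<le> n"
  shows "ip (F j) (F j) \<le> (sobolev_norm n u)\<^sup>2"
proof -
  have eq: "(L2_norm ((weak_deriv ^^ i) u))\<^sup>2 = ip (F i) (F i)" if "i \<le> n" for i
  proof -
    have w: "(weak_deriv ^^ i) u \<in> borel_measurable borel" "AE x in lborel. (weak_deriv ^^ i) u x = F i x"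
      using weak_deriv_iter_AE[of i F u] H u that by auto
    have "F i \<in> borel_measurable borel"
    proof (cases "i < n")
      case True then show ?thesis using H1_D(2)[OF H] by (simp add: L2_measurable)
    next
      case False
      then have "H1 (F (n - 1)) (F i)" using H[of "n - 1"] n that by simp
      then show ?thesis using H1_D(3) by (simp add: L2_measurable)
    qed
    then show ?thesis unfolding L2_norm_sq using w by (intro ip_cong_AE) auto
  qed
  have "(sobolev_norm n u)\<^sup>2 = (\<Sum>i\<le>n. (L2_norm ((weak_deriv ^^ i) u))\<^sup>2)"
    by (simp add: sobolev_norm_def sum_nonneg)
  also have "\<dots> \<ge> (L2_norm ((weak_deriv ^^ j) u))\<^sup>2"
    using j by (intro member_le_sum) auto
  finally show ?thesis using eq[OF j] by simp
qed

text \<open>Momentum and background are scaled together. The exponents \<open>4/3\<close> and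
  \<open>2/3\<close> add up to 2, the degree of the quadratic part.\<close>

lemma F_functional_scale:
  assumes s: "s > 0" and \<kappa>: "\<kappa> > 0" and m: "\<And>x. m x > 0"
  shows "F_functional (s * \<kappa>) (\<lambda>x. s * m x) = s\<^sup>2 * F_functional \<kappa> m"
proof -
  have H: "helmholtz_inv (\<lambda>x. s * m x) x = s * helmholtz_inv m x" for x
    unfolding helmholtz_real by (simp add: mult.left_commute)
  have P: "s powr (4/3) * s powr (2/3) = s\<^sup>2" using s by (simp flip: powr_add)
  have "E_density (s * \<kappa>) (\<lambda>x. s * m x) x - 3 * (s * \<kappa>) powr (4/3) * F1_density (s * \<kappa>) (\<lambda>x. s * m x) x
     = s\<^sup>2 * (E_density \<kappa> m x - 3 * \<kappa> powr (4/3) * F1_density \<kappa> m x)" for x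
  proof -
    have "3 * (s * \<kappa>) powr (4/3) * F1_density (s * \<kappa>) (\<lambda>x. s * m x) x
      = (s powr (4/3) * s powr (2/3)) * (3 * \<kappa> powr (4/3) * F1_density \<kappa> m x)"
      using s \<kappa> m[of x] by (simp add: F1_density_def powr_mult algebra_simps)
    then show ?thesis unfolding P by (simp add: E_density_def H power2_eq_square algebra_simps)
  qed
  then show ?thesis unfolding F_functional_def by simp
qed

lemma (in wave) H1_deriv_pow: "H1 ((deriv ^^ n) (\<lambda>y. \<phi> y - k)) ((deriv ^^ Suc n) (\<lambda>y. \<phi> y - k))"
proof -
  have sm: "smooth (\<lambda>y. \<phi> y - k)" using smooth_add[OF smooth_phi smooth_const[of "- k"]] by simp
  have s: "smooth ((deriv ^^ n) (\<lambda>y. \<phi> y - k))" for n by (induction n) (auto intro: sm smooth_deriv)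
  have L: "L2 ((deriv ^^ n) (\<lambda>y. \<phi> y - k))" for n
    by (rule expdecay_L2) (use profile smooth_continuous[OF s] in \<open>auto simp: solitary_profile_def expdecay_def\<close>)
  have "ac ((deriv ^^ n) (\<lambda>y. \<phi> y - k)) ((deriv ^^ Suc n) (\<lambda>y. \<phi> y - k))"
    using smooth_DERIV[OF s[of n]] smooth_continuous[OF s[of "Suc n"]] by (intro ac_DERIV) auto
  then show ?thesis using L[of n] L[of "Suc n"] by (simp add: H1_def)
qed

section \<open>Differentiation of the waves in the parameter\<close>

locale wave_family =
  fixes c k :: real and \<Phi> :: "real \<Rightarrow> real \<Rightarrow> real"
  assumes c: "c > 0" and k: "k \<in> {0<..<sqrt c / 2}"
    and profiles: "\<And>\<kappa>. \<kappa> \<in> {0<..<sqrt c / 2} \<Longrightarrow> solitary_profile c \<kappa> (\<Phi> \<kappa>)"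
    and family: "smooth_family c \<Phi>"

sublocale wave_family \<subseteq> wave c k "\<Phi> k"
  using c k profiles by unfold_locales auto

context wave_family
begin

lemma wave_at: "\<kappa> \<in> {0<..<sqrt c / 2} \<Longrightarrow> wave c \<kappa> (\<Phi> \<kappa>)"
  using c profiles by unfold_locales auto

text \<open>Spatial derivatives of the decaying part of the profile. Removing the background
  \<open>\<kappa>\<close> keeps all of them in L2 while the background varies.\<close>

definition p where "p \<kappa> i = (deriv ^^ i) (\<lambda>y. \<Phi> \<kappa> y - \<kappa>)"

lemma H1_p: "\<kappa> \<in> {0<..<sqrt c / 2} \<Longrightarrow> H1 (p \<kappa> i) (p \<kappa> (Suc i))"
  using wave.H1_deriv_pow[OF wave_at] unfolding p_def .

lemma p_values:
  assumes "\<kappa> \<in> {0<..<sqrt c / 2}"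
  shows "\<Phi> \<kappa> x = \<kappa> + p \<kappa> 0 x" "momentum (\<Phi> \<kappa>) x = \<kappa> + (p \<kappa> 0 x - p \<kappa> 2 x)"
    "deriv (momentum (\<Phi> \<kappa>)) x = p \<kappa> 1 x - p \<kappa> 3 x" "deriv (deriv (momentum (\<Phi> \<kappa>))) x = p \<kappa> 2 x - p \<kappa> 4 x"
proof -
  note s = wave.deriv_pow_sub[OF wave_at[OF assms]]
  note m = wave.deriv_mu[OF wave_at[OF assms]]
  show 0: "\<Phi> \<kappa> x = \<kappa> + p \<kappa> 0 x" by (simp add: p_def)
  show "momentum (\<Phi> \<kappa>) x = \<kappa> + (p \<kappa> 0 x - p \<kappa> 2 x)"
    using fun_cong[OF s[of 1], of x] by (simp add: p_def momentum_def numeral_2_eq_2)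
  show "deriv (momentum (\<Phi> \<kappa>)) x = p \<kappa> 1 x - p \<kappa> 3 x"
    using fun_cong[OF m[of 1], of x] fun_cong[OF s[of 0], of x] fun_cong[OF s[of 2], of x]
    by (simp add: p_def numeral_3_eq_3 numeral_2_eq_2)
  show "deriv (deriv (momentum (\<Phi> \<kappa>))) x = p \<kappa> 2 x - p \<kappa> 4 x"
    using fun_cong[OF m[of 2], of x] fun_cong[OF s[of 1], of x] fun_cong[OF s[of 3], of x]
    by (simp add: p_def eval_nat_numeral)
qed

lemma in_range: "\<forall>\<^sub>F h in at 0. k + h \<in> {0<..<sqrt c / 2}"
proof -
  have "((\<lambda>h. k + h) \<longlongrightarrow> k + 0) (at 0)" by (intro tendsto_intros)
  then show ?thesis using k by (intro topological_tendstoD[where S = "{0<..<sqrt c / 2}" and l = "k + 0"]) auto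
qed

definition dq where "dq i h x = (p (k + h) i x - p k i x) / h"

lemma H1_dq: "k + h \<in> {0<..<sqrt c / 2} \<Longrightarrow> H1 (dq i h) (dq (Suc i) h)"
  using H1_cmult[OF H1_diff[OF H1_p[of "k + h" i] H1_p[OF k, of i]], of "1 / h"]
  by (simp add: dq_def[abs_def])

text \<open>Why order 5: the Euler-Lagrange equation contains the second derivative of
  \<open>\<mu>\<close>, hence the fourth of the profile, and pointwise convergence in order
  \<open>i\<close> uses L2 convergence in order \<open>i + 1\<close>.\<close>

lemma parameter_derivative:
  "\<exists>U. (\<forall>i\<le>5. H1 (U i) (U (Suc i))) \<and>
     (\<forall>i\<le>5. ((\<lambda>h. ip (\<lambda>x. dq i h x - U i x) (\<lambda>x. dq i h x - U i x)) \<longlongrightarrow> 0) (at 0))"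
proof -
  obtain P where P': "(\<forall>\<kappa>\<in>{0<..<sqrt c / 2}. P 0 \<kappa> = (\<lambda>x. \<Phi> \<kappa> x - \<kappa>)) \<and>
    (\<forall>j n. \<forall>\<kappa>\<in>{0<..<sqrt c / 2}. sobolev n (P j \<kappa>) \<and>
      ((\<lambda>h. sobolev_norm n (\<lambda>x. (P j (\<kappa> + h) x - P j \<kappa> x) / h - P (Suc j) \<kappa> x)) \<longlongrightarrow> 0) (at 0))"
    using family unfolding smooth_family_def by (rule exE)
  have P0: "\<And>\<kappa>. \<kappa> \<in> {0<..<sqrt c / 2} \<Longrightarrow> P 0 \<kappa> = (\<lambda>x. \<Phi> \<kappa> x - \<kappa>)"
    and P: "\<And>j n \<kappa>. \<kappa> \<in> {0<..<sqrt c / 2} \<Longrightarrow> sobolev n (P j \<kappa>)"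
      "\<And>j n \<kappa>. \<kappa> \<in> {0<..<sqrt c / 2} \<Longrightarrow>
        ((\<lambda>h. sobolev_norm n (\<lambda>x. (P j (\<kappa> + h) x - P j \<kappa> x) / h - P (Suc j) \<kappa> x)) \<longlongrightarrow> 0) (at 0)"
    using P' by blast+
  obtain U where U: "\<And>i. i \<le> 5 \<Longrightarrow> H1 (U i) (U (Suc i))" "AE x in lborel. P (Suc 0) k x = U 0 x"
    using sobolev_chain[OF P(1)[OF k, of "Suc 5" "Suc 0"]] by blast
  define N where "N = (\<lambda>h. sobolev_norm 6 (\<lambda>x. (P 0 (k + h) x - P 0 k x) / h - P (Suc 0) k x))"
  have N: "(N \<longlongrightarrow> 0) (at 0)" unfolding N_def by (rule P(2)[OF k])
  have mP: "P (Suc 0) k \<in> borel_measurable borel" using P(1)[OF k, of 0 "Suc 0"] by (simp add: L2_measurable)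
  have "((\<lambda>h. ip (\<lambda>x. dq i h x - U i x) (\<lambda>x. dq i h x - U i x)) \<longlongrightarrow> 0) (at 0)" if i: "i \<le> 5" for i
  proof (rule tendsto_sandwich[of "\<lambda>h. 0" _ _ "\<lambda>h. (N h)\<^sup>2"])
    show "\<forall>\<^sub>F h in at 0. 0 \<le> ip (\<lambda>x. dq i h x - U i x) (\<lambda>x. dq i h x - U i x)" by (simp add: ip_nonneg)
    show "((\<lambda>h. (N h)\<^sup>2) \<longlongrightarrow> 0) (at 0)" using tendsto_power[OF N, of 2] by simp
    show "\<forall>\<^sub>F h in at 0. ip (\<lambda>x. dq i h x - U i x) (\<lambda>x. dq i h x - U i x) \<le> (N h)\<^sup>2"
      using in_range
    proof eventually_elim
      case (elim h)
      have e: "(P 0 (k + h) x - P 0 k x) / h = dq 0 h x" for x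
        using P0[OF elim] P0[OF k] by (simp add: dq_def p_def)
      have m: "dq 0 h \<in> borel_measurable borel" using H1_D(2)[OF H1_dq[OF elim, of 0]] by (rule L2_measurable)
      show ?case unfolding N_def e
      proof (rule sobolev_norm_chain[where F = "\<lambda>i x. dq i h x - U i x"])
        show "H1 (\<lambda>x. dq j h x - U j x) (\<lambda>x. dq (Suc j) h x - U (Suc j) x)" if "j < 6" for j
          using H1_diff[OF H1_dq[OF elim] U(1)] that by simp
        show "AE x in lborel. dq 0 h x - P (Suc 0) k x = dq 0 h x - U 0 x" using U(2) by eventually_elim simp
      qed (use m mP i in auto)
    qed
  qed simp
  then show ?thesis using U by blast
qed

text \<open>The supremum bound turns L2 convergence of the difference quotients and of their spatial
  derivatives into convergence at every point.\<close>

lemma pointwise_derivative: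
  assumes "H1 (U i) (U (Suc i))"
    "((\<lambda>h. ip (\<lambda>x. dq i h x - U i x) (\<lambda>x. dq i h x - U i x)) \<longlongrightarrow> 0) (at 0)"
    "((\<lambda>h. ip (\<lambda>x. dq (Suc i) h x - U (Suc i) x) (\<lambda>x. dq (Suc i) h x - U (Suc i) x)) \<longlongrightarrow> 0) (at 0)"
  shows "((\<lambda>\<kappa>. p \<kappa> i x) has_field_derivative U i x) (at k)"
proof -
  have "((\<lambda>h. (dq i h x - U i x)\<^sup>2) \<longlongrightarrow> 0) (at 0)"
  proof (rule tendsto_sandwich[of "\<lambda>h. 0"])
    show "((\<lambda>h. ip (\<lambda>x. dq i h x - U i x) (\<lambda>x. dq i h x - U i x)
      + ip (\<lambda>x. dq (Suc i) h x - U (Suc i) x) (\<lambda>x. dq (Suc i) h x - U (Suc i) x)) \<longlongrightarrow> 0) (at 0)"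
      using tendsto_add[OF assms(2,3)] by simp
    show "\<forall>\<^sub>F h in at 0. (dq i h x - U i x)\<^sup>2 \<le> ip (\<lambda>x. dq i h x - U i x) (\<lambda>x. dq i h x - U i x)
      + ip (\<lambda>x. dq (Suc i) h x - U (Suc i) x) (\<lambda>x. dq (Suc i) h x - U (Suc i) x)"
      using in_range
    proof eventually_elim
      case (elim h)
      show ?case using H1_sup_bound[OF H1_diff[OF H1_dq[OF elim] assms(1)], where x = x] by (simp add: n1_def)
    qed
  qed auto
  then have "((\<lambda>h. dq i h x - U i x) \<longlongrightarrow> 0) (at 0)" by (simp add: power_tendsto_0_iff)
  then have "((\<lambda>h. dq i h x) \<longlongrightarrow> U i x) (at 0)" by (rule LIM_zero_cancel)
  then show ?thesis by (simp add: DERIV_def dq_def)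
qed

lemma omega_derivatives:
  shows "(omega0 c has_field_derivative - 9 * (- (2/3) * k powr (-5/3) / (c - k\<^sup>2) + 2 * k powr (1/3) / (c - k\<^sup>2)\<^sup>2)) (at k)"
    and "(omega1 c has_field_derivative - 12 * k powr (-7/3) * (c + 2 * k\<^sup>2) / (c - k\<^sup>2) + 54 * c * k powr (-1/3) / (c - k\<^sup>2)\<^sup>2) (at k)"
proof -
  have d: "c - k\<^sup>2 \<noteq> 0" "k > 0" using ck k_pos by auto
  have P: "k powr (-2/3) * k = k powr (1/3)" "k powr (-4/3) * k = k powr (-1/3)"
    using k_pos powr_add[of k "-2/3" 1] powr_add[of k "-4/3" 1] by auto
  have 0: "((\<lambda>\<kappa>. - 9 * \<kappa> powr (-2/3) / (c - \<kappa>\<^sup>2)) has_field_derivative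
     - 9 * (- (2/3) * k powr (-5/3) / (c - k\<^sup>2) + 2 * k powr (1/3) / (c - k\<^sup>2)\<^sup>2)) (at k)"
  proof -
    define X where "X = k powr (-5/3)"
    define Y where "Y = k powr (-2/3)"
    have "((\<lambda>\<kappa>. \<kappa> powr (-2/3)) has_field_derivative (-2/3) * X) (at k)"
      unfolding X_def using has_real_derivative_powr[OF k_pos, of "-2/3"] by simp
    then have "((\<lambda>\<kappa>. - 9 * \<kappa> powr (-2/3) / (c - \<kappa>\<^sup>2)) has_field_derivative
      ((- 9 * ((-2/3) * X)) * (c - k\<^sup>2) - (- 9 * Y) * (- (2 * k))) / ((c - k\<^sup>2) * (c - k\<^sup>2))) (at k)"
      unfolding Y_def using d by (intro DERIV_divide DERIV_cmult) (auto intro!: derivative_eq_intros)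
    moreover have "((- 9 * ((-2/3) * X)) * (c - k\<^sup>2) - (- 9 * Y) * (- (2 * k))) / ((c - k\<^sup>2) * (c - k\<^sup>2))
      = - 9 * (- (2/3) * X / (c - k\<^sup>2) + 2 * (Y * k) / (c - k\<^sup>2)\<^sup>2)"
      using d by (simp add: divide_simps power2_eq_square) (simp add: algebra_simps)
    ultimately show ?thesis using P unfolding X_def Y_def by simp
  qed
  have 1: "((\<lambda>\<kappa>. 9 * \<kappa> powr (-4/3) * (c + 2 * \<kappa>\<^sup>2) / (c - \<kappa>\<^sup>2)) has_field_derivative
     - 12 * k powr (-7/3) * (c + 2 * k\<^sup>2) / (c - k\<^sup>2) + 54 * c * k powr (-1/3) / (c - k\<^sup>2)\<^sup>2) (at k)"
  proof -
    define X where "X = k powr (-7/3)"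
    define Y where "Y = k powr (-4/3)"
    have "((\<lambda>\<kappa>. \<kappa> powr (-4/3)) has_field_derivative (-4/3) * X) (at k)"
      unfolding X_def using has_real_derivative_powr[OF k_pos, of "-4/3"] by simp
    then have "((\<lambda>\<kappa>. (9 * \<kappa> powr (-4/3)) * (c + 2 * \<kappa>\<^sup>2) / (c - \<kappa>\<^sup>2)) has_field_derivative
      (((9 * ((-4/3) * X)) * (c + 2 * k\<^sup>2) + (4 * k) * (9 * Y)) * (c - k\<^sup>2) - (9 * Y * (c + 2 * k\<^sup>2)) * (- (2 * k))) / ((c - k\<^sup>2) * (c - k\<^sup>2))) (at k)"
      unfolding Y_def using d by (intro DERIV_divide DERIV_mult DERIV_cmult) (auto intro!: derivative_eq_intros)
    moreover have "(((9 * ((-4/3) * X)) * (c + 2 * k\<^sup>2) + (4 * k) * (9 * Y)) * (c - k\<^sup>2) - (9 * Y * (c + 2 * k\<^sup>2)) * (- (2 * k))) / ((c - k\<^sup>2) * (c - k\<^sup>2))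
      = - 12 * X * (c + 2 * k\<^sup>2) / (c - k\<^sup>2) + 54 * c * (Y * k) / (c - k\<^sup>2)\<^sup>2"
      using d by (simp add: divide_simps power2_eq_square) (simp add: algebra_simps)
    ultimately show ?thesis using P unfolding X_def Y_def by simp
  qed
  have ev: "\<forall>\<^sub>F \<kappa> in nhds k. \<kappa> \<in> {0<..<sqrt c / 2}" using k by (intro eventually_nhds_in_open) auto
  have e0: "\<forall>\<^sub>F \<kappa> in nhds k. omega0 c \<kappa> = - 9 * \<kappa> powr (-2/3) / (c - \<kappa>\<^sup>2)"
    using ev by eventually_elim (rule wave.w0_k[OF wave_at])
  have e1: "\<forall>\<^sub>F \<kappa> in nhds k. omega1 c \<kappa> = 9 * \<kappa> powr (-4/3) * (c + 2 * \<kappa>\<^sup>2) / (c - \<kappa>\<^sup>2)"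
    using ev by eventually_elim (rule wave.w1_k[OF wave_at])
  show "(omega0 c has_field_derivative - 9 * (- (2/3) * k powr (-5/3) / (c - k\<^sup>2) + 2 * k powr (1/3) / (c - k\<^sup>2)\<^sup>2)) (at k)"
    using 0 DERIV_cong_ev[OF refl e0 refl] by blast
  show "(omega1 c has_field_derivative - 12 * k powr (-7/3) * (c + 2 * k\<^sup>2) / (c - k\<^sup>2) + 54 * c * k powr (-1/3) / (c - k\<^sup>2)\<^sup>2) (at k)"
    using 1 DERIV_cong_ev[OF refl e1 refl] by blast
qed

text \<open>The equation is differentiated in the parameter at fixed \<open>x\<close>; besides the
  linearization this produces the derivatives of the two multipliers.\<close>

lemma Euler_Lagrange_derivative:
  fixes U W W1 W2 W0' W1' :: real
  assumes U: "((\<lambda>\<kappa>. \<Phi> \<kappa> x) has_field_derivative U) (at k)"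
    and W: "((\<lambda>\<kappa>. momentum (\<Phi> \<kappa>) x) has_field_derivative W) (at k)"
    and W1: "((\<lambda>\<kappa>. deriv (momentum (\<Phi> \<kappa>)) x) has_field_derivative W1) (at k)"
    and W2: "((\<lambda>\<kappa>. deriv (deriv (momentum (\<Phi> \<kappa>))) x) has_field_derivative W2) (at k)"
    and w: "(omega0 c has_field_derivative W0') (at k)" "(omega1 c has_field_derivative W1') (at k)"
  shows "2 * W0' * \<Phi> k x + 2 * w0 * U + 2 / 3 * W1' * \<mu> x powr (-1/3) + Lin x W W1 W2 = 0"
proof -
  define f where "f = (\<lambda>\<kappa>. momentum (\<Phi> \<kappa>) x)"
  define f1 where "f1 = (\<lambda>\<kappa>. deriv (momentum (\<Phi> \<kappa>)) x)"
  define f2 where "f2 = (\<lambda>\<kappa>. deriv (deriv (momentum (\<Phi> \<kappa>))) x)"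
  define g where "g = (\<lambda>\<kappa>. \<Phi> \<kappa> x)"
  have pos: "f k > 0" unfolding f_def by (rule mu_pos)
  have pw: "((\<lambda>\<kappa>. f \<kappa> powr r) has_field_derivative r * f k powr (r - 1) * W) (at k)" for r
    using DERIV_chain'[OF W[folded f_def] has_real_derivative_powr[OF pos, of r]] by (simp add: mult_ac)
  define EL where "EL = (\<lambda>\<kappa>. 2 * (omega0 c \<kappa> * g \<kappa>) + 2 / 3 * (omega1 c \<kappa> * f \<kappa> powr (-1/3)) - 2 * (f \<kappa> powr (-8/3) * f2 \<kappa>)
     + 8 / 3 * (f \<kappa> powr (-11/3) * (f1 \<kappa> * f1 \<kappa>)) - 6 * f \<kappa> powr (-5/3))"
  have ev: "\<forall>\<^sub>F \<kappa> in nhds k. \<kappa> \<in> {0<..<sqrt c / 2}" using k by (intro eventually_nhds_in_open) auto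
  have EV: "\<forall>\<^sub>F \<kappa> in nhds k. EL \<kappa> = 0" using ev
  proof eventually_elim
    case (elim \<kappa>)
    interpret v: wave c \<kappa> "\<Phi> \<kappa>" by (rule wave_at[OF elim])
    show ?case using v.Euler_Lagrange[of x]
      by (simp add: EL_def f_def f1_def f2_def g_def v.\<mu>1_def v.\<mu>2_def power2_eq_square mult_ac)
  qed
  have "(EL has_field_derivative 0) (at k)" by (rule iffD2[OF DERIV_cong_ev[OF refl EV refl] DERIV_const])
  moreover have "(EL has_field_derivative
      2 * (W0' * g k + U * omega0 c k) + 2 / 3 * (W1' * f k powr (-1/3) + ((-1/3) * f k powr (-1/3 - 1) * W) * omega1 c k)
      - 2 * (((-8/3) * f k powr (-8/3 - 1) * W) * f2 k + W2 * f k powr (-8/3))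
      + 8 / 3 * (((-11/3) * f k powr (-11/3 - 1) * W) * (f1 k * f1 k) + (W1 * f1 k + W1 * f1 k) * f k powr (-11/3))
      - 6 * ((-5/3) * f k powr (-5/3 - 1) * W)) (at k)"
    unfolding EL_def
    by (intro DERIV_add DERIV_diff DERIV_cmult DERIV_mult pw w U[folded g_def] W1[folded f1_def] W2[folded f2_def])
  ultimately have "2 * (W0' * g k + U * omega0 c k) + 2 / 3 * (W1' * f k powr (-1/3) + ((-1/3) * f k powr (-1/3 - 1) * W) * omega1 c k)
      - 2 * (((-8/3) * f k powr (-8/3 - 1) * W) * f2 k + W2 * f k powr (-8/3))
      + 8 / 3 * (((-11/3) * f k powr (-11/3 - 1) * W) * (f1 k * f1 k) + (W1 * f1 k + W1 * f1 k) * f k powr (-11/3))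
      - 6 * ((-5/3) * f k powr (-5/3 - 1) * W) = 0" using DERIV_unique by metis
  moreover have "f k = \<mu> x" "f1 k = \<mu>1 x" "f2 k = \<mu>2 x" "g k = \<Phi> k x"
    by (auto simp: f_def f1_def f2_def g_def \<mu>1_def \<mu>2_def)
  ultimately show ?thesis by (simp add: Lin_def power2_eq_square field_simps)
qed

text \<open>The quadratic part is nonnegative, and \<open>prem (2/3)\<close> is at most 0 because
  the power \<open>2/3\<close> is concave; in terms of cube roots this is
  \<open>(z - y)\<^sup>2 (2 z + y) \<ge> 0\<close>.\<close>

lemma F_mu_nonneg: "F_functional k \<mu> \<ge> 0"
proof -
  have "prem (2/3) k (\<mu> x) \<le> 0" for x
  proof -
    define y where "y = k powr (1/3)"
    define z where "z = \<mu> x powr (1/3)"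
    have y: "y > 0" "y ^ 3 = k" and z: "z > 0" "z ^ 3 = \<mu> x"
      using k_pos mu_pos[of x] by (auto simp: y_def z_def powr_powr simp flip: powr_numeral)
    have P: "k powr (2/3) = y\<^sup>2" "\<mu> x powr (2/3) = z\<^sup>2" "k powr (2/3 - 1) = 1 / y"
      using k_pos mu_pos[of x] by (auto simp: y_def z_def powr_powr powr_minus_divide simp flip: powr_numeral)
    have "0 \<le> (z - y)\<^sup>2 * (2 * z + y)" using y z by (intro mult_nonneg_nonneg) auto
    then have "3 * y * z\<^sup>2 - 3 * y ^ 3 - 2 * (z ^ 3 - y ^ 3) \<le> 0"
      by (simp add: power2_eq_square power3_eq_cube algebra_simps)
    moreover have "3 * y * prem (2/3) k (\<mu> x) = 3 * y * z\<^sup>2 - 3 * y ^ 3 - 2 * (z ^ 3 - y ^ 3)"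
      unfolding prem_def P using y z by (simp add: field_simps power2_eq_square power3_eq_cube)
    ultimately have "3 * y * prem (2/3) k (\<mu> x) \<le> 0" by linarith
    then show ?thesis using y(1) by (simp add: mult_le_0_iff)
  qed
  then have "(LINT x|lborel. prem (2/3) k (\<mu> x)) \<le> 0" using Bochner_Integration.integral_nonneg[of lborel "\<lambda>x. - prem (2/3) k (\<mu> x)"] by simp
  then have "3 * k powr (4/3) * (LINT x|lborel. prem (2/3) k (\<mu> x)) \<le> 0" by (intro mult_nonneg_nonpos) auto
  moreover have "ip w (helmholtz_inv w) \<ge> 0"
    using helmholtz_bounds(1)[OF H1_D(2)[OF H1_waves(1)]] by (simp add: ip_commute[of w])
  ultimately show ?thesis using F_functional_eq[OF mu_X k_pos] by (simp add: w_def)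
qed

text \<open>\<open>F_functional\<close> changes with its background, so the expansion at
  \<open>\<mu>\<close> applies to nearby waves only after they are rescaled by
  \<open>k / (k + h)\<close>. The expansion and the homogeneity give two values for the derivative
  of the rescaled functional: the pairing to be estimated, and
  \<open>D - 2 / k * F_functional k \<mu>\<close>.\<close>

lemma slope_sign:
  assumes D: "((\<lambda>\<kappa>. F_functional \<kappa> (momentum (\<Phi> \<kappa>))) has_real_derivative D) (at k)" "D < 0"
    and W: "H1 W W1"
      "((\<lambda>h. ip (\<lambda>x. (dq 0 h x - dq 2 h x) - W x) (\<lambda>x. (dq 0 h x - dq 2 h x) - W x)) \<longlongrightarrow> 0) (at 0)"
      "((\<lambda>h. ip (\<lambda>x. (dq 1 h x - dq 3 h x) - W1 x) (\<lambda>x. (dq 1 h x - dq 3 h x) - W1 x)) \<longlongrightarrow> 0) (at 0)"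
  shows "ip Fp (\<lambda>x. W x - w x / k) < 0"
proof -
  note wH = H1_waves(1)
  have WL: "L2 W" "L2 w" using W(1) wH by (auto simp: H1_def)
  define q where "q = (\<lambda>h x. dq 0 h x - dq 2 h x)"
  define q' where "q' = (\<lambda>h x. dq 1 h x - dq 3 h x)"
  have qH: "H1 (q h) (q' h)" if "k + h \<in> {0<..<sqrt c / 2}" for h
    using H1_diff[OF H1_dq[OF that, of 0] H1_dq[OF that, of 2]] by (simp add: q_def q'_def)
  define e where "e = (\<lambda>h. n1 (\<lambda>x. q h x - W x) (\<lambda>x. q' h x - W1 x))"
  have e: "(e \<longlongrightarrow> 0) (at 0)" unfolding e_def n1_def q_def q'_def using tendsto_add[OF W(2,3)] by simp
  have e0: "e h \<ge> 0" for h unfolding e_def by (rule n1_nonneg)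
  \<comment> \<open>The rescaled wave is \<open>\<mu> + h * y h\<close>, and \<open>y h\<close>
    tends to \<open>W - w / k\<close>.\<close>
  define y where "y = (\<lambda>h x. (k / (k + h)) * q h x - (1 / (k + h)) * w x)"
  define y' where "y' = (\<lambda>h x. (k / (k + h)) * q' h x - (1 / (k + h)) * \<mu>1 x)"
  have yH: "H1 (y h) (y' h)" if "k + h \<in> {0<..<sqrt c / 2}" for h
    unfolding y_def y'_def by (intro H1_diff H1_cmult qH that wH)
  have scale: "(k / (k + h)) * momentum (\<Phi> (k + h)) x = \<mu> x + h * y h x" if h: "k + h \<in> {0<..<sqrt c / 2}" "h \<noteq> 0" for h x
  proof -
    have kh: "k + h > 0" using h by auto
    have "h * q h x = (momentum (\<Phi> (k + h)) x - (k + h)) - w x"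
    proof -
      have hd: "h * dq i h x = p (k + h) i x - p k i x" for i using h(2) by (simp add: dq_def)
      show ?thesis unfolding q_def right_diff_distrib hd p_values(2)[OF h(1)] w_def p_values(2)[OF k] by simp
    qed
    then have m: "momentum (\<Phi> (k + h)) x = h * q h x + w x + (k + h)" by simp
    define v where "v = 1 / (k + h)"
    have v: "v * (k + h) = 1" "k / (k + h) = k * v" using kh by (auto simp: v_def)
    have "k * v * (h * q h x + w x + (k + h)) = w x + k + h * (k * v * q h x - v * w x)"
    proof -
      have kv: "k * v = 1 - h * v" using v(1) by (simp add: algebra_simps)
      have "k * v * (h * q h x + w x + (k + h)) = h * (k * v * q h x) + (k * v) * w x + k * (v * (k + h))" by (simp add: algebra_simps)
      moreover have "(k * v) * w x = w x - h * (v * w x)" unfolding kv by (simp add: algebra_simps)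
      ultimately show ?thesis unfolding v(1) right_diff_distrib by simp
    qed
    then show ?thesis unfolding m y_def v_def[symmetric] v(2) by (simp add: w_def)
  qed
  \<comment> \<open>A bound for the squared norm of \<open>y h\<close> that stays finite as
    \<open>h\<close> tends to 0; the quadratic error therefore vanishes after division by
    \<open>h\<close>.\<close>
  define B where "B = (\<lambda>h. 2 * (k / (k + h))\<^sup>2 * (2 * e h + 2 * n1 W W1) + 2 * (1 / (k + h))\<^sup>2 * n1 w \<mu>1)"
  have Bb: "n1 (y h) (y' h) \<le> B h" if h: "k + h \<in> {0<..<sqrt c / 2}" for h
  proof -
    have "n1 (y h) (y' h) \<le> 2 * ((k / (k + h))\<^sup>2 * n1 (q h) (q' h)) + 2 * ((1 / (k + h))\<^sup>2 * n1 w \<mu>1)"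
      using n1_add_le[OF H1_cmult[OF qH[OF h], of "k / (k + h)"] H1_cmult[OF wH, of "- 1 / (k + h)"]]
      unfolding n1_cmult by (simp add: y_def y'_def)
    moreover have "n1 (q h) (q' h) \<le> 2 * e h + 2 * n1 W W1"
      using n1_add_le[OF H1_diff[OF qH[OF h] W(1)] W(1)] by (simp add: e_def)
    then have "(k / (k + h))\<^sup>2 * n1 (q h) (q' h) \<le> (k / (k + h))\<^sup>2 * (2 * e h + 2 * n1 W W1)" by (rule mult_left_mono) simp
    ultimately show ?thesis unfolding B_def by simp
  qed
  have kl: "((\<lambda>h. k + h) \<longlongrightarrow> k) (at 0)" using tendsto_add[OF tendsto_const tendsto_ident_at, of k 0] by simp
  have k0: "k \<noteq> 0" using k_pos by simp
  have Bl: "(B \<longlongrightarrow> 2 * (k / k)\<^sup>2 * (2 * 0 + 2 * n1 W W1) + 2 * (1 / k)\<^sup>2 * n1 w \<mu>1) (at 0)"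
    unfolding B_def by (intro tendsto_intros kl e k0)
  have hl: "((\<lambda>h::real. h) \<longlongrightarrow> 0) (at 0)" by (rule tendsto_ident_at)
  obtain C r where C: "C \<ge> 0" "r > 0" "\<And>h h1. H1 h h1 \<Longrightarrow> (\<forall>x. \<bar>h x\<bar> \<le> r) \<Longrightarrow> (\<lambda>x. \<mu> x + h x) \<in> X_space k \<Longrightarrow>
     \<bar>F_functional k (\<lambda>x. \<mu> x + h x) - F_functional k \<mu> - ip Fp h\<bar> \<le> C * ip h h" using F_expansion by blast
  define G where "G = (\<lambda>h. (k / (k + h))\<^sup>2 * F_functional (k + h) (momentum (\<Phi> (k + h))))"
  have small: "\<forall>\<^sub>F h in at 0. h\<^sup>2 * B h < r\<^sup>2"
  proof (rule order_tendstoD(2))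
    show "((\<lambda>h. h\<^sup>2 * B h) \<longlongrightarrow> 0\<^sup>2 * (2 * (k / k)\<^sup>2 * (2 * 0 + 2 * n1 W W1) + 2 * (1 / k)\<^sup>2 * n1 w \<mu>1)) (at 0)"
      by (intro tendsto_intros Bl)
  qed (use C(2) in simp)
  have nz: "\<forall>\<^sub>F h in at 0. h \<noteq> (0::real)" by (simp add: eventually_at_filter)
  have est: "\<forall>\<^sub>F h in at 0. \<bar>(G h - F_functional k \<mu>) / h - ip Fp (y h)\<bar> \<le> C * \<bar>h\<bar> * B h"
    using in_range small nz
  proof eventually_elim
    case (elim h)
    have kh: "k + h > 0" using elim by auto
    note yh = yH[OF elim(1)]
    have H: "H1 (\<lambda>x. h * y h x) (\<lambda>x. h * y' h x)" by (rule H1_cmult[OF yh])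
    have n: "n1 (\<lambda>x. h * y h x) (\<lambda>x. h * y' h x) \<le> h\<^sup>2 * B h"
      unfolding n1_cmult by (intro mult_left_mono Bb elim) auto
    have sup: "\<bar>h * y h x\<bar> \<le> r" for x
    proof -
      have "(h * y h x)\<^sup>2 \<le> r\<^sup>2" using H1_sup_bound[OF H, of x] n elim(2) by linarith
      then show ?thesis using C(2) by (simp add: abs_le_square_iff[symmetric])
    qed
    have mpos: "momentum (\<Phi> (k + h)) x > 0" for x by (rule wave.mu_pos[OF wave_at[OF elim(1)]])
    have eq: "(\<lambda>x. \<mu> x + h * y h x) = (\<lambda>x. (k / (k + h)) * momentum (\<Phi> (k + h)) x)" using scale[OF elim(1,3)] by simp
    have X: "(\<lambda>x. \<mu> x + h * y h x) \<in> X_space k"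
    proof -
      have "continuous_on UNIV (\<lambda>x. \<mu> x + h * y h x)"
        by (intro continuous_intros cont ac_continuous[OF H1_D(1)[OF yh]])
      moreover have "sobolev 1 (\<lambda>x. \<mu> x + h * y h x - k)"
        using H1_imp_sobolev(1)[OF H1_add[OF wH H]] by (simp add: w_def algebra_simps)
      moreover have "\<mu> x + h * y h x > 0" for x using fun_cong[OF eq, of x] mpos[of x] k_pos kh by simp
      ultimately show ?thesis by (simp add: X_space_def)
    qed
    have Gh: "F_functional k (\<lambda>x. \<mu> x + h * y h x) = G h"
      unfolding eq G_def using F_functional_scale[of "k / (k + h)" "k + h" "momentum (\<Phi> (k + h))"] k_pos kh mpos by simp
    have "\<bar>G h - F_functional k \<mu> - h * ip Fp (y h)\<bar> \<le> C * (h\<^sup>2 * B h)"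
    proof -
      have "ip (\<lambda>x. h * y h x) (\<lambda>x. h * y h x) \<le> n1 (\<lambda>x. h * y h x) (\<lambda>x. h * y' h x)"
        by (simp add: n1_def ip_nonneg)
      then have "C * ip (\<lambda>x. h * y h x) (\<lambda>x. h * y h x) \<le> C * (h\<^sup>2 * B h)" using n C(1) by (intro mult_left_mono) auto
      moreover have "ip Fp (\<lambda>x. h * y h x) = h * ip Fp (y h)"
        unfolding ip_commute[of Fp "\<lambda>x. h * y h x"] ip_commute[of Fp "y h"] by (rule ip_cmult)
      ultimately show ?thesis using C(3)[OF H _ X] sup unfolding Gh by fastforce
    qed
    then have "\<bar>G h - F_functional k \<mu> - h * ip Fp (y h)\<bar> / \<bar>h\<bar> \<le> C * (h\<^sup>2 * B h) / \<bar>h\<bar>" by (rule divide_right_mono) simp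
    moreover have "\<bar>G h - F_functional k \<mu> - h * ip Fp (y h)\<bar> / \<bar>h\<bar> = \<bar>(G h - F_functional k \<mu>) / h - ip Fp (y h)\<bar>"
      using elim(3) unfolding abs_divide[symmetric] by (simp add: diff_divide_distrib)
    moreover have "C * (h\<^sup>2 * B h) / \<bar>h\<bar> = C * \<bar>h\<bar> * B h"
      using elim(3) by (simp add: power2_eq_square abs_if)
    ultimately show ?case by simp
  qed
  have "((\<lambda>h. C * \<bar>h\<bar> * B h) \<longlongrightarrow> C * \<bar>0\<bar> * (2 * (k / k)\<^sup>2 * (2 * 0 + 2 * n1 W W1) + 2 * (1 / k)\<^sup>2 * n1 w \<mu>1)) (at 0)"
    by (intro tendsto_intros Bl)
  then have "((\<lambda>h. C * \<bar>h\<bar> * B h) \<longlongrightarrow> 0) (at 0)" by simp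
  then have lim1: "((\<lambda>h. (G h - F_functional k \<mu>) / h - ip Fp (y h)) \<longlongrightarrow> 0) (at 0)"
    by (rule Lim_null_comparison[rotated]) (use est in simp)
  have qW: "((\<lambda>h. ip Fp (q h)) \<longlongrightarrow> ip Fp W) (at 0)"
  proof (rule LIM_zero_cancel, rule Lim_null_comparison)
    show "\<forall>\<^sub>F h in at 0. norm (ip Fp (q h) - ip Fp W) \<le> sqrt (ip Fp Fp) * sqrt (e h)" using in_range
    proof eventually_elim
      case (elim h)
      have L: "L2 (q h)" using qH[OF elim] by (simp add: H1_def)
      have 1: "ip Fp (q h) - ip Fp W = ip Fp (\<lambda>x. q h x - W x)"
        unfolding ip_commute[of Fp "q h"] ip_commute[of Fp W] ip_commute[of Fp "\<lambda>x. q h x - W x"]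
        by (rule ip_diff[OF L WL(1) Fp_L2, symmetric])
      have 2: "\<bar>ip Fp (\<lambda>x. q h x - W x)\<bar> \<le> sqrt (ip Fp Fp) * sqrt (ip (\<lambda>x. q h x - W x) (\<lambda>x. q h x - W x))"
        by (rule ip_abs_le[OF Fp_L2 L2_diff[OF L WL(1)]])
      have "ip (\<lambda>x. q h x - W x) (\<lambda>x. q h x - W x) \<le> e h" by (simp add: e_def n1_def ip_nonneg)
      then have 3: "sqrt (ip Fp Fp) * sqrt (ip (\<lambda>x. q h x - W x) (\<lambda>x. q h x - W x)) \<le> sqrt (ip Fp Fp) * sqrt (e h)"
        by (intro mult_left_mono real_sqrt_le_mono) (auto simp: ip_nonneg)
      show ?case unfolding 1 real_norm_def by (rule order_trans[OF 2 3])
    qed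
    show "((\<lambda>h. sqrt (ip Fp Fp) * sqrt (e h)) \<longlongrightarrow> 0) (at 0)"
      using tendsto_mult[OF tendsto_const[of "sqrt (ip Fp Fp)"] tendsto_real_sqrt[OF e]] by simp
  qed
  have l1: "((\<lambda>h. (k / (k + h)) * ip Fp (q h) - (1 / (k + h)) * ip Fp w) \<longlongrightarrow> (k / k) * ip Fp W - (1 / k) * ip Fp w) (at 0)"
    by (intro tendsto_intros kl qW k0)
  have l2: "\<forall>\<^sub>F h in at 0. (k / (k + h)) * ip Fp (q h) - (1 / (k + h)) * ip Fp w = ip Fp (y h)" using in_range
  proof eventually_elim
    case (elim h)
    have L: "L2 (q h)" using qH[OF elim] by (simp add: H1_def)
    have "ip (y h) Fp = ip (\<lambda>x. k / (k + h) * q h x) Fp - ip (\<lambda>x. 1 / (k + h) * w x) Fp"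
      unfolding y_def by (rule ip_diff[OF L2_cmult[OF L] L2_cmult[OF WL(2)] Fp_L2])
    also have "\<dots> = k / (k + h) * ip (q h) Fp - 1 / (k + h) * ip w Fp" by (simp only: ip_cmult)
    finally show ?case unfolding ip_commute[of Fp "q h"] ip_commute[of Fp w] ip_commute[of Fp "y h"] by simp
  qed
  have lim2: "((\<lambda>h. ip Fp (y h)) \<longlongrightarrow> (k / k) * ip Fp W - (1 / k) * ip Fp w) (at 0)"
    by (rule Lim_transform_eventually[OF l1 l2])
  define \<Psi> where "\<Psi> = ip Fp (\<lambda>x. W x - w x / k)"
  have Psi: "\<Psi> = (k / k) * ip Fp W - (1 / k) * ip Fp w"
  proof -
    have e: "(\<lambda>x. W x - w x / k) = (\<lambda>x. W x - 1 / k * w x)" by simp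
    have "ip (\<lambda>x. W x - 1 / k * w x) Fp = ip W Fp - ip (\<lambda>x. 1 / k * w x) Fp"
      by (rule ip_diff[OF WL(1) L2_cmult[OF WL(2)] Fp_L2])
    also have "\<dots> = ip W Fp - 1 / k * ip w Fp" by (simp only: ip_cmult)
    finally show ?thesis unfolding \<Psi>_def e ip_commute[of Fp "\<lambda>x. W x - 1 / k * w x"] ip_commute[of Fp W] ip_commute[of Fp w]
      using k0 by simp
  qed
  have "((\<lambda>h. ((G h - F_functional k \<mu>) / h - ip Fp (y h)) + ip Fp (y h)) \<longlongrightarrow> 0 + \<Psi>) (at 0)"
    unfolding Psi by (rule tendsto_add[OF lim1 lim2])
  then have "((\<lambda>h. (G h - F_functional k \<mu>) / h) \<longlongrightarrow> \<Psi>) (at 0)" by simp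
  moreover have "G 0 = F_functional k \<mu>" using k0 by (simp add: G_def)
  ultimately have "((\<lambda>h. (G (0 + h) - G 0) / h) \<longlongrightarrow> \<Psi>) (at 0)" by (simp only: add_0_left)
  then have dG: "(G has_field_derivative \<Psi>) (at 0)" unfolding DERIV_def .
  have kh: "((\<lambda>h. k + h) has_field_derivative 1) (at 0)"
    by (auto intro!: derivative_eq_intros)
  have "((\<lambda>\<kappa>. F_functional \<kappa> (momentum (\<Phi> \<kappa>))) has_real_derivative D) (at (k + 0))" using D(1) by simp
  from DERIV_chain2[where f = "\<lambda>\<kappa>. F_functional \<kappa> (momentum (\<Phi> \<kappa>))" and g = "\<lambda>h. k + h", OF this kh]
  have dF: "((\<lambda>h. F_functional (k + h) (momentum (\<Phi> (k + h)))) has_field_derivative D) (at 0)" by (simp only: mult_1_right)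
  have b: "((\<lambda>h. k / (k + h)) has_field_derivative - (1 / k)) (at 0)"
    using DERIV_divide[OF DERIV_const[of k] kh] k0 by simp
  have p2: "((\<lambda>h. (k / (k + h))\<^sup>2) has_field_derivative real 2 * (- (1 / k) * (k / (k + 0)) ^ (2 - Suc 0))) (at 0)"
    by (rule DERIV_power[OF b])
  have p3: "(G has_field_derivative real 2 * (- (1 / k) * (k / (k + 0)) ^ (2 - Suc 0)) * F_functional (k + 0) (momentum (\<Phi> (k + 0)))
      + D * (k / (k + 0))\<^sup>2) (at 0)" unfolding G_def by (rule DERIV_mult[OF p2 dF])
  have p4: "real 2 * (- (1 / k) * (k / (k + 0)) ^ (2 - Suc 0)) * F_functional (k + 0) (momentum (\<Phi> (k + 0)))
      + D * (k / (k + 0))\<^sup>2 = - 2 / k * F_functional k \<mu> + D" using k0 by simp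
  have "(G has_field_derivative (- 2 / k * F_functional k \<mu> + D)) (at 0)" using p3 unfolding p4 .
  then have "\<Psi> = - 2 / k * F_functional k \<mu> + D" by (rule DERIV_unique[OF dG])
  moreover have "2 / k * F_functional k \<mu> \<ge> 0" using F_mu_nonneg k_pos by simp
  ultimately show ?thesis using D(2) unfolding \<Psi>_def by simp
qed

text \<open>Subtracting \<open>1 / k\<close> times the scaling relation \<open>Lin_mu\<close> from
  the equation differentiated in the parameter leaves only multiples of the profile and of
  \<open>\<mu> powr (-1/3)\<close>, and these occur in the proportion found in
  \<open>Fp\<close>.\<close>

lemma constraint_direction:
  assumes D: "\<exists>D<0. ((\<lambda>\<kappa>. F_functional \<kappa> (momentum (\<Phi> \<kappa>))) has_real_derivative D) (at k)"
  shows "\<exists>psi psi1 psi2 \<gamma>. H2 psi psi1 psi2 \<and> (\<forall>x. Lin x (psi x) (psi1 x) (psi2 x) + 2 * w0 * helmholtz_inv psi x = \<gamma> * Fp x)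
     \<and> \<gamma> > 0 \<and> ip Fp psi < 0"
proof -
  obtain U where U: "\<And>i. i \<le> 5 \<Longrightarrow> H1 (U i) (U (Suc i))"
    "\<And>i. i \<le> 5 \<Longrightarrow> ((\<lambda>h. ip (\<lambda>x. dq i h x - U i x) (\<lambda>x. dq i h x - U i x)) \<longlongrightarrow> 0) (at 0)"
    using parameter_derivative by blast
  have UH: "H1 (U 0) (U 1)" "H1 (U 1) (U 2)" "H1 (U 2) (U 3)" "H1 (U 3) (U 4)" "H1 (U 4) (U 5)"
    using U(1)[of 0] U(1)[of 1] U(1)[of 2] U(1)[of 3] U(1)[of 4] by (simp_all add: eval_nat_numeral)
  have pd: "((\<lambda>\<kappa>. p \<kappa> i x) has_field_derivative U i x) (at k)" if "i \<le> 4" for i x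
    using that by (intro pointwise_derivative U) auto
  define W where "W = (\<lambda>x. U 0 x - U 2 x)"
  define W1 where "W1 = (\<lambda>x. U 1 x - U 3 x)"
  define W2 where "W2 = (\<lambda>x. U 2 x - U 4 x)"
  have WH: "H1 W W1" "H1 W1 W2" unfolding W_def W1_def W2_def by (intro H1_diff UH)+
  have HW: "helmholtz_inv W = U 0" unfolding W_def by (rule helmholtz_inverse[OF UH(1,2)])
  have lim: "((\<lambda>h. ip (\<lambda>x. (dq i h x - dq j h x) - (U i x - U j x)) (\<lambda>x. (dq i h x - dq j h x) - (U i x - U j x))) \<longlongrightarrow> 0) (at 0)"
    if ij: "i \<le> 5" "j \<le> 5" for i j
  proof (rule tendsto_sandwich[of "\<lambda>h. 0"])
    have "((\<lambda>h. 2 * ip (\<lambda>x. dq i h x - U i x) (\<lambda>x. dq i h x - U i x) + 2 * ip (\<lambda>x. dq j h x - U j x) (\<lambda>x. dq j h x - U j x)) \<longlongrightarrow> 2 * 0 + 2 * 0) (at 0)"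
      by (intro tendsto_intros U(2) ij)
    then show "((\<lambda>h. 2 * ip (\<lambda>x. dq i h x - U i x) (\<lambda>x. dq i h x - U i x) + 2 * ip (\<lambda>x. dq j h x - U j x) (\<lambda>x. dq j h x - U j x)) \<longlongrightarrow> 0) (at 0)"
      by simp
    show "\<forall>\<^sub>F h in at 0. ip (\<lambda>x. (dq i h x - dq j h x) - (U i x - U j x)) (\<lambda>x. (dq i h x - dq j h x) - (U i x - U j x))
      \<le> 2 * ip (\<lambda>x. dq i h x - U i x) (\<lambda>x. dq i h x - U i x) + 2 * ip (\<lambda>x. dq j h x - U j x) (\<lambda>x. dq j h x - U j x)"
      using in_range
    proof eventually_elim
      case (elim h)
      have L: "L2 (\<lambda>x. dq l h x - U l x)" if "l \<le> 5" for l
        using H1_D(2)[OF H1_diff[OF H1_dq[OF elim] U(1)[OF that]]] .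
      have e: "(\<lambda>x. (dq i h x - dq j h x) - (U i x - U j x)) = (\<lambda>x. (dq i h x - U i x) + (-1) * (dq j h x - U j x))" by (simp add: fun_eq_iff)
      have m: "ip (\<lambda>x. (-1) * (dq j h x - U j x)) (\<lambda>x. (-1) * (dq j h x - U j x)) = ip (\<lambda>x. dq j h x - U j x) (\<lambda>x. dq j h x - U j x)"
        by (simp add: ip_def algebra_simps)
      show ?case unfolding e using ip_sum_le[OF L[OF ij(1)] L2_cmult[OF L[OF ij(2)], of "-1"]] unfolding m .
    qed
  qed (auto simp: ip_nonneg)
  \<comment> \<open>Equal to \<open>1 + W - \<mu> / k\<close>, where \<open>1 + W\<close> is the
    parameter derivative of the momentum: the constants contributed by the moving background
    cancel.\<close>
  define psi where "psi = (\<lambda>x. W x - w x / k)"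
  define psi1 where "psi1 = (\<lambda>x. W1 x + (- 1 / k) * \<mu>1 x)"
  define psi2 where "psi2 = (\<lambda>x. W2 x + (- 1 / k) * \<mu>2 x)"
  have H: "H2 psi psi1 psi2"
  proof -
    have e: "psi = (\<lambda>x. W x + (- 1 / k) * w x)" by (simp add: psi_def fun_eq_iff)
    show ?thesis unfolding H2_def e psi1_def psi2_def by (intro conjI H1_add H1_cmult WH H1_waves)
  qed
  \<comment> \<open>Half the coefficient of the profile computed in \<open>qc\<close>; the
    coefficient in \<open>mc\<close> is \<open>- k powr (4/3)\<close> times that of
    \<open>qc\<close>, as in \<open>Fp\<close>.\<close>
  define \<gamma> where "\<gamma> = 18 * c * k powr (-5/3) / (c - k\<^sup>2)\<^sup>2"
  have g: "\<gamma> > 0" unfolding \<gamma>_def using c k_pos ck by simp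
  have eq: "Lin x (psi x) (psi1 x) (psi2 x) + 2 * w0 * helmholtz_inv psi x = \<gamma> * Fp x" for x
  proof -
    have ev: "\<forall>\<^sub>F \<kappa> in nhds k. \<kappa> \<in> {0<..<sqrt c / 2}" using k by (intro eventually_nhds_in_open) auto
    have "((\<lambda>\<kappa>. \<Phi> \<kappa> x) has_field_derivative 1 + U 0 x) (at k)"
      by (subst DERIV_cong_ev[OF refl eventually_mono[OF ev] refl, where g = "\<lambda>\<kappa>. \<kappa> + p \<kappa> 0 x"])
         (auto simp: p_values intro!: DERIV_add pd derivative_eq_intros)
    moreover have "((\<lambda>\<kappa>. momentum (\<Phi> \<kappa>) x) has_field_derivative 1 + W x) (at k)"
      unfolding W_def by (subst DERIV_cong_ev[OF refl eventually_mono[OF ev] refl, where g = "\<lambda>\<kappa>. \<kappa> + (p \<kappa> 0 x - p \<kappa> 2 x)"])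
         (auto simp: p_values intro!: DERIV_add DERIV_diff pd derivative_eq_intros)
    moreover have "((\<lambda>\<kappa>. deriv (momentum (\<Phi> \<kappa>)) x) has_field_derivative W1 x) (at k)"
      unfolding W1_def by (subst DERIV_cong_ev[OF refl eventually_mono[OF ev] refl, where g = "\<lambda>\<kappa>. p \<kappa> 1 x - p \<kappa> 3 x"])
         (auto simp: p_values intro!: DERIV_diff pd)
    moreover have "((\<lambda>\<kappa>. deriv (deriv (momentum (\<Phi> \<kappa>))) x) has_field_derivative W2 x) (at k)"
      unfolding W2_def by (subst DERIV_cong_ev[OF refl eventually_mono[OF ev] refl, where g = "\<lambda>\<kappa>. p \<kappa> 2 x - p \<kappa> 4 x"])
         (auto simp: p_values intro!: DERIV_diff pd)
    ultimately have E: "2 * (- 9 * (- (2/3) * k powr (-5/3) / (c - k\<^sup>2) + 2 * k powr (1/3) / (c - k\<^sup>2)\<^sup>2)) * \<Phi> k x + 2 * w0 * (1 + U 0 x)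
       + 2 / 3 * (- 12 * k powr (-7/3) * (c + 2 * k\<^sup>2) / (c - k\<^sup>2) + 54 * c * k powr (-1/3) / (c - k\<^sup>2)\<^sup>2) * \<mu> x powr (-1/3)
       + Lin x (1 + W x) (W1 x) (W2 x) = 0"
      by (rule Euler_Lagrange_derivative[OF _ _ _ _ omega_derivatives])
    have L: "Lin x (psi x) (psi1 x) (psi2 x) = Lin x (1 + W x) (W1 x) (W2 x) + (- 1 / k) * Lin x (\<mu> x) (\<mu>1 x) (\<mu>2 x)"
    proof -
      have "psi x = 1 + W x + (- 1 / k) * \<mu> x" using k_pos by (simp add: psi_def w_def field_simps)
      then show ?thesis unfolding psi1_def psi2_def by (simp only: Lin_lin)
    qed
    have Hp: "helmholtz_inv psi x = 1 + U 0 x - \<Phi> k x / k"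
    proof -
      have "psi = (\<lambda>x. W x + (- 1 / k) * w x)" by (simp add: psi_def fun_eq_iff)
      then show ?thesis using helmholtz_linear[OF H1_D(2)[OF WH(1)] H1_D(2)[OF H1_waves(1)], of "- 1 / k" x]
        HW helmholtz_w k_pos by (simp add: field_simps)
    qed
    \<comment> \<open>With \<open>y\<close> the cube root of \<open>k\<close> and
      \<open>d = c - k\<^sup>2\<close>, all coefficients become rational functions of
      \<open>y\<close> and \<open>d\<close>.\<close>
    define y where "y = k powr (1/3)"
    have y: "y > 0" "y ^ 3 = k" using k_pos by (auto simp: y_def powr_powr simp flip: powr_numeral)
    have P: "k powr (-2/3) = 1 / y\<^sup>2" "k powr (-4/3) = 1 / y ^ 4" "k powr (-1/3) = 1 / y" "k powr (-5/3) = 1 / y ^ 5" "k powr (-7/3) = 1 / y ^ 7"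
      using powr_third[OF y(1), of 2] powr_third[OF y(1), of 4] powr_third[OF y(1), of 1] powr_third[OF y(1), of 5] powr_third[OF y(1), of 7] y(2) by auto
    have P4: "k powr (4/3) = y ^ 4" using k_pos by (simp add: y_def powr_powr flip: powr_numeral)
    define d where "d = c - k\<^sup>2"
    have d: "d > 0" "k\<^sup>2 = c - d" using ck by (auto simp: d_def)
    have w0e: "w0 = - 9 / (y\<^sup>2 * d)" and w1e: "w1 = 9 * (c + 2 * k\<^sup>2) / (y ^ 4 * d)"
      using w0_k w1_k unfolding P d_def by auto
    define M where "M = \<mu> x powr (-1/3)"
    define Q where "Q = \<Phi> k x"
    have c6: "c = d + y ^ 6" using y(2) d(2) by (simp add: power_mult[symmetric] flip: y(2))
    have "Lin x (1 + W x) (W1 x) (W2 x) + 2 * w0 * (1 + U 0 x)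
      = - (2 * (- 9 * (- (2/3) * (1 / y ^ 5) / d + 2 * y / d\<^sup>2)) * Q
       + 2 / 3 * (- 12 * (1 / y ^ 7) * (c + 2 * k\<^sup>2) / d + 54 * c * (1 / y) / d\<^sup>2) * M)"
      using E unfolding P y_def[symmetric] M_def[symmetric] Q_def[symmetric] d_def[symmetric] by linarith
    then have "Lin x (psi x) (psi1 x) (psi2 x) + 2 * w0 * helmholtz_inv psi x
      = - (2 * (- 9 * (- (2/3) * (1 / y ^ 5) / d + 2 * y / d\<^sup>2)) * Q
       + 2 / 3 * (- 12 * (1 / y ^ 7) * (c + 2 * k\<^sup>2) / d + 54 * c * (1 / y) / d\<^sup>2) * M)
       - (10 / 3 * w0 * Q + 8 / 9 * w1 * M) / k - 2 * w0 * Q / k"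
      unfolding L Hp Lin_mu M_def[symmetric] Q_def[symmetric] by (simp add: algebra_simps add_divide_distrib diff_divide_distrib)
    also have "\<dots> = 18 * c * (1 / y ^ 5) / d\<^sup>2 * (2 * Q - 2 * y ^ 4 * M)"
    proof -
      have qc: "- (2 * (- 9 * (- (2/3) * (1 / y ^ 5) / d + 2 * y / d\<^sup>2))) - 10 / 3 * w0 / k - 2 * w0 / k = 36 * c / (y ^ 5 * d\<^sup>2)"
        unfolding w0e unfolding y(2)[symmetric] unfolding c6 using y(1) d(1)
        by (simp add: divide_simps) (simp add: algebra_simps power2_eq_square eval_nat_numeral)
      have mc: "- (2 / 3 * (- 12 * (1 / y ^ 7) * (c + 2 * k\<^sup>2) / d + 54 * c * (1 / y) / d\<^sup>2)) - 8 / 9 * w1 / k = - 36 * c / (y * d\<^sup>2)"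
        unfolding w1e unfolding y(2)[symmetric] unfolding c6 using y(1) d(1)
        by (simp add: divide_simps) (simp add: algebra_simps power2_eq_square eval_nat_numeral)
      have "- (2 * (- 9 * (- (2/3) * (1 / y ^ 5) / d + 2 * y / d\<^sup>2)) * Q
       + 2 / 3 * (- 12 * (1 / y ^ 7) * (c + 2 * k\<^sup>2) / d + 54 * c * (1 / y) / d\<^sup>2) * M)
       - (10 / 3 * w0 * Q + 8 / 9 * w1 * M) / k - 2 * w0 * Q / k
        = (- (2 * (- 9 * (- (2/3) * (1 / y ^ 5) / d + 2 * y / d\<^sup>2))) - 10 / 3 * w0 / k - 2 * w0 / k) * Q
        + (- (2 / 3 * (- 12 * (1 / y ^ 7) * (c + 2 * k\<^sup>2) / d + 54 * c * (1 / y) / d\<^sup>2)) - 8 / 9 * w1 / k) * M"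
        by (simp add: algebra_simps add_divide_distrib)
      also have "\<dots> = 36 * c / (y ^ 5 * d\<^sup>2) * Q + - 36 * c / (y * d\<^sup>2) * M" unfolding qc mc ..
      also have "\<dots> = 18 * c * (1 / y ^ 5) / d\<^sup>2 * (2 * Q - 2 * y ^ 4 * M)"
        using y(1) d(1) by (simp add: divide_simps) (simp add: algebra_simps eval_nat_numeral)
      finally show ?thesis .
    qed
    also have "\<dots> = \<gamma> * Fp x" unfolding \<gamma>_def Fp_eq P P4 M_def Q_def d_def by simp
    finally show ?thesis .
  qed
  obtain D where D: "((\<lambda>\<kappa>. F_functional \<kappa> (momentum (\<Phi> \<kappa>))) has_real_derivative D) (at k)" "D < 0" using assms by blast
  have "ip Fp psi < 0" unfolding psi_def
    by (rule slope_sign[OF D WH(1)]) (use lim[of 0 2] lim[of 1 3] in \<open>simp_all add: W_def W1_def\<close>)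
  then show ?thesis using H eq g by blast
qed

end

section \<open>Orbital stability\<close>

lemma LINT_translate:
  fixes f :: "real \<Rightarrow> real"
  shows "(LINT x|lborel. f (x + s)) = (LINT x|lborel. f x)"
  using lborel_integral_real_affine[of 1 f s] by (simp add: add.commute)

lemma integrable_translate:
  fixes f :: "real \<Rightarrow> real"
  shows "integrable lborel f \<Longrightarrow> integrable lborel (\<lambda>x. f (x + s))"
  using lborel_integrable_real_affine[of f 1 s] by (simp add: add.commute)

lemma L2_translate:
  fixes f :: "real \<Rightarrow> real"
  assumes "L2 f" shows "L2 (\<lambda>x. f (x + s))"
proof -
  have [measurable]: "f \<in> borel_measurable borel" using assms by (rule L2_measurable)
  show ?thesis using assms integrable_translate[of "\<lambda>x. (f x)\<^sup>2" s] by (simp add: L2_real_iff)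
qed

lemma ip_translate: "ip (\<lambda>x. f (x + s)) (\<lambda>x. g (x + s)) = ip f g"
  unfolding ip_def by (rule LINT_translate[of "\<lambda>x. f x * g x"])

lemma H1_translate:
  assumes "H1 F f" shows "H1 (\<lambda>x. F (x + s)) (\<lambda>x. f (x + s))"
proof -
  have ind: "indicator {a..b} x *\<^sub>R f (x + s) = indicator {a + s..b + s} (x + s) *\<^sub>R f (x + s)" for a b x :: real
    by (auto simp: indicator_def)
  have a: "ac F f" "L2 F" "L2 f" using assms by (auto simp: H1_def)
  have "ac (\<lambda>x. F (x + s)) (\<lambda>x. f (x + s))"
    unfolding ac_def locally_integrable_def set_integrable_def set_lebesgue_integral_def ind
  proof (intro conjI allI impI)
    fix a' b' :: real
    show "integrable lborel (\<lambda>x. indicator {a' + s..b' + s} (x + s) *\<^sub>R f (x + s))"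
      using a(1) integrable_translate[of "\<lambda>x. indicator {a' + s..b' + s} x *\<^sub>R f x" s]
      by (simp add: ac_def locally_integrable_def set_integrable_def)
    assume "a' \<le> b'"
    then have "F (b' + s) - F (a' + s) = (LINT x:{a' + s..b' + s}|lborel. f x)" using ac_integral[OF a(1)] by simp
    then show "F (b' + s) - F (a' + s) = (LINT x|lborel. indicator {a' + s..b' + s} (x + s) *\<^sub>R f (x + s))"
      using LINT_translate[of "\<lambda>x. indicator {a' + s..b' + s} x *\<^sub>R f x" s] by (simp add: set_lebesgue_integral_def)
  qed
  then show ?thesis using a L2_translate by (simp add: H1_def)
qed

lemma n1_translate: "n1 (\<lambda>x. F (x + s)) (\<lambda>x. f (x + s)) = n1 F f"
  by (simp add: n1_def ip_translate)

text \<open>The mean value inequality with exponential decay: a shift by at most 1 costs a factor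
  \<open>exp \<alpha>\<close>, so one square-integrable majorant serves all such shifts.\<close>

lemma increment_bound:
  fixes F f :: "real \<Rightarrow> real"
  assumes D: "\<And>x. (F has_field_derivative f x) (at x)" and f: "expdecay f"
  shows "\<exists>E. L2 E \<and> (\<forall>x. E x \<ge> 0) \<and> (\<forall>x t. \<bar>t\<bar> \<le> 1 \<longrightarrow> \<bar>F (x + t) - F x\<bar> \<le> \<bar>t\<bar> * E x)"
proof -
  obtain C \<alpha> where C: "\<alpha> > 0" "\<And>x. \<bar>f x\<bar> \<le> C * exp (- \<alpha> * \<bar>x\<bar>)" using f by (auto simp: expdecay_def)
  have C0: "C \<ge> 0" using order_trans[OF abs_ge_zero C(2)[of 0]] by simp
  define E where "E = (\<lambda>x. C * exp \<alpha> * exp (- \<alpha> * \<bar>x\<bar>))"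
  have "expdecay E" unfolding expdecay_def E_def using C C0 by (intro exI[of _ "C * exp \<alpha>"] exI[of _ \<alpha>]) auto
  then have "L2 E" by (rule expdecay_L2) (auto simp: E_def intro!: continuous_intros)
  moreover have "\<bar>F (x + t) - F x\<bar> \<le> \<bar>t\<bar> * E x" if "\<bar>t\<bar> \<le> 1" for x t
  proof -
    have "norm (F (x + t) - F x) \<le> E x * norm (x + t - x)"
    proof (rule field_differentiable_bound[of "cball x 1" F f])
      fix z assume "z \<in> cball x 1"
      then have "\<bar>x\<bar> - 1 \<le> \<bar>z\<bar>" by (simp add: dist_real_def)
      then have "\<alpha> * (\<bar>x\<bar> - 1) \<le> \<alpha> * \<bar>z\<bar>" using C(1) by (intro mult_left_mono) auto
      then have "C * exp (- \<alpha> * \<bar>z\<bar>) \<le> C * exp (\<alpha> + - \<alpha> * \<bar>x\<bar>)"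
        using C0 by (intro mult_left_mono) (auto simp: algebra_simps)
      then have "C * exp (- \<alpha> * \<bar>z\<bar>) \<le> C * (exp \<alpha> * exp (- \<alpha> * \<bar>x\<bar>))" unfolding exp_add .
      from order_trans[OF C(2)[of z] this] show "norm (f z) \<le> E x" by (simp add: E_def mult.assoc)
    qed (use that in \<open>auto simp: dist_real_def intro: has_field_derivative_at_within D\<close>)
    then show ?thesis by (simp add: mult.commute)
  qed
  ultimately show ?thesis using C0 by (intro exI[of _ E]) (auto simp: E_def)
qed

text \<open>Smallness of \<open>N\<close> absorbs the cubic and quartic terms into
  \<open>\<alpha> / 4 * N\<^sup>2\<close>, and Young's inequality puts the product of
  \<open>d\<close> and \<open>N\<close> into another quarter; half of the left-hand side
  survives.\<close>

lemma bootstrap_inequality: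
  fixes \<alpha> N d S a K CL C1 s r :: real
  assumes pos: "\<alpha> > 0" "N \<ge> 0" "d \<ge> 0" "S \<ge> 0" "a \<ge> 0" "K \<ge> 0" "CL \<ge> 0" "C1 \<ge> 0"
    and r: "r \<le> 1" "N \<le> r" "r * (4 * CL + 4 * S * a + 2 * K * S\<^sup>2) \<le> \<alpha> / 4"
    and s: "\<bar>s\<bar> \<le> S * (N\<^sup>2 + d)"
    and main: "\<alpha> * N\<^sup>2 \<le> 4 * C1 * d\<^sup>2 + 4 * CL * N ^ 3 + 4 * \<bar>s\<bar> * a * N + K * s\<^sup>2"
  shows "N\<^sup>2 \<le> 2 / \<alpha> * (4 * C1 + 16 * S\<^sup>2 * a\<^sup>2 / \<alpha> + 2 * K * S\<^sup>2) * d\<^sup>2"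
proof -
  have N3: "N ^ 3 \<le> r * N\<^sup>2" using mult_right_mono[OF r(2), of "N\<^sup>2"] by (simp add: power3_eq_cube power2_eq_square mult.assoc)
  have N4: "(N\<^sup>2)\<^sup>2 \<le> r * N\<^sup>2"
  proof -
    have "N * N \<le> 1 * r" using r pos by (intro mult_mono) auto
    then have "(N * N) * N\<^sup>2 \<le> r * N\<^sup>2" by (intro mult_right_mono) auto
    then show ?thesis by (simp add: power2_eq_square mult_ac)
  qed
  have "4 * \<bar>s\<bar> * a * N \<le> 4 * (S * (N\<^sup>2 + d)) * a * N"
    using s pos by (intro mult_right_mono mult_left_mono) auto
  also have "\<dots> = 4 * S * a * N ^ 3 + 4 * S * a * d * N" by (simp add: power2_eq_square power3_eq_cube algebra_simps)
  also have "4 * S * a * d * N \<le> \<alpha> / 4 * N\<^sup>2 + 16 * S\<^sup>2 * a\<^sup>2 / \<alpha> * d\<^sup>2"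
  proof -
    have "0 \<le> (\<alpha> * N / 2 - 4 * S * a * d)\<^sup>2 / \<alpha>" using pos(1) by simp
    also have "\<dots> = \<alpha> / 4 * N\<^sup>2 + 16 * S\<^sup>2 * a\<^sup>2 / \<alpha> * d\<^sup>2 - 4 * S * a * d * N"
      using pos(1) by (simp add: field_simps power2_eq_square)
    finally show ?thesis by simp
  qed
  finally have 1: "4 * \<bar>s\<bar> * a * N \<le> 4 * S * a * N ^ 3 + (\<alpha> / 4 * N\<^sup>2 + 16 * S\<^sup>2 * a\<^sup>2 / \<alpha> * d\<^sup>2)" by simp
  have "s\<^sup>2 \<le> (S * (N\<^sup>2 + d))\<^sup>2" using power_mono[OF s, of 2] by simp
  also have "\<dots> \<le> S\<^sup>2 * (2 * (N\<^sup>2)\<^sup>2 + 2 * d\<^sup>2)"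
    unfolding power_mult_distrib using zero_le_power2[of "N\<^sup>2 - d"] by (intro mult_left_mono) (auto simp: power2_sum power2_diff)
  finally have "K * s\<^sup>2 \<le> K * (S\<^sup>2 * (2 * (N\<^sup>2)\<^sup>2 + 2 * d\<^sup>2))" using pos by (intro mult_left_mono) auto
  then have 2: "K * s\<^sup>2 \<le> 2 * K * S\<^sup>2 * (N\<^sup>2)\<^sup>2 + 2 * K * S\<^sup>2 * d\<^sup>2" by (simp add: algebra_simps)
  have 3: "(4 * CL + 4 * S * a) * N ^ 3 \<le> (4 * CL + 4 * S * a) * (r * N\<^sup>2)" using N3 pos by (intro mult_left_mono) auto
  have 4: "2 * K * S\<^sup>2 * (N\<^sup>2)\<^sup>2 \<le> 2 * K * S\<^sup>2 * (r * N\<^sup>2)" using N4 pos by (intro mult_left_mono) auto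
  have 5: "(r * (4 * CL + 4 * S * a + 2 * K * S\<^sup>2)) * N\<^sup>2 \<le> \<alpha> / 4 * N\<^sup>2" by (rule mult_right_mono[OF r(3)]) simp
  have "\<alpha> * N\<^sup>2 \<le> \<alpha> / 2 * N\<^sup>2 + (4 * C1 + 16 * S\<^sup>2 * a\<^sup>2 / \<alpha> + 2 * K * S\<^sup>2) * d\<^sup>2"
    using main 1 2 3 4 5 by (simp add: algebra_simps)
  moreover have "N\<^sup>2 * (\<alpha> / 2) = \<alpha> * N\<^sup>2 - \<alpha> / 2 * N\<^sup>2" by (simp add: field_simps)
  ultimately have "N\<^sup>2 * (\<alpha> / 2) \<le> (4 * C1 + 16 * S\<^sup>2 * a\<^sup>2 / \<alpha> + 2 * K * S\<^sup>2) * d\<^sup>2" by linarith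
  then have "N\<^sup>2 \<le> (4 * C1 + 16 * S\<^sup>2 * a\<^sup>2 / \<alpha> + 2 * K * S\<^sup>2) * d\<^sup>2 / (\<alpha> / 2)" using pos(1) by (subst pos_le_divide_eq) auto
  moreover have "X * d\<^sup>2 / (\<alpha> / 2) = 2 / \<alpha> * X * d\<^sup>2" for X by simp
  ultimately show ?thesis by (simp only:)
qed

lemma novikov_solution_subset:
  assumes M: "novikov_solution k I M" and J: "J \<subseteq> I" shows "novikov_solution k J M"
  using assms unfolding novikov_solution_def by (blast intro: tendsto_within_subset)

context wave
begin

section \<open>Distance to the orbit and invariance under translation\<close>

lemma X_diff_H1: "m \<in> X_space k \<Longrightarrow> \<exists>h1. H1 (\<lambda>x. m (x + \<xi>) - \<mu> x) h1"
proof -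
  assume "m \<in> X_space k"
  then obtain m1 where "H1 (\<lambda>x. m x - k) m1" using X_space_H1 by blast
  from H1_diff[OF H1_translate[OF this, of \<xi>] H1_waves(1)] show ?thesis by (auto simp: w_def)
qed

text \<open>Distance to one chosen translate of the wave. Translation invariance of the norm allows
  the shift to be put on \<open>m\<close> instead.\<close>

definition orbit_dist where "orbit_dist m \<xi> = sobolev_norm 1 (\<lambda>x. m x - \<mu> (x - \<xi>))"

lemma orbit_dist_eq:
  assumes "H1 (\<lambda>x. m (x + \<xi>) - \<mu> x) h1"
  shows "orbit_dist m \<xi> = sqrt (n1 (\<lambda>x. m (x + \<xi>) - \<mu> x) h1)"
proof -
  have "H1 (\<lambda>x. m x - \<mu> (x - \<xi>)) (\<lambda>x. h1 (x - \<xi>))" using H1_translate[OF assms, of "- \<xi>"] by simp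
  from H1_imp_sobolev(3)[OF this] show ?thesis
    using n1_translate[of "\<lambda>x. m (x + \<xi>) - \<mu> x" "- \<xi>" h1] by (simp add: orbit_dist_def)
qed

lemma X_translate: "m \<in> X_space k \<Longrightarrow> (\<lambda>x. m (x + \<xi>)) \<in> X_space k"
proof -
  assume m: "m \<in> X_space k"
  then obtain m1 where m1: "H1 (\<lambda>x. m x - k) m1" using X_space_H1 by blast
  have "continuous_on UNIV m" using m by (simp add: X_space_def)
  then have "continuous_on UNIV (\<lambda>x. m (x + \<xi>))"
    by (rule continuous_on_compose2[where g = m and t = UNIV]) (auto intro!: continuous_intros)
  then show ?thesis using m H1_imp_sobolev(1)[OF H1_translate[OF m1, of \<xi>]] by (simp add: X_space_def)
qed

lemma ip_helmholtz_translate: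
  "ip (\<lambda>x. f (x + \<xi>)) (helmholtz_inv (\<lambda>x. f (x + \<xi>))) = ip f (helmholtz_inv f)"
proof -
  have "helmholtz_inv (\<lambda>x. f (x + \<xi>)) = (\<lambda>x. helmholtz_inv f (x + \<xi>))" using helmholtz_translate by blast
  then show ?thesis by (simp only: ip_translate)
qed

lemma F_translate: "m \<in> X_space k \<Longrightarrow> F_functional k (\<lambda>x. m (x + \<xi>)) = F_functional k m"
  using F_functional_eq[OF X_translate[of m \<xi>] k_pos] F_functional_eq[of m k] k_pos
    ip_helmholtz_translate[of "\<lambda>x. m x - k" \<xi>] LINT_translate[of "\<lambda>x. prem (2/3) k (m x)" \<xi>] by simp

lemma Lambda_translate:
  assumes m: "m \<in> X_space k" shows "Lambda_functional c k (\<lambda>x. m (x + \<xi>)) = Lambda_functional c k m"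
proof -
  obtain m1 where m1: "H1 (\<lambda>x. m x - k) m1" using X_space_H1[OF m] by blast
  show ?thesis
    unfolding Lambda_functional_eq(2)[OF X_translate[OF m] H1_translate[OF m1]] Lambda_functional_eq(2)[OF m m1]
      ip_helmholtz_translate[of "\<lambda>x. m x - k" \<xi>]
      LINT_translate[of "\<lambda>x. w1 * prem (2/3) k (m x) + 9 * prem (-2/3) k (m x) + m x powr (-8/3) * (m1 x)\<^sup>2" \<xi>] ..
qed

text \<open>Parity: \<open>Fp\<close> is even and \<open>\<mu>1\<close> is odd. Removing the
  component along \<open>Fp\<close> therefore preserves orthogonality to
  \<open>\<mu>1\<close>.\<close>

lemma Fp_mu1: "ip Fp \<mu>1 = 0"
proof -
  have "ip Fp \<mu>1 = (LINT x|lborel. Fp (- x) * \<mu>1 (- x))"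
    unfolding ip_def using lborel_integral_real_affine[of "-1" "\<lambda>x. Fp x * \<mu>1 x" 0] by simp
  also have "\<dots> = - ip Fp \<mu>1" unfolding ip_def by (simp add: Fp_def phi_even mu_even mu1_odd)
  finally show ?thesis by simp
qed

text \<open>Membership in the operator domain lets the form pairing of \<open>Fp\<close> with
  \<open>h\<close> be bounded by the L2 norm of \<open>h\<close> alone.\<close>

lemma Fp_H2: "\<exists>f1 f2. H2 Fp f1 f2"
proof -
  obtain B where B: "\<And>x. \<mu> x powr (-4/3) \<le> B" using powr_mu_bounds by blast
  obtain B' where B': "\<And>x. \<mu> x powr (-4/3 - 1) \<le> B'" using powr_mu_bounds by blast
  obtain M where M: "\<And>x. \<bar>\<mu>1 x\<bar> \<le> M" using mu_bounds by blast
  have "H1 (\<lambda>x. \<mu> x powr (-4/3) * \<mu>1 x) (\<lambda>x. (-4/3) * \<mu> x powr (-4/3 - 1) * \<mu>1 x * \<mu>1 x + \<mu> x powr (-4/3) * \<mu>2 x)"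
  proof (rule H1_bounded_mult[OF H1_waves(2) powr_mu_DERIV])
    show "continuous_on UNIV (\<lambda>x. (-4/3) * \<mu> x powr (-4/3 - 1) * \<mu>1 x)" by (intro continuous_intros powr_mu_cont cont)
    show "\<bar>\<mu> x powr (-4/3)\<bar> \<le> B" for x using B[of x] by simp
    have "\<mu> x powr (-4/3 - 1) * \<bar>\<mu>1 x\<bar> \<le> B' * M" for x
      using B'[of x] M[of x] order_trans[OF powr_ge_zero B'[of x]] by (intro mult_mono) auto
    then show "\<bar>(-4/3) * \<mu> x powr (-4/3 - 1) * \<mu>1 x\<bar> \<le> 4 / 3 * (B' * M)" for x by (simp add: abs_mult mult_ac)
  qed
  note g = this
  have acf: "ac (\<lambda>x. \<mu> x powr (-1/3) - k powr (-1/3)) (\<lambda>x. (-1/3) * (\<mu> x powr (-4/3) * \<mu>1 x))"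
  proof (rule ac_DERIV)
    have "((\<lambda>x. \<mu> x powr (-1/3)) has_field_derivative (-1/3) * \<mu> x powr (-1/3 - 1) * \<mu>1 x) (at x)" for x by (rule powr_mu_DERIV)
    from DERIV_diff[OF this DERIV_const]
    show "((\<lambda>x. \<mu> x powr (-1/3) - k powr (-1/3)) has_field_derivative (-1/3) * (\<mu> x powr (-4/3) * \<mu>1 x)) (at x)" for x by simp
    show "continuous_on UNIV (\<lambda>x. (-1/3) * (\<mu> x powr (-4/3) * \<mu>1 x))" by (intro continuous_intros powr_mu_cont cont)
  qed
  have f: "H1 (\<lambda>x. \<mu> x powr (-1/3) - k powr (-1/3)) (\<lambda>x. (-1/3) * (\<mu> x powr (-4/3) * \<mu>1 x))"
    unfolding H1_def by (rule conjI[OF acf conjI[OF L2_powr_mu_diff L2_cmult[OF H1_D(2)[OF g]]]])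
  show ?thesis unfolding H2_def Fp_def[abs_def]
    using H1_diff[OF H1_cmult[OF H1_waves(4), of 2] H1_cmult[OF f, of "2 * k powr (4/3)"]]
      H1_diff[OF H1_cmult[OF H1_waves(5), of 2] H1_cmult[OF H1_cmult[OF g, of "-1/3"], of "2 * k powr (4/3)"]] by blast
qed

section \<open>Estimates at a fixed time\<close>

lemma bform_upper: "\<exists>K\<ge>0. \<forall>h h1. L2 h \<and> L2 h1 \<longrightarrow> \<bar>bform h h1 h h1\<bar> \<le> K * n1 h h1"
proof -
  obtain M where M: "\<And>x. \<mu> x powr (-8/3) \<le> M" using powr_mu_bounds by blast
  obtain CV where CV: "\<And>x. \<bar>V x\<bar> \<le> CV" using V_bounded by blast
  have M0: "M \<ge> 0" using order_trans[OF powr_ge_zero M] .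
  have CV0: "CV \<ge> 0" using order_trans[OF abs_ge_zero CV] .
  have "\<bar>bform h h1 h h1\<bar> \<le> (2 * M + CV + 2 * \<bar>w0\<bar>) * n1 h h1" if h: "L2 h" "L2 h1" for h h1
  proof -
    have i2: "integrable lborel (\<lambda>x. (h x)\<^sup>2)" "integrable lborel (\<lambda>x. (h1 x)\<^sup>2)" using h by (auto simp: L2_real_iff)
    have "norm (LINT x|lborel. 2 * \<mu> x powr (-8/3) * (h1 x * h1 x) + V x * (h x * h x)) \<le> (LINT x|lborel. 2 * M * (h1 x)\<^sup>2 + CV * (h x)\<^sup>2)"
    proof (rule Bochner_Integration.integral_norm_bound_integral)
      fix x
      have "2 * \<mu> x powr (-8/3) * (h1 x)\<^sup>2 \<le> 2 * M * (h1 x)\<^sup>2" using M[of x] by (intro mult_right_mono) auto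
      moreover have "\<bar>V x\<bar> * (h x)\<^sup>2 \<le> CV * (h x)\<^sup>2" using CV[of x] by (intro mult_right_mono) auto
      moreover have "norm (2 * \<mu> x powr (-8/3) * (h1 x * h1 x) + V x * (h x * h x)) \<le> \<bar>2 * \<mu> x powr (-8/3) * (h1 x * h1 x)\<bar> + \<bar>V x * (h x * h x)\<bar>"
        unfolding real_norm_def by (rule abs_triangle_ineq)
      ultimately show "norm (2 * \<mu> x powr (-8/3) * (h1 x * h1 x) + V x * (h x * h x)) \<le> 2 * M * (h1 x)\<^sup>2 + CV * (h x)\<^sup>2"
        by (simp add: abs_mult power2_eq_square)
    qed (use bform_integrable[OF h h] i2 in auto)
    also have "\<dots> = 2 * M * ip h1 h1 + CV * ip h h" using i2 by (simp add: ip_self)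
    finally have 1: "\<bar>LINT x|lborel. 2 * \<mu> x powr (-8/3) * (h1 x * h1 x) + V x * (h x * h x)\<bar> \<le> 2 * M * ip h1 h1 + CV * ip h h" by simp
    have 2: "\<bar>2 * w0 * ip (helmholtz_inv h) h\<bar> \<le> 2 * \<bar>w0\<bar> * ip h h"
      unfolding abs_mult using helmholtz_bounds[OF h(1)] by (intro mult_mono) auto
    have "\<bar>bform h h1 h h1\<bar> \<le> 2 * M * ip h1 h1 + CV * ip h h + 2 * \<bar>w0\<bar> * ip h h"
      unfolding bform_def using abs_triangle_ineq[of "LINT x|lborel. 2 * \<mu> x powr (-8/3) * (h1 x * h1 x) + V x * (h x * h x)" "2 * w0 * ip (helmholtz_inv h) h"] 1 2
      by linarith
    also have "\<dots> \<le> (2 * M + CV + 2 * \<bar>w0\<bar>) * n1 h h1"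
      using M0 CV0 ip_nonneg[of h] ip_nonneg[of h1] by (simp add: n1_def algebra_simps)
    finally show ?thesis .
  qed
  then show ?thesis using M0 CV0 by (intro exI[of _ "2 * M + CV + 2 * \<bar>w0\<bar>"]) auto
qed

text \<open>\<open>F_functional\<close> deviates to first order but \<Lambda> only to second order,
  because \<open>\<mu>\<close> is critical for it. This makes the final estimate linear in the
  initial distance.\<close>

lemma functional_bounds:
  "\<exists>C\<ge>0. \<exists>r>0. \<forall>h h1. H1 h h1 \<and> (\<lambda>x. \<mu> x + h x) \<in> X_space k \<and> n1 h h1 \<le> r\<^sup>2 \<longrightarrow>
     \<bar>F_functional k (\<lambda>x. \<mu> x + h x) - F_functional k \<mu>\<bar> \<le> C * sqrt (n1 h h1) \<and>
     \<bar>Lambda_functional c k (\<lambda>x. \<mu> x + h x) - Lambda_functional c k \<mu>\<bar> \<le> C * n1 h h1"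
proof -
  obtain CF rF where F: "CF \<ge> 0" "rF > 0" "\<And>h h1. H1 h h1 \<Longrightarrow> (\<forall>x. \<bar>h x\<bar> \<le> rF) \<Longrightarrow> (\<lambda>x. \<mu> x + h x) \<in> X_space k \<Longrightarrow>
     \<bar>F_functional k (\<lambda>x. \<mu> x + h x) - F_functional k \<mu> - ip Fp h\<bar> \<le> CF * ip h h" using F_expansion by blast
  obtain CL rL where L: "CL \<ge> 0" "rL > 0" "\<And>h h1 \<delta>. H1 h h1 \<Longrightarrow> (\<forall>x. \<bar>h x\<bar> \<le> \<delta>) \<Longrightarrow> \<delta> \<le> rL \<Longrightarrow> (\<lambda>x. \<mu> x + h x) \<in> X_space k \<Longrightarrow>
     \<bar>Lambda_functional c k (\<lambda>x. \<mu> x + h x) - Lambda_functional c k \<mu> - bform h h1 h h1 / 2\<bar> \<le> CL * \<delta> * n1 h h1"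
    using Lambda_expansion by blast
  obtain K where K: "K \<ge> 0" "\<And>h h1. L2 h \<Longrightarrow> L2 h1 \<Longrightarrow> \<bar>bform h h1 h h1\<bar> \<le> K * n1 h h1" using bform_upper by blast
  define r where "r = min rF rL"
  have r: "r > 0" "r \<le> rF" "r \<le> rL" using F L by (auto simp: r_def)
  define C where "C = sqrt (ip Fp Fp) + CF * r + K + CL * r"
  have C0: "sqrt (ip Fp Fp) \<ge> 0" "CF * r \<ge> 0" "CL * r \<ge> 0" using F(1) L(1) r(1) by (auto simp: ip_nonneg)
  have "\<bar>F_functional k (\<lambda>x. \<mu> x + h x) - F_functional k \<mu>\<bar> \<le> C * sqrt (n1 h h1) \<and>
     \<bar>Lambda_functional c k (\<lambda>x. \<mu> x + h x) - Lambda_functional c k \<mu>\<bar> \<le> C * n1 h h1"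
    if h: "H1 h h1" "(\<lambda>x. \<mu> x + h x) \<in> X_space k" "n1 h h1 \<le> r\<^sup>2" for h h1
  proof
    define N where "N = sqrt (n1 h h1)"
    have N: "N \<ge> 0" "n1 h h1 = N\<^sup>2" "N \<le> r" using n1_nonneg[of h h1] h(3) r(1) by (auto simp: N_def real_le_lsqrt)
    have sup: "\<bar>h x\<bar> \<le> r" for x using H1_sup_bound'[OF h(1), of x] N(3) by (simp add: N_def)
    have hL: "L2 h" "L2 h1" using h by (auto simp: H1_def)
    have ih: "ip h h \<le> N\<^sup>2" "sqrt (ip h h) \<le> N"
      using ip_nonneg[of h1] N(2) by (auto simp: n1_def N_def)
    have "\<bar>F_functional k (\<lambda>x. \<mu> x + h x) - F_functional k \<mu> - ip Fp h\<bar> \<le> CF * ip h h"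
      by (rule F(3)[OF h(1) _ h(2)]) (use sup r(2) in \<open>auto intro: order_trans\<close>)
    also have "\<dots> \<le> CF * (r * N)"
      using ih(1) mult_right_mono[OF N(3,1)] F(1) by (intro mult_left_mono) (auto simp: power2_eq_square)
    finally have "\<bar>F_functional k (\<lambda>x. \<mu> x + h x) - F_functional k \<mu> - ip Fp h\<bar> \<le> CF * r * N" by (simp add: mult.assoc)
    moreover have "\<bar>ip Fp h\<bar> \<le> sqrt (ip Fp Fp) * N"
      using ip_abs_le[OF Fp_L2 hL(1)] mult_left_mono[OF ih(2) C0(1)] by linarith
    moreover have "C * N = sqrt (ip Fp Fp) * N + CF * r * N + K * N + CL * r * N" by (simp add: C_def algebra_simps)
    moreover have "0 \<le> K * N" "0 \<le> CL * r * N" using N K(1) C0 by auto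
    ultimately show "\<bar>F_functional k (\<lambda>x. \<mu> x + h x) - F_functional k \<mu>\<bar> \<le> C * sqrt (n1 h h1)"
      unfolding N_def[symmetric] by linarith
    have "\<bar>Lambda_functional c k (\<lambda>x. \<mu> x + h x) - Lambda_functional c k \<mu> - bform h h1 h h1 / 2\<bar> \<le> CL * r * n1 h h1"
      using L(3)[OF h(1) _ r(3) h(2)] sup by blast
    moreover have "C * n1 h h1 = sqrt (ip Fp Fp) * n1 h h1 + CF * r * n1 h h1 + K * n1 h h1 + CL * r * n1 h h1" by (simp add: C_def algebra_simps)
    moreover have "0 \<le> sqrt (ip Fp Fp) * n1 h h1" "0 \<le> CF * r * n1 h h1" "0 \<le> K * n1 h h1" using K(1) C0 n1_nonneg[of h h1] by auto
    ultimately show "\<bar>Lambda_functional c k (\<lambda>x. \<mu> x + h x) - Lambda_functional c k \<mu>\<bar> \<le> C * n1 h h1"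
      using K(2)[OF hL] by linarith
  qed
  moreover have "C \<ge> 0" using C0 K by (simp add: C_def)
  ultimately show ?thesis using r(1) by blast
qed

text \<open>The bound on the change of \<open>F_functional\<close> makes the component
  \<open>s\<close> of \<open>h\<close> along \<open>Fp\<close> of size \<open>N\<^sup>2 + d\<close>
  instead of \<open>N\<close>. What is left of \<open>h\<close> satisfies both constraints, and
  coercivity bounds it through \<Lambda>, up to terms that the smallness of \<open>N\<close>
  absorbs. In the application \<open>d\<close> is the initial distance.\<close>

lemma static_estimate:
  assumes coer: "\<exists>\<alpha>>0. \<forall>y y1. H1 y y1 \<and> ip y Fp = 0 \<and> ip y \<mu>1 = 0 \<longrightarrow> bform y y1 y y1 \<ge> \<alpha> * n1 y y1"
    and nz: "ip Fp Fp > 0" and C1: "C1 \<ge> 0"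
  shows "\<exists>C\<ge>0. \<exists>r>0. \<forall>h h1 d. H1 h h1 \<and> (\<lambda>x. \<mu> x + h x) \<in> X_space k \<and> ip h \<mu>1 = 0 \<and> n1 h h1 \<le> r\<^sup>2 \<and> d \<ge> 0 \<and>
     \<bar>F_functional k (\<lambda>x. \<mu> x + h x) - F_functional k \<mu>\<bar> \<le> C1 * d \<and>
     \<bar>Lambda_functional c k (\<lambda>x. \<mu> x + h x) - Lambda_functional c k \<mu>\<bar> \<le> C1 * d\<^sup>2 \<longrightarrow> n1 h h1 \<le> C * d\<^sup>2"
proof -
  obtain \<alpha> where \<alpha>: "\<alpha> > 0" "\<And>y y1. H1 y y1 \<Longrightarrow> ip y Fp = 0 \<Longrightarrow> ip y \<mu>1 = 0 \<Longrightarrow> bform y y1 y y1 \<ge> \<alpha> * n1 y y1"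
    using coer by blast
  obtain CF rF where F: "CF \<ge> 0" "rF > 0" "\<And>h h1. H1 h h1 \<Longrightarrow> (\<forall>x. \<bar>h x\<bar> \<le> rF) \<Longrightarrow> (\<lambda>x. \<mu> x + h x) \<in> X_space k \<Longrightarrow>
     \<bar>F_functional k (\<lambda>x. \<mu> x + h x) - F_functional k \<mu> - ip Fp h\<bar> \<le> CF * ip h h" using F_expansion by blast
  obtain CL rL where L: "CL \<ge> 0" "rL > 0" "\<And>h h1 \<delta>. H1 h h1 \<Longrightarrow> (\<forall>x. \<bar>h x\<bar> \<le> \<delta>) \<Longrightarrow> \<delta> \<le> rL \<Longrightarrow> (\<lambda>x. \<mu> x + h x) \<in> X_space k \<Longrightarrow>
     \<bar>Lambda_functional c k (\<lambda>x. \<mu> x + h x) - Lambda_functional c k \<mu> - bform h h1 h h1 / 2\<bar> \<le> CL * \<delta> * n1 h h1"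
    using Lambda_expansion by blast
  obtain f1 f2 where f: "H2 Fp f1 f2" using Fp_H2 by blast
  have fH: "H1 Fp f1" using f by (simp add: H2_def)
  have fL: "L2 Fp" "L2 f1" using fH by (auto simp: H1_def)
  define G where "G = ip Fp Fp"
  define S where "S = (CF + C1) / G"
  define a where "a = sqrt (ip (A Fp) (A Fp))"
  define K where "K = 2 * \<bar>bform Fp f1 Fp f1\<bar> + 2 * \<alpha> * n1 Fp f1"
  have pos: "S \<ge> 0" "a \<ge> 0" "K \<ge> 0" using F(1) C1 nz \<alpha>(1) n1_nonneg[of Fp f1] by (auto simp: S_def G_def a_def K_def ip_nonneg)
  define T where "T = 4 * CL + 4 * S * a + 2 * K * S\<^sup>2"
  have T: "T \<ge> 0" unfolding T_def using pos L(1) by auto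
  \<comment> \<open>The bound \<open>\<alpha> / (4 * (T + 1))\<close> yields
    \<open>r * T \<le> \<alpha> / 4\<close>, the smallness required for absorption;
    \<open>rF\<close> and \<open>rL\<close> keep \<open>h\<close> in the range of the two
    expansions.\<close>
  define r where "r = min (min 1 (\<alpha> / (4 * (T + 1)))) (min rF rL)"
  have r: "r > 0" "r \<le> 1" "r \<le> rF" "r \<le> rL" "r \<le> \<alpha> / (4 * (T + 1))" using F(2) L(2) \<alpha>(1) T by (auto simp: r_def)
  have rT: "r * T \<le> \<alpha> / 4"
  proof -
    have le: "r * T \<le> (\<alpha> / (4 * (T + 1))) * (T + 1)" using r T \<alpha>(1) by (intro mult_mono) auto
    have "T + 1 \<noteq> 0" using T by simp
    then have e: "(\<alpha> / (4 * (T + 1))) * (T + 1) = \<alpha> / 4"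
      unfolding times_divide_eq_left by (rule mult_divide_mult_cancel_right)
    show ?thesis using le unfolding e .
  qed
  define C where "C = 2 / \<alpha> * (4 * C1 + 16 * S\<^sup>2 * a\<^sup>2 / \<alpha> + 2 * K * S\<^sup>2)"
  have C0: "C \<ge> 0" unfolding C_def using \<alpha>(1) C1 pos by auto
  have "n1 h h1 \<le> C * d\<^sup>2"
    if h: "H1 h h1" "(\<lambda>x. \<mu> x + h x) \<in> X_space k" "ip h \<mu>1 = 0" "n1 h h1 \<le> r\<^sup>2" "d \<ge> 0"
      "\<bar>F_functional k (\<lambda>x. \<mu> x + h x) - F_functional k \<mu>\<bar> \<le> C1 * d"
      "\<bar>Lambda_functional c k (\<lambda>x. \<mu> x + h x) - Lambda_functional c k \<mu>\<bar> \<le> C1 * d\<^sup>2" for h h1 d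
  proof -
    define N where "N = sqrt (n1 h h1)"
    have N: "N \<ge> 0" "n1 h h1 = N\<^sup>2" "N \<le> r" using n1_nonneg[of h h1] h(4) r(1) by (auto simp: N_def real_le_lsqrt)
    have sup: "\<bar>h x\<bar> \<le> N" for x using H1_sup_bound'[OF h(1), of x] by (simp add: N_def)
    have hL: "L2 h" "L2 h1" using h by (auto simp: H1_def)
    have ih: "ip h h \<le> N\<^sup>2" "sqrt (ip h h) \<le> N"
      using ip_nonneg[of h1] N(2) by (auto simp: n1_def N_def)
    define s where "s = ip h Fp / G"
    have G0: "G > 0" using nz by (simp add: G_def)
    have sb: "\<bar>s\<bar> \<le> S * (N\<^sup>2 + d)"
    proof -
      have "\<bar>F_functional k (\<lambda>x. \<mu> x + h x) - F_functional k \<mu> - ip Fp h\<bar> \<le> CF * ip h h"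
        by (rule F(3)[OF h(1) _ h(2)]) (use sup N(3) r(3) in \<open>auto intro: order_trans\<close>)
      then have "\<bar>F_functional k (\<lambda>x. \<mu> x + h x) - F_functional k \<mu> - ip Fp h\<bar> \<le> CF * N\<^sup>2"
        using mult_left_mono[OF ih(1) F(1)] by linarith
      then have "\<bar>ip Fp h\<bar> \<le> CF * N\<^sup>2 + C1 * d" using h(6) by linarith
      also have "\<dots> \<le> (CF + C1) * (N\<^sup>2 + d)" using F(1) C1 h(5) by (simp add: algebra_simps)
      finally show ?thesis using G0 ip_commute[of h Fp] by (simp add: s_def S_def divide_right_mono)
    qed
    define y where "y = (\<lambda>x. h x + (- s) * Fp x)"
    define y1 where "y1 = (\<lambda>x. h1 x + (- s) * f1 x)"
    have yH: "H1 y y1" unfolding y_def y1_def by (rule H1_add[OF h(1) H1_cmult[OF fH]])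
    have yL: "L2 y" "L2 y1" using yH by (auto simp: H1_def)
    have y0: "ip y Fp = 0" unfolding y_def ip_add[OF hL(1) L2_cmult[OF fL(1)] fL(1)] ip_cmult
      using G0 by (simp add: s_def G_def)
    have ym: "ip y \<mu>1 = 0" unfolding y_def ip_add[OF hL(1) L2_cmult[OF fL(1)] H1_D(2)[OF H1_waves(2)]] ip_cmult
      using h(3) Fp_mu1 by simp
    have co: "\<alpha> * n1 y y1 \<le> bform y y1 y y1" by (rule \<alpha>(2)[OF yH y0 ym])
    define b where "b = bform h h1 h h1"
    define bF where "bF = bform Fp f1 Fp f1"
    define bh where "bh = bform Fp f1 h h1"
    have "bform y y1 y y1 = bform h h1 y y1 + (- s) * bform Fp f1 y y1"
      unfolding y_def y1_def by (rule bform_add) (use hL fL yL in \<open>auto simp: y_def y1_def\<close>)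
    also have "bform h h1 y y1 = bform y y1 h h1" by (rule bform_sym) (use hL yL in auto)
    also have "\<dots> = b + (- s) * bh" unfolding y_def y1_def b_def bh_def by (rule bform_add) (use hL fL in auto)
    also have "bform Fp f1 y y1 = bform y y1 Fp f1" by (rule bform_sym) (use fL yL in auto)
    also have "\<dots> = bform h h1 Fp f1 + (- s) * bF" unfolding y_def y1_def bF_def by (rule bform_add) (use hL fL in auto)
    also have "bform h h1 Fp f1 = bh" unfolding bh_def by (rule bform_sym) (use fL hL in auto)
    finally have yb: "bform y y1 y y1 = b - 2 * (s * bh) + s\<^sup>2 * bF" by (simp add: power2_eq_square algebra_simps)
    have bh: "\<bar>s * bh\<bar> \<le> \<bar>s\<bar> * (a * N)"
    proof -
      have "bh = ip (A Fp) h" unfolding bh_def by (rule bform_A[OF f h(1)])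
      then have "\<bar>bh\<bar> \<le> a * sqrt (ip h h)" using ip_abs_le[OF A_L2[OF f] hL(1)] by (simp add: a_def)
      also have "\<dots> \<le> a * N" using ih(2) pos(2) by (intro mult_left_mono)
      finally show ?thesis unfolding abs_mult by (intro mult_left_mono) auto
    qed
    have bb: "b \<le> 2 * (C1 * d\<^sup>2) + 2 * (CL * N ^ 3)"
    proof -
      have "\<bar>Lambda_functional c k (\<lambda>x. \<mu> x + h x) - Lambda_functional c k \<mu> - b / 2\<bar> \<le> CL * N * n1 h h1"
        unfolding b_def by (rule L(3)[OF h(1) _ _ h(2)]) (use sup N(3) r(4) in auto)
      moreover have "CL * N * n1 h h1 = CL * N ^ 3" unfolding N(2) by (simp add: power2_eq_square power3_eq_cube)
      ultimately show ?thesis using h(7) unfolding abs_le_iff by linarith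
    qed
    have sF: "s\<^sup>2 * bF \<le> s\<^sup>2 * \<bar>bF\<bar>" by (intro mult_left_mono) auto
    have "n1 h h1 \<le> 2 * n1 y y1 + 2 * (s\<^sup>2 * n1 Fp f1)"
      using n1_add_le[OF yH H1_cmult[OF fH, of s]] unfolding n1_cmult by (simp add: y_def y1_def)
    then have "\<alpha> * N\<^sup>2 \<le> \<alpha> * (2 * n1 y y1 + 2 * (s\<^sup>2 * n1 Fp f1))" unfolding N(2)[symmetric] using \<alpha>(1) by (intro mult_left_mono) auto
    also have "\<dots> = 2 * (\<alpha> * n1 y y1) + 2 * \<alpha> * n1 Fp f1 * s\<^sup>2" by (simp add: algebra_simps)
    finally have "\<alpha> * N\<^sup>2 \<le> 2 * bform y y1 y y1 + 2 * \<alpha> * n1 Fp f1 * s\<^sup>2" using co by linarith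
    moreover have "2 * bform y y1 y y1 = 2 * b - 4 * (s * bh) + 2 * (s\<^sup>2 * bF)" unfolding yb by simp
    ultimately have "\<alpha> * N\<^sup>2 \<le> 2 * b - 4 * (s * bh) + 2 * (s\<^sup>2 * bF) + 2 * \<alpha> * n1 Fp f1 * s\<^sup>2" by (simp only:)
    \<comment> \<open>A purely numerical implication; here \<open>A\<close> is a real variable and
      not the operator.\<close>
    moreover have "A \<le> 4 * X + 4 * Y + 4 * Z + 2 * P + n"
      if "A \<le> 2 * B - 4 * Q + 2 * R + n" "B \<le> 2 * X + 2 * Y" "- Q \<le> Z" "R \<le> P" for A B Q R n X Y Z P :: real
      using that by linarith
    ultimately have "\<alpha> * N\<^sup>2 \<le> 4 * (C1 * d\<^sup>2) + 4 * (CL * N ^ 3) + 4 * (\<bar>s\<bar> * (a * N)) + 2 * (s\<^sup>2 * \<bar>bF\<bar>) + 2 * \<alpha> * n1 Fp f1 * s\<^sup>2"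
      using bb abs_le_D2[OF bh] sF by blast
    also have "\<dots> = 4 * C1 * d\<^sup>2 + 4 * CL * N ^ 3 + 4 * \<bar>s\<bar> * a * N + K * s\<^sup>2" unfolding K_def bF_def by (simp add: algebra_simps)
    finally have "\<alpha> * N\<^sup>2 \<le> 4 * C1 * d\<^sup>2 + 4 * CL * N ^ 3 + 4 * \<bar>s\<bar> * a * N + K * s\<^sup>2" .
    from bootstrap_inequality[OF \<alpha>(1) N(1) h(5) pos L(1) C1 r(2) N(3) rT[unfolded T_def] sb this]
    show ?thesis unfolding C_def N(2) .
  qed
  then show ?thesis using r(1) C0 by blast
qed

text \<open>The intermediate value theorem suffices. At shift \<open>t\<close> the pairing with
  \<open>\<mu>1\<close> is \<open>t * a\<^sup>2\<close> up to an error \<open>N * a\<close> from the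
  perturbation and \<open>t\<^sup>2 * Q\<close> from the second-order part of the translation, so it
  changes sign between \<open>- t\<close> and \<open>t\<close> for
  \<open>t = 2 * N / a\<close>.\<close>

lemma modulation:
  "\<exists>K\<ge>0. \<exists>r>0. \<forall>m h1. m \<in> X_space k \<and> H1 (\<lambda>x. m x - \<mu> x) h1 \<and> n1 (\<lambda>x. m x - \<mu> x) h1 \<le> r\<^sup>2 \<longrightarrow>
     (\<exists>\<tau> h2. H1 (\<lambda>x. m (x + \<tau>) - \<mu> x) h2 \<and> ip (\<lambda>x. m (x + \<tau>) - \<mu> x) \<mu>1 = 0 \<and>
        n1 (\<lambda>x. m (x + \<tau>) - \<mu> x) h2 \<le> K * n1 (\<lambda>x. m x - \<mu> x) h1)"
proof -
  have mL: "L2 \<mu>1" using H1_waves(2) by (simp add: H1_def)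
  define a where "a = sqrt (ip \<mu>1 \<mu>1)"
  have "ip \<mu>1 \<mu>1 \<noteq> 0"
  proof
    assume "ip \<mu>1 \<mu>1 = 0"
    then have "AE x in lborel. \<mu>1 x = 0" using ip_zero_AE mL by blast
    then have "\<mu>1 = (\<lambda>x. 0)" by (intro AE_eq_continuous cont continuous_on_const)
    then show False using mu1_nonzero by metis
  qed
  then have a: "a > 0" "ip \<mu>1 \<mu>1 = a\<^sup>2" using ip_nonneg[of \<mu>1] by (auto simp: a_def)
  obtain E0 where E0: "L2 E0" "\<And>x. E0 x \<ge> 0" "\<And>x t. \<bar>t\<bar> \<le> 1 \<Longrightarrow> \<bar>\<mu> (x + t) - \<mu> x\<bar> \<le> \<bar>t\<bar> * E0 x"
    using increment_bound[OF mu_DERIV(1) mu_decay(2)] by blast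
  obtain E1 where E1: "L2 E1" "\<And>x. E1 x \<ge> 0" "\<And>x t. \<bar>t\<bar> \<le> 1 \<Longrightarrow> \<bar>\<mu>1 (x + t) - \<mu>1 x\<bar> \<le> \<bar>t\<bar> * E1 x"
    using increment_bound[OF mu_DERIV(2) mu_decay(3)] by blast
  define L0 where "L0 = ip E0 E0"
  define L1 where "L1 = ip E1 E1"
  have Lp: "L0 \<ge> 0" "L1 \<ge> 0" by (auto simp: L0_def L1_def ip_nonneg)
  have Hs: "H1 (\<lambda>x. \<mu> (x + t) - \<mu> x) (\<lambda>x. \<mu>1 (x + t) - \<mu>1 x)" for t
    using H1_diff[OF H1_translate[OF H1_waves(1), of t] H1_waves(1)] by (simp add: w_def)
  have b0: "ip (\<lambda>x. \<mu> (x + t) - \<mu> x) (\<lambda>x. \<mu> (x + t) - \<mu> x) \<le> t\<^sup>2 * L0" if "\<bar>t\<bar> \<le> 1" for t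
    using L2_bound(2)[OF E0(1) L2_measurable[OF H1_D(2)[OF Hs]], of t "\<bar>t\<bar>"] E0(2,3) that by (simp add: ip_self L0_def)
  have b1: "ip (\<lambda>x. \<mu>1 (x + t) - \<mu>1 x) (\<lambda>x. \<mu>1 (x + t) - \<mu>1 x) \<le> t\<^sup>2 * L1" if "\<bar>t\<bar> \<le> 1" for t
    using L2_bound(2)[OF E1(1) L2_measurable[OF H1_D(3)[OF Hs]], of t "\<bar>t\<bar>"] E1(2,3) that by (simp add: ip_self L1_def)
  have q: "\<bar>ip (\<lambda>x. \<mu> (x + t) - \<mu> x) \<mu>1 - t * a\<^sup>2\<bar> \<le> t\<^sup>2 * (sqrt L1 * a)" if t: "\<bar>t\<bar> \<le> 1" for t
  proof -
    have pt: "\<bar>\<mu> (x + t) - \<mu> x - t * \<mu>1 x\<bar> \<le> t\<^sup>2 * E1 x" for x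
    proof -
      have "norm ((\<mu> (x + t) - t * \<mu>1 x) - (\<mu> (x + 0) - 0 * \<mu>1 x)) \<le> (\<bar>t\<bar> * E1 x) * norm (t - 0)"
      proof (rule field_differentiable_bound[of "cball 0 \<bar>t\<bar>" "\<lambda>z. \<mu> (x + z) - z * \<mu>1 x" "\<lambda>z. \<mu>1 (x + z) - \<mu>1 x"])
        fix z :: real assume z: "z \<in> cball 0 \<bar>t\<bar>"
        have "((\<lambda>z. \<mu> (x + z)) has_field_derivative \<mu>1 (x + z) * 1) (at z)"
          by (rule DERIV_chain2[OF mu_DERIV(1)]) (auto intro!: derivative_eq_intros)
        then have "((\<lambda>z. \<mu> (x + z) - z * \<mu>1 x) has_field_derivative \<mu>1 (x + z) * 1 - 1 * \<mu>1 x) (at z)"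
          by (intro DERIV_diff DERIV_cmult_right DERIV_ident)
        then show "((\<lambda>z. \<mu> (x + z) - z * \<mu>1 x) has_field_derivative \<mu>1 (x + z) - \<mu>1 x) (at z within cball 0 \<bar>t\<bar>)"
          by (simp add: has_field_derivative_at_within)
        have "\<bar>\<mu>1 (x + z) - \<mu>1 x\<bar> \<le> \<bar>z\<bar> * E1 x" using E1(3)[of z x] z t by simp
        also have "\<dots> \<le> \<bar>t\<bar> * E1 x" using z E1(2) by (intro mult_right_mono) auto
        finally show "norm (\<mu>1 (x + z) - \<mu>1 x) \<le> \<bar>t\<bar> * E1 x" by simp
      qed auto
      then show ?thesis by (simp add: power2_eq_square algebra_simps abs_mult_self_eq)
    qed
    have RL: "L2 (\<lambda>x. \<mu> (x + t) - \<mu> x - t * \<mu>1 x)" by (rule L2_diff[OF H1_D(2)[OF Hs] L2_cmult[OF mL]])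
    have "ip (\<lambda>x. \<mu> (x + t) - \<mu> x - t * \<mu>1 x) (\<lambda>x. \<mu> (x + t) - \<mu> x - t * \<mu>1 x) \<le> (t\<^sup>2)\<^sup>2 * L1"
      using L2_bound(2)[OF E1(1) L2_measurable[OF RL], of "t\<^sup>2"] E1(2) pt by (simp add: ip_self L1_def)
    then have "sqrt (ip (\<lambda>x. \<mu> (x + t) - \<mu> x - t * \<mu>1 x) (\<lambda>x. \<mu> (x + t) - \<mu> x - t * \<mu>1 x)) \<le> sqrt ((t\<^sup>2)\<^sup>2 * L1)"
      by (rule real_sqrt_le_mono)
    then have s: "sqrt (ip (\<lambda>x. \<mu> (x + t) - \<mu> x - t * \<mu>1 x) (\<lambda>x. \<mu> (x + t) - \<mu> x - t * \<mu>1 x)) \<le> t\<^sup>2 * sqrt L1"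
      unfolding real_sqrt_mult real_sqrt_abs by simp
    have "ip (\<lambda>x. \<mu> (x + t) - \<mu> x) \<mu>1 - t * a\<^sup>2 = ip (\<lambda>x. \<mu> (x + t) - \<mu> x - t * \<mu>1 x) \<mu>1"
      unfolding ip_diff[OF H1_D(2)[OF Hs] L2_cmult[OF mL] mL] ip_cmult a(2) ..
    also have "\<bar>\<dots>\<bar> \<le> (t\<^sup>2 * sqrt L1) * a"
      using ip_abs_le[OF RL mL] mult_right_mono[OF s, of a] a(1) unfolding a_def[symmetric] by linarith
    finally show ?thesis by (simp add: mult.assoc)
  qed
  define Q where "Q = sqrt L1 * a"
  have Q0: "Q \<ge> 0" using Lp a by (simp add: Q_def)
  \<comment> \<open>\<open>N \<le> a / 2\<close> gives \<open>t \<le> 1\<close>, where the increment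
    bounds hold, and \<open>4 * Q * N \<le> a ^ 3\<close> makes the quadratic error at most
    \<open>N * a\<close>.\<close>
  define r where "r = min (a / 2) (a ^ 3 / (4 * (Q + 1)))"
  have r: "r > 0" using a(1) Q0 by (auto simp: r_def)
  have r2: "r \<le> a / 2" "r \<le> a ^ 3 / (4 * (Q + 1))" unfolding r_def by (rule min.cobounded1, rule min.cobounded2)
  define K where "K = 2 + 2 * (L0 + L1) * (2 / a)\<^sup>2"
  have K0: "K \<ge> 0" using Lp by (simp add: K_def)
  have "\<exists>\<tau> h2. H1 (\<lambda>x. m (x + \<tau>) - \<mu> x) h2 \<and> ip (\<lambda>x. m (x + \<tau>) - \<mu> x) \<mu>1 = 0 \<and>
        n1 (\<lambda>x. m (x + \<tau>) - \<mu> x) h2 \<le> K * n1 (\<lambda>x. m x - \<mu> x) h1"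
    if m: "m \<in> X_space k" "H1 (\<lambda>x. m x - \<mu> x) h1" "n1 (\<lambda>x. m x - \<mu> x) h1 \<le> r\<^sup>2" for m h1
  proof -
    define h where "h = (\<lambda>x. m x - \<mu> x)"
    have hH: "H1 h h1" unfolding h_def by (rule m(2))
    define N where "N = sqrt (n1 h h1)"
    have N: "N \<ge> 0" "n1 h h1 = N\<^sup>2" "N \<le> r"
      using n1_nonneg[of h h1] m(3) r by (auto simp: N_def h_def real_le_lsqrt)
    have hL: "L2 h" using hH by (simp add: H1_def)
    have ih: "sqrt (ip h h) \<le> N" using ip_nonneg[of h1] by (auto simp: n1_def N_def)
    define g where "g = (\<lambda>\<tau>. ip (\<lambda>x. m (x + \<tau>) - \<mu> x) \<mu>1)"
    have split: "(\<lambda>x. m (x + \<tau>) - \<mu> x) = (\<lambda>x. h (x + \<tau>) + (\<mu> (x + \<tau>) - \<mu> x))" for \<tau> by (simp add: h_def)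
    have g_eq: "g \<tau> = ip (\<lambda>x. h (x + \<tau>)) \<mu>1 + ip (\<lambda>x. \<mu> (x + \<tau>) - \<mu> x) \<mu>1" for \<tau>
      unfolding g_def split by (rule ip_add[OF L2_translate[OF hL] H1_D(2)[OF Hs] mL])
    have ghb: "\<bar>ip (\<lambda>x. h (x + \<tau>)) \<mu>1\<bar> \<le> N * a" for \<tau>
      using ip_abs_le[OF L2_translate[OF hL, of \<tau>] mL] mult_right_mono[OF ih, of a] a(1)
      unfolding ip_translate a_def[symmetric] by linarith
    define t where "t = 2 * N / a"
    have t: "0 \<le> t" "t \<le> 1" using N r2(1) a(1) by (auto simp: t_def field_simps)
    have tq: "t\<^sup>2 * Q \<le> N * a"
    proof -
      have "4 * (Q + 1) * N \<le> a ^ 3" using order_trans[OF N(3) r2(2)] Q0 by (simp add: field_simps)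
      then have "4 * Q * N \<le> a ^ 3" using N(1) by (simp add: algebra_simps)
      then have "(4 * Q * N) * N \<le> a ^ 3 * N" using N(1) by (rule mult_right_mono)
      then show ?thesis using a(1) by (simp add: t_def field_simps power2_eq_square power3_eq_cube)
    qed
    have ta: "t * a\<^sup>2 = 2 * N * a" using a(1) by (simp add: t_def power2_eq_square)
    have gp: "g t \<ge> 0" using q[of t] ghb[of t] tq ta t unfolding g_eq Q_def[symmetric] abs_le_iff by simp
    have gm: "g (- t) \<le> 0" using q[of "- t"] ghb[of "- t"] tq ta t unfolding g_eq Q_def[symmetric] abs_le_iff by simp
    have "isCont g \<tau>" for \<tau>
    proof -
      obtain m1 where m1: "H1 (\<lambda>x. m x - k) m1" using X_space_H1[OF m(1)] by blast
      have mkL: "L2 (\<lambda>x. m x - k)" "L2 w" using m1 H1_waves(1) by (auto simp: H1_def)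
      \<comment> \<open>For continuity the shift is moved onto the smooth factor
        \<open>\<mu>1\<close>, whose increments are controlled in L2.\<close>
      have shift: "g \<sigma> = ip (\<lambda>x. m x - k) (\<lambda>x. \<mu>1 (x - \<sigma>)) - ip w \<mu>1" for \<sigma>
      proof -
        have "(\<lambda>x. m (x + \<sigma>) - \<mu> x) = (\<lambda>x. (m (x + \<sigma>) - k) - w x)" by (simp add: w_def)
        then have "g \<sigma> = ip (\<lambda>x. m (x + \<sigma>) - k) \<mu>1 - ip w \<mu>1"
          unfolding g_def using ip_diff[OF L2_translate[OF mkL(1)] mkL(2) mL] by simp
        then show ?thesis using ip_translate[of "\<lambda>x. m x - k" \<sigma> "\<lambda>x. \<mu>1 (x - \<sigma>)"] by simp
      qed
      define B where "B = sqrt (ip (\<lambda>x. m x - k) (\<lambda>x. m x - k))"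
      have "\<bar>g \<sigma> - g \<tau>\<bar> \<le> B * (\<bar>\<sigma> - \<tau>\<bar> * sqrt L1)" if st: "\<bar>\<sigma> - \<tau>\<bar> \<le> 1" for \<sigma>
      proof -
        have s1: "L2 (\<lambda>x. \<mu>1 (x - \<rho>))" for \<rho> using L2_translate[OF mL, of "- \<rho>"] by simp
        define D where "D = ip (\<lambda>x. \<mu>1 (x - \<sigma>) - \<mu>1 (x - \<tau>)) (\<lambda>x. \<mu>1 (x - \<sigma>) - \<mu>1 (x - \<tau>))"
        have "g \<sigma> - g \<tau> = ip (\<lambda>x. m x - k) (\<lambda>x. \<mu>1 (x - \<sigma>)) - ip (\<lambda>x. m x - k) (\<lambda>x. \<mu>1 (x - \<tau>))"
          unfolding shift by simp
        moreover have "ip (\<lambda>x. m x - k) (\<lambda>x. \<mu>1 (x - \<sigma>) - \<mu>1 (x - \<tau>))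
          = ip (\<lambda>x. m x - k) (\<lambda>x. \<mu>1 (x - \<sigma>)) - ip (\<lambda>x. m x - k) (\<lambda>x. \<mu>1 (x - \<tau>))"
          using ip_diff[OF s1[of \<sigma>] s1[of \<tau>] mkL(1)]
          by (simp only: ip_commute[of "\<lambda>x. m x - k" "\<lambda>x. \<mu>1 (x - \<sigma>)"] ip_commute[of "\<lambda>x. m x - k" "\<lambda>x. \<mu>1 (x - \<tau>)"]
            ip_commute[of "\<lambda>x. m x - k" "\<lambda>x. \<mu>1 (x - \<sigma>) - \<mu>1 (x - \<tau>)"])
        moreover have "\<bar>ip (\<lambda>x. m x - k) (\<lambda>x. \<mu>1 (x - \<sigma>) - \<mu>1 (x - \<tau>))\<bar> \<le> B * sqrt D"
          unfolding B_def D_def by (rule ip_abs_le[OF mkL(1) L2_diff[OF s1 s1]])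
        ultimately have 1: "\<bar>g \<sigma> - g \<tau>\<bar> \<le> B * sqrt D" by (simp only:)
        have "D = ip (\<lambda>x. \<mu>1 (x + (\<tau> - \<sigma>)) - \<mu>1 x) (\<lambda>x. \<mu>1 (x + (\<tau> - \<sigma>)) - \<mu>1 x)"
          using ip_translate[of "\<lambda>x. \<mu>1 (x - \<sigma>) - \<mu>1 (x - \<tau>)" \<tau> "\<lambda>x. \<mu>1 (x - \<sigma>) - \<mu>1 (x - \<tau>)"]
          unfolding D_def by (simp add: add_diff_eq)
        then have "D \<le> (\<tau> - \<sigma>)\<^sup>2 * L1" using b1[of "\<tau> - \<sigma>"] st by (simp add: abs_minus_commute)
        then have 2: "B * sqrt D \<le> B * sqrt ((\<tau> - \<sigma>)\<^sup>2 * L1)"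
          by (intro mult_left_mono real_sqrt_le_mono) (auto simp: B_def ip_nonneg)
        show ?thesis using order_trans[OF 1 2] by (simp add: real_sqrt_mult abs_minus_commute)
      qed
      then have ev: "\<forall>\<^sub>F \<sigma> in at \<tau>. norm (g \<sigma> - g \<tau>) \<le> B * (\<bar>\<sigma> - \<tau>\<bar> * sqrt L1)"
        unfolding eventually_at by (intro exI[of _ 1]) (auto simp: dist_real_def)
      have "((\<lambda>\<sigma>. B * (\<bar>\<sigma> - \<tau>\<bar> * sqrt L1)) \<longlongrightarrow> B * (\<bar>\<tau> - \<tau>\<bar> * sqrt L1)) (at \<tau>)" by (intro tendsto_intros)
      then have "((\<lambda>\<sigma>. B * (\<bar>\<sigma> - \<tau>\<bar> * sqrt L1)) \<longlongrightarrow> 0) (at \<tau>)" by simp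
      from Lim_null_comparison[OF ev this] have "((\<lambda>\<sigma>. g \<sigma> - g \<tau>) \<longlongrightarrow> 0) (at \<tau>)" .
      then show ?thesis unfolding isCont_def by (rule LIM_zero_cancel)
    qed
    then obtain \<tau> where \<tau>: "- t \<le> \<tau>" "\<tau> \<le> t" "g \<tau> = 0" using IVT[of g "- t" 0 t] gp gm t(1) by auto
    have \<tau>1: "\<bar>\<tau>\<bar> \<le> 1" unfolding abs_le_iff using \<tau>(1,2) t(2) by linarith
    define h2 where "h2 = (\<lambda>x. h1 (x + \<tau>) + (\<mu>1 (x + \<tau>) - \<mu>1 x))"
    have H2: "H1 (\<lambda>x. m (x + \<tau>) - \<mu> x) h2" unfolding split h2_def by (rule H1_add[OF H1_translate[OF hH] Hs])
    have "n1 (\<lambda>x. m (x + \<tau>) - \<mu> x) h2 \<le> 2 * n1 h h1 + 2 * n1 (\<lambda>x. \<mu> (x + \<tau>) - \<mu> x) (\<lambda>x. \<mu>1 (x + \<tau>) - \<mu>1 x)"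
      unfolding split h2_def using n1_add_le[OF H1_translate[OF hH, of \<tau>] Hs[of \<tau>]] unfolding n1_translate .
    also have "n1 (\<lambda>x. \<mu> (x + \<tau>) - \<mu> x) (\<lambda>x. \<mu>1 (x + \<tau>) - \<mu>1 x) \<le> \<tau>\<^sup>2 * (L0 + L1)"
      using b0[of \<tau>] b1[of \<tau>] \<tau>1 by (simp add: n1_def algebra_simps)
    also have "\<dots> \<le> t\<^sup>2 * (L0 + L1)" using \<tau> Lp by (intro mult_right_mono) (auto simp: abs_le_square_iff[symmetric])
    also have "2 * n1 h h1 + 2 * (t\<^sup>2 * (L0 + L1)) = K * n1 h h1"
      unfolding N(2) by (simp add: K_def t_def power_divide power_mult_distrib algebra_simps add_divide_distrib)
    finally have "n1 (\<lambda>x. m (x + \<tau>) - \<mu> x) h2 \<le> K * n1 h h1" by simp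
    then show ?thesis using H2 \<tau>(3) unfolding g_def h_def by blast
  qed
  then show ?thesis using K0 r by blast
qed

text \<open>Closeness \<open>r\<close> to some translate is improved by conservation to a multiple
  of the initial distance. That translate may be arbitrary, because the functionals are translation
  invariant; modulation then selects a translate meeting the orthogonality constraint.\<close>

lemma orbit_recovery:
  assumes coer: "\<exists>\<alpha>>0. \<forall>y y1. H1 y y1 \<and> ip y Fp = 0 \<and> ip y \<mu>1 = 0 \<longrightarrow> bform y y1 y y1 \<ge> \<alpha> * n1 y y1"
    and nz: "ip Fp Fp > 0"
  shows "\<exists>C>0. \<exists>r>0. \<forall>m0 m s. m0 \<in> X_space k \<and> m \<in> X_space k \<and> F_functional k m = F_functional k m0 \<and>
     Lambda_functional c k m = Lambda_functional c k m0 \<and> orbit_dist m0 0 \<le> r \<and> orbit_dist m s \<le> r \<longrightarrow>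
     (\<exists>s'. orbit_dist m s' \<le> C * orbit_dist m0 0)"
proof -
  obtain C1 r1 where 1: "C1 \<ge> 0" "r1 > 0" "\<And>h h1. H1 h h1 \<Longrightarrow> (\<lambda>x. \<mu> x + h x) \<in> X_space k \<Longrightarrow> n1 h h1 \<le> r1\<^sup>2 \<Longrightarrow>
     \<bar>F_functional k (\<lambda>x. \<mu> x + h x) - F_functional k \<mu>\<bar> \<le> C1 * sqrt (n1 h h1) \<and>
     \<bar>Lambda_functional c k (\<lambda>x. \<mu> x + h x) - Lambda_functional c k \<mu>\<bar> \<le> C1 * n1 h h1"
    using functional_bounds by blast
  obtain C2 r2 where 2: "C2 \<ge> 0" "r2 > 0" "\<And>h h1 d. H1 h h1 \<Longrightarrow> (\<lambda>x. \<mu> x + h x) \<in> X_space k \<Longrightarrow> ip h \<mu>1 = 0 \<Longrightarrow> n1 h h1 \<le> r2\<^sup>2 \<Longrightarrow> d \<ge> 0 \<Longrightarrow>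
     \<bar>F_functional k (\<lambda>x. \<mu> x + h x) - F_functional k \<mu>\<bar> \<le> C1 * d \<Longrightarrow>
     \<bar>Lambda_functional c k (\<lambda>x. \<mu> x + h x) - Lambda_functional c k \<mu>\<bar> \<le> C1 * d\<^sup>2 \<Longrightarrow> n1 h h1 \<le> C2 * d\<^sup>2"
    using static_estimate[OF coer nz 1(1)] by blast
  obtain K r3 where 3: "K \<ge> 0" "r3 > 0" "\<And>m h1. m \<in> X_space k \<Longrightarrow> H1 (\<lambda>x. m x - \<mu> x) h1 \<Longrightarrow> n1 (\<lambda>x. m x - \<mu> x) h1 \<le> r3\<^sup>2 \<Longrightarrow>
     (\<exists>\<tau> h2. H1 (\<lambda>x. m (x + \<tau>) - \<mu> x) h2 \<and> ip (\<lambda>x. m (x + \<tau>) - \<mu> x) \<mu>1 = 0 \<and>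
        n1 (\<lambda>x. m (x + \<tau>) - \<mu> x) h2 \<le> K * n1 (\<lambda>x. m x - \<mu> x) h1)"
    using modulation by blast
  define r where "r = min (min r1 r3) (r2 / (K + 1))"
  have r: "r > 0" "r \<le> r1" "r \<le> r3" "r \<le> r2 / (K + 1)" using 1 2 3 by (auto simp: r_def)
  have Kr: "K * r\<^sup>2 \<le> r2\<^sup>2"
  proof -
    have "(K + 1) * r \<le> r2" using r(4) 3(1) by (simp add: field_simps)
    then have "((K + 1) * r)\<^sup>2 \<le> r2\<^sup>2" using r(1) 3(1) by (intro power_mono) auto
    moreover have "K * r\<^sup>2 \<le> (K + 1)\<^sup>2 * r\<^sup>2" using 3(1) by (intro mult_right_mono) (auto simp: power2_eq_square algebra_simps)
    ultimately show ?thesis by (simp add: power_mult_distrib)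
  qed
  have "\<exists>s'. orbit_dist m s' \<le> sqrt (C2 + 1) * orbit_dist m0 0"
    if A: "m0 \<in> X_space k" "m \<in> X_space k" "F_functional k m = F_functional k m0"
      "Lambda_functional c k m = Lambda_functional c k m0" "orbit_dist m0 0 \<le> r" "orbit_dist m s \<le> r" for m0 m s
  proof -
    obtain h0 where h0: "H1 (\<lambda>x. m0 (x + 0) - \<mu> x) h0" using X_diff_H1[OF A(1)] by blast
    define d where "d = orbit_dist m0 0"
    have d: "d \<ge> 0" "n1 (\<lambda>x. m0 x - \<mu> x) h0 = d\<^sup>2" "d = sqrt (n1 (\<lambda>x. m0 x - \<mu> x) h0)"
      using orbit_dist_eq[OF h0] n1_nonneg[of "\<lambda>x. m0 x - \<mu> x" h0] by (auto simp: d_def)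
    have dr: "n1 (\<lambda>x. m0 x - \<mu> x) h0 \<le> r1\<^sup>2" unfolding d(2) using A(5) r(2) d(1) unfolding d_def by (intro power_mono) auto
    have b: "\<bar>F_functional k m0 - F_functional k \<mu>\<bar> \<le> C1 * d" "\<bar>Lambda_functional c k m0 - Lambda_functional c k \<mu>\<bar> \<le> C1 * d\<^sup>2"
    proof -
      have e: "(\<lambda>x. \<mu> x + (m0 x - \<mu> x)) = m0" by simp
      have "H1 (\<lambda>x. m0 x - \<mu> x) h0" using h0 by simp
      note B = 1(3)[OF this _ dr, unfolded e, OF A(1)]
      show "\<bar>F_functional k m0 - F_functional k \<mu>\<bar> \<le> C1 * d" using conjunct1[OF B] unfolding d(3)[symmetric] .
      show "\<bar>Lambda_functional c k m0 - Lambda_functional c k \<mu>\<bar> \<le> C1 * d\<^sup>2" using conjunct2[OF B] unfolding d(2) .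
    qed
    define m' where "m' = (\<lambda>x. m (x + s))"
    have m': "m' \<in> X_space k" unfolding m'_def by (rule X_translate[OF A(2)])
    obtain h1 where h1: "H1 (\<lambda>x. m (x + s) - \<mu> x) h1" using X_diff_H1[OF A(2)] by blast
    have n: "n1 (\<lambda>x. m' x - \<mu> x) h1 \<le> r\<^sup>2"
    proof -
      have "sqrt (n1 (\<lambda>x. m' x - \<mu> x) h1) \<le> r" using orbit_dist_eq[OF h1] A(6) by (simp add: m'_def)
      then show ?thesis using n1_nonneg by (metis real_sqrt_ge_zero power_mono real_sqrt_pow2)
    qed
    have "n1 (\<lambda>x. m' x - \<mu> x) h1 \<le> r3\<^sup>2" using n power_mono[OF r(3), of 2] r(1) by simp
    then obtain \<tau> h2 where h2: "H1 (\<lambda>x. m' (x + \<tau>) - \<mu> x) h2" "ip (\<lambda>x. m' (x + \<tau>) - \<mu> x) \<mu>1 = 0"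
      "n1 (\<lambda>x. m' (x + \<tau>) - \<mu> x) h2 \<le> K * n1 (\<lambda>x. m' x - \<mu> x) h1"
      using 3(3)[OF m'] h1 unfolding m'_def by blast
    have X: "(\<lambda>x. m' (x + \<tau>)) \<in> X_space k" by (rule X_translate[OF m'])
    have eq: "F_functional k (\<lambda>x. m' (x + \<tau>)) = F_functional k m0" "Lambda_functional c k (\<lambda>x. m' (x + \<tau>)) = Lambda_functional c k m0"
      using F_translate[OF m'] F_translate[OF A(2)] Lambda_translate[OF m'] Lambda_translate[OF A(2)] A(3,4) by (auto simp: m'_def)
    have "n1 (\<lambda>x. m' (x + \<tau>) - \<mu> x) h2 \<le> r2\<^sup>2"
      using h2(3) mult_left_mono[OF n 3(1)] Kr by linarith
    then have "n1 (\<lambda>x. m' (x + \<tau>) - \<mu> x) h2 \<le> C2 * d\<^sup>2"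
      using 2(3)[OF h2(1) _ h2(2) _ d(1)] X eq b by simp
    \<comment> \<open>Adding 1 makes the constant strictly positive.\<close>
    also have "\<dots> \<le> (C2 + 1) * d\<^sup>2" by (simp add: algebra_simps)
    finally have "sqrt (n1 (\<lambda>x. m' (x + \<tau>) - \<mu> x) h2) \<le> sqrt ((C2 + 1) * d\<^sup>2)" by (rule real_sqrt_le_mono)
    moreover have "sqrt ((C2 + 1) * d\<^sup>2) = sqrt (C2 + 1) * d" using d(1) by (simp add: real_sqrt_mult)
    moreover have "orbit_dist m (\<tau> + s) = sqrt (n1 (\<lambda>x. m' (x + \<tau>) - \<mu> x) h2)"
      using orbit_dist_eq[of m "\<tau> + s" h2] h2(1) by (simp add: m'_def add.assoc)
    ultimately have "orbit_dist m (\<tau> + s) \<le> sqrt (C2 + 1) * d" by simp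
    then show ?thesis unfolding d_def by blast
  qed
  moreover have "sqrt (C2 + 1) > 0" using 2(1) by simp
  ultimately show ?thesis using r(1) by blast
qed

section \<open>Propagation of the bound in time\<close>

lemma orbit_dist_perturb:
  assumes "m \<in> X_space k" "n \<in> X_space k"
  shows "(orbit_dist n \<xi>)\<^sup>2 \<le> 2 * (orbit_dist m \<xi>)\<^sup>2 + 2 * (sobolev_norm 1 (\<lambda>x. n x - m x))\<^sup>2"
proof -
  obtain m1 where m1: "H1 (\<lambda>x. m x - k) m1" using X_space_H1[OF assms(1)] by blast
  obtain n1' where n1': "H1 (\<lambda>x. n x - k) n1'" using X_space_H1[OF assms(2)] by blast
  have D: "H1 (\<lambda>x. n x - m x) (\<lambda>x. n1' x - m1 x)" using H1_diff[OF n1' m1] by simp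
  obtain h1 where h1: "H1 (\<lambda>x. m (x + \<xi>) - \<mu> x) h1" using X_diff_H1[OF assms(1)] by blast
  have S: "H1 (\<lambda>x. n (x + \<xi>) - \<mu> x) (\<lambda>x. h1 x + (n1' (x + \<xi>) - m1 (x + \<xi>)))"
    using H1_add[OF h1 H1_translate[OF D, of \<xi>]] by simp
  have "n1 (\<lambda>x. n (x + \<xi>) - \<mu> x) (\<lambda>x. h1 x + (n1' (x + \<xi>) - m1 (x + \<xi>)))
    \<le> 2 * n1 (\<lambda>x. m (x + \<xi>) - \<mu> x) h1 + 2 * n1 (\<lambda>x. n x - m x) (\<lambda>x. n1' x - m1 x)"
    using n1_add_le[OF h1 H1_translate[OF D, of \<xi>]] n1_translate[of "\<lambda>x. n x - m x" \<xi> "\<lambda>x. n1' x - m1 x"] by simp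
  then show ?thesis unfolding orbit_dist_eq[OF S] orbit_dist_eq[OF h1] H1_imp_sobolev(3)[OF D] by (simp add: n1_nonneg)
qed

text \<open>The recovered bound leaves a margin: distance \<open>r / 3\<close> at one time and a
  motion of at most \<open>r / 3\<close> still give distance at most \<open>r\<close>, where
  recovery applies again. The bound is thus locally constant in time as a property and spreads over
  the connected half-line.\<close>

lemma orbital_stability:
  assumes coer: "\<exists>\<alpha>>0. \<forall>y y1. H1 y y1 \<and> ip y Fp = 0 \<and> ip y \<mu>1 = 0 \<longrightarrow> bform y y1 y y1 \<ge> \<alpha> * n1 y y1"
    and nz: "ip Fp Fp > 0"
    and cons: "novikov_conserved k (F_functional k)" "novikov_conserved k (Lambda_functional c k)"
  shows "\<exists>C>0. \<exists>\<epsilon>>0. \<forall>M. novikov_solution k {0..} M \<and> orbit_dist (M 0) 0 \<le> \<epsilon> \<longrightarrow>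
     (\<forall>t\<ge>0. \<exists>s. orbit_dist (M t) s \<le> C * orbit_dist (M 0) 0)"
proof -
  obtain C r where R: "C > 0" "r > 0" "\<And>m0 m s. m0 \<in> X_space k \<Longrightarrow> m \<in> X_space k \<Longrightarrow> F_functional k m = F_functional k m0 \<Longrightarrow>
     Lambda_functional c k m = Lambda_functional c k m0 \<Longrightarrow> orbit_dist m0 0 \<le> r \<Longrightarrow> orbit_dist m s \<le> r \<Longrightarrow>
     (\<exists>s'. orbit_dist m s' \<le> C * orbit_dist m0 0)" using orbit_recovery[OF coer nz] by blast
  \<comment> \<open>The first term makes the initial distance small enough for recovery; the second
    makes the recovered bound \<open>C * d\<close> at most \<open>r / 3\<close>.\<close>
  define \<epsilon> where "\<epsilon> = min (r / 3) (r / (3 * C))"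
  have e: "\<epsilon> > 0" "\<epsilon> \<le> r / 3" "C * \<epsilon> \<le> r / 3" using R by (auto simp: \<epsilon>_def min_def field_simps)
  have "\<exists>s. orbit_dist (M t) s \<le> C * orbit_dist (M 0) 0"
    if M: "novikov_solution k {0..} M" "orbit_dist (M 0) 0 \<le> \<epsilon>" and t: "t \<ge> 0" for M t
  proof -
    have X: "M u \<in> X_space k" if "u \<ge> 0" for u using M(1) that by (auto simp: novikov_solution_def)
    have contM: "((\<lambda>u. sobolev_norm 1 (\<lambda>x. M u x - M v x)) \<longlongrightarrow> 0) (at v within {0..})" if "v \<ge> 0" for v
      using M(1) that by (auto simp: novikov_solution_def)
    have sub: "novikov_solution k {0..<T} M" for T by (rule novikov_solution_subset[OF M(1)]) auto
    have cF: "F_functional k (M u) = F_functional k (M 0)" "Lambda_functional c k (M u) = Lambda_functional c k (M 0)"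
      if "u \<ge> 0" for u
    proof -
      have u: "u \<in> {0..<u + 1}" using that by simp
      show "F_functional k (M u) = F_functional k (M 0)"
        using cons(1)[unfolded novikov_conserved_def, THEN spec, THEN spec, THEN mp, OF sub, THEN bspec, OF u] .
      show "Lambda_functional c k (M u) = Lambda_functional c k (M 0)"
        using cons(2)[unfolded novikov_conserved_def, THEN spec, THEN spec, THEN mp, OF sub, THEN bspec, OF u] .
    qed
    define d where "d = orbit_dist (M 0) 0"
    define P where "P = (\<lambda>u. \<exists>s. orbit_dist (M u) s \<le> C * d)"
    have od0: "orbit_dist m s \<ge> 0" for m s by (simp add: orbit_dist_def sobolev_norm_def sum_nonneg)
    have Cd: "C * d \<le> r / 3" using e(3) M(2) R(1) mult_left_mono[of d \<epsilon> C] unfolding d_def by linarith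
    have rec: "P u" if "u \<ge> 0" "orbit_dist (M u) s \<le> r" for u s
      unfolding P_def d_def by (rule R(3)[OF X X cF _ that(2)]) (use that M(2) e(2) R(2) in auto)
    have P0: "P 0" by (rule rec[of 0 0]) (use M(2) e(2) R(2) in auto)
    have "P t"
    proof (rule connected_induction_simple[of "{0..}" 0 t P])
      fix v :: real assume v: "v \<in> {0..}"
      have "\<forall>\<^sub>F u in at v within {0..}. sobolev_norm 1 (\<lambda>x. M u x - M v x) < r / 3"
        using order_tendstoD(2)[OF contM[of v], of "r / 3"] v R(2) by simp
      then obtain \<delta> where \<delta>: "\<delta> > 0" "\<And>u. u \<in> {0..} \<Longrightarrow> u \<noteq> v \<Longrightarrow> dist u v < \<delta> \<Longrightarrow> sobolev_norm 1 (\<lambda>x. M u x - M v x) < r / 3"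
        unfolding eventually_at by blast
      have sn: "sobolev_norm 1 (\<lambda>x. M u x - M v x) \<le> r / 3 \<and> sobolev_norm 1 (\<lambda>x. M v x - M u x) \<le> r / 3" if u: "u \<in> {0..}" "dist u v < \<delta>" for u
      proof -
        obtain h where h: "H1 (\<lambda>x. M u x - M v x) h"
        proof -
          obtain f g where "H1 (\<lambda>x. M u x - k) f" "H1 (\<lambda>x. M v x - k) g"
            using X_space_H1 X u(1) v by (metis atLeast_iff)
          from H1_diff[OF this] show thesis using that by simp
        qed
        have h': "H1 (\<lambda>x. M v x - M u x) (\<lambda>x. (-1) * h x)" using H1_cmult[OF h, of "-1"] by simp
        have "n1 (\<lambda>x. M v x - M u x) (\<lambda>x. (-1) * h x) = n1 (\<lambda>x. M u x - M v x) h"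
          using n1_cmult[of "-1" "\<lambda>x. M u x - M v x" h] by simp
        then have sym: "sobolev_norm 1 (\<lambda>x. M v x - M u x) = sobolev_norm 1 (\<lambda>x. M u x - M v x)"
          unfolding H1_imp_sobolev(3)[OF h] H1_imp_sobolev(3)[OF h'] by simp
        show ?thesis
        proof (cases "u = v")
          case True
          have "n1 (\<lambda>x. 0) (\<lambda>x. 0) = 0" by (simp add: n1_def ip_def)
          then have "sobolev_norm 1 (\<lambda>x. M v x - M v x) = 0" using H1_imp_sobolev(3)[OF H1_zero] by simp
          then show ?thesis using True R(2) by simp
        next
          case False then show ?thesis using \<delta>(2)[OF u(1) _ u(2)] sym by simp
        qed
      qed
      have step: "P u" if three: "u \<ge> 0" "v' \<ge> 0" "P v'" "sobolev_norm 1 (\<lambda>x. M u x - M v' x) \<le> r / 3" for u v'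
      proof -
        obtain s where s: "orbit_dist (M v') s \<le> C * d" using three(3) P_def by blast
        have "(orbit_dist (M v') s)\<^sup>2 \<le> (r / 3)\<^sup>2" using s Cd od0 by (intro power_mono) auto
        moreover have "(sobolev_norm 1 (\<lambda>x. M u x - M v' x))\<^sup>2 \<le> (r / 3)\<^sup>2"
          using three(4) by (intro power_mono) (auto simp: sobolev_norm_def sum_nonneg)
        \<comment> \<open>The squared triangle inequality contributes a factor 2 on each term;
          \<open>4 / 9\<close> is still below 1.\<close>
        ultimately have "(orbit_dist (M u) s)\<^sup>2 \<le> 4 * (r / 3)\<^sup>2"
          using orbit_dist_perturb[OF X[OF three(2)] X[OF three(1)], of s] by linarith
        also have "\<dots> \<le> r\<^sup>2" by (simp add: power_divide)
        finally have "orbit_dist (M u) s \<le> r" using R(2) od0 by (simp add: abs_le_square_iff[symmetric])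
        then show ?thesis using rec three(1) by blast
      qed
      show "\<exists>T. openin (top_of_set {0..}) T \<and> v \<in> T \<and> (\<forall>x\<in>T. \<forall>y\<in>T. P x \<longrightarrow> P y)"
      proof (intro exI[of _ "{0..} \<inter> ball v \<delta>"] conjI ballI impI)
        show "openin (top_of_set {0..}) ({0..} \<inter> ball v \<delta>)" by (rule openin_open_Int) simp
        show "v \<in> {0..} \<inter> ball v \<delta>" using v \<delta>(1) by simp
        fix x y assume x: "x \<in> {0..} \<inter> ball v \<delta>" and y: "y \<in> {0..} \<inter> ball v \<delta>" and "P x"
        have "P v" by (rule step[OF _ _ \<open>P x\<close>]) (use x v sn[of x] in \<open>auto simp: dist_commute\<close>)
        then show "P y" by (rule step[rotated 2]) (use y v sn[of y] in \<open>auto simp: dist_commute\<close>)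
      qed
    qed (use t P0 in auto)
    then show ?thesis unfolding P_def d_def .
  qed
  then show ?thesis using R(1) e(1) by blast
qed

end

theorem theorem4p5:
  fixes c k :: real and \<phi> :: "real \<Rightarrow> real \<Rightarrow> real" and \<mu> :: "real \<Rightarrow> real \<Rightarrow> real"
  assumes c: "c > 0" and k: "k \<in> {0<..<sqrt c / 2}"
    and wave: "\<And>\<kappa>. \<kappa> \<in> {0<..<sqrt c / 2} \<Longrightarrow> solitary_profile c \<kappa> (\<phi> \<kappa>)"
    and family: "smooth_family c \<phi>"
    and \<mu>: "\<And>\<kappa>. \<mu> \<kappa> = momentum (\<phi> \<kappa>)"
    and wellposed: "novikov_wellposed k"
    and conserved_F: "novikov_conserved k (F_functional k)"
    and conserved_Lambda: "novikov_conserved k (Lambda_functional c k)"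
    and spectral: "spectral_assumption (sobolev 2) (L_operator c k (\<mu> k))"
    and slope: "\<exists>D<0. ((\<lambda>\<kappa>. F_functional \<kappa> (\<mu> \<kappa>)) has_real_derivative D) (at k)"
  shows "\<exists>\<epsilon>0>0. \<forall>\<epsilon>. 0 < \<epsilon> \<and> \<epsilon> < \<epsilon>0 \<longrightarrow> (\<exists>C>0.
           \<forall>v. sobolev 1 v \<and> sobolev_norm 1 v \<le> \<epsilon> \<longrightarrow>
             (\<forall>T m. T > 0 \<and> novikov_solution k {0..<T} m \<and>
                (AE x in lborel. m 0 x = \<mu> k x + v x) \<longrightarrow>
                (\<exists>M. novikov_solution k {0..} M \<and> (\<forall>t\<in>{0..<T}. M t = m t) \<and>
                   (SUP t\<in>{0<..}. INF x0. ereal (sobolev_norm 1 (\<lambda>x. M t x - \<mu> k (x - x0))))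
                     \<le> ereal (C * sobolev_norm 1 v))))"
proof -
  interpret W: wave_family c k \<phi>
    using c k wave family by unfold_locales auto
  have mk: "\<mu> k = momentum (\<phi> k)" by (rule \<mu>)
  have "\<exists>D<0. ((\<lambda>\<kappa>. F_functional \<kappa> (momentum (\<phi> \<kappa>))) has_real_derivative D) (at k)" using slope by (simp add: \<mu>)
  from W.constraint_direction[OF this] obtain psi psi1 psi2 \<gamma> where psi: "H2 psi psi1 psi2"
    "\<And>x. W.Lin x (psi x) (psi1 x) (psi2 x) + 2 * omega0 c k * helmholtz_inv psi x = \<gamma> * W.Fp x" "\<gamma> > 0" "ip W.Fp psi < 0"
    by blast
  have coer: "\<exists>\<alpha>>0. \<forall>y y1. H1 y y1 \<and> ip y W.Fp = 0 \<and> ip y W.\<mu>1 = 0 \<longrightarrow> W.bform y y1 y y1 \<ge> \<alpha> * n1 y y1"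
    by (rule W.coercive[OF _ psi]) (use spectral in \<open>simp add: mk\<close>)
  \<comment> \<open>A negative pairing with \<open>psi\<close> excludes a null gradient. The
    component along it is later computed by division by this number.\<close>
  have nz: "ip W.Fp W.Fp > 0"
  proof -
    have "L2 psi" using psi(1) by (simp add: H2_def H1_def)
    from ip_Cauchy_Schwarz[OF W.Fp_L2 this] have "ip W.Fp W.Fp \<noteq> 0" using psi(4) by auto
    then show ?thesis using ip_nonneg[of W.Fp] by simp
  qed
  obtain C \<epsilon>0 where S: "C > 0" "\<epsilon>0 > 0" "\<And>M t. novikov_solution k {0..} M \<Longrightarrow> W.orbit_dist (M 0) 0 \<le> \<epsilon>0 \<Longrightarrow> t \<ge> 0 \<Longrightarrow>
     \<exists>s. W.orbit_dist (M t) s \<le> C * W.orbit_dist (M 0) 0"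
    using W.orbital_stability[OF coer nz conserved_F conserved_Lambda] by blast
  show ?thesis
  proof (rule exI[of _ \<epsilon>0], intro conjI allI impI S(2))
    fix \<epsilon> assume eps: "0 < \<epsilon> \<and> \<epsilon> < \<epsilon>0"
    show "\<exists>C>0. \<forall>v. sobolev 1 v \<and> sobolev_norm 1 v \<le> \<epsilon> \<longrightarrow>
             (\<forall>T m. T > 0 \<and> novikov_solution k {0..<T} m \<and>
                (AE x in lborel. m 0 x = \<mu> k x + v x) \<longrightarrow>
                (\<exists>M. novikov_solution k {0..} M \<and> (\<forall>t\<in>{0..<T}. M t = m t) \<and>
                   (SUP t\<in>{0<..}. INF x0. ereal (sobolev_norm 1 (\<lambda>x. M t x - \<mu> k (x - x0))))
                     \<le> ereal (C * sobolev_norm 1 v)))"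
    \<comment> \<open>The same constant serves every \<epsilon> below the threshold.\<close>
    proof (rule exI[of _ C], intro conjI allI impI S(1))
      fix v T m
      assume v: "sobolev 1 v \<and> sobolev_norm 1 v \<le> \<epsilon>"
        and m: "T > 0 \<and> novikov_solution k {0..<T} m \<and> (AE x in lborel. m 0 x = \<mu> k x + v x)"
      have m0: "m 0 \<in> X_space k" using m by (auto simp: novikov_solution_def)
      \<comment> \<open>The continuation is the global solution with the same initial datum;
        uniqueness makes it agree with \<open>m\<close> on the given interval.\<close>
      then obtain M where M: "novikov_solution k {0..} M" "M 0 = m 0" using wellposed unfolding novikov_wellposed_def by blast
      obtain h1 where h1: "H1 (\<lambda>x. m 0 (x + 0) - momentum (\<phi> k) x) h1" using W.X_diff_H1[OF m0] by blast
      obtain Fv fv where F: "H1 Fv fv" "AE x in lborel. v x = Fv x" "sobolev_norm 1 v = sqrt (n1 Fv fv)"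
        using sobolev_imp_H1 v by blast
      have "AE x in lborel. m 0 x - momentum (\<phi> k) x = Fv x"
      proof -
        have "AE x in lborel. m 0 x = \<mu> k x + v x" using m by blast
        then show ?thesis using F(2) by eventually_elim (simp add: mk)
      qed
      \<comment> \<open>\<open>v\<close> is fixed only almost everywhere, but both sides here are
        continuous; hence the initial distance is exactly the norm of \<open>v\<close>.\<close>
      then have "(\<lambda>x. m 0 x - momentum (\<phi> k) x) = Fv"
        using ac_continuous[OF H1_D(1)[OF h1]] ac_continuous[OF H1_D(1)[OF F(1)]] by (intro AE_eq_continuous) auto
      then have d: "W.orbit_dist (M 0) 0 = sobolev_norm 1 v"
        using W.orbit_dist_eq[of "m 0" 0 fv] F(1,3) M(2) by simp
      have "M t = m t" if "t \<in> {0..<T}" for t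
      proof -
        have "novikov_solution k {0..<T} M" by (rule novikov_solution_subset[OF M(1)]) auto
        then show ?thesis using wellposed m M(2) that unfolding novikov_wellposed_def by blast
      qed
      moreover have "(SUP t\<in>{0<..}. INF x0. ereal (sobolev_norm 1 (\<lambda>x. M t x - \<mu> k (x - x0)))) \<le> ereal (C * sobolev_norm 1 v)"
      proof (rule SUP_least)
        fix t :: real assume "t \<in> {0<..}"
        then obtain s where s: "W.orbit_dist (M t) s \<le> C * sobolev_norm 1 v"
          using S(3)[OF M(1), of t] v eps d by force
        show "(INF x0. ereal (sobolev_norm 1 (\<lambda>x. M t x - \<mu> k (x - x0)))) \<le> ereal (C * sobolev_norm 1 v)"
          by (rule INF_lower2[of s]) (use s in \<open>auto simp: W.orbit_dist_def mk\<close>)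
      qed
      ultimately show "\<exists>M. novikov_solution k {0..} M \<and> (\<forall>t\<in>{0..<T}. M t = m t) \<and>
                   (SUP t\<in>{0<..}. INF x0. ereal (sobolev_norm 1 (\<lambda>x. M t x - \<mu> k (x - x0))))
                     \<le> ereal (C * sobolev_norm 1 v)" using M(1) by blast
    qed
  qed
qed

end
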